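(* Let $R$ be a commutative Noetherian ring. If the formal power-series ring $R[[x_1]]$ is a unique factorization domain, then $R[[x_1,\ldots,x_n]]$ is a unique factorization domain for every $n\geq 1$.
   Context: Rings are commutative with identity. *)

theory Defs
  imports "HOL-Algebra.Algebra" "HOL-Library.Poly_Mapping"
begin

text \<open>
  The monomial \<open>\<Prod>i. x\<^sub>i ^ e i\<close> is encoded by its finitely supported exponent vector
  \<open>e :: nat \<Rightarrow>\<^sub>0 nat\<close>. The variables are indexed from 0, so that
  \<open>R[[x\<^sub>0, \<dots>, x\<^bsub>n-1\<^esub>]]\<close> consists of the coefficient functions, with no
  finiteness condition on their support, that vanish on every monomial involving some
  \<open>x\<^sub>i\<close> with \<open>i \<ge> n\<close>.
\<close>

definition power_series_ring ::
  "('a, 'b) ring_scheme \<Rightarrow> nat \<Rightarrow> ((nat \<Rightarrow>\<^sub>0 nat) \<Rightarrow> 'a) ring"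
  where "power_series_ring R n =
    \<lparr> carrier = {f. (\<forall>e. f e \<in> carrier R) \<and>
                    (\<forall>e. \<not> Poly_Mapping.keys e \<subseteq> {..<n} \<longrightarrow> f e = \<zero>\<^bsub>R\<^esub>)},
      monoid.mult = (\<lambda>f g e. finsum R (\<lambda>(a, b). f a \<otimes>\<^bsub>R\<^esub> g b) {(a, b). a + b = e}),
      monoid.one = (\<lambda>e. if e = 0 then \<one>\<^bsub>R\<^esub> else \<zero>\<^bsub>R\<^esub>),
      ring.zero = (\<lambda>e. \<zero>\<^bsub>R\<^esub>),
      ring.add = (\<lambda>f g e. f e \<oplus>\<^bsub>R\<^esub> g e) \<rparr>"

text \<open>
  The Cauchy product above is a genuine finite sum (\<^const>\<open>finsum\<close> over an infinite
  set would be a junk value).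
\<close>

lemma finite_exponent_splittings:
  fixes e :: "nat \<Rightarrow>\<^sub>0 nat"
  shows "finite {(a, b). a + b = e}"
proof -
  let ?S = "{(a, b). a + b = e}"
  let ?F = "\<lambda>p. restrict (Poly_Mapping.lookup (fst p)) (Poly_Mapping.keys e)"
  have out: "Poly_Mapping.lookup a i = 0"
    if "a + b = e" "i \<notin> Poly_Mapping.keys e" for a b i
    using that by (auto simp: in_keys_iff lookup_add)
  have "?F ` ?S \<subseteq> (\<Pi>\<^sub>E i \<in> Poly_Mapping.keys e. {..Poly_Mapping.lookup e i})"
    by (auto simp: lookup_add)
  moreover have "finite (\<Pi>\<^sub>E i \<in> Poly_Mapping.keys e. {..Poly_Mapping.lookup e i})"
    by (intro finite_PiE) auto
  ultimately have "finite (?F ` ?S)"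
    by (rule finite_subset)
  moreover have "inj_on ?F ?S"
  proof (rule inj_onI)
    fix p q
    assume p: "p \<in> ?S" and q: "q \<in> ?S" and eq: "?F p = ?F q"
    obtain a b a' b' where pq: "p = (a, b)" "q = (a', b')"
      by (cases p, cases q)
    have sums: "a + b = e" "a' + b' = e"
      using p q pq by auto
    have "Poly_Mapping.lookup a i = Poly_Mapping.lookup a' i" for i
    proof (cases "i \<in> Poly_Mapping.keys e")
      case True
      then show ?thesis using fun_cong[OF eq, of i] pq by simp
    next
      case False
      then show ?thesis using out[OF sums(1)] out[OF sums(2)] by simp
    qed
    then have "a = a'" by (intro poly_mapping_eqI) blast
    then show "p = q" using sums pq by (metis add_left_cancel)
  qed
  ultimately show ?thesis by (rule finite_imageD)
qed

end

(*
  Splitting off the last variable identifies R[[x_1,...,x_(n+1)]] with A[[x]] for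
  A = R[[x_1,...,x_n]], so it suffices to show, for a Noetherian domain R with R[[x]] factorial,
  that B = R[[x,y]] is factorial, i.e. that every colon ideal I = (g : f) of B is principal.

  Locally at a prime p of R this holds: the relations of generators of I are, modulo y and after
  inverting constants outside p, spanned by one relation fewer than there are generators, and the
  maximal minors of lifts of these relations are proportional to the generators (Hilbert-Burch).
  Globally, generic generators f1, g1 of I with c g1 = s f1 are chosen such that the constant terms
  of c and s are r p and r q with p, q coprime. It remains to find F, G with c G = s F and constant
  terms p and q: then F, G are coprime, and f1 / F generates I. On each monomial curve
  x = t^(n+1), y = t^(n+2) such a pair exists, because R[[t]] is factorial and the local
  generators control the constant terms. The curve separates the monomials of degree n in x, y, which
  allows the pair F, G to be built degree by degree.
*)
theory Submission
  imports Defs "HOL-Library.Sublist"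
begin

section \<open>Power series in one variable\<close>

text \<open>Principal colon ideals suffice because an irreducible p with p | ab and (p : a) = (w)
  satisfies p = w x, so w or x is a unit, giving p | a or p | b. Locally the argument rests on
  \<open>R\<close> being factorial itself: the localization at a prime element is then a discrete
  valuation ring, where submodules of free modules are free. Localizing \<open>R\<close> does not
  commute with forming power series, so no localized ring is built; statements hold up to
  multipliers whose constant coefficient is a permitted denominator, and x, y behave like elements
  of a Jacobson radical because subtracting a multiple of them leaves the constant coefficient
  alone. The obstacle is the passage to a global generator: c / s would have to be reduced to lowest
  terms in B, which presupposes that B is factorial. Constant coefficients can be reduced in
  \<open>R\<close>, but their quotients p, q must be lifted to series. After substituting powers of
  t the reduction takes place in \<open>R[[t]]\<close>, which is factorial by hypothesis, and the
  constant terms found there are forced to be p, q up to a unit.\<close>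

definition shift :: "(nat \<Rightarrow> 'a) \<Rightarrow> nat \<Rightarrow> 'a"
  where "shift f = (\<lambda>i. f (Suc i))"

lemma shift_nth [simp]: "shift f i = f (Suc i)"
  by (simp add: shift_def)

text \<open>Recursion on the degree along \<open>f = f 0 + X * shift f\<close>, so that the ring
  laws follow by induction without reindexing finite sums.\<close>

fun conv :: "('a, 'b) ring_scheme \<Rightarrow> (nat \<Rightarrow> 'a) \<Rightarrow> (nat \<Rightarrow> 'a) \<Rightarrow> nat \<Rightarrow> 'a" where
  "conv R f g 0 = f 0 \<otimes>\<^bsub>R\<^esub> g 0"
| "conv R f g (Suc n) = f 0 \<otimes>\<^bsub>R\<^esub> g (Suc n) \<oplus>\<^bsub>R\<^esub> conv R (shift f) g n"

definition ps :: "('a, 'b) ring_scheme \<Rightarrow> (nat \<Rightarrow> 'a) ring" where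
  "ps R = \<lparr> carrier = {f. \<forall>n. f n \<in> carrier R},
     monoid.mult = conv R,
     monoid.one = (\<lambda>n. if n = 0 then \<one>\<^bsub>R\<^esub> else \<zero>\<^bsub>R\<^esub>),
     ring.zero = (\<lambda>n. \<zero>\<^bsub>R\<^esub>),
     ring.add = (\<lambda>f g n. f n \<oplus>\<^bsub>R\<^esub> g n) \<rparr>"

definition const :: "('a, 'b) ring_scheme \<Rightarrow> 'a \<Rightarrow> nat \<Rightarrow> 'a" where
  "const R a = (\<lambda>n. if n = 0 then a else \<zero>\<^bsub>R\<^esub>)"

definition psX :: "('a, 'b) ring_scheme \<Rightarrow> nat \<Rightarrow> 'a" where
  "psX R = (\<lambda>n. if n = 1 then \<one>\<^bsub>R\<^esub> else \<zero>\<^bsub>R\<^esub>)"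

lemma ps_carrier: "f \<in> carrier (ps R) \<longleftrightarrow> (\<forall>n. f n \<in> carrier R)"
  by (simp add: ps_def)

lemma ps_carrierD: "f \<in> carrier (ps R) \<Longrightarrow> f n \<in> carrier R"
  by (simp add: ps_def)

lemma ps_shift_closed [intro, simp]: "f \<in> carrier (ps R) \<Longrightarrow> shift f \<in> carrier (ps R)"
  by (simp add: ps_def)

lemma ps_zero [simp]: "\<zero>\<^bsub>ps R\<^esub> n = \<zero>\<^bsub>R\<^esub>"
  by (simp add: ps_def)

lemma ps_one: "\<one>\<^bsub>ps R\<^esub> n = (if n = 0 then \<one>\<^bsub>R\<^esub> else \<zero>\<^bsub>R\<^esub>)"
  by (simp add: ps_def)

lemma ps_add [simp]: "(f \<oplus>\<^bsub>ps R\<^esub> g) n = f n \<oplus>\<^bsub>R\<^esub> g n"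
  by (simp add: ps_def)

lemma ps_mult_0 [simp]: "(f \<otimes>\<^bsub>ps R\<^esub> g) 0 = f 0 \<otimes>\<^bsub>R\<^esub> g 0"
  by (simp add: ps_def)

lemma ps_mult_Suc: "(f \<otimes>\<^bsub>ps R\<^esub> g) (Suc n) = f 0 \<otimes>\<^bsub>R\<^esub> g (Suc n) \<oplus>\<^bsub>R\<^esub> (shift f \<otimes>\<^bsub>ps R\<^esub> g) n"
  by (simp add: ps_def)

context cring
begin

lemma conv_closed: "(\<And>i. f i \<in> carrier R) \<Longrightarrow> (\<And>i. g i \<in> carrier R) \<Longrightarrow> conv R f g n \<in> carrier R"
  by (induction n arbitrary: f) auto

lemma conv_scale: "a \<in> carrier R \<Longrightarrow> (\<And>i. f i \<in> carrier R) \<Longrightarrow> (\<And>i. g i \<in> carrier R) \<Longrightarrow>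
    conv R (\<lambda>i. a \<otimes> f i) g n = a \<otimes> conv R f g n"
proof (induction n arbitrary: f)
  case (Suc n)
  have "conv R (shift (\<lambda>i. a \<otimes> f i)) g n = a \<otimes> conv R (shift f) g n"
    using Suc by (auto simp: shift_def)
  then show ?case using Suc.prems by (simp add: r_distr m_assoc conv_closed)
qed (simp add: m_assoc)

lemma conv_add: "(\<And>i. f i \<in> carrier R) \<Longrightarrow> (\<And>i. f' i \<in> carrier R) \<Longrightarrow> (\<And>i. g i \<in> carrier R) \<Longrightarrow>
    conv R (\<lambda>i. f i \<oplus> f' i) g n = conv R f g n \<oplus> conv R f' g n"
proof (induction n arbitrary: f f')
  case (Suc n)
  have "conv R (shift (\<lambda>i. f i \<oplus> f' i)) g n = conv R (shift f) g n \<oplus> conv R (shift f') g n"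
    using Suc by (auto simp: shift_def)
  moreover have "conv R (shift f) g n \<in> carrier R" "conv R (shift f') g n \<in> carrier R"
    using Suc.prems by (auto intro!: conv_closed)
  ultimately show ?case using Suc.prems by (simp add: l_distr a_ac)
qed (simp add: l_distr)

lemma conv_zero: "(\<And>i. g i \<in> carrier R) \<Longrightarrow> conv R (\<lambda>i. \<zero>) g n = \<zero>"
  by (induction n) (auto simp: shift_def)

text \<open>The defining recursion peels the first factor; peeling the second one instead is what
  commutativity comes down to.\<close>

lemma conv_Suc_right: "(\<And>i. f i \<in> carrier R) \<Longrightarrow> (\<And>i. g i \<in> carrier R) \<Longrightarrow>
    conv R f g (Suc n) = g 0 \<otimes> f (Suc n) \<oplus> conv R f (shift g) n"
proof (induction n arbitrary: f)
  case 0
  then show ?case by (simp add: m_comm a_comm)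
next
  case (Suc n)
  have "conv R (shift f) g (Suc n) = g 0 \<otimes> f (Suc (Suc n)) \<oplus> conv R (shift f) (shift g) n"
    using Suc.IH[of "shift f"] Suc.prems by (simp add: shift_def del: conv.simps)
  moreover have "conv R (shift f) (shift g) n \<in> carrier R"
    using Suc.prems by (auto intro!: conv_closed)
  moreover have "conv R f g (Suc (Suc n)) = f 0 \<otimes> g (Suc (Suc n)) \<oplus> conv R (shift f) g (Suc n)"
    "conv R f (shift g) (Suc n) = f 0 \<otimes> g (Suc (Suc n)) \<oplus> conv R (shift f) (shift g) n"
    by simp_all
  ultimately have "conv R f g (Suc (Suc n)) = g 0 \<otimes> f (Suc (Suc n)) \<oplus> conv R f (shift g) (Suc n)"
    using Suc.prems by (simp add: a_ac del: conv.simps)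
  then show ?case .
qed

lemma conv_comm: "(\<And>i. f i \<in> carrier R) \<Longrightarrow> (\<And>i. g i \<in> carrier R) \<Longrightarrow> conv R f g n = conv R g f n"
proof (induction n arbitrary: f)
  case (Suc n)
  have "conv R (shift f) g n = conv R g (shift f) n"
    using Suc by (intro Suc.IH) auto
  then show ?case using conv_Suc_right[of g f n] Suc.prems by simp
qed (simp add: m_comm)

lemma conv_assoc: "(\<And>i. f i \<in> carrier R) \<Longrightarrow> (\<And>i. g i \<in> carrier R) \<Longrightarrow> (\<And>i. h i \<in> carrier R) \<Longrightarrow>
    conv R (conv R f g) h n = conv R f (conv R g h) n"
proof (induction n arbitrary: f)
  case (Suc n)
  have "shift (conv R f g) = (\<lambda>i. f 0 \<otimes> shift g i \<oplus> conv R (shift f) g i)"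
    by (simp add: fun_eq_iff)
  moreover have "conv R (\<lambda>i. f 0 \<otimes> shift g i \<oplus> conv R (shift f) g i) h n =
      conv R (\<lambda>i. f 0 \<otimes> shift g i) h n \<oplus> conv R (conv R (shift f) g) h n"
    using Suc.prems by (intro conv_add) (auto intro!: conv_closed)
  moreover have "conv R (\<lambda>i. f 0 \<otimes> shift g i) h n = f 0 \<otimes> conv R (shift g) h n"
    using Suc.prems by (intro conv_scale) auto
  moreover have "conv R (conv R (shift f) g) h n = conv R (shift f) (conv R g h) n"
    using Suc by (intro Suc.IH) auto
  moreover have "conv R (shift g) h n \<in> carrier R" "conv R (shift f) (conv R g h) n \<in> carrier R"
    using Suc.prems by (auto intro!: conv_closed)
  ultimately show ?case using Suc.prems
    by (simp add: m_assoc a_assoc r_distr)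
qed (simp add: m_assoc)

lemma ps_cring: "cring (ps R)"
proof (rule cringI)
  show "abelian_group (ps R)"
  proof (rule abelian_groupI)
    fix x assume "x \<in> carrier (ps R)"
    then show "\<exists>y\<in>carrier (ps R). y \<oplus>\<^bsub>ps R\<^esub> x = \<zero>\<^bsub>ps R\<^esub>"
      by (intro bexI[of _ "\<lambda>n. \<ominus> x n"]) (auto simp: ps_def l_neg)
  qed (auto simp: ps_def a_ac)
  show "comm_monoid (ps R)"
  proof (rule comm_monoidI)
    fix x y z assume "x \<in> carrier (ps R)" "y \<in> carrier (ps R)" "z \<in> carrier (ps R)"
    then show "x \<otimes>\<^bsub>ps R\<^esub> y \<otimes>\<^bsub>ps R\<^esub> z = x \<otimes>\<^bsub>ps R\<^esub> (y \<otimes>\<^bsub>ps R\<^esub> z)"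
      by (simp add: ps_def fun_eq_iff conv_assoc)
  next
    fix x assume "x \<in> carrier (ps R)"
    then show "\<one>\<^bsub>ps R\<^esub> \<otimes>\<^bsub>ps R\<^esub> x = x"
    proof (intro ext)
      fix n
      have "shift (\<lambda>n. if n = 0 then \<one> else \<zero>) = (\<lambda>i. \<zero>)" by (simp add: fun_eq_iff)
      then show "(\<one>\<^bsub>ps R\<^esub> \<otimes>\<^bsub>ps R\<^esub> x) n = x n"
        using \<open>x \<in> carrier (ps R)\<close> by (cases n) (auto simp: ps_def conv_zero)
    qed
  next
    fix x y assume "x \<in> carrier (ps R)" "y \<in> carrier (ps R)"
    then show "x \<otimes>\<^bsub>ps R\<^esub> y = y \<otimes>\<^bsub>ps R\<^esub> x"
      by (simp add: ps_def fun_eq_iff conv_comm)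
  qed (auto simp: ps_def conv_closed)
qed (simp add: ps_def fun_eq_iff conv_add)

lemma ps_a_inv [simp]: "f \<in> carrier (ps R) \<Longrightarrow> (\<ominus>\<^bsub>ps R\<^esub> f) n = \<ominus> f n"
proof -
  assume f: "f \<in> carrier (ps R)"
  interpret P: cring "ps R" by (rule ps_cring)
  have "(\<ominus>\<^bsub>ps R\<^esub> f \<oplus>\<^bsub>ps R\<^esub> f) n = \<zero>" using f by (simp add: P.l_neg del: ps_add)
  then show ?thesis using f P.a_inv_closed[OF f] by (simp add: sum_zero_eq_neg ps_carrierD)
qed

lemma ps_minus [simp]: "f \<in> carrier (ps R) \<Longrightarrow> g \<in> carrier (ps R) \<Longrightarrow> (f \<ominus>\<^bsub>ps R\<^esub> g) n = f n \<ominus> g n"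
  by (simp add: a_minus_def)

lemma ct_hom: "(\<lambda>f. f 0) \<in> ring_hom (ps R) R"
  by (rule ring_hom_memI) (auto simp: ps_one ps_carrierD)

lemma const_closed [intro, simp]: "a \<in> carrier R \<Longrightarrow> const R a \<in> carrier (ps R)"
  by (auto simp: const_def ps_carrier)

lemma const_0 [simp]: "const R a 0 = a"
  by (simp add: const_def)

lemma const_mult_nth [simp]: "a \<in> carrier R \<Longrightarrow> f \<in> carrier (ps R) \<Longrightarrow> (const R a \<otimes>\<^bsub>ps R\<^esub> f) n = a \<otimes> f n"
proof (cases n)
  case (Suc m)
  assume a: "a \<in> carrier R" "f \<in> carrier (ps R)"
  have "shift (const R a) = (\<lambda>i. \<zero>)" by (simp add: const_def fun_eq_iff)
  then show ?thesis using a Suc by (simp add: ps_mult_Suc) (simp add: ps_def conv_zero)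
qed simp

lemma const_hom: "const R \<in> ring_hom R (ps R)"
proof (rule ring_hom_memI)
  fix a b assume a: "a \<in> carrier R" "b \<in> carrier R"
  show "const R (a \<otimes> b) = const R a \<otimes>\<^bsub>ps R\<^esub> const R b"
    using a by (simp add: fun_eq_iff) (simp add: const_def)
qed (auto simp: const_def ps_def)

lemma psX_closed [intro, simp]: "psX R \<in> carrier (ps R)"
  by (auto simp: psX_def ps_carrier)

lemma psX_0 [simp]: "psX R 0 = \<zero>"
  by (simp add: psX_def)

lemma psX_mult [simp]:
  assumes "f \<in> carrier (ps R)"
  shows "(psX R \<otimes>\<^bsub>ps R\<^esub> f) 0 = \<zero>" "(psX R \<otimes>\<^bsub>ps R\<^esub> f) (Suc n) = f n"
proof -
  interpret P: cring "ps R" by (rule ps_cring)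
  have "shift (psX R) = \<one>\<^bsub>ps R\<^esub>" by (simp add: psX_def fun_eq_iff ps_one)
  then show "(psX R \<otimes>\<^bsub>ps R\<^esub> f) (Suc n) = f n"
    using assms P.l_one[OF assms] by (simp add: ps_mult_Suc ps_carrierD)
  show "(psX R \<otimes>\<^bsub>ps R\<^esub> f) 0 = \<zero>" using assms by (simp add: psX_def ps_carrierD)
qed

lemma ps_decomp: 
  assumes "f \<in> carrier (ps R)"
  shows "f = const R (f 0) \<oplus>\<^bsub>ps R\<^esub> psX R \<otimes>\<^bsub>ps R\<^esub> shift f"
proof
  fix n show "f n = (const R (f 0) \<oplus>\<^bsub>ps R\<^esub> psX R \<otimes>\<^bsub>ps R\<^esub> shift f) n"
    using assms by (cases n) (auto simp: const_def ps_carrierD)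
qed

lemma ps_psX_eq:
  assumes "f \<in> carrier (ps R)" "f 0 = \<zero>"
  shows "f = psX R \<otimes>\<^bsub>ps R\<^esub> shift f"
proof
  fix n show "f n = (psX R \<otimes>\<^bsub>ps R\<^esub> shift f) n"
    using assms by (cases n) (auto simp: ps_carrierD)
qed

text \<open>Unrolling the recursion gives \<open>a 0 = (\<Sum>i. d i * X^i) * F\<close>. The
  remainder is pushed into ever higher degrees, so comparing single coefficients replaces a
  convergence argument.\<close>

lemma ps_limit:
  assumes F: "F \<in> carrier (ps R)" and a: "\<And>i. a i \<in> carrier (ps R)" and d: "\<And>i. d i \<in> carrier R"
    and step: "\<And>i. a i = const R (d i) \<otimes>\<^bsub>ps R\<^esub> F \<oplus>\<^bsub>ps R\<^esub> psX R \<otimes>\<^bsub>ps R\<^esub> a (Suc i)"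
  shows "a 0 = d \<otimes>\<^bsub>ps R\<^esub> F"
proof -
  have "a i n = ((\<lambda>m. d (i + m)) \<otimes>\<^bsub>ps R\<^esub> F) n" for i n
  proof (induction n arbitrary: i)
    case 0
    show ?case by (subst step) (use F a d in \<open>auto simp: ps_carrierD\<close>)
  next
    case (Suc n)
    have "shift (\<lambda>m. d (i + m)) = (\<lambda>m. d (Suc i + m))" by (simp add: fun_eq_iff)
    moreover have "((\<lambda>m. d (i + m)) \<otimes>\<^bsub>ps R\<^esub> F) (Suc n) = d i \<otimes> F (Suc n) \<oplus> (shift (\<lambda>m. d (i + m)) \<otimes>\<^bsub>ps R\<^esub> F) n"
      by (simp add: ps_mult_Suc)
    moreover have "a i (Suc n) = (const R (d i) \<otimes>\<^bsub>ps R\<^esub> F) (Suc n) \<oplus> (psX R \<otimes>\<^bsub>ps R\<^esub> a (Suc i)) (Suc n)"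
      by (subst step) simp
    ultimately show ?case using F a d Suc[of "Suc i"] by simp
  qed
  from this[of 0] show ?thesis by auto
qed

end

lemma (in domain) ps_domain: "domain (ps R)"
proof -
  interpret P: cring "ps R" by (rule ps_cring)
  have ne: "\<one>\<^bsub>ps R\<^esub> \<noteq> \<zero>\<^bsub>ps R\<^esub>"
    by (metis ps_one ps_zero one_not_zero)
  \<comment> \<open>The lowest coefficients of the two factors meet alone in degree
    \<open>m + n\<close>; factors \<open>X\<close> are stripped first from \<open>f\<close>, then
    from \<open>g\<close>.\<close>
  have nz: "(f \<otimes>\<^bsub>ps R\<^esub> g) (m + n) \<noteq> \<zero>"
    if "f \<in> carrier (ps R)" "g \<in> carrier (ps R)" "f m \<noteq> \<zero>" "g n \<noteq> \<zero>"
      "\<forall>i<m. f i = \<zero>" "\<forall>i<n. g i = \<zero>" for f g m n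
    using that
  proof (induction m arbitrary: f)
    case (Suc m)
    have "(shift f \<otimes>\<^bsub>ps R\<^esub> g) (m + n) \<noteq> \<zero>"
      using Suc.IH[of "shift f"] Suc.prems ps_shift_closed[of f R] by (auto simp: shift_def)
    moreover have "f 0 = \<zero>" using Suc.prems by auto
    ultimately show ?case using Suc.prems P.m_closed[of "shift f" g] by (simp add: ps_mult_Suc ps_carrierD)
  next
    case 0
    show ?case using 0(1,2,3,4,6)
    proof (induction n arbitrary: g)
      case (Suc n)
      have "(f \<otimes>\<^bsub>ps R\<^esub> shift g) (0 + n) \<noteq> \<zero>"
        using Suc.IH[of "shift g"] Suc.prems ps_shift_closed[of g R] by (auto simp: shift_def)
      moreover have "(f \<otimes>\<^bsub>ps R\<^esub> g) (Suc n) = (f \<otimes>\<^bsub>ps R\<^esub> shift g) n"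
        using Suc.prems P.m_comm[of f g] P.m_comm[of f "shift g"] P.m_closed[of "shift g" f]
        by (simp add: ps_mult_Suc ps_carrierD)
      ultimately show ?case by simp
    qed (auto simp: integral_iff ps_carrierD)
  qed
  show ?thesis
  proof (rule domain.intro[OF ps_cring], unfold_locales)
    show "\<one>\<^bsub>ps R\<^esub> \<noteq> \<zero>\<^bsub>ps R\<^esub>" by (rule ne)
  next
    fix f g assume fg: "f \<otimes>\<^bsub>ps R\<^esub> g = \<zero>\<^bsub>ps R\<^esub>" "f \<in> carrier (ps R)" "g \<in> carrier (ps R)"
    show "f = \<zero>\<^bsub>ps R\<^esub> \<or> g = \<zero>\<^bsub>ps R\<^esub>"
    proof (rule ccontr)
      assume "\<not> ?thesis"
      then obtain i j where "f i \<noteq> \<zero>" "g j \<noteq> \<zero>" by (auto simp: fun_eq_iff)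
      then obtain m n where "f m \<noteq> \<zero>" "\<forall>i<m. f i = \<zero>" "g n \<noteq> \<zero>" "\<forall>i<n. g i = \<zero>"
        using that[of "LEAST i. f i \<noteq> \<zero>" "LEAST i. g i \<noteq> \<zero>"]
        by (metis (mono_tags, lifting) LeastI not_less_Least)
      then show False using nz[of f g m n] fg by simp
    qed
  qed
qed

section \<open>Linear combinations and minors\<close>

text \<open>Vectors are total functions; the columns that matter are singled out by a set
  \<open>K\<close> or a bound \<open>k\<close> in the notions built on them.\<close>

definition vecs :: "('a, 'b) ring_scheme \<Rightarrow> ('i \<Rightarrow> 'a) set" where
  "vecs R = {v. \<forall>c. v c \<in> carrier R}"

fun lc :: "('a, 'b) ring_scheme \<Rightarrow> (nat \<Rightarrow> 'a) \<Rightarrow> ('i \<Rightarrow> 'a) list \<Rightarrow> 'i \<Rightarrow> 'a" where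
  "lc R a [] c = \<zero>\<^bsub>R\<^esub>"
| "lc R a (v # vs) c = a 0 \<otimes>\<^bsub>R\<^esub> v c \<oplus>\<^bsub>R\<^esub> lc R (\<lambda>i. a (Suc i)) vs c"

definition unit_vec :: "('a, 'b) ring_scheme \<Rightarrow> 'i \<Rightarrow> 'i \<Rightarrow> 'a" where
  "unit_vec R c d = (if d = c then \<one>\<^bsub>R\<^esub> else \<zero>\<^bsub>R\<^esub>)"

text \<open>
  Laplace expansion along the column \<open>c\<close>, where \<open>F\<close> yields the complementary minors and the
  first list collects the rows already passed. Deleting a row is list concatenation, so no
  index arithmetic is needed.
\<close>

fun expand :: "('a, 'b) ring_scheme \<Rightarrow> (('i \<Rightarrow> 'a) list \<Rightarrow> 'a) \<Rightarrow> 'i \<Rightarrow> ('i \<Rightarrow> 'a) list \<Rightarrow> ('i \<Rightarrow> 'a) list \<Rightarrow> 'a" where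
  "expand R F c us [] = \<zero>\<^bsub>R\<^esub>"
| "expand R F c us (v # vs) = v c \<otimes>\<^bsub>R\<^esub> F (us @ vs) \<ominus>\<^bsub>R\<^esub> expand R F c (us @ [v]) vs"

fun minor :: "('a, 'b) ring_scheme \<Rightarrow> 'i list \<Rightarrow> ('i \<Rightarrow> 'a) list \<Rightarrow> 'a" where
  "minor R [] vs = (if vs = [] then \<one>\<^bsub>R\<^esub> else \<zero>\<^bsub>R\<^esub>)"
| "minor R (c # cs) vs = expand R (minor R cs) c [] vs"

text \<open>For a prime ideal \<open>P\<close> this is linear independence, over the residue domain
  of \<open>P\<close>, of the rows restricted to the columns \<open>K\<close>, stated without
  forming the quotient. The zero ideal of a domain gives ordinary independence.\<close>

definition indep_mod :: "('a, 'b) ring_scheme \<Rightarrow> 'a set \<Rightarrow> 'i set \<Rightarrow> ('i \<Rightarrow> 'a) list \<Rightarrow> bool" where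
  "indep_mod R P K vs \<longleftrightarrow> (\<forall>a\<in>vecs R. (\<forall>c\<in>K. lc R a vs c \<in> P) \<longrightarrow> (\<forall>i<length vs. a i \<in> P))"

lemma vecsD: "v \<in> vecs R \<Longrightarrow> v c \<in> carrier R"
  by (simp add: vecs_def)

context cring
begin

lemma lc_closed [simp]: "a \<in> vecs R \<Longrightarrow> set vs \<subseteq> vecs R \<Longrightarrow> lc R a vs c \<in> carrier R"
  by (induction vs arbitrary: a) (auto simp: vecs_def)

lemma lc_add: "a \<in> vecs R \<Longrightarrow> b \<in> vecs R \<Longrightarrow> set vs \<subseteq> vecs R \<Longrightarrow>
    lc R (\<lambda>i. a i \<oplus> b i) vs c = lc R a vs c \<oplus> lc R b vs c"
proof (induction vs arbitrary: a b)
  case (Cons v vs)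
  have v: "(\<lambda>i. a (Suc i)) \<in> vecs R" "(\<lambda>i. b (Suc i)) \<in> vecs R" using Cons.prems by (auto simp: vecs_def)
  have "lc R (\<lambda>i. a (Suc i)) vs c \<in> carrier R" "lc R (\<lambda>i. b (Suc i)) vs c \<in> carrier R"
    "a 0 \<in> carrier R" "b 0 \<in> carrier R" "v c \<in> carrier R"
    using v Cons.prems by (auto simp: vecs_def)
  then show ?case using Cons.IH[OF v] Cons.prems by (simp add: l_distr a_ac)
qed simp

lemma lc_smult: "s \<in> carrier R \<Longrightarrow> a \<in> vecs R \<Longrightarrow> set vs \<subseteq> vecs R \<Longrightarrow>
    lc R (\<lambda>i. s \<otimes> a i) vs c = s \<otimes> lc R a vs c"
proof (induction vs arbitrary: a)
  case (Cons v vs)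
  have v: "(\<lambda>i. a (Suc i)) \<in> vecs R" using Cons.prems by (auto simp: vecs_def)
  have "lc R (\<lambda>i. a (Suc i)) vs c \<in> carrier R" "a 0 \<in> carrier R" "v c \<in> carrier R"
    using v Cons.prems by (auto simp: vecs_def)
  then show ?case using Cons.IH[OF _ v] Cons.prems by (simp add: r_distr m_assoc)
qed simp

lemma lc_append: "a \<in> vecs R \<Longrightarrow> set us \<subseteq> vecs R \<Longrightarrow> set vs \<subseteq> vecs R \<Longrightarrow>
    lc R a (us @ vs) c = lc R a us c \<oplus> lc R (\<lambda>i. a (i + length us)) vs c"
proof (induction us arbitrary: a)
  case (Cons v us)
  have v: "(\<lambda>i. a (Suc i)) \<in> vecs R" "(\<lambda>i. a (Suc (i + length us))) \<in> vecs R" using Cons.prems by (auto simp: vecs_def)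
  have "lc R (\<lambda>i. a (Suc i)) us c \<in> carrier R" "a 0 \<in> carrier R" "v c \<in> carrier R"
     "lc R (\<lambda>i. a (Suc (i + length us))) vs c \<in> carrier R"
    using v Cons.prems by (auto simp: vecs_def)
  then show ?case using Cons.IH[OF v(1)] Cons.prems by (simp add: a_assoc)
next
  case Nil then show ?case by (simp add: vecs_def)
qed

lemma lc_cong: "(\<And>i. i < length vs \<Longrightarrow> a i = b i) \<Longrightarrow> lc R a vs c = lc R b vs c"
proof (induction vs arbitrary: a b)
  case (Cons v vs)
  have "lc R (\<lambda>i. a (Suc i)) vs c = lc R (\<lambda>i. b (Suc i)) vs c"
    by (rule Cons.IH) (use Cons.prems in auto)
  moreover have "a 0 = b 0" using Cons.prems by auto
  ultimately show ?case by simp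
qed simp

lemma lc_ideal: "ideal P R \<Longrightarrow> a \<in> vecs R \<Longrightarrow> set vs \<subseteq> vecs R \<Longrightarrow>
    (\<And>v. v \<in> set vs \<Longrightarrow> v c \<in> P) \<Longrightarrow> lc R a vs c \<in> P"
proof (induction vs arbitrary: a)
  case (Cons v vs)
  have v: "(\<lambda>i. a (Suc i)) \<in> vecs R" "a 0 \<in> carrier R" using Cons.prems by (auto simp: vecs_def)
  then show ?case using Cons by (auto intro!: additive_subgroup.a_closed[OF ideal.axioms(1)] ideal.I_l_closed)
next
  case Nil then show ?case by (simp add: additive_subgroup.zero_closed ideal.axioms(1))
qed

lemma lc_unit: "k < length vs \<Longrightarrow> set vs \<subseteq> vecs R \<Longrightarrow> lc R (\<lambda>i. if i = k then \<one> else \<zero>) vs c = (vs ! k) c"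
proof (induction vs arbitrary: k)
  case (Cons v vs)
  have z: "lc R (\<lambda>i. \<zero>) vs c = \<zero>" if "set vs \<subseteq> vecs R" for vs c
    using that by (induction vs) (auto simp: vecs_def)
  show ?case
  proof (cases k)
    case 0
    then show ?thesis using Cons.prems z[of vs] by (auto simp: vecs_def)
  next
    case (Suc l)
    then have "(vs ! l) c \<in> carrier R" using Cons.prems nth_mem[of l vs] by (intro vecsD) auto
    then show ?thesis using Suc Cons.prems Cons.IH[of l] by (auto simp: vecs_def)
  qed
qed simp

section \<open>Laplace expansion: multilinearity, alternation, reduction modulo ideals\<close>

lemma expand_closed:
  assumes "\<And>vs. set vs \<subseteq> vecs R \<Longrightarrow> F vs \<in> carrier R"
  shows "set us \<subseteq> vecs R \<Longrightarrow> set vs \<subseteq> vecs R \<Longrightarrow> expand R F c us vs \<in> carrier R"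
  using assms by (induction vs arbitrary: us) (auto simp: vecsD)

lemma minor_closed [simp]: "set vs \<subseteq> vecs R \<Longrightarrow> minor R cs vs \<in> carrier R"
  by (induction cs arbitrary: vs) (auto intro!: expand_closed)

definition multilin :: "(('i \<Rightarrow> 'a) list \<Rightarrow> 'a) \<Rightarrow> bool" where
  "multilin F \<longleftrightarrow> (\<forall>us ws a b v w. set us \<subseteq> vecs R \<longrightarrow> set ws \<subseteq> vecs R \<longrightarrow> a \<in> carrier R \<longrightarrow> b \<in> carrier R \<longrightarrow>
     v \<in> vecs R \<longrightarrow> w \<in> vecs R \<longrightarrow>
     F (us @ (\<lambda>c. a \<otimes> v c \<oplus> b \<otimes> w c) # ws) = a \<otimes> F (us @ v # ws) \<oplus> b \<otimes> F (us @ w # ws))"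

lemma multilinD: "multilin F \<Longrightarrow> set us \<subseteq> vecs R \<Longrightarrow> set ws \<subseteq> vecs R \<Longrightarrow> a \<in> carrier R \<Longrightarrow> b \<in> carrier R \<Longrightarrow>
     v \<in> vecs R \<Longrightarrow> w \<in> vecs R \<Longrightarrow>
     F (us @ (\<lambda>c. a \<otimes> v c \<oplus> b \<otimes> w c) # ws) = a \<otimes> F (us @ v # ws) \<oplus> b \<otimes> F (us @ w # ws)"
  by (auto simp: multilin_def)

text \<open>The altered row has already been passed by the expansion, so it enters only through the
  complementary minors \<open>F\<close>; the opposite position is treated next.\<close>

lemma expand_multilin1:
  assumes F: "multilin F" "\<And>vs. set vs \<subseteq> vecs R \<Longrightarrow> F vs \<in> carrier R"
    and ab: "a \<in> carrier R" "b \<in> carrier R" "v \<in> vecs R" "w \<in> vecs R"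
  shows "set us \<subseteq> vecs R \<Longrightarrow> set us' \<subseteq> vecs R \<Longrightarrow> set vs \<subseteq> vecs R \<Longrightarrow>
    expand R F c (us @ (\<lambda>c. a \<otimes> v c \<oplus> b \<otimes> w c) # us') vs =
      a \<otimes> expand R F c (us @ v # us') vs \<oplus> b \<otimes> expand R F c (us @ w # us') vs"
proof (induction vs arbitrary: us')
  case (Cons x vs)
  have IH: "expand R F c (us @ (\<lambda>c. a \<otimes> v c \<oplus> b \<otimes> w c) # us' @ [x]) vs =
      a \<otimes> expand R F c (us @ v # us' @ [x]) vs \<oplus> b \<otimes> expand R F c (us @ w # us' @ [x]) vs"
    using Cons.IH[of "us' @ [x]"] Cons.prems by simp
  have M: "F (us @ (\<lambda>c. a \<otimes> v c \<oplus> b \<otimes> w c) # us' @ vs) =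
      a \<otimes> F (us @ v # us' @ vs) \<oplus> b \<otimes> F (us @ w # us' @ vs)"
    using multilinD[OF F(1), of us "us' @ vs"] Cons.prems ab by simp
  have c: "x c \<in> carrier R" "F (us @ v # us' @ vs) \<in> carrier R" "F (us @ w # us' @ vs) \<in> carrier R"
    "expand R F c (us @ v # us' @ [x]) vs \<in> carrier R" "expand R F c (us @ w # us' @ [x]) vs \<in> carrier R"
    using Cons.prems ab F(2) by (auto simp: vecsD intro!: expand_closed)
  have id: "z \<otimes> (a \<otimes> f \<oplus> b \<otimes> g) \<ominus> (a \<otimes> e \<oplus> b \<otimes> h) = a \<otimes> (z \<otimes> f \<ominus> e) \<oplus> b \<otimes> (z \<otimes> g \<ominus> h)"
    if "z \<in> carrier R" "f \<in> carrier R" "g \<in> carrier R" "e \<in> carrier R" "h \<in> carrier R" for z f g e h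
    using ab that by algebra
  show ?case using id[OF c] by (simp add: IH M)
next
  case Nil then show ?case using ab by simp
qed

lemma expand_multilin:
  assumes F: "multilin F" "\<And>vs. set vs \<subseteq> vecs R \<Longrightarrow> F vs \<in> carrier R"
    and ab: "a \<in> carrier R" "b \<in> carrier R" "v \<in> vecs R" "w \<in> vecs R"
  shows "set us \<subseteq> vecs R \<Longrightarrow> set vs \<subseteq> vecs R \<Longrightarrow> set vs' \<subseteq> vecs R \<Longrightarrow>
    expand R F c us (vs @ (\<lambda>c. a \<otimes> v c \<oplus> b \<otimes> w c) # vs') =
      a \<otimes> expand R F c us (vs @ v # vs') \<oplus> b \<otimes> expand R F c us (vs @ w # vs')"
proof (induction vs arbitrary: us)
  case Nil
  have e: "expand R F c (us @ [\<lambda>c. a \<otimes> v c \<oplus> b \<otimes> w c]) vs' =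
      a \<otimes> expand R F c (us @ [v]) vs' \<oplus> b \<otimes> expand R F c (us @ [w]) vs'"
    using expand_multilin1[OF F ab, of us "[]" vs'] Nil by simp
  have c: "v c \<in> carrier R" "w c \<in> carrier R" "F (us @ vs') \<in> carrier R"
    "expand R F c (us @ [v]) vs' \<in> carrier R" "expand R F c (us @ [w]) vs' \<in> carrier R"
    using Nil ab F(2) by (auto simp: vecsD intro!: expand_closed)
  have id: "(a \<otimes> x \<oplus> b \<otimes> y) \<otimes> f \<ominus> (a \<otimes> e \<oplus> b \<otimes> h) = a \<otimes> (x \<otimes> f \<ominus> e) \<oplus> b \<otimes> (y \<otimes> f \<ominus> h)"
    if "x \<in> carrier R" "y \<in> carrier R" "f \<in> carrier R" "e \<in> carrier R" "h \<in> carrier R" for x y f e h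
    using ab that by algebra
  show ?case using id[OF c] by (simp add: e)
next
  case (Cons x vs)
  have IH: "expand R F c (us @ [x]) (vs @ (\<lambda>c. a \<otimes> v c \<oplus> b \<otimes> w c) # vs') =
      a \<otimes> expand R F c (us @ [x]) (vs @ v # vs') \<oplus> b \<otimes> expand R F c (us @ [x]) (vs @ w # vs')"
    using Cons by simp
  have M: "F ((us @ vs) @ (\<lambda>c. a \<otimes> v c \<oplus> b \<otimes> w c) # vs') =
      a \<otimes> F ((us @ vs) @ v # vs') \<oplus> b \<otimes> F ((us @ vs) @ w # vs')"
    using multilinD[OF F(1), of "us @ vs" vs'] Cons.prems ab by simp
  have c: "x c \<in> carrier R" "F (us @ vs @ v # vs') \<in> carrier R" "F (us @ vs @ w # vs') \<in> carrier R"
    "expand R F c (us @ [x]) (vs @ v # vs') \<in> carrier R" "expand R F c (us @ [x]) (vs @ w # vs') \<in> carrier R"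
    using Cons.prems ab F(2) by (auto simp: vecsD intro!: expand_closed)
  have id: "z \<otimes> (a \<otimes> f \<oplus> b \<otimes> g) \<ominus> (a \<otimes> e \<oplus> b \<otimes> h) = a \<otimes> (z \<otimes> f \<ominus> e) \<oplus> b \<otimes> (z \<otimes> g \<ominus> h)"
    if "z \<in> carrier R" "f \<in> carrier R" "g \<in> carrier R" "e \<in> carrier R" "h \<in> carrier R" for z f g e h
    using ab that by algebra
  show ?case using id[OF c] M by (simp add: IH)
qed

lemma minor_multilin: "multilin (minor R cs)"
proof (induction cs)
  case Nil
  then show ?case by (auto simp: multilin_def)
next
  case (Cons c cs)
  show ?case unfolding multilin_def minor.simps
    using expand_multilin[OF Cons, of _ _ _ _ "[]"] by auto
qed

lemma expand_adj1:
  assumes F: "\<And>us ws. set us \<subseteq> vecs R \<Longrightarrow> set ws \<subseteq> vecs R \<Longrightarrow> F (us @ v # v # ws) = \<zero>" and v: "v \<in> vecs R"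
  shows "set us \<subseteq> vecs R \<Longrightarrow> set us' \<subseteq> vecs R \<Longrightarrow> set vs \<subseteq> vecs R \<Longrightarrow> expand R F c (us @ v # v # us') vs = \<zero>"
proof (induction vs arbitrary: us')
  case (Cons x vs)
  have "F (us @ v # v # us' @ vs) = \<zero>" using F[of us "us' @ vs"] Cons.prems by simp
  then show ?case using Cons.IH[of "us' @ [x]"] Cons.prems by (simp add: vecsD a_minus_def)
qed simp

text \<open>Two summands delete one copy of \<open>v\<close> each; they cancel because the copies
  are adjacent and the signs alternate. In all other summands both copies survive inside
  \<open>F\<close>.\<close>

lemma expand_adj:
  assumes F: "\<And>us ws. set us \<subseteq> vecs R \<Longrightarrow> set ws \<subseteq> vecs R \<Longrightarrow> F (us @ v # v # ws) = \<zero>" and v: "v \<in> vecs R"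
    and Fc: "\<And>vs. set vs \<subseteq> vecs R \<Longrightarrow> F vs \<in> carrier R"
  shows "set us \<subseteq> vecs R \<Longrightarrow> set vs \<subseteq> vecs R \<Longrightarrow> set vs' \<subseteq> vecs R \<Longrightarrow> expand R F c us (vs @ v # v # vs') = \<zero>"
proof (induction vs arbitrary: us)
  case Nil
  have "expand R F c (us @ [v, v]) vs' = \<zero>" using expand_adj1[where F = F and v = v, OF F v, of us "[]"] Nil by simp
  moreover have "v c \<otimes> F (us @ v # vs') \<in> carrier R" using Nil v Fc by (auto simp: vecsD)
  ultimately show ?case by (simp add: a_minus_def r_neg)
next
  case (Cons x vs)
  then show ?case using Cons.IH[of "us @ [x]"] F[of "us @ vs" vs'] by (simp add: vecsD a_minus_def)
qed

lemma minor_adj: "v \<in> vecs R \<Longrightarrow> set us \<subseteq> vecs R \<Longrightarrow> set ws \<subseteq> vecs R \<Longrightarrow> minor R cs (us @ v # v # ws) = \<zero>"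
proof (induction cs arbitrary: us ws)
  case (Cons c cs)
  show ?case unfolding minor.simps by (rule expand_adj) (use Cons in auto)
qed simp

text \<open>With \<open>v + w\<close> in both places the minor vanishes; multilinearity expands it
  into four terms, two of which vanish as well.\<close>

lemma minor_swap:
  assumes "v \<in> vecs R" "w \<in> vecs R" "set us \<subseteq> vecs R" "set ws \<subseteq> vecs R"
  shows "minor R cs (us @ v # w # ws) = \<ominus> minor R cs (us @ w # v # ws)"
proof -
  define s where "s = (\<lambda>c. \<one> \<otimes> v c \<oplus> \<one> \<otimes> w c)"
  have s: "s \<in> vecs R" using assms by (auto simp: vecs_def s_def)
  note ml = multilinD[OF minor_multilin, where a = \<one> and b = \<one> and v = v and w = w, folded s_def]
  have "\<zero> = minor R cs (us @ s # s # ws)" using s assms by (simp add: minor_adj)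
  also have "\<dots> = minor R cs (us @ v # s # ws) \<oplus> minor R cs (us @ w # s # ws)"
    using ml[of us "s # ws"] s assms by simp
  also have "minor R cs (us @ v # s # ws) = minor R cs (us @ v # w # ws)"
    using ml[of "us @ [v]" ws] assms minor_adj[of v us ws cs] by simp
  also have "minor R cs (us @ w # s # ws) = minor R cs (us @ w # v # ws)"
    using ml[of "us @ [w]" ws] assms minor_adj[of w us ws cs] by simp
  finally have "minor R cs (us @ v # w # ws) \<oplus> minor R cs (us @ w # v # ws) = \<zero>" by simp
  then show ?thesis using assms by (intro sum_zero_eq_neg) auto
qed

text \<open>Swaps of neighbours bring the two copies together, changing at most the sign.\<close>

lemma minor_dup: "v \<in> vecs R \<Longrightarrow> set us \<subseteq> vecs R \<Longrightarrow> set us' \<subseteq> vecs R \<Longrightarrow> set ws \<subseteq> vecs R \<Longrightarrow>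
    minor R cs (us @ v # us' @ v # ws) = \<zero>"
proof (induction us' arbitrary: us)
  case (Cons u us')
  then show ?case using minor_swap[of v u us "us' @ v # ws" cs] Cons.IH[of "us @ [u]"] by simp
qed (simp add: minor_adj)

lemma minor_mem: "v \<in> set vs \<Longrightarrow> set vs \<subseteq> vecs R \<Longrightarrow> minor R cs (v # vs) = \<zero>"
  by (metis (no_types, lifting) Un_subset_iff append_Nil empty_set empty_subsetI in_set_conv_decomp insert_subset list.simps(15) minor_dup set_append)

lemma minor_lc_zero:
  assumes "set us \<subseteq> vecs R" "set ws \<subseteq> vecs R"
  shows "a \<in> vecs R \<Longrightarrow> set xs \<subseteq> vecs R \<Longrightarrow> (\<And>x. x \<in> set xs \<Longrightarrow> minor R cs (us @ x # ws) = \<zero>) \<Longrightarrow>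
    minor R cs (us @ lc R a xs # ws) = \<zero>"
proof (induction xs arbitrary: a)
  case Nil
  have z: "(\<lambda>c. \<zero>) \<in> vecs R" by (auto simp: vecs_def)
  have "lc R a [] = (\<lambda>c. \<zero> \<otimes> \<zero> \<oplus> \<zero> \<otimes> \<zero>)" by auto
  then show ?case
    using multilinD[OF minor_multilin, of us ws \<zero> \<zero> "\<lambda>c. \<zero>" "\<lambda>c. \<zero>" cs] assms z by simp
next
  case (Cons x xs)
  let ?a = "\<lambda>i. a (Suc i)"
  have a: "?a \<in> vecs R" "a 0 \<in> carrier R" using Cons.prems by (auto simp: vecs_def)
  have l: "lc R ?a xs \<in> vecs R" using a Cons.prems by (auto simp: vecs_def[of R])
  have "lc R a (x # xs) = (\<lambda>c. a 0 \<otimes> x c \<oplus> \<one> \<otimes> lc R ?a xs c)" using l by (auto simp: vecsD)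
  then show ?case
    using multilinD[OF minor_multilin, of us ws "a 0" \<one> x "lc R ?a xs" cs] assms Cons a l by simp
qed

text \<open>Every row other than \<open>v\<close> in the combination already occurs elsewhere in the
  list and contributes a minor with a repeated row, so only the coefficient at the position of
  \<open>v\<close> survives.\<close>

lemma minor_lc:
  assumes vs: "set us \<subseteq> vecs R" "set ws \<subseteq> vecs R" "v \<in> vecs R" and a: "a \<in> vecs R"
  shows "minor R cs (us @ lc R a (us @ v # ws) # ws) = a (length us) \<otimes> minor R cs (us @ v # ws)"
proof -
  let ?b = "\<lambda>i. a (Suc i + length us)"
  have b: "?b \<in> vecs R" "(\<lambda>i. a (i + length us)) \<in> vecs R" using a by (auto simp: vecs_def)
  let ?w = "\<lambda>c. a (length us) \<otimes> v c \<oplus> \<one> \<otimes> lc R ?b ws c"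
  have l: "lc R a us \<in> vecs R" "lc R ?b ws \<in> vecs R" "?w \<in> vecs R"
    using vs a b by (auto simp: vecs_def[of R] intro!: m_closed a_closed)
  have e: "lc R a (us @ v # ws) = (\<lambda>c. \<one> \<otimes> lc R a us c \<oplus> \<one> \<otimes> ?w c)"
  proof
    fix c
    show "lc R a (us @ v # ws) c = \<one> \<otimes> lc R a us c \<oplus> \<one> \<otimes> ?w c"
      using vs a l vecsD[OF l(1)] vecsD[OF l(2)] vecsD[OF l(3)] by (subst lc_append) (auto)
  qed
  have "minor R cs (us @ lc R a us # ws) = \<zero>"
    by (rule minor_lc_zero) (use vs a in \<open>auto simp: in_set_conv_decomp intro!: minor_dup\<close>)
  moreover have "minor R cs (us @ lc R ?b ws # ws) = \<zero>"
  proof (rule minor_lc_zero)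
    fix x assume "x \<in> set ws"
    then obtain w1 w2 where "ws = w1 @ x # w2" by (auto simp: in_set_conv_decomp)
    then show "minor R cs (us @ x # ws) = \<zero>" using vs by (auto intro!: minor_dup)
  qed (use vs b in auto)
  ultimately show ?thesis
    using vs l b a vecsD[OF a] multilinD[OF minor_multilin, of us ws \<one> \<one> "lc R a us" ?w cs]
      multilinD[OF minor_multilin, of us ws "a (length us)" \<one> v "lc R ?b ws" cs]
    by (simp add: e)
qed


lemma ideal_minus: "ideal P R \<Longrightarrow> x \<in> P \<Longrightarrow> y \<in> P \<Longrightarrow> x \<ominus> y \<in> P"
  unfolding a_minus_def
  by (intro additive_subgroup.a_closed additive_subgroup.a_inv_closed ideal.axioms(1))

lemma expand_passed_in_ideal:
  assumes P: "ideal P R" and F: "\<And>us ws. set us \<subseteq> vecs R \<Longrightarrow> set ws \<subseteq> vecs R \<Longrightarrow> F (us @ u # ws) \<in> P"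
  shows "set us \<subseteq> vecs R \<Longrightarrow> set us' \<subseteq> vecs R \<Longrightarrow> set vs \<subseteq> vecs R \<Longrightarrow> expand R F c (us @ u # us') vs \<in> P"
proof (induction vs arbitrary: us')
  case (Cons x vs)
  have "F (us @ u # us' @ vs) \<in> P" using F[of us "us' @ vs"] Cons.prems by simp
  then show ?case using Cons.IH[of "us' @ [x]"] Cons.prems P
    by (auto simp: vecsD intro!: ideal_minus ideal.I_l_closed)
qed (simp add: P additive_subgroup.zero_closed ideal.axioms(1))

text \<open>Only the summand that deletes \<open>u\<close> survives modulo \<open>P\<close>. Its
  sign depends on the position of \<open>u\<close> and is left as an unspecified \<open>e\<close>,
  since minors matter only up to units.\<close>

lemma expand_mod:
  assumes P: "ideal P R" and F: "\<And>us ws. set us \<subseteq> vecs R \<Longrightarrow> set ws \<subseteq> vecs R \<Longrightarrow> F (us @ u # ws) \<in> P"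
    and Fc: "\<And>vs. set vs \<subseteq> vecs R \<Longrightarrow> F vs \<in> carrier R" and u: "u \<in> vecs R"
  shows "set us \<subseteq> vecs R \<Longrightarrow> set vs \<subseteq> vecs R \<Longrightarrow> set vs' \<subseteq> vecs R \<Longrightarrow>
     \<exists>e\<in>{\<one>, \<ominus> \<one>}. expand R F c us (vs @ u # vs') \<ominus> e \<otimes> (u c \<otimes> F (us @ vs @ vs')) \<in> P"
proof (induction vs arbitrary: us)
  case Nil
  have m: "expand R F c (us @ [u]) vs' \<in> P" using expand_passed_in_ideal[where F = F and u = u, OF P F, of us "[]"] Nil by simp
  then have c: "expand R F c (us @ [u]) vs' \<in> carrier R" "u c \<in> carrier R" "F (us @ vs') \<in> carrier R"
    using Nil Fc u ideal.Icarr[OF P] by (auto simp: vecsD)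
  have "(x \<otimes> f \<ominus> e) \<ominus> \<one> \<otimes> (x \<otimes> f) = \<ominus> e" if "x \<in> carrier R" "f \<in> carrier R" "e \<in> carrier R" for x f e
    using that by algebra
  from this[OF c(2,3,1)] show ?case using m P
    by (intro bexI[of _ \<one>]) (auto intro: additive_subgroup.a_inv_closed ideal.axioms(1))
next
  case (Cons x vs)
  obtain e where e: "e \<in> {\<one>, \<ominus> \<one>}"
    "expand R F c (us @ [x]) (vs @ u # vs') \<ominus> e \<otimes> (u c \<otimes> F ((us @ [x]) @ vs @ vs')) \<in> P"
    using Cons.IH[of "us @ [x]"] Cons.prems by auto
  have m: "F (us @ vs @ u # vs') \<in> P" using F[of "us @ vs" vs'] Cons.prems by simp
  have c: "x c \<in> carrier R" "F (us @ vs @ u # vs') \<in> carrier R" "expand R F c (us @ [x]) (vs @ u # vs') \<in> carrier R"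
    "u c \<otimes> F (us @ x # vs @ vs') \<in> carrier R" "e \<in> carrier R"
    using Cons.prems Fc u e(1) by (auto simp: vecsD intro!: expand_closed)
  have id: "(y \<otimes> f \<ominus> g) \<ominus> (\<ominus> d) \<otimes> h = y \<otimes> f \<ominus> (g \<ominus> d \<otimes> h)"
    if "y \<in> carrier R" "f \<in> carrier R" "g \<in> carrier R" "h \<in> carrier R" "d \<in> carrier R" for y f g h d
    using that by algebra
  have "expand R F c us ((x # vs) @ u # vs') \<ominus> (\<ominus> e) \<otimes> (u c \<otimes> F (us @ (x # vs) @ vs')) \<in> P"
    using id[OF c] e m c P by (auto intro!: ideal_minus ideal.I_l_closed)
  moreover have "\<ominus> e \<in> {\<one>, \<ominus> \<one>}" using e by auto
  ultimately show ?case by blast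
qed

text \<open>By \<open>expand_mod\<close> only the summand deleting \<open>u\<close> remains modulo
  \<open>P\<close>, and it carries an entry of \<open>u\<close> as a factor. The zero ideal gives
  the case of a vanishing row.\<close>

lemma minor_in_ideal:
  assumes P: "ideal P R" and u: "u \<in> vecs R"
  shows "set us \<subseteq> vecs R \<Longrightarrow> set ws \<subseteq> vecs R \<Longrightarrow> (\<And>c. c \<in> set cs \<Longrightarrow> u c \<in> P) \<Longrightarrow> minor R cs (us @ u # ws) \<in> P"
proof (induction cs arbitrary: us ws)
  case Nil then show ?case by (simp add: P additive_subgroup.zero_closed ideal.axioms(1))
next
  case (Cons c cs)
  have IH: "minor R cs (us @ u # ws) \<in> P" if "set us \<subseteq> vecs R" "set ws \<subseteq> vecs R" for us ws
    using Cons that by auto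
  obtain e where e: "e \<in> {\<one>, \<ominus> \<one>}"
    "expand R (minor R cs) c [] (us @ u # ws) \<ominus> e \<otimes> (u c \<otimes> minor R cs ([] @ us @ ws)) \<in> P"
    using expand_mod[where F = "minor R cs" and u = u, OF P IH minor_closed u, where us = "[]" and vs = us and vs' = ws and c = c] Cons.prems by auto
  have c: "expand R (minor R cs) c [] (us @ u # ws) \<in> carrier R" "e \<in> carrier R" "minor R cs (us @ ws) \<in> carrier R" "u c \<in> P"
    using Cons.prems u e by (auto intro!: expand_closed)
  then have "u c \<otimes> minor R cs (us @ ws) \<in> P" using P by (blast intro: ideal.I_r_closed)
  then have m: "e \<otimes> (u c \<otimes> minor R cs (us @ ws)) \<in> P" using P c(2) by (blast intro: ideal.I_l_closed)
  have "x = (x \<ominus> y) \<oplus> y" if "x \<in> carrier R" "y \<in> carrier R" for x y using that by algebra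
  from this[OF c(1) ideal.Icarr[OF P m]] e(2) m show ?case
    by (simp del: expand.simps) (metis P additive_subgroup.a_closed ideal.axioms(1))
qed

lemma minor_expand_mod:
  assumes P: "ideal P R" and u: "u \<in> vecs R" "set us \<subseteq> vecs R" "set ws \<subseteq> vecs R" "\<And>c. c \<in> set cs \<Longrightarrow> u c \<in> P"
  shows "\<exists>e\<in>{\<one>, \<ominus> \<one>}. minor R (c # cs) (us @ u # ws) \<ominus> e \<otimes> (u c \<otimes> minor R cs (us @ ws)) \<in> P"
  using expand_mod[where F = "minor R cs" and u = u, OF P minor_in_ideal[OF P u(1) _ _ u(4)] minor_closed u(1), where us = "[]" and vs = us and vs' = ws and c = c] u
  by auto

lemma unit_vec_vecs [simp]: "unit_vec R c \<in> vecs R"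
  by (auto simp: unit_vec_def vecs_def)

lemma zero_ideal: "ideal {\<zero>} R"
  by (rule zeroideal)

lemma expand_Cons_passed:
  assumes F: "\<And>l. set l \<subseteq> vecs R \<Longrightarrow> F (u # l) = e \<otimes> G l" and G: "\<And>vs. set vs \<subseteq> vecs R \<Longrightarrow> G vs \<in> carrier R" and e: "e \<in> carrier R"
  shows "set us \<subseteq> vecs R \<Longrightarrow> set vs \<subseteq> vecs R \<Longrightarrow> expand R F c (u # us) vs = e \<otimes> expand R G c us vs"
proof (induction vs arbitrary: us)
  case (Cons x vs)
  have c: "x c \<in> carrier R" "G (us @ vs) \<in> carrier R" "expand R G c (us @ [x]) vs \<in> carrier R"
    using Cons.prems G by (auto simp: vecsD intro!: expand_closed)
  have id: "y \<otimes> (e \<otimes> g) \<ominus> e \<otimes> h = e \<otimes> (y \<otimes> g \<ominus> h)"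
    if "y \<in> carrier R" "g \<in> carrier R" "h \<in> carrier R" for y g h
    using that e by algebra
  show ?case using Cons.IH[of "us @ [x]"] Cons.prems F[of "us @ vs"] id[OF c] by simp
qed (simp add: e)

text \<open>A unit row strikes out its own column. The sign depends on the position of
  \<open>c\<close> among the columns and not on the other rows; the induction needs this uniformity,
  because the complementary minors take varying rows.\<close>

lemma minor_unit_vec:
  assumes vs: "set vs \<subseteq> vecs R" and "c \<notin> set xs" "c \<notin> set ys"
  shows "\<exists>e\<in>{\<one>, \<ominus> \<one>}. \<forall>vs. set vs \<subseteq> vecs R \<longrightarrow> minor R (xs @ c # ys) (unit_vec R c # vs) = e \<otimes> minor R (xs @ ys) vs"
  using assms(2)
proof (induction xs)
  case Nil
  have z: "minor R ys (us @ unit_vec R c # ws) \<in> {\<zero>}" if "set us \<subseteq> vecs R" "set ws \<subseteq> vecs R" for us ws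
    using that assms by (intro minor_in_ideal zero_ideal) (auto simp: unit_vec_def)
  have "minor R (c # ys) (unit_vec R c # vs) = \<one> \<otimes> minor R ys vs" if "set vs \<subseteq> vecs R" for vs
    using expand_passed_in_ideal[where F = "minor R ys" and u = "unit_vec R c", OF zero_ideal z, of "[]" "[]" vs c] that
    by (simp add: unit_vec_def a_minus_def)
  then show ?case by auto
next
  case (Cons x xs)
  then have "\<exists>e\<in>{\<one>, \<ominus> \<one>}. \<forall>vs. set vs \<subseteq> vecs R \<longrightarrow> minor R (xs @ c # ys) (unit_vec R c # vs) = e \<otimes> minor R (xs @ ys) vs"
    by (intro Cons.IH) auto
  then obtain e where e: "e \<in> {\<one>, \<ominus> \<one>}"
    "\<And>vs. set vs \<subseteq> vecs R \<Longrightarrow> minor R (xs @ c # ys) (unit_vec R c # vs) = e \<otimes> minor R (xs @ ys) vs"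
    by blast
  have ec: "e \<in> carrier R" using e by auto
  have "minor R ((x # xs) @ c # ys) (unit_vec R c # vs) = (\<ominus> e) \<otimes> minor R ((x # xs) @ ys) vs"
    if vs: "set vs \<subseteq> vecs R" for vs
  proof -
    have "minor R (xs @ c # ys) vs \<in> carrier R" "expand R (minor R (xs @ ys)) x [] vs \<in> carrier R"
      using vs by (auto intro!: expand_closed)
    moreover have "expand R (minor R (xs @ c # ys)) x [unit_vec R c] vs = e \<otimes> expand R (minor R (xs @ ys)) x [] vs"
      using vs by (intro expand_Cons_passed e ec) auto
    moreover have "unit_vec R c x = \<zero>" using Cons.prems by (auto simp: unit_vec_def)
    ultimately show ?thesis using ec by (simp add: a_minus_def l_minus)
  qed
  moreover have "\<ominus> e \<in> {\<one>, \<ominus> \<one>}" using e by auto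
  ultimately show ?case by blast
qed

lemma expand_hom:
  assumes h: "ring_hom_cring R S h" and F: "\<And>vs. set vs \<subseteq> vecs R \<Longrightarrow> h (F vs) = G (map (\<lambda>v c. h (v c)) vs)"
    and Fc: "\<And>vs. set vs \<subseteq> vecs R \<Longrightarrow> F vs \<in> carrier R"
  shows "set us \<subseteq> vecs R \<Longrightarrow> set vs \<subseteq> vecs R \<Longrightarrow>
    h (expand R F c us vs) = expand S G c (map (\<lambda>v c. h (v c)) us) (map (\<lambda>v c. h (v c)) vs)"
proof (induction vs arbitrary: us)
  interpret h: ring_hom_cring R S h by (rule h)
  case (Cons x vs)
  have c: "x c \<in> carrier R" "F (us @ vs) \<in> carrier R" "expand R F c (us @ [x]) vs \<in> carrier R"
    using Cons.prems Fc by (auto simp: vecsD intro!: expand_closed)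
  then show ?case using Cons.IH[of "us @ [x]"] Cons.prems F[of "us @ vs"] by (simp add: a_minus_def)
next
  interpret h: ring_hom_cring R S h by (rule h)
  case Nil then show ?case by simp
qed

lemma minor_hom:
  assumes h: "ring_hom_cring R S h"
  shows "set vs \<subseteq> vecs R \<Longrightarrow> h (minor R cs vs) = minor S cs (map (\<lambda>v c. h (v c)) vs)"
proof (induction cs arbitrary: vs)
  interpret h: ring_hom_cring R S h by (rule h)
  case Nil then show ?case by simp
next
  case (Cons c cs)
  show ?case unfolding minor.simps
    using expand_hom[OF h, of "minor R cs" "minor S cs" "[]" vs c] Cons by simp
qed

lemma lc_hom:
  assumes h: "ring_hom_cring R S h"
  shows "a \<in> vecs R \<Longrightarrow> set vs \<subseteq> vecs R \<Longrightarrow> h (lc R a vs c) = lc S (\<lambda>i. h (a i)) (map (\<lambda>v c. h (v c)) vs) c"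
proof (induction vs arbitrary: a)
  interpret h: ring_hom_cring R S h by (rule h)
  case Nil then show ?case by simp
next
  interpret h: ring_hom_cring R S h by (rule h)
  case (Cons v vs)
  have a: "(\<lambda>i. a (Suc i)) \<in> vecs R" "a 0 \<in> carrier R" "v c \<in> carrier R" using Cons.prems by (auto simp: vecs_def)
  then show ?case using Cons by (simp add: comp_def)
qed

text \<open>Rank is detected by minors, over the residue domain of \<open>P\<close>. Columns are
  discarded while the rows stay independent. When dropping \<open>c\<close> makes them dependent,
  some combination with a coefficient \<open>a k \<notin> P\<close> vanishes off \<open>c\<close>
  modulo \<open>P\<close>; put into row \<open>k\<close> it multiplies the minor by
  \<open>a k\<close>, and expansion along it leaves its entry in column \<open>c\<close> times a
  minor of the other rows.\<close>

lemma indep_minor: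
  assumes P: "primeideal P R"
  shows "set vs \<subseteq> vecs R \<Longrightarrow> indep_mod R P (set cols) vs \<Longrightarrow>
    \<exists>cs. subseq cs cols \<and> length cs = length vs \<and> minor R cs vs \<notin> P"
proof (induction cols arbitrary: vs)
  interpret P: primeideal P R by (rule P)
  have one: "\<one> \<notin> P" using P.I_notcarr P.one_imp_carrier by auto
  {
    case Nil
    have "vs = []"
    proof (rule ccontr)
      assume "vs \<noteq> []"
      moreover have "(\<lambda>i. \<one>) \<in> vecs R" by (simp add: vecs_def)
      ultimately show False using Nil one unfolding indep_mod_def by (metis empty_iff empty_set length_greater_0_conv)
    qed
    then show ?case using one by auto
  next
    case (Cons c cols)
    show ?case
    proof (cases "indep_mod R P (set cols) vs")
      case True
      then show ?thesis using Cons.IH[OF Cons.prems(1)] by (metis list_emb_Cons)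
    next
      case False
      then obtain a k where a: "a \<in> vecs R" "\<And>d. d \<in> set cols \<Longrightarrow> lc R a vs d \<in> P" "k < length vs" "a k \<notin> P"
        by (auto simp: indep_mod_def)
      define us v ws where "us = take k vs" and "v = vs ! k" and "ws = drop (Suc k) vs"
      have vs: "vs = us @ v # ws" "length us = k" using a(3) by (auto simp: us_def v_def ws_def id_take_nth_drop)
      have cl: "set us \<subseteq> vecs R" "set ws \<subseteq> vecs R" "v \<in> vecs R" using Cons.prems(1) vs by auto
      have b: "lc R a vs c \<notin> P"
        using Cons.prems(2) a by (auto simp: indep_mod_def)
      have uc: "lc R a vs \<in> vecs R" using a Cons.prems by (auto simp: vecs_def[of R])
      \<comment> \<open>A second relation among the rows other than \<open>k\<close> could be
        combined with \<open>a\<close> so that column \<open>c\<close> is cancelled too, against the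
        independence on all columns.\<close>
      have ind: "indep_mod R P (set cols) (us @ ws)"
        unfolding indep_mod_def
      proof (intro ballI impI)
        fix d assume d: "d \<in> vecs R" "\<forall>c\<in>set cols. lc R d (us @ ws) c \<in> P"
        define d' where "d' = (\<lambda>i. if i < k then d i else if i = k then \<zero> else d (i - 1))"
        have d': "d' \<in> vecs R" using d by (auto simp: d'_def vecs_def)
        have dd: "lc R d' vs x = lc R d (us @ ws) x" for x
        proof -
          have "lc R d' us x = lc R d us x" by (rule lc_cong) (simp add: d'_def vs(2))
          moreover have "lc R (\<lambda>i. d' (Suc i + k)) ws x = lc R (\<lambda>i. d (i + k)) ws x"
            by (rule lc_cong) (simp add: d'_def)
          moreover have "(\<lambda>i. d (i + k)) \<in> vecs R" "(\<lambda>i. d' (i + k)) \<in> vecs R" using d d' by (auto simp: vecs_def)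
          ultimately show ?thesis
            using cl d d' unfolding vs(1) by (subst (1 2) lc_append) (auto simp: vs(2) vecsD, auto simp: d'_def vecsD)
        qed
        let ?x = "lc R d' vs c" and ?y = "lc R a vs c"
        have xy: "?x \<in> carrier R" "?y \<in> carrier R" using d' a Cons.prems by auto
        \<comment> \<open>This cross combination cancels in column \<open>c\<close>. Its entry at
          \<open>k\<close> is \<open>?x \<otimes> a k\<close>, because \<open>d'\<close> is zero
          there, and this forces \<open>?x \<in> P\<close>.\<close>
        define f where "f = (\<lambda>i. ?x \<otimes> a i \<oplus> (\<ominus> ?y) \<otimes> d' i)"
        have f: "f \<in> vecs R" using xy a d' by (auto simp: f_def vecs_def)
        have lf: "lc R f vs x = ?x \<otimes> lc R a vs x \<oplus> (\<ominus> ?y) \<otimes> lc R d' vs x" for x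
          unfolding f_def using xy a d' Cons.prems
          by (subst lc_add) (auto simp: lc_smult vecs_def intro!: lc_smult)
        have "lc R f vs x \<in> P" if "x \<in> set (c # cols)" for x
        proof (cases "x = c")
          case True
          have "?x \<otimes> ?y \<oplus> (\<ominus> ?y) \<otimes> ?x = \<zero>" using xy by algebra
          then show ?thesis by (simp add: lf True)
        next
          case False
          then have "lc R a vs x \<in> P" "lc R d' vs x \<in> P" using that a d dd by auto
          then show ?thesis using xy by (simp add: lf P.I_l_closed P.a_closed)
        qed
        then have fP: "f i \<in> P" if "i < length vs" for i
          using Cons.prems(2) f that by (auto simp: indep_mod_def)
        have "f k = ?x \<otimes> a k" using xy a by (simp add: f_def d'_def vecsD)
        then have "?x \<in> P" using fP[OF a(3)] P.I_prime[OF xy(1) vecsD[OF a(1)]] a(4) by metis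
        have "d' i \<in> P" if "i < length vs" for i
        proof -
          have c: "a i \<in> carrier R" "d' i \<in> carrier R" using a d' by (auto simp: vecsD)
          have "f i \<in> P" "?x \<otimes> a i \<in> P" using fP that \<open>?x \<in> P\<close> c by (auto intro!: P.I_r_closed)
          moreover have "x \<otimes> z \<ominus> (x \<otimes> z \<oplus> (\<ominus> y) \<otimes> w) = y \<otimes> w"
            if "x \<in> carrier R" "y \<in> carrier R" "z \<in> carrier R" "w \<in> carrier R" for x y z w
            using that by algebra
          ultimately have "?y \<otimes> d' i \<in> P"
            using ideal_minus[OF P.ideal_axioms] xy c unfolding f_def by metis
          then show ?thesis using P.I_prime[OF xy(2) c(2)] b by auto
        qed
        moreover have "d i = (if i < k then d' i else d' (Suc i))" for i by (simp add: d'_def)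
        moreover have "length vs = Suc (length (us @ ws))" using vs by simp
        ultimately show "\<forall>i<length (us @ ws). d i \<in> P" by (metis Suc_less_eq less_Suc_eq)
      qed
      have uws: "set (us @ ws) \<subseteq> vecs R" using cl by simp
      obtain cs where cs: "subseq cs cols" "length cs = length (us @ ws)" "minor R cs (us @ ws) \<notin> P"
        using Cons.IH[OF uws ind] by blast
      let ?M = "minor R (c # cs) (us @ lc R a vs # ws)"
      have "set cs \<subseteq> set cols"
      proof
        fix x assume "x \<in> set cs"
        then show "x \<in> set cols" using list_emb_set[OF cs(1)] by metis
      qed
      then obtain e where e: "e \<in> {\<one>, \<ominus> \<one>}" "?M \<ominus> e \<otimes> (lc R a vs c \<otimes> minor R cs (us @ ws)) \<in> P"
        using minor_expand_mod[OF P.ideal_axioms uc cl(1,2), of cs c] a(2) by blast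
      have M: "?M = a k \<otimes> minor R (c # cs) vs"
        using minor_lc[OF cl a(1), of "c # cs"] vs by (simp del: minor.simps)
      have "minor R (c # cs) vs \<notin> P"
      proof
        assume "minor R (c # cs) vs \<in> P"
        then have MP: "?M \<in> P" unfolding M using a by (intro P.I_l_closed) (auto simp: vecsD)
        let ?N = "lc R a vs c \<otimes> minor R cs (us @ ws)"
        have "set (us @ lc R a vs # ws) \<subseteq> vecs R" using uc cl by simp
        then have N: "?N \<in> carrier R" "?M \<in> carrier R" "e \<in> carrier R"
          using uc cl e(1) minor_closed[of _ "c # cs"] by (auto simp: vecsD simp del: minor.simps)
        have "x \<ominus> (x \<ominus> y) = y" if "x \<in> carrier R" "y \<in> carrier R" for x y using that by algebra
        then have "e \<otimes> ?N \<in> P" using ideal_minus[OF P.ideal_axioms MP e(2)] N by simp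
        then have "e \<otimes> (e \<otimes> ?N) \<in> P" using N(3) by (rule P.I_l_closed)
        moreover have "e \<otimes> (e \<otimes> ?N) = ?N" using e(1) N by (auto simp: l_minus)
        ultimately show False using P.I_prime[of "lc R a vs c" "minor R cs (us @ ws)"] b cs(3) uc cl by (auto simp: vecsD)
      qed
      then show ?thesis using cs vs by (intro exI[of _ "c # cs"]) auto
    qed
  }
qed

end

section \<open>Factorial domains\<close>

text \<open>Nonzero is demanded separately because in a domain zero satisfies the conditions of
  \<open>prime\<close>.\<close>

definition prime_el :: "('a, 'b) ring_scheme \<Rightarrow> 'a \<Rightarrow> bool" where
  "prime_el R p \<longleftrightarrow> p \<in> carrier R \<and> p \<noteq> \<zero>\<^bsub>R\<^esub> \<and> prime R p"

definition coprime_el :: "('a, 'b) ring_scheme \<Rightarrow> 'a \<Rightarrow> 'a \<Rightarrow> bool" where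
  "coprime_el R a b \<longleftrightarrow> (\<forall>p. prime_el R p \<longrightarrow> \<not> (p divides\<^bsub>R\<^esub> a \<and> p divides\<^bsub>R\<^esub> b))"

lemma dividesI2: "c \<in> carrier R \<Longrightarrow> b = a \<otimes>\<^bsub>R\<^esub> c \<Longrightarrow> a divides\<^bsub>R\<^esub> b"
  by (auto simp: factor_def)

lemma dividesE2: "a divides\<^bsub>R\<^esub> b \<Longrightarrow> (\<And>c. c \<in> carrier R \<Longrightarrow> b = a \<otimes>\<^bsub>R\<^esub> c \<Longrightarrow> thesis) \<Longrightarrow> thesis"
  by (auto simp: factor_def)

lemma (in cring) ideal_criterion:
  assumes "I \<subseteq> carrier R" "\<zero> \<in> I" "\<And>x y. x \<in> I \<Longrightarrow> y \<in> I \<Longrightarrow> x \<oplus> y \<in> I"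
    "\<And>a x. a \<in> carrier R \<Longrightarrow> x \<in> I \<Longrightarrow> a \<otimes> x \<in> I"
  shows "ideal I R"
proof (rule idealI[OF ring_axioms])
  show "subgroup I (add_monoid R)"
  proof (rule subgroup.intro)
    fix x assume x: "x \<in> I"
    then have "\<ominus> x = (\<ominus> \<one>) \<otimes> x" using assms(1) by (auto simp: l_minus)
    then show "inv\<^bsub>add_monoid R\<^esub> x \<in> I" using assms(4)[of "\<ominus> \<one>" x] x by (simp add: a_inv_def[symmetric])
  qed (use assms in auto)
  fix a x assume "a \<in> I" "x \<in> carrier R"
  then show "x \<otimes> a \<in> I" "a \<otimes> x \<in> I" using assms(1) assms(4)[of x a] by (auto simp: m_comm[of a x])
qed

context domain
begin

lemma prime_elD:
  assumes "prime_el R p"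
  shows "p \<in> carrier R" "p \<noteq> \<zero>" "p \<notin> Units R"
  using assms by (auto simp: prime_el_def prime_def)

lemma prime_el_dvd:
  assumes "prime_el R p" "p divides a \<otimes> b" "a \<in> carrier R" "b \<in> carrier R"
  shows "p divides a \<or> p divides b"
  using assms by (auto simp: prime_el_def prime_def)

lemma prime_el_primeideal:
  assumes "prime_el R p" shows "primeideal (PIdl p) R"
  using assms primeideal_iff_prime[of p] by (auto simp: prime_el_def ring_prime_def)

lemma mem_PIdl_iff: "p \<in> carrier R \<Longrightarrow> x \<in> PIdl p \<longleftrightarrow> p divides x"
  by (auto simp: cgenideal_def factor_def m_comm)

lemma dvd_trans: "a divides b \<Longrightarrow> b divides c \<Longrightarrow> a \<in> carrier R \<Longrightarrow> a divides c"
  by (rule divides_trans)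

lemma dvd_multI: "a divides b \<Longrightarrow> a \<in> carrier R \<Longrightarrow> b \<in> carrier R \<Longrightarrow> c \<in> carrier R \<Longrightarrow> a divides b \<otimes> c"
  by (erule dividesE2, rule dividesI2[of "_ \<otimes> c"]) (auto simp: m_assoc)

lemma dvd_multI2: "a divides c \<Longrightarrow> a \<in> carrier R \<Longrightarrow> b \<in> carrier R \<Longrightarrow> c \<in> carrier R \<Longrightarrow> a divides b \<otimes> c"
  using dvd_multI[of a c b] by (simp add: m_comm)

lemma dvd_selfI: "a \<in> carrier R \<Longrightarrow> c \<in> carrier R \<Longrightarrow> a divides a \<otimes> c"
  by (rule dividesI2) auto

lemma dvd_addI:
  assumes "a divides b" "a divides c" "a \<in> carrier R"
  shows "a divides (b \<oplus> c)"
proof -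
  obtain x y where "x \<in> carrier R" "b = a \<otimes> x" "y \<in> carrier R" "c = a \<otimes> y" using assms by (auto elim!: dividesE2)
  then show ?thesis using assms by (intro dividesI2[of "x \<oplus> y"]) (auto simp: r_distr)
qed

lemma dvd_a_inv:
  assumes "a divides b" "a \<in> carrier R"
  shows "a divides (\<ominus> b)"
proof -
  obtain x where "x \<in> carrier R" "b = a \<otimes> x" using assms by (auto elim!: dividesE2)
  then show ?thesis using assms by (intro dividesI2[of "\<ominus> x"]) (auto simp: r_minus)
qed

lemma dvd_add_cancel:
  assumes "a divides (b \<oplus> c)" "a divides b" "a \<in> carrier R" "b \<in> carrier R" "c \<in> carrier R"
  shows "a divides c"
proof -
  have "c = (b \<oplus> c) \<oplus> \<ominus> b" using assms by algebra
  then show ?thesis using dvd_addI[OF assms(1) dvd_a_inv[OF assms(2)]] assms by metis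
qed

lemma dvd_mult_cancel:
  assumes "c \<otimes> a divides c \<otimes> b" "a \<in> carrier R" "b \<in> carrier R" "c \<in> carrier R" "c \<noteq> \<zero>"
  shows "a divides b"
  using mult_divides[of a b c] assms by auto

lemma prime_el_dvd_prime_el:
  assumes p: "prime_el R p" and q: "prime_el R q" and pq: "p divides q"
  shows "q divides p"
proof -
  note pp = p and qq = q
  note p = prime_elD[OF pp] and q = prime_elD[OF qq]
  obtain c where c: "c \<in> carrier R" "q = p \<otimes> c" using pq by (auto elim: dividesE2)
  have "q divides p \<otimes> c" using c(2) q(1) divides_refl by metis
  then consider "q divides p" | "q divides c" using prime_el_dvd[OF qq _ p(1) c(1)] by blast
  then show ?thesis
  proof cases
    case 2
    then obtain d where d: "d \<in> carrier R" "c = q \<otimes> d" by (auto elim: dividesE2)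
    then have "q \<otimes> \<one> = q \<otimes> (p \<otimes> d)" using c(2) p(1) q(1) by (metis m_lcomm r_one)
    then have "\<one> = p \<otimes> d" using m_lcancel[OF q(2,1) one_closed m_closed[OF p(1) d(1)]] by simp
    then have "p \<in> Units R" using p(1) d m_comm[OF p(1) d(1)] unfolding Units_def by auto
    then show ?thesis using p(3) by simp
  qed
qed

lemma unit_dvd: "u \<in> Units R \<Longrightarrow> a \<in> carrier R \<Longrightarrow> u divides a"
  by (rule dividesI2[of "inv u \<otimes> a"]) (simp_all add: m_assoc[symmetric] Units_closed)

lemma prime_not_dvd_unit: "prime_el R p \<Longrightarrow> u \<in> Units R \<Longrightarrow> \<not> p divides u"
proof
  assume p: "prime_el R p" and u: "u \<in> Units R" "p divides u"
  then obtain c where "c \<in> carrier R" "u = p \<otimes> c" by (auto elim: dividesE2)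
  then show False using p u unit_factor[of p c] by (auto simp: prime_el_def prime_def)
qed

end

context factorial_domain
begin

lemma prime_induct [consumes 2, case_names unit prime]:
  assumes a: "a \<in> carrier R" "a \<noteq> \<zero>"
    and unit: "\<And>u. u \<in> Units R \<Longrightarrow> P u"
    and step: "\<And>p a. prime_el R p \<Longrightarrow> a \<in> carrier R \<Longrightarrow> a \<noteq> \<zero> \<Longrightarrow> P a \<Longrightarrow> P (p \<otimes> a)"
  shows "P a"
proof (cases "a \<in> Units R")
  case False
  have *: "foldr (\<otimes>) fs \<one> \<in> carrier R - {\<zero>} \<and> P (foldr (\<otimes>) fs \<one>)"
    if "set fs \<subseteq> carrier (mult_of R)" "\<forall>x\<in>set fs. irreducible (mult_of R) x" for fs
    using that
  proof (induction fs)
    case Nil then show ?case using unit[of \<one>] by auto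
  next
    case (Cons x fs)
    have x: "x \<in> carrier R" "x \<noteq> \<zero>" "prime (mult_of R) x" using Cons.prems factorial_monoid.irreducible_prime[OF factorial_monoid_axioms] by auto
    then have "prime_el R x" using prime_eq_prime_mult by (auto simp: prime_el_def)
    then show ?case using Cons step[of x "foldr (\<otimes>) fs \<one>"] x by (auto simp: integral_iff)
  qed
  obtain fs where "set fs \<subseteq> carrier (mult_of R)" "factors (mult_of R) fs a"
    using factorial_monoid.factors_exist[OF factorial_monoid_axioms, of a] a False by auto
  then show ?thesis using *[of fs] by (auto simp: factors_def)
qed (rule unit)

text \<open>\<open>d\<close> is the greatest common divisor of \<open>I\<close>. It is found by
  induction over the prime factors of one nonzero element, stripping a prime \<open>p\<close> by
  passing to \<open>J = (I : p)\<close>. If \<open>p\<close> divides all of \<open>I\<close>, the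
  divisor of \<open>J\<close> is multiplied by \<open>p\<close>; otherwise it serves for
  \<open>I\<close> unchanged.\<close>

lemma ideal_content:
  assumes "ideal I R" "a \<in> I" "a \<noteq> \<zero>"
  shows "\<exists>d\<in>carrier R. d \<noteq> \<zero> \<and> (\<forall>b\<in>I. d divides b) \<and>
    (\<forall>p. prime_el R p \<longrightarrow> (\<exists>j\<in>carrier R. d \<otimes> j \<in> I \<and> \<not> p divides j))"
proof -
  have "a \<in> carrier R" using assms ideal.Icarr by fast
  from this assms(3) show ?thesis using assms(1,2)
  proof (induction a arbitrary: I rule: prime_induct)
    case (unit u)
    then have "\<one> \<in> I" by (metis Units_inv_closed Units_r_inv ideal.I_r_closed)
    then show ?case using unit by (intro bexI[of _ \<one>]) (auto dest: ideal.Icarr intro!: bexI[of _ \<one>] one_divides simp: prime_not_dvd_unit)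
  next
    case (prime p a)
    note p = prime_elD[OF prime.hyps(1)]
    interpret I: ideal I R by (rule prime.prems)
    define J where "J = {x \<in> carrier R. p \<otimes> x \<in> I}"
    have iJ: "ideal J R"
    proof (rule ideal_criterion)
      fix x y assume "x \<in> J" "y \<in> J"
      then show "x \<oplus> y \<in> J" using p by (auto simp: J_def r_distr)
    next
      fix c x assume "c \<in> carrier R" "x \<in> J"
      then show "c \<otimes> x \<in> J" using p by (auto simp: J_def m_lcomm[of p] I.I_l_closed)
    qed (use p in \<open>auto simp: J_def\<close>)
    have aJ: "a \<in> J" using prime.hyps(2) prime.prems(2) by (simp add: J_def)
    obtain d where d: "d \<in> carrier R" "d \<noteq> \<zero>" "\<And>b. b \<in> J \<Longrightarrow> d divides b"
      "\<And>q. prime_el R q \<Longrightarrow> \<exists>j\<in>carrier R. d \<otimes> j \<in> J \<and> \<not> q divides j"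
      using prime.IH[OF iJ aJ] by blast
    show ?case
    proof (cases "\<forall>b\<in>I. p divides b")
      case True
      have "p \<otimes> d divides b" if "b \<in> I" for b
      proof -
        obtain c where c: "c \<in> carrier R" "b = p \<otimes> c" using dividesE2[OF bspec[OF True \<open>b \<in> I\<close>]] by auto
        then have "d divides c" using d(3) that by (auto simp: J_def)
        then show ?thesis using c p d divides_mult by blast
      qed
      moreover have "\<exists>j\<in>carrier R. p \<otimes> d \<otimes> j \<in> I \<and> \<not> q divides j" if "prime_el R q" for q
        using d(4)[OF that] p d(1) by (auto simp: J_def m_assoc)
      ultimately show ?thesis using d p by (intro bexI[of _ "p \<otimes> d"]) (auto simp: integral_iff)
    next
      case False
      then obtain b where b: "b \<in> I" "\<not> p divides b" by auto
      have IJ: "x \<in> J" if "x \<in> I" for x using that p by (auto simp: J_def I.I_l_closed)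
      \<comment> \<open>Multiplying a witness for \<open>J\<close> by \<open>p\<close> gives one for
        \<open>I\<close>, unless \<open>q\<close> is associated to \<open>p\<close>; in that case
        \<open>b\<close>, which \<open>p\<close> does not divide, supplies the witness.\<close>
      have "\<exists>j\<in>carrier R. d \<otimes> j \<in> I \<and> \<not> q divides j" if q: "prime_el R q" for q
      proof (rule ccontr)
        assume n: "\<not> ?thesis"
        obtain j where j: "j \<in> carrier R" "d \<otimes> j \<in> J" "\<not> q divides j" using d(4)[OF q] by auto
        have "d \<otimes> (p \<otimes> j) \<in> I" using j p d by (auto simp: J_def m_lcomm)
        then have "q divides p \<otimes> j" using n j p by auto
        then have "q divides p" using prime_el_dvd[OF q] j p by blast
        then have pq: "p divides q" using prime_el_dvd_prime_el[OF q prime.hyps(1)] by simp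
        obtain c where c: "c \<in> carrier R" "b = d \<otimes> c" using d(3)[OF IJ[OF b(1)]] by (auto elim: dividesE2)
        then have "q divides c" using n b by auto
        then have "p divides b" using pq c d p prime_elD[OF q]
          by (auto intro!: dvd_multI2 intro: dvd_trans)
        then show False using b by simp
      qed
      then show ?thesis using d IJ by (intro bexI[of _ d]) auto
    qed
  qed
qed

text \<open>Prime avoidance, by induction over the prime factors of \<open>p\<close>. If a new prime
  divides the \<open>q\<close> found so far, it does not divide the remaining cofactor
  \<open>a\<close>; adding \<open>a \<otimes> j\<close> with \<open>j \<in> I\<close> outside that
  prime repairs this and changes nothing modulo the primes dividing \<open>a\<close>.\<close>

lemma ideal_coprime_to:
  assumes I: "ideal I R" and p: "p \<in> carrier R" "p \<noteq> \<zero>"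
    and nc: "\<And>q. prime_el R q \<Longrightarrow> \<exists>j\<in>I. \<not> q divides j"
  shows "\<exists>q\<in>I. coprime_el R p q"
  using p
proof (induction p rule: prime_induct)
  case (unit u)
  then show ?case using ideal.axioms(1)[OF I] additive_subgroup.zero_closed prime_not_dvd_unit
    by (fastforce simp: coprime_el_def)
next
  case (prime p a)
  interpret I: ideal I R by (rule I)
  note p = prime_elD[OF prime.hyps(1)]
  obtain q where q: "q \<in> I" "coprime_el R a q" using prime by auto
  have qc: "q \<in> carrier R" using q by (simp add: I.Icarr)
  show ?case
  proof (cases "p divides q")
    case False
    have "coprime_el R (p \<otimes> a) q"
      unfolding coprime_el_def
    proof (intro allI impI notI)
      fix r assume r: "prime_el R r" "r divides p \<otimes> a \<and> r divides q"
      then have "r divides p" using q(2) prime_el_dvd[OF r(1) _ p(1) prime.hyps(2)] by (auto simp: coprime_el_def)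
      then have "p divides r" using prime_el_dvd_prime_el[OF r(1) prime.hyps(1)] by simp
      then show False using r False p dvd_trans by blast
    qed
    then show ?thesis using q by auto
  next
    case True
    then have pa: "\<not> p divides a" using q(2) prime.hyps(1) by (auto simp: coprime_el_def)
    obtain j where j: "j \<in> I" "\<not> p divides j" using nc[OF prime.hyps(1)] by auto
    have jc: "j \<in> carrier R" using j by (simp add: I.Icarr)
    let ?q = "q \<oplus> a \<otimes> j"
    have "coprime_el R (p \<otimes> a) ?q"
      unfolding coprime_el_def
    proof (intro allI impI notI)
      fix r assume r: "prime_el R r" "r divides p \<otimes> a \<and> r divides ?q"
      note rp = prime_elD[OF r(1)]
      consider "r divides p" | "r divides a" using r prime_el_dvd[OF r(1) _ p(1) prime.hyps(2)] by blast
      then show False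
      proof cases
        case 1
        then have "p divides r" using prime_el_dvd_prime_el[OF r(1) prime.hyps(1)] by simp
        then have "p divides ?q" using r p dvd_trans by blast
        then have "p divides a \<otimes> j" using True p qc jc prime dvd_add_cancel by blast
        then show False using prime_el_dvd[OF prime.hyps(1)] pa j jc prime.hyps(2) by blast
      next
        case 2
        then have "r divides a \<otimes> j" using rp jc prime by (auto intro: dvd_multI)
        then have "r divides q" using r rp qc jc prime dvd_add_cancel[of r "a \<otimes> j" q] by (auto simp: a_comm)
        then show False using 2 q r by (auto simp: coprime_el_def)
      qed
    qed
    moreover have "?q \<in> I" using q j prime by (auto intro: I.a_closed I.I_l_closed)
    ultimately show ?thesis by auto
  qed
qed

text \<open>Euclid's lemma, one prime factor of \<open>p\<close> at a time: a prime factor cannot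
  divide \<open>q\<close>, so it divides \<open>z\<close> and can be cancelled.\<close>

lemma coprime_el_dvd:
  assumes "p \<in> carrier R" "p \<noteq> \<zero>" "coprime_el R p q" "q \<in> carrier R" "z \<in> carrier R" "p divides q \<otimes> z"
  shows "p divides z"
  using assms
proof (induction p arbitrary: z rule: prime_induct)
  case (unit u)
  then show ?case by (auto intro: unit_dvd)
next
  case (prime p a)
  note p = prime_elD[OF prime.hyps(1)]
  note ac = prime.hyps(2) and qc = prime.prems(2) and zc = prime.prems(3)
  have cp: "coprime_el R (p \<otimes> a) q" "p \<otimes> a divides q \<otimes> z" using prime.prems by simp_all
  have "\<not> p divides q" using cp(1) prime.hyps(1) dvd_selfI[OF p(1) ac] by (auto simp: coprime_el_def)
  moreover have "p divides q \<otimes> z" using dvd_trans[OF dvd_selfI[OF p(1) ac] cp(2) p(1)] .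
  ultimately have "p divides z" using prime_el_dvd[OF prime.hyps(1)] qc zc by blast
  then obtain w where w: "w \<in> carrier R" "z = p \<otimes> w" by (auto elim: dividesE2)
  have "p \<otimes> a divides p \<otimes> (q \<otimes> w)" using cp(2) w p qc by (simp add: m_lcomm)
  then have "a divides q \<otimes> w" using dvd_mult_cancel[of p a "q \<otimes> w"] ac qc w p by simp
  moreover have "coprime_el R a q"
    using cp(1) unfolding coprime_el_def by (metis ac p(1) dvd_multI2 prime_elD(1))
  ultimately have "a divides w" using prime.IH w(1) qc by simp
  then show ?case using w p divides_mult[OF ac p(1)] by simp
qed

text \<open>Reduction to lowest terms, with \<open>d\<close> the content of the ideal generated by
  \<open>c\<close> and \<open>s\<close>.\<close>

lemma coprime_quotients:
  assumes "c \<in> carrier R" "s \<in> carrier R" "c \<noteq> \<zero>"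
  shows "\<exists>d\<in>carrier R. \<exists>f\<in>carrier R. \<exists>g\<in>carrier R. d \<noteq> \<zero> \<and> c = d \<otimes> f \<and> s = d \<otimes> g \<and> coprime_el R f g"
proof -
  define I where "I = {x. \<exists>a\<in>carrier R. \<exists>b\<in>carrier R. x = a \<otimes> c \<oplus> b \<otimes> s}"
  have "ideal I R"
  proof (rule ideal_criterion)
    fix x y assume "x \<in> I" "y \<in> I"
    then obtain a b a' b' where ab: "a \<in> carrier R" "b \<in> carrier R" "x = a \<otimes> c \<oplus> b \<otimes> s"
      "a' \<in> carrier R" "b' \<in> carrier R" "y = a' \<otimes> c \<oplus> b' \<otimes> s" by (auto simp: I_def)
    then have "x \<oplus> y = (a \<oplus> a') \<otimes> c \<oplus> (b \<oplus> b') \<otimes> s" using assms by algebra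
    then show "x \<oplus> y \<in> I" using ab by (auto simp: I_def)
  next
    fix x a assume x: "x \<in> carrier R" and "a \<in> I"
    then obtain d b where ab: "d \<in> carrier R" "b \<in> carrier R" "a = d \<otimes> c \<oplus> b \<otimes> s" by (auto simp: I_def)
    then have "x \<otimes> a = (x \<otimes> d) \<otimes> c \<oplus> (x \<otimes> b) \<otimes> s" using assms x by algebra
    then show "x \<otimes> a \<in> I" using ab x by (auto simp: I_def)
  qed (use assms in \<open>auto simp: I_def intro!: bexI[of _ \<zero>]\<close>)
  moreover have "c \<in> I" "s \<in> I"
    using assms by (auto simp: I_def) (metis l_one l_null l_zero r_zero one_closed zero_closed)+
  ultimately obtain d where d: "d \<in> carrier R" "d \<noteq> \<zero>" "\<And>b. b \<in> I \<Longrightarrow> d divides b"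
    "\<And>p. prime_el R p \<Longrightarrow> \<exists>j\<in>carrier R. d \<otimes> j \<in> I \<and> \<not> p divides j"
    using ideal_content[of I c] assms by auto
  obtain f g where fg: "f \<in> carrier R" "c = d \<otimes> f" "g \<in> carrier R" "s = d \<otimes> g"
    using d(3) \<open>c \<in> I\<close> \<open>s \<in> I\<close> by (metis dividesE2)
  have "coprime_el R f g" unfolding coprime_el_def
  proof (intro allI impI notI)
    fix p assume p: "prime_el R p" "p divides f \<and> p divides g"
    obtain j where j: "j \<in> carrier R" "d \<otimes> j \<in> I" "\<not> p divides j" using d(4)[OF p(1)] by auto
    obtain a b where ab: "a \<in> carrier R" "b \<in> carrier R" "d \<otimes> j = a \<otimes> c \<oplus> b \<otimes> s" using j by (auto simp: I_def)
    have "d \<otimes> j = d \<otimes> (a \<otimes> f \<oplus> b \<otimes> g)" unfolding ab(3) fg(2,4) using fg(1,3) ab(1,2) d(1) by algebra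
    then have "j = a \<otimes> f \<oplus> b \<otimes> g" using d(1,2) j(1) fg ab(1,2) m_lcancel[of d j "a \<otimes> f \<oplus> b \<otimes> g"] by simp
    then show False using j(3) p ab fg prime_elD(1)[OF p(1)] by (auto intro!: dvd_addI dvd_multI2)
  qed
  then show ?thesis using d fg by blast
qed

end

text \<open>In a Noetherian domain factorizations into irreducibles exist, so uniqueness reduces to
  irreducible elements being prime.\<close>

lemma (in noetherian_domain) factorial_domainI:
  assumes "\<And>p. p \<in> carrier R \<Longrightarrow> p \<noteq> \<zero> \<Longrightarrow> p \<notin> Units R \<Longrightarrow>
      (\<And>a b. a \<in> carrier R \<Longrightarrow> b \<in> carrier R \<Longrightarrow> p = a \<otimes> b \<Longrightarrow> a \<in> Units R \<or> b \<in> Units R) \<Longrightarrow> prime_el R p"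
  shows "factorial_domain R"
proof -
  have "primeness_condition_monoid (mult_of R)"
  proof (unfold_locales)
    fix p assume p: "p \<in> carrier (mult_of R)" "irreducible (mult_of R) p"
    then have i: "ring_irreducible p" by (auto intro: ring_irreducibleI')
    have "prime_el R p" using p ring_irreducibleE[OF _ i] by (intro assms) auto
    then show "prime (mult_of R) p" using p prime_eq_prime_mult by (auto simp: prime_el_def)
  qed
  then interpret pc: primeness_condition_monoid "mult_of R" .
  have "factorial_monoid (mult_of R)"
    using factorization_property pc.wfactors_unique by (intro mult_of.factorial_monoidI) auto
  then show ?thesis using domain_axioms by (simp add: factorial_domain_def)
qed

lemma (in factorial_domain) irreducible_prime_el:
  assumes p: "p \<in> carrier R" "p \<noteq> \<zero>" "p \<notin> Units R"
    and irr: "\<And>a b. a \<in> carrier R \<Longrightarrow> b \<in> carrier R \<Longrightarrow> p = a \<otimes> b \<Longrightarrow> a \<in> Units R \<or> b \<in> Units R"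
  shows "prime_el R p"
proof -
  have "ring_irreducible p" by (rule ring_irreducibleI) (use p irr in simp_all)
  then have "irreducible (mult_of R) p"
    using irreducible_imp_irreducible_mult[OF p(1)] by (simp add: ring_irreducible_def)
  then have "prime (mult_of R) p" using irreducible_prime p by simp
  then show ?thesis using prime_eq_prime_mult[OF p(1)] p by (simp add: prime_el_def)
qed

section \<open>Noetherian rings\<close>

text \<open>Agreement is asked on the columns \<open>K\<close> only, so the entries elsewhere are
  arbitrary, even outside the carrier.\<close>

definition span_on :: "('a, 'b) ring_scheme \<Rightarrow> 'i set \<Rightarrow> ('i \<Rightarrow> 'a) list \<Rightarrow> ('i \<Rightarrow> 'a) set" where
  "span_on R K vs = {w. \<exists>a\<in>vecs R. \<forall>c\<in>K. w c = lc R a vs c}"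

lemma span_onI: "a \<in> vecs R \<Longrightarrow> (\<And>c. c \<in> K \<Longrightarrow> w c = lc R a vs c) \<Longrightarrow> w \<in> span_on R K vs"
  by (auto simp: span_on_def)

lemma span_onE: "w \<in> span_on R K vs \<Longrightarrow> (\<And>a. a \<in> vecs R \<Longrightarrow> (\<And>c. c \<in> K \<Longrightarrow> w c = lc R a vs c) \<Longrightarrow> thesis) \<Longrightarrow> thesis"
  by (auto simp: span_on_def)

lemma span_on_cong: "w \<in> span_on R K vs \<Longrightarrow> (\<And>c. c \<in> K \<Longrightarrow> w c = w' c) \<Longrightarrow> w' \<in> span_on R K vs"
  by (auto simp: span_on_def)

context cring
begin

lemma span_on_zero: "set vs \<subseteq> vecs R \<Longrightarrow> (\<lambda>c. \<zero>) \<in> span_on R K vs"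
proof (rule span_onI[of "\<lambda>i. \<zero>"])
  fix c assume "set vs \<subseteq> vecs R"
  then show "\<zero> = lc R (\<lambda>i. \<zero>) vs c" by (induction vs) (auto simp: vecsD)
qed (simp add: vecs_def)

lemma span_on_add:
  assumes vs: "set vs \<subseteq> vecs R" and v: "v \<in> span_on R K vs" and w: "w \<in> span_on R K vs"
  shows "(\<lambda>c. v c \<oplus> w c) \<in> span_on R K vs"
proof -
  obtain a where a: "a \<in> vecs R" "\<And>c. c \<in> K \<Longrightarrow> v c = lc R a vs c" using v by (auto elim: span_onE)
  obtain b where b: "b \<in> vecs R" "\<And>c. c \<in> K \<Longrightarrow> w c = lc R b vs c" using w by (auto elim: span_onE)
  show ?thesis
    by (rule span_onI[of "\<lambda>i. a i \<oplus> b i"]) (use a b vs in \<open>auto simp: lc_add, auto simp: vecs_def\<close>)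
qed

lemma span_on_smult:
  assumes vs: "set vs \<subseteq> vecs R" and v: "v \<in> span_on R K vs" and s: "s \<in> carrier R"
  shows "(\<lambda>c. s \<otimes> v c) \<in> span_on R K vs"
proof -
  obtain a where a: "a \<in> vecs R" "\<And>c. c \<in> K \<Longrightarrow> v c = lc R a vs c" using v by (auto elim: span_onE)
  show ?thesis
    by (rule span_onI[of "\<lambda>i. s \<otimes> a i"]) (use a s vs in \<open>auto simp: lc_smult, auto simp: vecs_def\<close>)
qed

lemma span_on_mem:
  assumes "set vs \<subseteq> vecs R" "v \<in> set vs"
  shows "v \<in> span_on R K vs"
proof -
  obtain k where "k < length vs" "v = vs ! k" using assms by (auto simp: in_set_conv_nth)
  then show ?thesis
    by (intro span_onI[of "\<lambda>i. if i = k then \<one> else \<zero>"]) (use assms in \<open>auto simp: lc_unit, auto simp: vecs_def\<close>)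
qed

lemma span_on_lc:
  assumes vs: "set vs \<subseteq> vecs R"
  shows "a \<in> vecs R \<Longrightarrow> set us \<subseteq> span_on R K vs \<Longrightarrow> lc R a us \<in> span_on R K vs"
proof (induction us arbitrary: a)
  case Nil
  then show ?case using span_on_zero[OF vs, of K] by (auto elim: span_on_cong)
next
  case (Cons u us)
  have a: "(\<lambda>i. a (Suc i)) \<in> vecs R" "a 0 \<in> carrier R" using Cons.prems by (auto simp: vecs_def)
  have "(\<lambda>c. a 0 \<otimes> u c \<oplus> lc R (\<lambda>i. a (Suc i)) us c) \<in> span_on R K vs"
    using Cons a by (intro span_on_add[OF vs] span_on_smult[OF vs]) auto
  then show ?case by (auto elim: span_on_cong)
qed

lemma span_on_lc_closed: "w \<in> span_on R K vs \<Longrightarrow> set vs \<subseteq> vecs R \<Longrightarrow> c \<in> K \<Longrightarrow> w c \<in> carrier R"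
  by (auto elim!: span_onE)

text \<open>Elements of the ring are treated as vectors with a single coordinate of type \<open>unit\<close>.\<close>

definition ispan :: "'a list \<Rightarrow> 'a set" where
  "ispan xs = {x. (\<lambda>_::unit. x) \<in> span_on R UNIV (map (\<lambda>x _. x) xs)}"

lemma ispan_vecs: "set xs \<subseteq> carrier R \<Longrightarrow> set (map (\<lambda>x _. x) xs) \<subseteq> vecs R"
  by (auto simp: vecs_def)

lemma ispan_ideal: assumes "set xs \<subseteq> carrier R" shows "ideal (ispan xs) R"
proof (rule ideal_criterion)
  show "ispan xs \<subseteq> carrier R"
    using span_on_lc_closed[OF _ ispan_vecs[OF assms], of _ UNIV "()"] by (auto simp: ispan_def)
  note z = span_on_zero[OF ispan_vecs[OF assms], where K = UNIV] and a = span_on_add[OF ispan_vecs[OF assms], where K = UNIV]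
    and m = span_on_smult[OF ispan_vecs[OF assms], where K = UNIV]
  show "\<zero> \<in> ispan xs" using z by (simp add: ispan_def)
  show "x \<oplus> y \<in> ispan xs" if "x \<in> ispan xs" "y \<in> ispan xs" for x y
    using a that unfolding ispan_def by blast
  show "a \<otimes> x \<in> ispan xs" if "a \<in> carrier R" "x \<in> ispan xs" for a x
    using m that unfolding ispan_def by blast
qed

lemma ispan_mem: "set xs \<subseteq> carrier R \<Longrightarrow> x \<in> set xs \<Longrightarrow> x \<in> ispan xs"
  unfolding ispan_def using span_on_mem[OF ispan_vecs, of xs "\<lambda>_. x"] by auto

lemma Idl_ispan:
  assumes "set xs \<subseteq> carrier R" shows "Idl (set xs) = ispan xs"
proof
  show "Idl (set xs) \<subseteq> ispan xs"
    by (rule genideal_minimal) (use assms ispan_ideal ispan_mem in auto)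
next
  show "ispan xs \<subseteq> Idl (set xs)"
  proof
    fix x assume "x \<in> ispan xs"
    then obtain a where a: "a \<in> vecs R" "x = lc R a (map (\<lambda>x _. x) xs) ()"
      by (auto simp: ispan_def elim: span_onE)
    have "lc R a (map (\<lambda>x _. x) xs) () \<in> Idl (set xs)"
      by (rule lc_ideal) (use assms a genideal_ideal genideal_self[of "set xs"] ispan_vecs[OF assms] in \<open>auto simp del: set_map\<close>, auto)
    then show "x \<in> Idl (set xs)" using a by simp
  qed
qed

end

lemma (in cring) noetherian_ideal_list:
  assumes "noetherian_ring R" "ideal I R"
  shows "\<exists>xs. set xs \<subseteq> I \<and> I = ispan xs"
proof -
  interpret N: noetherian_ring R by (rule assms)
  obtain A where A: "A \<subseteq> carrier R" "finite A" "I = Idl A" using N.finetely_gen[OF assms(2)] by auto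
  obtain xs where "set xs = A" using A finite_list by auto
  then show ?thesis using A Idl_ispan[of xs] genideal_self[of A] by auto
qed

lemma (in cring) noetherian_sequence:
  assumes N: "noetherian_ring R" and s: "\<And>i. s i \<in> carrier R"
  shows "\<exists>L. \<forall>j. s j \<in> ispan (map s [0..<L])"
proof -
  interpret N: noetherian_ring R by (rule N)
  define J where "J = (\<lambda>n. Idl (s ` {..<n}))"
  have sub: "s ` {..<n} \<subseteq> carrier R" for n using s by auto
  have mono: "J m \<subseteq> J n" if "m \<le> n" for m n
    unfolding J_def by (rule genideal_minimal) (use genideal_ideal sub genideal_self[OF sub, of n] that in auto)
  have "subset.chain {I. ideal I R} (range J)"
    unfolding pred_on.chain_def
  proof (intro conjI ballI)
    show "range J \<subseteq> {I. ideal I R}" using genideal_ideal sub by (auto simp: J_def)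
    fix x y assume "x \<in> range J" "y \<in> range J"
    then obtain m n where "x = J m" "y = J n" by auto
    then show "(\<subset>)\<^sup>=\<^sup>= x y \<or> (\<subset>)\<^sup>=\<^sup>= y x" using mono[of m n] mono[of n m] nat_le_linear[of m n] by blast
  qed
  then obtain L where L: "\<Union>(range J) = J L" using N.ideal_chain_is_trivial[of "range J"] by auto
  have "s j \<in> J (Suc j)" for j unfolding J_def using genideal_self[OF sub, of "Suc j"] by auto
  then have "s j \<in> J L" for j using L by blast
  moreover have "J L = ispan (map s [0..<L])"
    using Idl_ispan[of "map s [0..<L]"] s by (auto simp: J_def lessThan_atLeast0 image_subset_iff)
  ultimately show ?thesis by auto
qed

text \<open>The ascending chain condition for submodules of a finite free module, in the one form
  needed later. Beyond the first \<open>L\<close> terms the last coordinate is a combination of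
  theirs; subtracting that combination clears it, and the induction applies to the other
  coordinates.\<close>

lemma (in cring) noetherian_vector_sequence:
  assumes N: "noetherian_ring R"
  shows "(\<And>i. v i \<in> vecs R) \<Longrightarrow> \<exists>l. v l \<in> span_on R {..<k::nat} (map v [0..<l])"
proof (induction k arbitrary: v)
  case 0
  have "v 0 \<in> span_on R {..<0::nat} (map v [0..<0])" by (rule span_onI[of "\<lambda>_. \<zero>"]) (auto simp: vecs_def)
  then show ?case by blast
next
  case (Suc k)
  have vc: "v i c \<in> carrier R" for i c using Suc.prems by (simp add: vecsD)
  obtain L where L: "\<And>j. v j k \<in> ispan (map (\<lambda>i. v i k) [0..<L])"
    using noetherian_sequence[OF N, of "\<lambda>i. v i k"] vc by auto
  let ?V = "map v [0..<L]"
  have V: "set ?V \<subseteq> vecs R" using Suc.prems by auto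
  have lck: "lc R a (map (\<lambda>x _. x) (map (\<lambda>v. v k) vs)) () = lc R a vs k" for a vs
    by (induction vs arbitrary: a) auto
  have "\<exists>b\<in>vecs R. v j k = lc R b ?V k" for j
  proof -
    obtain b where "b \<in> vecs R" "v j k = lc R b (map (\<lambda>x _. x) (map (\<lambda>i. v i k) [0..<L])) ()"
      using L[of j] by (auto simp: ispan_def elim: span_onE)
    moreover have "map (\<lambda>i. v i k) [0..<L] = map (\<lambda>v. v k) ?V" by simp
    ultimately show ?thesis using lck by metis
  qed
  then obtain b where b: "\<And>j. b j \<in> vecs R" "\<And>j. v j k = lc R (b j) ?V k" by metis
  define w where "w = (\<lambda>j c. v (j + L) c \<ominus> lc R (b (j + L)) ?V c)"
  have lb: "lc R (b j) ?V \<in> vecs R" for j using V b by (auto simp: vecs_def[of R])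
  have w: "w j \<in> vecs R" for j using vc lb by (auto simp: w_def vecs_def)
  have wk: "w j k = \<zero>" for j
    unfolding w_def using b(2)[of "j + L"] vecsD[OF lb[of "j + L"], of k] by (simp add: r_neg a_minus_def)
  obtain l where l: "w l \<in> span_on R {..<k} (map w [0..<l])" using Suc.IH[of w] w by auto
  then obtain a where a: "a \<in> vecs R" "\<And>c. c < k \<Longrightarrow> w l c = lc R a (map w [0..<l]) c"
    by (auto elim: span_onE)
  have "lc R a (map w [0..<l]) k \<in> {\<zero>}"
    by (rule lc_ideal[OF zeroideal]) (use a w wk in auto)
  then have a': "w l c = lc R a (map w [0..<l]) c" if "c < Suc k" for c
    using a(2)[of c] wk that by (cases "c = k") auto
  let ?W = "map v [0..<l + L]"
  have W: "set ?W \<subseteq> vecs R" using Suc.prems by auto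
  have Vs: "set ?V \<subseteq> span_on R {..<Suc k} ?W"
    by (auto intro!: span_on_mem[OF W])
  have ws: "w i \<in> span_on R {..<Suc k} ?W" if "i < l" for i
  proof -
    have "v (i + L) \<in> span_on R {..<Suc k} ?W" using that by (intro span_on_mem[OF W]) auto
    moreover have "(\<lambda>c. \<ominus> \<one> \<otimes> lc R (b (i + L)) ?V c) \<in> span_on R {..<Suc k} ?W"
      by (intro span_on_smult[OF W] span_on_lc[OF W] b Vs) auto
    ultimately have "(\<lambda>c. v (i + L) c \<oplus> \<ominus> \<one> \<otimes> lc R (b (i + L)) ?V c) \<in> span_on R {..<Suc k} ?W"
      by (rule span_on_add[OF W])
    then show ?thesis
      by (rule span_on_cong) (use vecsD[OF lb] in \<open>simp add: w_def a_minus_def l_minus\<close>)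
  qed
  have "lc R a (map w [0..<l]) \<in> span_on R {..<Suc k} ?W"
    by (rule span_on_lc[OF W a(1)]) (use ws in auto)
  moreover have "lc R (b (l + L)) ?V \<in> span_on R {..<Suc k} ?W" by (intro span_on_lc[OF W] b Vs)
  ultimately have "(\<lambda>c. lc R a (map w [0..<l]) c \<oplus> lc R (b (l + L)) ?V c) \<in> span_on R {..<Suc k} ?W"
    by (rule span_on_add[OF W])
  then have "v (l + L) \<in> span_on R {..<Suc k} ?W"
  proof (rule span_on_cong)
    fix c assume "c \<in> {..<Suc k}"
    then have "lc R a (map w [0..<l]) c = w l c" using a' by auto
    then show "lc R a (map w [0..<l]) c \<oplus> lc R (b (l + L)) ?V c = v (l + L) c"
      using vecsD[OF lb] vc by (simp add: w_def a_minus_def a_assoc l_neg)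
  qed
  then show ?case by blast
qed

text \<open>
  A common form of Krull's intersection theorem and Nakayama's lemma for the localization at \<open>T\<close>:
  writing \<open>t\<^sub>i v\<^sub>i = y v\<^bsub>i+1\<^esub>\<close> modulo \<open>N\<close>, some \<open>v\<^sub>l\<close> is a combination of the earlier ones,
  so \<open>y\<^sup>l v\<^sub>l\<close> is both \<open>t\<^sub>0 \<cdots> t\<^bsub>l-1\<^esub> v\<^sub>0\<close> and a multiple of \<open>y v\<^sub>0\<close> modulo \<open>N\<close>.
\<close>

lemma (in cring) localized_Nakayama:
  assumes N: "noetherian_ring R" and y: "y \<in> carrier R"
    and T: "T \<subseteq> carrier R" "\<one> \<in> T" "\<And>s t. s \<in> T \<Longrightarrow> t \<in> T \<Longrightarrow> s \<otimes> t \<in> T" "\<And>t r. t \<in> T \<Longrightarrow> r \<in> carrier R \<Longrightarrow> t \<ominus> y \<otimes> r \<in> T"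
    and ns: "set ns \<subseteq> vecs R" and M: "M \<subseteq> vecs R"
    and step: "\<And>v. v \<in> M \<Longrightarrow> \<exists>t\<in>T. \<exists>v'\<in>M. (\<lambda>c. t \<otimes> v c \<ominus> y \<otimes> v' c) \<in> span_on R {..<k::nat} ns"
    and v: "v \<in> M"
  shows "\<exists>t\<in>T. (\<lambda>c. t \<otimes> v c) \<in> span_on R {..<k} ns"
proof -
  have "\<exists>V. \<forall>i. (V i \<in> M \<and> (i = 0 \<longrightarrow> V i = v)) \<and> (\<exists>t\<in>T. (\<lambda>c. t \<otimes> V i c \<ominus> y \<otimes> V (Suc i) c) \<in> span_on R {..<k} ns)"
  proof (rule dependent_nat_choice)
    show "\<exists>x. x \<in> M \<and> (0 = (0::nat) \<longrightarrow> x = v)" using v by auto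
    fix x and n :: nat assume "x \<in> M \<and> (n = 0 \<longrightarrow> x = v)"
    then show "\<exists>y'. (y' \<in> M \<and> (Suc n = 0 \<longrightarrow> y' = v)) \<and> (\<exists>t\<in>T. (\<lambda>c. t \<otimes> x c \<ominus> y \<otimes> y' c) \<in> span_on R {..<k} ns)"
      using step[of x] by blast
  qed
  then obtain V where V': "\<And>i. (V i \<in> M \<and> (i = 0 \<longrightarrow> V i = v)) \<and> (\<exists>t\<in>T. (\<lambda>c. t \<otimes> V i c \<ominus> y \<otimes> V (Suc i) c) \<in> span_on R {..<k} ns)"
    by blast
  then have V: "\<And>i. V i \<in> M" "V 0 = v" "\<And>i. \<exists>t\<in>T. (\<lambda>c. t \<otimes> V i c \<ominus> y \<otimes> V (Suc i) c) \<in> span_on R {..<k} ns"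
    by blast+
  obtain t where t: "\<And>i. t i \<in> T" "\<And>i. (\<lambda>c. t i \<otimes> V i c \<ominus> y \<otimes> V (Suc i) c) \<in> span_on R {..<k} ns"
    using V(3) by metis
  have Vv: "V i \<in> vecs R" for i using V(1) M by auto
  have Vc: "V i c \<in> carrier R" for i c using Vv by (simp add: vecsD)
  define \<tau> where "\<tau> = rec_nat \<one> (\<lambda>i p. t i \<otimes> p)"
  have \<tau>: "\<tau> 0 = \<one>" "\<tau> (Suc i) = t i \<otimes> \<tau> i" for i by (simp_all add: \<tau>_def)
  have \<tau>T: "\<tau> i \<in> T" for i by (induction i) (use \<tau> T t in auto)
  have \<tau>c: "\<tau> i \<in> carrier R" "t i \<in> carrier R" for i using \<tau>T t T by auto
  have claim: "(\<lambda>c. y [^] i \<otimes> V i c \<ominus> \<tau> i \<otimes> v c) \<in> span_on R {..<k} ns" for i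
  proof (induction i)
    case 0
    show ?case by (rule span_on_cong[OF span_on_zero[OF ns]]) (use Vc[of 0] V(2) in \<open>simp add: \<tau> a_minus_def r_neg\<close>)
  next
    case (Suc i)
    have "(\<lambda>c. t i \<otimes> (y [^] i \<otimes> V i c \<ominus> \<tau> i \<otimes> v c) \<oplus> (\<ominus> (y [^] i)) \<otimes> (t i \<otimes> V i c \<ominus> y \<otimes> V (Suc i) c)) \<in> span_on R {..<k} ns"
      by (intro span_on_add[OF ns] span_on_smult[OF ns] Suc t) (use \<tau>c y in auto)
    then show ?case
    proof (rule span_on_cong)
      fix c
      have id: "s \<otimes> (p \<otimes> a \<ominus> q \<otimes> w) \<oplus> (\<ominus> p) \<otimes> (s \<otimes> a \<ominus> y \<otimes> b) = (p \<otimes> y) \<otimes> b \<ominus> (s \<otimes> q) \<otimes> w"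
        if "s \<in> carrier R" "p \<in> carrier R" "a \<in> carrier R" "q \<in> carrier R" "w \<in> carrier R" "b \<in> carrier R" for s p a q w b
        using that y by algebra
      show "t i \<otimes> (y [^] i \<otimes> V i c \<ominus> \<tau> i \<otimes> v c) \<oplus> (\<ominus> (y [^] i)) \<otimes> (t i \<otimes> V i c \<ominus> y \<otimes> V (Suc i) c) =
         y [^] Suc i \<otimes> V (Suc i) c \<ominus> \<tau> (Suc i) \<otimes> v c"
        using id[of "t i" "y [^] i" "V i c" "\<tau> i" "v c" "V (Suc i) c"] \<tau>c y Vc Vc[of 0 c] V(2) by (simp add: \<tau>)
    qed
  qed
  obtain l where "V l \<in> span_on R {..<k} (map V [0..<l])"
    using noetherian_vector_sequence[OF N, where v = V and k = k] Vv by blast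
  then obtain b where b: "b \<in> vecs R" "\<And>c. c < k \<Longrightarrow> V l c = lc R b (map V [0..<l]) c"
    by (auto elim: span_onE)
  have vc: "v c \<in> carrier R" for c using Vc[of 0] V(2) by simp
  \<comment> \<open>Being congruent to a multiple of \<open>y v\<close> modulo \<open>ns\<close>,
    after multiplication by \<open>y^l\<close>, passes from vectors to their combinations.\<close>
  have comb: "\<exists>r\<in>carrier R. (\<lambda>c. y [^] l \<otimes> lc R b us c \<ominus> y \<otimes> r \<otimes> v c) \<in> span_on R {..<k} ns"
    if "b \<in> vecs R" "set us \<subseteq> vecs R" "\<And>u. u \<in> set us \<Longrightarrow> \<exists>r\<in>carrier R. (\<lambda>c. y [^] l \<otimes> u c \<ominus> y \<otimes> r \<otimes> v c) \<in> span_on R {..<k} ns"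
    for b us using that
  proof (induction us arbitrary: b)
    case Nil
    show ?case
      by (rule bexI[of _ \<zero>], rule span_on_cong[OF span_on_zero[OF ns]]) (use y vc in \<open>auto simp: a_minus_def\<close>)
  next
    case (Cons u us)
    have b: "(\<lambda>i. b (Suc i)) \<in> vecs R" "b 0 \<in> carrier R" using Cons.prems by (auto simp: vecs_def)
    obtain r where r: "r \<in> carrier R" "(\<lambda>c. y [^] l \<otimes> u c \<ominus> y \<otimes> r \<otimes> v c) \<in> span_on R {..<k} ns"
      using Cons.prems(3)[of u] by auto
    obtain r' where r': "r' \<in> carrier R" "(\<lambda>c. y [^] l \<otimes> lc R (\<lambda>i. b (Suc i)) us c \<ominus> y \<otimes> r' \<otimes> v c) \<in> span_on R {..<k} ns"
      using Cons.IH[OF b(1)] Cons.prems by auto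
    have "(\<lambda>c. b 0 \<otimes> (y [^] l \<otimes> u c \<ominus> y \<otimes> r \<otimes> v c) \<oplus> (y [^] l \<otimes> lc R (\<lambda>i. b (Suc i)) us c \<ominus> y \<otimes> r' \<otimes> v c)) \<in> span_on R {..<k} ns"
      by (intro span_on_add[OF ns] span_on_smult[OF ns] r r' b)
    then have "(\<lambda>c. y [^] l \<otimes> lc R b (u # us) c \<ominus> y \<otimes> (b 0 \<otimes> r \<oplus> r') \<otimes> v c) \<in> span_on R {..<k} ns"
    proof (rule span_on_cong)
      fix c
      have id: "a \<otimes> (p \<otimes> u \<ominus> y \<otimes> r \<otimes> w) \<oplus> (p \<otimes> q \<ominus> y \<otimes> r' \<otimes> w) = p \<otimes> (a \<otimes> u \<oplus> q) \<ominus> y \<otimes> (a \<otimes> r \<oplus> r') \<otimes> w"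
        if "a \<in> carrier R" "p \<in> carrier R" "u \<in> carrier R" "w \<in> carrier R" "q \<in> carrier R" for a p u w q
        using that r(1) r'(1) y by algebra
      show "b 0 \<otimes> (y [^] l \<otimes> u c \<ominus> y \<otimes> r \<otimes> v c) \<oplus> (y [^] l \<otimes> lc R (\<lambda>i. b (Suc i)) us c \<ominus> y \<otimes> r' \<otimes> v c) =
        y [^] l \<otimes> lc R b (u # us) c \<ominus> y \<otimes> (b 0 \<otimes> r \<oplus> r') \<otimes> v c"
        using id[of "b 0" "y [^] l" "u c" "v c" "lc R (\<lambda>i. b (Suc i)) us c"] b y vc Cons.prems by (simp add: vecsD)
    qed
    then show ?case using r r' b by (intro bexI[of _ "b 0 \<otimes> r \<oplus> r'"]) auto
  qed
  \<comment> \<open>Since \<open>i < l\<close>, at least one factor \<open>y\<close> is left over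
    once \<open>claim\<close> has used up \<open>y^i\<close>.\<close>
  have "\<exists>r\<in>carrier R. (\<lambda>c. y [^] l \<otimes> u c \<ominus> y \<otimes> r \<otimes> v c) \<in> span_on R {..<k} ns" if u: "u \<in> set (map V [0..<l])" for u
  proof -
    obtain i where i: "i < l" "u = V i" using u by auto
    define m where "m = l - Suc i"
    have l: "l = Suc m + i" using i by (simp add: m_def)
    have yl: "y [^] l = y \<otimes> y [^] m \<otimes> y [^] i" using y unfolding l by (simp add: nat_pow_mult[symmetric] m_ac)
    have "(\<lambda>c. (y \<otimes> y [^] m) \<otimes> (y [^] i \<otimes> V i c \<ominus> \<tau> i \<otimes> v c)) \<in> span_on R {..<k} ns"
      by (intro span_on_smult[OF ns] claim) (use y in auto)
    then have "(\<lambda>c. y [^] l \<otimes> u c \<ominus> y \<otimes> (y [^] m \<otimes> \<tau> i) \<otimes> v c) \<in> span_on R {..<k} ns"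
    proof (rule span_on_cong)
      fix c
      have id: "(y \<otimes> p) \<otimes> (q \<otimes> a \<ominus> s \<otimes> w) = (y \<otimes> p \<otimes> q) \<otimes> a \<ominus> y \<otimes> (p \<otimes> s) \<otimes> w"
        if "p \<in> carrier R" "q \<in> carrier R" "a \<in> carrier R" "s \<in> carrier R" "w \<in> carrier R" for p q a s w
        using that y by algebra
      show "(y \<otimes> y [^] m) \<otimes> (y [^] i \<otimes> V i c \<ominus> \<tau> i \<otimes> v c) = y [^] l \<otimes> u c \<ominus> y \<otimes> (y [^] m \<otimes> \<tau> i) \<otimes> v c"
        unfolding yl i(2) using id[of "y [^] m" "y [^] i" "V i c" "\<tau> i" "v c"] y Vc vc \<tau>c by simp
    qed
    then show ?thesis using y \<tau>c by blast
  qed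
  then obtain r where r: "r \<in> carrier R" "(\<lambda>c. y [^] l \<otimes> lc R b (map V [0..<l]) c \<ominus> y \<otimes> r \<otimes> v c) \<in> span_on R {..<k} ns"
    using comb[OF b(1), of "map V [0..<l]"] Vv by auto
  have "(\<lambda>c. (y [^] l \<otimes> lc R b (map V [0..<l]) c \<ominus> y \<otimes> r \<otimes> v c) \<oplus> (\<ominus> \<one>) \<otimes> (y [^] l \<otimes> V l c \<ominus> \<tau> l \<otimes> v c)) \<in> span_on R {..<k} ns"
    by (intro span_on_add[OF ns] span_on_smult[OF ns] r claim) auto
  then have "(\<lambda>c. (\<tau> l \<ominus> y \<otimes> r) \<otimes> v c) \<in> span_on R {..<k} ns"
  proof (rule span_on_cong)
    fix c assume "c \<in> {..<k}"
    then have e: "lc R b (map V [0..<l]) c = V l c" using b by simp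
    have id: "(p \<otimes> a \<ominus> y \<otimes> r \<otimes> w) \<oplus> (\<ominus> \<one>) \<otimes> (p \<otimes> a \<ominus> s \<otimes> w) = (s \<ominus> y \<otimes> r) \<otimes> w"
      if "p \<in> carrier R" "a \<in> carrier R" "s \<in> carrier R" "w \<in> carrier R" for p a s w
      using that r(1) y by algebra
    show "(y [^] l \<otimes> lc R b (map V [0..<l]) c \<ominus> y \<otimes> r \<otimes> v c) \<oplus> (\<ominus> \<one>) \<otimes> (y [^] l \<otimes> V l c \<ominus> \<tau> l \<otimes> v c) = (\<tau> l \<ominus> y \<otimes> r) \<otimes> v c"
      unfolding e using id[of "y [^] l" "V l c" "\<tau> l" "v c"] y Vc vc \<tau>c by simp
  qed
  \<comment> \<open>The multiplier \<open>\<tau> l \<ominus> y \<otimes> r\<close> is again a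
    denominator; here \<open>y\<close> acts like an element of the Jacobson radical.\<close>
  then show ?thesis using T(4)[OF \<tau>T r(1)] by blast
qed

section \<open>Power series over a Noetherian ring\<close>

lemma (in cring) ispan_mono:
  assumes "set xs \<subseteq> carrier R" "set ys \<subseteq> carrier R" "set xs \<subseteq> ispan ys"
  shows "ispan xs \<subseteq> ispan ys"
  using genideal_minimal[OF ispan_ideal[OF assms(2)] assms(3)] Idl_ispan[OF assms(1)] by simp

lemma (in cring) lc_ispan:
  assumes "a \<in> vecs R" "set xs \<subseteq> carrier R"
  shows "lc R a (map (\<lambda>x _. x) xs) () \<in> ispan xs"
  using assms by (auto simp: ispan_def intro!: span_onI[of a])

lemma (in cring) ispanE:
  assumes "x \<in> ispan xs"
  obtains a where "a \<in> vecs R" "x = lc R a (map (\<lambda>x _. x) xs) ()"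
  using assms by (auto simp: ispan_def elim: span_onE)

lemma (in cring) ps_rec_unique:
  assumes u: "\<And>i. u i \<in> carrier (ps R)" and a: "\<And>i. a i \<in> carrier (ps R)" and b: "\<And>i. b i \<in> carrier (ps R)"
    and ra: "\<And>i. a i = u i \<oplus>\<^bsub>ps R\<^esub> psX R \<otimes>\<^bsub>ps R\<^esub> a (Suc i)"
    and rb: "\<And>i. b i = u i \<oplus>\<^bsub>ps R\<^esub> psX R \<otimes>\<^bsub>ps R\<^esub> b (Suc i)"
  shows "a i = b i"
proof
  fix n show "a i n = b i n"
  proof (induction n arbitrary: i)
    case 0
    show ?case by (subst ra, subst rb) (use a b in \<open>simp add: ps_carrierD\<close>)
  next
    case (Suc n)
    show ?case by (subst ra, subst rb) (use a b Suc in \<open>simp add: ps_carrierD\<close>)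
  qed
qed

lemma (in cring) ps_hom: "ring_hom_cring (ps R) R (\<lambda>f. f 0)" "ring_hom_cring R (ps R) (const R)"
  using ps_cring is_cring ct_hom const_hom by (auto simp: ring_hom_cring_def ring_hom_cring_axioms_def)

text \<open>Successive approximation with several generators: the coefficients of each multiplier
  are collected from all stages, and both sides solve the same recursion.\<close>

lemma (in cring) ps_limit_list:
  assumes gs: "set gs \<subseteq> carrier (ps R)" and a: "\<And>i. a i \<in> carrier (ps R)" and d: "\<And>i. d i \<in> vecs R"
    and ra: "\<And>i. a i = lc (ps R) (\<lambda>j. const R (d i j)) (map (\<lambda>x _. x) gs) () \<oplus>\<^bsub>ps R\<^esub> psX R \<otimes>\<^bsub>ps R\<^esub> a (Suc i)"
  shows "\<exists>D\<in>vecs (ps R). a 0 = lc (ps R) D (map (\<lambda>x _. x) gs) ()"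
proof -
  interpret P: cring "ps R" by (rule ps_cring)
  let ?gs = "map (\<lambda>x _::unit. x) gs"
  have gv: "set ?gs \<subseteq> vecs (ps R)" using gs by (auto simp: vecs_def)
  define D where "D = (\<lambda>i j m. d (i + m) j)"
  have D: "D i \<in> vecs (ps R)" for i using d by (auto simp: D_def vecs_def ps_carrier)
  have cd: "(\<lambda>j. const R (d i j)) \<in> vecs (ps R)" for i using d by (auto simp: vecs_def)
  have "lc (ps R) (D i) ?gs () = lc (ps R) (\<lambda>j. const R (d i j)) ?gs () \<oplus>\<^bsub>ps R\<^esub> psX R \<otimes>\<^bsub>ps R\<^esub> lc (ps R) (D (Suc i)) ?gs ()" for i
  proof -
    have "shift (D i j) = D (Suc i) j" for j by (simp add: D_def fun_eq_iff)
    then have "D i j = const R (d i j) \<oplus>\<^bsub>ps R\<^esub> psX R \<otimes>\<^bsub>ps R\<^esub> D (Suc i) j" for j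
      using ps_decomp[of "D i j"] vecsD[OF D] by (simp add: D_def)
    then have e: "D i = (\<lambda>j. const R (d i j) \<oplus>\<^bsub>ps R\<^esub> psX R \<otimes>\<^bsub>ps R\<^esub> D (Suc i) j)" by auto
    have xd: "(\<lambda>j. psX R \<otimes>\<^bsub>ps R\<^esub> D (Suc i) j) \<in> vecs (ps R)" using D[of "Suc i"] by (auto simp: vecs_def)
    show ?thesis
      by (subst e) (simp add: P.lc_add[OF cd xd gv] P.lc_smult[OF psX_closed D gv])
  qed
  then have "a 0 = lc (ps R) (D 0) ?gs ()"
    using ps_rec_unique[of "\<lambda>i. lc (ps R) (\<lambda>j. const R (d i j)) ?gs ()" a "\<lambda>i. lc (ps R) (D i) ?gs ()" 0,
       OF P.lc_closed[OF cd gv] a P.lc_closed[OF D gv] ra] by blast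
  then show ?thesis using D by blast
qed

lemma (in cring) psX_pow_nth: 
  assumes "f \<in> carrier (ps R)"
  shows "(psX R [^]\<^bsub>ps R\<^esub> n \<otimes>\<^bsub>ps R\<^esub> f) i = (if i < n then \<zero> else f (i - n))"
proof -
  interpret P: cring "ps R" by (rule ps_cring)
  show ?thesis
  proof (induction n arbitrary: i)
    case (Suc n)
    let ?g = "psX R [^]\<^bsub>ps R\<^esub> n \<otimes>\<^bsub>ps R\<^esub> f"
    have g: "?g \<in> carrier (ps R)" using assms by auto
    have "psX R [^]\<^bsub>ps R\<^esub> Suc n \<otimes>\<^bsub>ps R\<^esub> f = psX R \<otimes>\<^bsub>ps R\<^esub> ?g"
      using assms by (simp add: P.m_ac)
    then show ?case using psX_mult[OF g] Suc by (cases i) auto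
  qed (use assms in auto)
qed

lemma (in cring) psX_pow_eq:
  assumes "f \<in> carrier (ps R)" "\<And>i. i < n \<Longrightarrow> f i = \<zero>"
  shows "f = psX R [^]\<^bsub>ps R\<^esub> n \<otimes>\<^bsub>ps R\<^esub> (\<lambda>i. f (i + n))"
proof
  fix i
  have "(\<lambda>i. f (i + n)) \<in> carrier (ps R)" using assms(1) by (simp add: ps_carrier)
  then show "f i = (psX R [^]\<^bsub>ps R\<^esub> n \<otimes>\<^bsub>ps R\<^esub> (\<lambda>i. f (i + n))) i"
    using assms(2) by (simp add: psX_pow_nth)
qed

lemma (in cring) lc_ps_nth0:
  assumes "d \<in> vecs R" "set gs \<subseteq> carrier (ps R)"
  shows "lc (ps R) (\<lambda>j. const R (d j)) (map (\<lambda>x _. x) gs) () n = lc R d (map (\<lambda>x _. x) (map (\<lambda>g. g n) gs)) ()"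
  using assms
proof (induction gs arbitrary: d)
  case (Cons g gs)
  then have "(\<lambda>i. d (Suc i)) \<in> vecs R" by (auto simp: vecs_def)
  from Cons.IH[OF this] Cons.prems show ?case by (simp add: vecsD)
qed simp

text \<open>Hilbert's argument with lowest in place of leading coefficients: the ideals
  \<open>L n\<close> of coefficients of \<open>X^n\<close> in members of \<open>I\<close> of order
  at least \<open>n\<close> increase and become constant at some \<open>N\<close>. Below
  \<open>N\<close> finitely many steps suffice; above it a limit is taken.\<close>

lemma (in cring) ps_noetherian:
  assumes N: "noetherian_ring R"
  shows "noetherian_ring (ps R)"
proof -
  interpret P: cring "ps R" by (rule ps_cring)
  interpret N: noetherian_ring R by (rule N)
  let ?X = "psX R"
  have "\<exists>A\<subseteq>carrier (ps R). finite A \<and> I = Idl\<^bsub>ps R\<^esub> A" if I: "ideal I (ps R)" for I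
  proof -
    interpret I: ideal I "ps R" by (rule I)
    define In where "In = (\<lambda>n. {f \<in> I. \<forall>i<n. f i = \<zero>})"
    define L where "L = (\<lambda>n. (\<lambda>f. f n) ` In n)"
    have Ic: "f \<in> carrier (ps R)" if "f \<in> I" for f using that I.Icarr by simp
    have LI: "ideal (L n) R" for n
    proof (rule ideal_criterion)
      show "L n \<subseteq> carrier R" using Ic by (auto simp: L_def In_def ps_carrierD)
      have "\<zero>\<^bsub>ps R\<^esub> \<in> In n" by (simp add: In_def)
      then show "\<zero> \<in> L n" using imageI[of "\<zero>\<^bsub>ps R\<^esub>" "In n" "\<lambda>f. f n"] by (simp add: L_def)
    next
      fix x y assume "x \<in> L n" "y \<in> L n"
      then obtain f g where fg: "f \<in> In n" "g \<in> In n" "x = f n" "y = g n" by (auto simp: L_def)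
      then have "f \<oplus>\<^bsub>ps R\<^esub> g \<in> In n" by (auto simp: In_def I.a_closed)
      then show "x \<oplus> y \<in> L n" using imageI[of "f \<oplus>\<^bsub>ps R\<^esub> g" "In n" "\<lambda>f. f n"] by (simp add: L_def fg)
    next
      fix a x assume a: "a \<in> carrier R" and "x \<in> L n"
      then obtain f where f: "f \<in> In n" "x = f n" by (auto simp: L_def)
      then have "const R a \<otimes>\<^bsub>ps R\<^esub> f \<in> In n" using a Ic by (auto simp: In_def I.I_l_closed)
      moreover have "(const R a \<otimes>\<^bsub>ps R\<^esub> f) n = a \<otimes> x" using f a Ic by (auto simp: In_def)
      ultimately show "a \<otimes> x \<in> L n"
        using imageI[of "const R a \<otimes>\<^bsub>ps R\<^esub> f" "In n" "\<lambda>f. f n"] by (simp add: L_def)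
    qed
    have "L n \<subseteq> L (Suc n)" for n
    proof
      fix x assume "x \<in> L n"
      then obtain f where f: "f \<in> In n" "x = f n" by (auto simp: L_def)
      have fI: "f \<in> I" "\<And>i. i < n \<Longrightarrow> f i = \<zero>" using f(1) by (auto simp: In_def)
      have "(?X \<otimes>\<^bsub>ps R\<^esub> f) i = \<zero>" if "i < Suc n" for i
        using that fI(2) psX_mult[OF Ic[OF fI(1)]] by (cases i) auto
      then have "?X \<otimes>\<^bsub>ps R\<^esub> f \<in> In (Suc n)" using fI(1) by (simp add: In_def I.I_l_closed)
      moreover have "(?X \<otimes>\<^bsub>ps R\<^esub> f) (Suc n) = x" using f(2) psX_mult(2)[OF Ic[OF fI(1)]] by simp
      ultimately show "x \<in> L (Suc n)"
        using imageI[of "?X \<otimes>\<^bsub>ps R\<^esub> f" "In (Suc n)" "\<lambda>f. f (Suc n)"] by (simp add: L_def)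
    qed
    then have mono: "L m \<subseteq> L n" if "m \<le> n" for m n
      using that by (rule lift_Suc_mono_le)
    have "subset.chain {I. ideal I R} (range L)"
      unfolding pred_on.chain_def
    proof (intro conjI ballI)
      show "range L \<subseteq> {I. ideal I R}" using LI by auto
      fix x y assume "x \<in> range L" "y \<in> range L"
      then obtain m n where "x = L m" "y = L n" by auto
      then show "(\<subset>)\<^sup>=\<^sup>= x y \<or> (\<subset>)\<^sup>=\<^sup>= y x" using mono[of m n] mono[of n m] nat_le_linear[of m n] by blast
    qed
    then obtain N where N: "\<Union>(range L) = L N" using N.ideal_chain_is_trivial[of "range L"] by auto
    have gens: "\<exists>gs. set gs \<subseteq> In n \<and> L n = ispan (map (\<lambda>g. g n) gs)" for n
    proof -
      obtain as where as: "set as \<subseteq> L n" "L n = ispan as" using noetherian_ideal_list[OF assms LI] by blast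
      have "\<forall>a\<in>L n. \<exists>f. f \<in> In n \<and> f n = a" by (auto simp: L_def)
      from bchoice[OF this] obtain G where G: "\<forall>a\<in>L n. G a \<in> In n \<and> G a n = a" ..
      then have "set (map G as) \<subseteq> In n" using as(1) by auto
      moreover have "map (\<lambda>a. G a n) as = map id as" by (rule map_cong) (use G as(1) in auto)
      then have "map (\<lambda>g. g n) (map G as) = as" by (simp add: comp_def)
      ultimately show ?thesis using as(2) by metis
    qed
    \<comment> \<open>From order \<open>N\<close> on, generators of \<open>L N\<close> serve in
      every degree, with multipliers that are infinite series.\<close>
    have top: "\<exists>xs. set xs \<subseteq> I \<and> In N \<subseteq> P.ispan xs"
    proof -
      obtain gs where gs: "set gs \<subseteq> In N" "L N = ispan (map (\<lambda>g. g N) gs)" using gens by blast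
      \<comment> \<open>The generators divided by \<open>X^N\<close>, so that the approximation
        always works on constant terms.\<close>
      define hs where "hs = map (\<lambda>g i. g (i + N)) gs"
      have gc: "g \<in> carrier (ps R)" if "g \<in> set gs" for g using gs that Ic by (auto simp: In_def)
      then have hc: "set hs \<subseteq> carrier (ps R)" by (auto simp: hs_def ps_carrier)
      have Xh: "?X [^]\<^bsub>ps R\<^esub> N \<otimes>\<^bsub>ps R\<^esub> h \<in> I" if hh: "h \<in> set hs" for h
      proof -
        obtain g where g: "g \<in> set gs" "h = (\<lambda>i. g (i + N))" using hh by (auto simp: hs_def)
        then have "g = ?X [^]\<^bsub>ps R\<^esub> N \<otimes>\<^bsub>ps R\<^esub> h" using gs psX_pow_eq[OF gc[OF g(1)], of N] by (auto simp: In_def)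
        then show ?thesis using gs g by (auto simp: In_def)
      qed
      have hs0: "map (\<lambda>h. h 0) hs = map (\<lambda>g. g N) gs" by (simp add: hs_def)
      have vh: "set (map (\<lambda>x _::unit. x) hs) \<subseteq> vecs (ps R)" using P.ispan_vecs[OF hc] .
      \<comment> \<open>The constant term of \<open>h\<close> lies in \<open>L (N + i)\<close>,
        hence in \<open>L N\<close>, and is cleared with constants; the remainder divided by
        \<open>X\<close> satisfies the same condition with \<open>i + 1\<close>.\<close>
      have step: "\<exists>d h'. d \<in> vecs R \<and> h' \<in> carrier (ps R) \<and> ?X [^]\<^bsub>ps R\<^esub> (N + Suc i) \<otimes>\<^bsub>ps R\<^esub> h' \<in> I \<and>
          h = lc (ps R) (\<lambda>j. const R (d j)) (map (\<lambda>x _. x) hs) () \<oplus>\<^bsub>ps R\<^esub> ?X \<otimes>\<^bsub>ps R\<^esub> h'"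
        if h: "h \<in> carrier (ps R)" "?X [^]\<^bsub>ps R\<^esub> (N + i) \<otimes>\<^bsub>ps R\<^esub> h \<in> I" for i h
      proof -
        have "?X [^]\<^bsub>ps R\<^esub> (N + i) \<otimes>\<^bsub>ps R\<^esub> h \<in> In (N + i)" using h by (auto simp: In_def psX_pow_nth)
        moreover have "(?X [^]\<^bsub>ps R\<^esub> (N + i) \<otimes>\<^bsub>ps R\<^esub> h) (N + i) = h 0" using h by (simp add: psX_pow_nth)
        ultimately have "h 0 \<in> L (N + i)"
          using imageI[of "?X [^]\<^bsub>ps R\<^esub> (N + i) \<otimes>\<^bsub>ps R\<^esub> h" "In (N + i)" "\<lambda>f. f (N + i)"] by (simp add: L_def)
        then have "h 0 \<in> ispan (map (\<lambda>h. h 0) hs)" using N gs(2) hs0 by auto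
        then obtain d where d: "d \<in> vecs R" "h 0 = lc R d (map (\<lambda>x _. x) (map (\<lambda>h. h 0) hs)) ()"
          by (rule ispanE)
        let ?s = "lc (ps R) (\<lambda>j. const R (d j)) (map (\<lambda>x _. x) hs) ()"
        have cd: "(\<lambda>j. const R (d j)) \<in> vecs (ps R)" using d by (auto simp: vecs_def)
        have s: "?s \<in> carrier (ps R)" using P.lc_closed[OF cd vh] .
        have "?s 0 = h 0" using lc_ps_nth0[OF d(1) hc, of 0] d(2) by simp
        then have "(h \<ominus>\<^bsub>ps R\<^esub> ?s) 0 = \<zero>" using h s by (simp add: ps_carrierD r_neg a_minus_def)
        then have e: "h \<ominus>\<^bsub>ps R\<^esub> ?s = ?X \<otimes>\<^bsub>ps R\<^esub> shift (h \<ominus>\<^bsub>ps R\<^esub> ?s)" using h s by (intro ps_psX_eq) auto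
        define h' where "h' = shift (h \<ominus>\<^bsub>ps R\<^esub> ?s)"
        have h': "h' \<in> carrier (ps R)" using h s by (auto simp: h'_def)
        have e: "h \<ominus>\<^bsub>ps R\<^esub> ?s = ?X \<otimes>\<^bsub>ps R\<^esub> h'" using e by (simp add: h'_def)
        have "h = ?s \<oplus>\<^bsub>ps R\<^esub> (h \<ominus>\<^bsub>ps R\<^esub> ?s)" using h s by (auto simp: P.a_ac P.minus_eq P.r_neg)
        then have he: "h = ?s \<oplus>\<^bsub>ps R\<^esub> ?X \<otimes>\<^bsub>ps R\<^esub> h'" using e by simp
        have J: "ideal {x \<in> carrier (ps R). ?X [^]\<^bsub>ps R\<^esub> N \<otimes>\<^bsub>ps R\<^esub> x \<in> I} (ps R)"
          by (rule P.ideal_criterion) (auto simp: P.r_distr I.a_closed P.m_lcomm[of "?X [^]\<^bsub>ps R\<^esub> N"] I.I_l_closed)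
        have "?s \<in> {x \<in> carrier (ps R). ?X [^]\<^bsub>ps R\<^esub> N \<otimes>\<^bsub>ps R\<^esub> x \<in> I}"
          by (rule P.lc_ideal[OF J cd vh]) (use Xh hc in auto)
        then have "?X [^]\<^bsub>ps R\<^esub> i \<otimes>\<^bsub>ps R\<^esub> (?X [^]\<^bsub>ps R\<^esub> N \<otimes>\<^bsub>ps R\<^esub> ?s) \<in> I" by (auto intro: I.I_l_closed)
        then have sI: "?X [^]\<^bsub>ps R\<^esub> (N + i) \<otimes>\<^bsub>ps R\<^esub> ?s \<in> I" using s
          by (simp add: P.nat_pow_mult[symmetric] P.m_ac)
        have "?X [^]\<^bsub>ps R\<^esub> (N + Suc i) \<otimes>\<^bsub>ps R\<^esub> h' = ?X [^]\<^bsub>ps R\<^esub> (N + i) \<otimes>\<^bsub>ps R\<^esub> (?X \<otimes>\<^bsub>ps R\<^esub> h')"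
          using h' by (simp add: P.m_assoc)
        also have "\<dots> = ?X [^]\<^bsub>ps R\<^esub> (N + i) \<otimes>\<^bsub>ps R\<^esub> h \<ominus>\<^bsub>ps R\<^esub> ?X [^]\<^bsub>ps R\<^esub> (N + i) \<otimes>\<^bsub>ps R\<^esub> ?s"
          unfolding e[symmetric] using h s by (simp add: P.minus_eq P.r_distr P.r_minus)
        finally have "?X [^]\<^bsub>ps R\<^esub> (N + Suc i) \<otimes>\<^bsub>ps R\<^esub> h' \<in> I" using P.ideal_minus[OF I h(2) sI] by simp
        then show ?thesis using d(1) h' he by blast
      qed
      have "f \<in> P.ispan (map (\<lambda>h. ?X [^]\<^bsub>ps R\<^esub> N \<otimes>\<^bsub>ps R\<^esub> h) hs)" if f: "f \<in> In N" for f
      proof -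
        define h0 where "h0 = (\<lambda>i. f (i + N))"
        have fc: "f \<in> carrier (ps R)" using f Ic by (auto simp: In_def)
        have h0: "h0 \<in> carrier (ps R)" using fc by (simp add: h0_def ps_carrier)
        have fe: "f = ?X [^]\<^bsub>ps R\<^esub> N \<otimes>\<^bsub>ps R\<^esub> h0" unfolding h0_def by (rule psX_pow_eq) (use f fc in \<open>auto simp: In_def\<close>)
        have "\<exists>H. \<forall>i. ((H i \<in> carrier (ps R) \<and> ?X [^]\<^bsub>ps R\<^esub> (N + i) \<otimes>\<^bsub>ps R\<^esub> H i \<in> I) \<and> (i = 0 \<longrightarrow> H i = h0)) \<and>
          (\<exists>d\<in>vecs R. H i = lc (ps R) (\<lambda>j. const R (d j)) (map (\<lambda>x _. x) hs) () \<oplus>\<^bsub>ps R\<^esub> ?X \<otimes>\<^bsub>ps R\<^esub> H (Suc i))"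
        proof (rule dependent_nat_choice)
          show "\<exists>x. (x \<in> carrier (ps R) \<and> ?X [^]\<^bsub>ps R\<^esub> (N + 0) \<otimes>\<^bsub>ps R\<^esub> x \<in> I) \<and> (0 = (0::nat) \<longrightarrow> x = h0)"
            using h0 fe f by (intro exI[of _ h0]) (auto simp: In_def)
          fix x and n :: nat
          assume "(x \<in> carrier (ps R) \<and> ?X [^]\<^bsub>ps R\<^esub> (N + n) \<otimes>\<^bsub>ps R\<^esub> x \<in> I) \<and> (n = 0 \<longrightarrow> x = h0)"
          then show "\<exists>y. ((y \<in> carrier (ps R) \<and> ?X [^]\<^bsub>ps R\<^esub> (N + Suc n) \<otimes>\<^bsub>ps R\<^esub> y \<in> I) \<and> (Suc n = 0 \<longrightarrow> y = h0)) \<and>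
             (\<exists>d\<in>vecs R. x = lc (ps R) (\<lambda>j. const R (d j)) (map (\<lambda>x _. x) hs) () \<oplus>\<^bsub>ps R\<^esub> ?X \<otimes>\<^bsub>ps R\<^esub> y)"
            using step[of x n] by blast
        qed
        then obtain H where H: "\<And>i. H i \<in> carrier (ps R)" "H 0 = h0"
           "\<And>i. \<exists>d\<in>vecs R. H i = lc (ps R) (\<lambda>j. const R (d j)) (map (\<lambda>x _. x) hs) () \<oplus>\<^bsub>ps R\<^esub> ?X \<otimes>\<^bsub>ps R\<^esub> H (Suc i)"
          by blast
        have "\<forall>i. \<exists>d. d \<in> vecs R \<and> H i = lc (ps R) (\<lambda>j. const R (d j)) (map (\<lambda>x _. x) hs) () \<oplus>\<^bsub>ps R\<^esub> ?X \<otimes>\<^bsub>ps R\<^esub> H (Suc i)"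
          using H(3) by blast
        from choice[OF this] obtain d where d: "\<And>i. d i \<in> vecs R"
           "\<And>i. H i = lc (ps R) (\<lambda>j. const R (d i j)) (map (\<lambda>x _. x) hs) () \<oplus>\<^bsub>ps R\<^esub> ?X \<otimes>\<^bsub>ps R\<^esub> H (Suc i)" by blast
        obtain D where D: "D \<in> vecs (ps R)" "h0 = lc (ps R) D (map (\<lambda>x _. x) hs) ()"
          using ps_limit_list[where a = H and d = d, OF hc H(1) d] unfolding H(2) by blast
        have Xc: "set (map (\<lambda>h. ?X [^]\<^bsub>ps R\<^esub> N \<otimes>\<^bsub>ps R\<^esub> h) hs) \<subseteq> carrier (ps R)" using hc by auto
        let ?K = "P.ispan (map (\<lambda>h. ?X [^]\<^bsub>ps R\<^esub> N \<otimes>\<^bsub>ps R\<^esub> h) hs)"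
        interpret K: ideal ?K "ps R" by (rule P.ispan_ideal[OF Xc])
        have J: "ideal {x \<in> carrier (ps R). ?X [^]\<^bsub>ps R\<^esub> N \<otimes>\<^bsub>ps R\<^esub> x \<in> ?K} (ps R)"
          by (rule P.ideal_criterion) (auto simp: P.r_distr K.a_closed P.m_lcomm[of "?X [^]\<^bsub>ps R\<^esub> N"] K.I_l_closed)
        have "h0 \<in> {x \<in> carrier (ps R). ?X [^]\<^bsub>ps R\<^esub> N \<otimes>\<^bsub>ps R\<^esub> x \<in> ?K}"
          unfolding D(2) by (rule P.lc_ideal[OF J D(1) vh]) (use hc P.ispan_mem[OF Xc] in auto)
        then show ?thesis using fe by simp
      qed
      then show ?thesis using Xh by (intro exI[of _ "map (\<lambda>h. ?X [^]\<^bsub>ps R\<^esub> N \<otimes>\<^bsub>ps R\<^esub> h) hs"]) auto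
    qed
    \<comment> \<open>Removing the coefficient of \<open>X^n\<close> with the generators of
      \<open>L n\<close> raises the order by one.\<close>
    have down: "\<exists>xs. set xs \<subseteq> I \<and> In n \<subseteq> P.ispan xs" if ex: "\<exists>xs. set xs \<subseteq> I \<and> In (Suc n) \<subseteq> P.ispan xs" for n
    proof -
      obtain xs where xs: "set xs \<subseteq> I" "In (Suc n) \<subseteq> P.ispan xs" using ex by blast
      obtain gs where gs: "set gs \<subseteq> In n" "L n = ispan (map (\<lambda>g. g n) gs)" using gens by blast
      have gI: "set gs \<subseteq> I" using gs by (auto simp: In_def)
      have cc: "set xs \<subseteq> carrier (ps R)" "set gs \<subseteq> carrier (ps R)" "set (xs @ gs) \<subseteq> carrier (ps R)" using xs gI Ic by auto
      interpret K: ideal "P.ispan (xs @ gs)" "ps R" by (rule P.ispan_ideal[OF cc(3)])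
      have "set xs \<subseteq> P.ispan (xs @ gs)" "set gs \<subseteq> P.ispan (xs @ gs)" using P.ispan_mem[OF cc(3)] by auto
      then have sub: "P.ispan xs \<subseteq> P.ispan (xs @ gs)" "P.ispan gs \<subseteq> P.ispan (xs @ gs)"
        using P.ispan_mono[OF cc(1,3)] P.ispan_mono[OF cc(2,3)] by simp_all
      have "f \<in> P.ispan (xs @ gs)" if f: "f \<in> In n" for f
      proof -
        have fc: "f \<in> carrier (ps R)" using f Ic by (auto simp: In_def)
        have "f n \<in> L n" using f by (auto simp: L_def)
        then obtain d where d: "d \<in> vecs R" "f n = lc R d (map (\<lambda>x _. x) (map (\<lambda>g. g n) gs)) ()"
          unfolding gs(2) by (rule ispanE)
        let ?s = "lc (ps R) (\<lambda>j. const R (d j)) (map (\<lambda>x _. x) gs) ()"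
        have cd: "(\<lambda>j. const R (d j)) \<in> vecs (ps R)" using d by (auto simp: vecs_def)
        have s: "?s \<in> carrier (ps R)" using P.lc_closed[OF cd P.ispan_vecs[OF cc(2)]] .
        have sI: "?s \<in> I" by (rule P.lc_ideal[OF I cd P.ispan_vecs[OF cc(2)]]) (use gI in auto)
        have si: "?s i = lc R d (map (\<lambda>x _. x) (map (\<lambda>g. g i) gs)) ()" for i by (rule lc_ps_nth0[OF d(1) cc(2)])
        have "f \<ominus>\<^bsub>ps R\<^esub> ?s \<in> In (Suc n)"
          unfolding In_def
        proof (intro CollectI conjI allI impI)
          show "f \<ominus>\<^bsub>ps R\<^esub> ?s \<in> I" using f sI P.ideal_minus[OF I] by (auto simp: In_def)
          fix i assume i: "i < Suc n"
          have "?s i = f i"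
          proof (cases "i = n")
            case False
            have "lc R d (map (\<lambda>x _. x) (map (\<lambda>g. g i) gs)) () \<in> {\<zero>}"
              by (rule lc_ideal[OF zeroideal d(1)]) (use gs cc i False in \<open>auto simp: In_def vecs_def ps_carrier\<close>)
            then show ?thesis using si f i False by (auto simp: In_def)
          qed (use si d in simp)
          then show "(f \<ominus>\<^bsub>ps R\<^esub> ?s) i = \<zero>" using fc s by (simp add: ps_carrierD a_minus_def r_neg)
        qed
        then have "f \<ominus>\<^bsub>ps R\<^esub> ?s \<in> P.ispan (xs @ gs)" using xs(2) sub by auto
        moreover have "?s \<in> P.ispan (xs @ gs)" using P.lc_ispan[OF cd cc(2)] sub by auto
        ultimately have "?s \<oplus>\<^bsub>ps R\<^esub> (f \<ominus>\<^bsub>ps R\<^esub> ?s) \<in> P.ispan (xs @ gs)" by (auto intro: K.a_closed)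
        moreover have "?s \<oplus>\<^bsub>ps R\<^esub> (f \<ominus>\<^bsub>ps R\<^esub> ?s) = f" using fc s by (auto simp: P.a_ac P.minus_eq P.r_neg)
        ultimately show ?thesis by simp
      qed
      then show ?thesis using xs gI by (intro exI[of _ "xs @ gs"]) auto
    qed
    have "\<exists>xs. set xs \<subseteq> I \<and> In 0 \<subseteq> P.ispan xs"
      using top by (induction N) (use down in blast)+
    then obtain xs where xs: "set xs \<subseteq> I" "I \<subseteq> P.ispan xs" by (auto simp: In_def)
    have xc: "set xs \<subseteq> carrier (ps R)" using xs Ic by auto
    have "I = Idl\<^bsub>ps R\<^esub> (set xs)"
      using xs P.Idl_ispan[OF xc] P.genideal_minimal[OF I xs(1)] by auto
    then show ?thesis using xc by blast
  qed
  then show ?thesis by (intro P.noetherian_ringI) auto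
qed

text \<open>By \<open>val\<close> all ideals become principal once \<open>T\<close> is inverted, so
  a submodule of a free module has a triangular basis: a vector \<open>v0\<close> whose last
  coordinate generates the ideal of last coordinates, together with a basis of the part where that
  coordinate vanishes. Elements of \<open>T\<close> clear the denominators.\<close>

lemma (in domain) local_basis:
  assumes T: "T \<subseteq> carrier R" "\<one> \<in> T" "\<And>s t. s \<in> T \<Longrightarrow> t \<in> T \<Longrightarrow> s \<otimes> t \<in> T"
    and val: "\<And>I. ideal I R \<Longrightarrow> I \<noteq> {\<zero>} \<Longrightarrow> \<exists>a\<in>I. a \<noteq> \<zero> \<and> (\<forall>b\<in>I. \<exists>t\<in>T. a divides (t \<otimes> b))"
  shows "M \<subseteq> vecs R \<Longrightarrow> (\<lambda>c. \<zero>) \<in> M \<Longrightarrow> (\<And>v w. v \<in> M \<Longrightarrow> w \<in> M \<Longrightarrow> (\<lambda>c. v c \<oplus> w c) \<in> M) \<Longrightarrow>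
    (\<And>a v. a \<in> carrier R \<Longrightarrow> v \<in> M \<Longrightarrow> (\<lambda>c. a \<otimes> v c) \<in> M) \<Longrightarrow>
    \<exists>ns. set ns \<subseteq> M \<and> indep_mod R {\<zero>} {..<k::nat} ns \<and> (\<forall>v\<in>M. \<exists>t\<in>T. (\<lambda>c. t \<otimes> v c) \<in> span_on R {..<k} ns)"
proof (induction k arbitrary: M)
  case 0
  have "(\<lambda>c. t \<otimes> v c) \<in> span_on R {..<0::nat} []" for t v
    by (rule span_onI[of "\<lambda>_. \<zero>"]) (auto simp: vecs_def)
  then show ?case using T(2) by (intro exI[of _ "[]"]) (auto simp: indep_mod_def)
next
  case (Suc k)
  note M = Suc.prems
  define I where "I = (\<lambda>v. v k) ` M"
  have I: "ideal I R"
  proof (rule ideal_criterion)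
    show "I \<subseteq> carrier R" using M(1) by (auto simp: I_def vecs_def)
    show "\<zero> \<in> I" using imageI[OF M(2), of "\<lambda>v. v k"] by (simp add: I_def)
    show "x \<oplus> y \<in> I" if "x \<in> I" "y \<in> I" for x y
      using that M(3) unfolding I_def by (smt (verit, best) image_iff)
    show "a \<otimes> x \<in> I" if "a \<in> carrier R" "x \<in> I" for a x
      using that M(4) unfolding I_def by (smt (verit, best) image_iff)
  qed
  define M' where "M' = {v \<in> M. v k = \<zero>}"
  have "\<exists>ns. set ns \<subseteq> M' \<and> indep_mod R {\<zero>} {..<k} ns \<and> (\<forall>v\<in>M'. \<exists>t\<in>T. (\<lambda>c. t \<otimes> v c) \<in> span_on R {..<k} ns)"
    by (rule Suc.IH) (use M in \<open>auto simp: M'_def\<close>)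
  then obtain ns where ns: "set ns \<subseteq> M'" "indep_mod R {\<zero>} {..<k} ns"
    "\<And>v. v \<in> M' \<Longrightarrow> \<exists>t\<in>T. (\<lambda>c. t \<otimes> v c) \<in> span_on R {..<k} ns" by blast
  have nv: "set ns \<subseteq> vecs R" using ns(1) M(1) by (auto simp: M'_def)
  have nk: "lc R a ns k = \<zero>" if "a \<in> vecs R" for a
    using lc_ideal[OF zeroideal that nv, of k] ns(1) by (auto simp: M'_def)
  have sp: "\<exists>t\<in>T. \<exists>a\<in>vecs R. \<forall>c<Suc k. t \<otimes> v c = lc R a ns c" if v: "v \<in> M'" for v
  proof -
    obtain t where t: "t \<in> T" "(\<lambda>c. t \<otimes> v c) \<in> span_on R {..<k} ns" using ns(3)[OF v] by auto
    then obtain a where a: "a \<in> vecs R" "\<And>c. c < k \<Longrightarrow> t \<otimes> v c = lc R a ns c" by (auto elim: span_onE)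
    have "t \<otimes> v k = lc R a ns k" using nk[OF a(1)] v t(1) T(1) by (auto simp: M'_def)
    then show ?thesis using a t(1) by (auto simp: less_Suc_eq)
  qed
  show ?case
  proof (cases "I = {\<zero>}")
    case True
    have "v k = \<zero>" if "v \<in> M" for v using imageI[OF that, of "\<lambda>v. v k"] True by (simp add: I_def)
    then have "M' = M" by (auto simp: M'_def)
    moreover have "indep_mod R {\<zero>} {..<Suc k} ns" using ns(2) by (auto simp: indep_mod_def)
    moreover have "\<exists>t\<in>T. (\<lambda>c. t \<otimes> v c) \<in> span_on R {..<Suc k} ns" if v: "v \<in> M'" for v
    proof -
      obtain t a where "t \<in> T" "a \<in> vecs R" "\<forall>c<Suc k. t \<otimes> v c = lc R a ns c" using sp[OF v] by blast
      then show ?thesis by (intro bexI[of _ t] span_onI[of a]) auto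
    qed
    ultimately show ?thesis using ns(1) by blast
  next
    case False
    then obtain v0 where v0: "v0 \<in> M" "v0 k \<noteq> \<zero>" "\<And>v. v \<in> M \<Longrightarrow> \<exists>t\<in>T. v0 k divides (t \<otimes> v k)"
      using val[OF I False] unfolding I_def by blast
    have v0c: "v0 c \<in> carrier R" for c using v0(1) M(1) by (auto simp: vecs_def)
    have "indep_mod R {\<zero>} {..<Suc k} (v0 # ns)"
      unfolding indep_mod_def
    proof (intro ballI impI)
      fix a assume a: "a \<in> vecs R" "\<forall>c\<in>{..<Suc k}. lc R a (v0 # ns) c \<in> {\<zero>}"
      have a': "(\<lambda>i. a (Suc i)) \<in> vecs R" "a 0 \<in> carrier R" using a by (auto simp: vecs_def)
      have "lc R a (v0 # ns) k = \<zero>" using a(2) by blast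
      then have "a 0 \<otimes> v0 k = \<zero>" using nk[OF a'(1)] a'(2) v0c by simp
      then have a0: "a 0 = \<zero>" using v0(2) a'(2) v0c integral by blast
      have "lc R (\<lambda>i. a (Suc i)) ns c \<in> {\<zero>}" if "c < k" for c
      proof -
        have "lc R a (v0 # ns) c = \<zero>" using a(2) that by auto
        then show ?thesis using a0 a' nv v0c by simp
      qed
      then have "\<forall>i<length ns. a (Suc i) \<in> {\<zero>}" using ns(2) a'(1) by (auto simp: indep_mod_def)
      then show "\<forall>i<length (v0 # ns). a i \<in> {\<zero>}" using a0 by (auto simp: less_Suc_eq_0_disj)
    qed
    moreover have "\<exists>t\<in>T. (\<lambda>c. t \<otimes> v c) \<in> span_on R {..<Suc k} (v0 # ns)" if v: "v \<in> M" for v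
    proof -
      have vc: "v c \<in> carrier R" for c using v M(1) by (auto simp: vecs_def)
      obtain t where t: "t \<in> T" "v0 k divides (t \<otimes> v k)" using v0(3)[OF v] by auto
      then obtain r where r: "r \<in> carrier R" "t \<otimes> v k = v0 k \<otimes> r" by (auto elim: dividesE2)
      have tc: "t \<in> carrier R" using t T by auto
      define w where "w = (\<lambda>c. t \<otimes> v c \<oplus> (\<ominus> r) \<otimes> v0 c)"
      have "w \<in> M" unfolding w_def using M(3)[OF M(4)[OF tc v] M(4)[OF _ v0(1), of "\<ominus> r"]] r by simp
      moreover have "v0 k \<otimes> r \<oplus> (\<ominus> r) \<otimes> v0 k = \<zero>" using r(1) v0c[of k] by algebra
      then have "w k = \<zero>" using r(2) by (simp add: w_def)
      ultimately obtain t' a where a: "t' \<in> T" "a \<in> vecs R" "\<And>c. c < Suc k \<Longrightarrow> t' \<otimes> w c = lc R a ns c"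
        using sp[of w] by (auto simp: M'_def)
      have t'c: "t' \<in> carrier R" using a T by auto
      have "(\<lambda>c. (t' \<otimes> t) \<otimes> v c) \<in> span_on R {..<Suc k} (v0 # ns)"
      proof (rule span_onI[of "\<lambda>i. case i of 0 \<Rightarrow> t' \<otimes> r | Suc j \<Rightarrow> a j"])
        show "(\<lambda>i. case i of 0 \<Rightarrow> t' \<otimes> r | Suc j \<Rightarrow> a j) \<in> vecs R"
          using a(2) r t'c by (auto simp: vecs_def split: nat.split)
        fix c assume "c \<in> {..<Suc k}"
        then have "lc R a ns c = t' \<otimes> (t \<otimes> v c \<oplus> (\<ominus> r) \<otimes> v0 c)" using a(3) by (simp add: w_def)
        moreover have "t' \<otimes> r \<otimes> z \<oplus> t' \<otimes> (t \<otimes> x \<oplus> (\<ominus> r) \<otimes> z) = t' \<otimes> t \<otimes> x" if "x \<in> carrier R" "z \<in> carrier R" for x z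
          using that t'c tc r(1) by algebra
        ultimately show "t' \<otimes> t \<otimes> v c = lc R (\<lambda>i. case i of 0 \<Rightarrow> t' \<otimes> r | Suc j \<Rightarrow> a j) (v0 # ns) c"
          using vc v0c by simp
      qed
      then show ?thesis using T(3)[OF a(1) t(1)] by blast
    qed
    ultimately show ?thesis using ns(1) v0(1) by (intro exI[of _ "v0 # ns"]) (auto simp: M'_def)
  qed
qed

section \<open>Scalar products and the vector of maximal minors\<close>

primrec dt :: "('a, 'b) ring_scheme \<Rightarrow> nat \<Rightarrow> (nat \<Rightarrow> 'a) \<Rightarrow> (nat \<Rightarrow> 'a) \<Rightarrow> 'a" where
  "dt R 0 v x = \<zero>\<^bsub>R\<^esub>"
| "dt R (Suc k) v x = dt R k v x \<oplus>\<^bsub>R\<^esub> v k \<otimes>\<^bsub>R\<^esub> x k"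

context cring
begin

lemma dt_closed [simp]: "v \<in> vecs R \<Longrightarrow> x \<in> vecs R \<Longrightarrow> dt R k v x \<in> carrier R"
  by (induction k) (auto simp: vecsD)

lemma dt_add: "v \<in> vecs R \<Longrightarrow> w \<in> vecs R \<Longrightarrow> x \<in> vecs R \<Longrightarrow>
    dt R k (\<lambda>c. v c \<oplus> w c) x = dt R k v x \<oplus> dt R k w x"
proof (induction k)
  case (Suc k)
  have "v k \<in> carrier R" "w k \<in> carrier R" "x k \<in> carrier R" using Suc.prems by (simp_all add: vecsD)
  then show ?case using Suc by (simp add: l_distr a_ac)
qed simp

lemma dt_smult: "s \<in> carrier R \<Longrightarrow> v \<in> vecs R \<Longrightarrow> x \<in> vecs R \<Longrightarrow>
    dt R k (\<lambda>c. s \<otimes> v c) x = s \<otimes> dt R k v x"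
proof (induction k)
  case (Suc k)
  have "v k \<in> carrier R" "x k \<in> carrier R" using Suc.prems by (simp_all add: vecsD)
  then show ?case using Suc by (simp add: r_distr m_assoc)
qed simp

lemma dt_comm: "v \<in> vecs R \<Longrightarrow> x \<in> vecs R \<Longrightarrow> dt R k v x = dt R k x v"
  by (induction k) (auto simp: vecsD m_comm)

lemma dt_cong: "(\<And>c. c < k \<Longrightarrow> v c = w c) \<Longrightarrow> dt R k v x = dt R k w x"
  by (induction k) auto

lemma dt_cong2: "(\<And>c. c < k \<Longrightarrow> x c = y c) \<Longrightarrow> dt R k v x = dt R k v y"
  by (induction k) auto

lemma dt_single:
  assumes "v \<in> vecs R" "x \<in> vecs R"
  shows "j < k \<Longrightarrow> (\<And>c. c < k \<Longrightarrow> c \<noteq> j \<Longrightarrow> v c \<otimes> x c = \<zero>) \<Longrightarrow> dt R k v x = v j \<otimes> x j"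
proof (induction k)
  case (Suc k)
  show ?case
  proof (cases "j = k")
    case True
    have "dt R l v x = \<zero>" if "l \<le> k" for l using that
      by (induction l) (use Suc.prems True in auto)
    then show ?thesis using True assms by (simp add: vecsD)
  next
    case False
    then have "v k \<otimes> x k = \<zero>" "dt R k v x = v j \<otimes> x j" using Suc by auto
    then show ?thesis using assms by (simp add: vecsD)
  qed
qed simp

lemma dt_hom: "ring_hom_cring R S h \<Longrightarrow> v \<in> vecs R \<Longrightarrow> x \<in> vecs R \<Longrightarrow>
    h (dt R k v x) = dt S k (\<lambda>c. h (v c)) (\<lambda>c. h (x c))"
proof (induction k)
  case (Suc k)
  interpret h: ring_hom_cring R S h by (rule Suc.prems)
  show ?case using Suc by (simp add: vecsD)
next
  case 0
  interpret h: ring_hom_cring R S h by (rule 0)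
  show ?case by simp
qed

lemma lc_vecs [simp]: "a \<in> vecs R \<Longrightarrow> set vs \<subseteq> vecs R \<Longrightarrow> lc R a vs \<in> vecs R"
  by (simp add: vecs_def[of R] del: lc.simps)

lemma dt_lc_zero:
  assumes x: "x \<in> vecs R"
  shows "a \<in> vecs R \<Longrightarrow> set vs \<subseteq> vecs R \<Longrightarrow> (\<And>v. v \<in> set vs \<Longrightarrow> dt R k v x = \<zero>) \<Longrightarrow> dt R k (lc R a vs) x = \<zero>"
proof (induction vs arbitrary: a)
  case Nil
  have "dt R k (\<lambda>c. \<zero>) x = \<zero>" by (induction k) (use x in \<open>auto simp: vecsD\<close>)
  moreover have "lc R a [] = (\<lambda>c. \<zero>)" by auto
  ultimately show ?case by simp
next
  case (Cons v vs)
  have a: "(\<lambda>i. a (Suc i)) \<in> vecs R" "a 0 \<in> carrier R" using Cons.prems by (auto simp: vecs_def)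
  have v: "v \<in> vecs R" "(\<lambda>c. a 0 \<otimes> v c) \<in> vecs R" using Cons.prems a by (auto simp: vecs_def)
  have e: "lc R a (v # vs) = (\<lambda>c. a 0 \<otimes> v c \<oplus> lc R (\<lambda>i. a (Suc i)) vs c)" by auto
  have "dt R k (lc R (\<lambda>i. a (Suc i)) vs) x = \<zero>" "dt R k v x = \<zero>" using Cons a by auto
  then show ?case unfolding e using dt_add[OF v(2) lc_vecs[OF a(1)] x] Cons.prems dt_smult[OF a(2) v(1) x] a by simp
qed

lemma lc_eq_dt: "set xs \<subseteq> carrier R \<Longrightarrow> a \<in> vecs R \<Longrightarrow>
    lc R a (map (\<lambda>x _. x) xs) () = dt R (length xs) a (\<lambda>c. if c < length xs then xs ! c else \<zero>)"
proof (induction xs rule: rev_induct)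
  case (snoc y xs)
  have sub: "set (map (\<lambda>x _::unit. x) xs) \<subseteq> vecs R" "set [\<lambda>_::unit. y] \<subseteq> vecs R" using snoc.prems by (auto simp: vecs_def)
  have c: "a (length xs) \<in> carrier R" "y \<in> carrier R" using snoc.prems by (auto simp: vecsD)
  have "dt R (length xs) a (\<lambda>c. if c < length (xs @ [y]) then (xs @ [y]) ! c else \<zero>) =
      dt R (length xs) a (\<lambda>c. if c < length xs then xs ! c else \<zero>)"
    by (rule dt_cong2) (simp add: nth_append)
  also have "\<dots> = lc R a (map (\<lambda>x _. x) xs) ()" using snoc by simp
  finally have "dt R (length (xs @ [y])) a (\<lambda>c. if c < length (xs @ [y]) then (xs @ [y]) ! c else \<zero>) =
      lc R a (map (\<lambda>x _. x) xs) () \<oplus> a (length xs) \<otimes> y" by simp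
  moreover have "lc R a (map (\<lambda>x _. x) (xs @ [y])) () = lc R a (map (\<lambda>x _. x) xs) () \<oplus> a (length xs) \<otimes> y"
    using lc_append[OF snoc.prems(2) sub, of "()"] c by simp
  ultimately show ?case by simp
qed simp

lemma minor_unit_vecs: 
  assumes "set ns \<subseteq> vecs R"
  shows "(\<lambda>c. minor R cs (unit_vec R c # ns)) \<in> vecs R"
proof -
  have "minor R cs (unit_vec R c # ns) \<in> carrier R" for c
    by (rule minor_closed) (use assms in simp)
  then show ?thesis by (simp add: vecs_def del: minor.simps)
qed

lemma minor_unit_sum:
  assumes ns: "set ns \<subseteq> vecs R" and v: "v \<in> vecs R"
  shows "minor R cs ((\<lambda>c. if c < n then v c else \<zero>) # ns) = dt R n v (\<lambda>c. minor R cs (unit_vec R c # ns))"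
proof (induction n)
  case 0
  have "minor R cs ([] @ (\<lambda>c. \<zero>) # ns) \<in> {\<zero>}" by (rule minor_in_ideal[OF zeroideal]) (use ns in \<open>auto simp: vecs_def\<close>)
  then show ?case by simp
next
  case (Suc n)
  have vn: "v n \<in> carrier R" "(\<lambda>c. if c < n then v c else \<zero>) \<in> vecs R" using v by (auto simp: vecs_def)
  have "(\<lambda>c. if c < Suc n then v c else \<zero>) = (\<lambda>c. \<one> \<otimes> (if c < n then v c else \<zero>) \<oplus> v n \<otimes> unit_vec R n c)"
    using v vn by (auto simp: unit_vec_def vecsD less_Suc_eq fun_eq_iff)
  moreover have "(\<lambda>c. minor R cs (unit_vec R c # ns)) \<in> vecs R" by (rule minor_unit_vecs[OF ns])
  ultimately show ?case using multilinD[OF minor_multilin, of "[]" ns \<one> "v n" "\<lambda>c. if c < n then v c else \<zero>" "unit_vec R n" cs] ns vn Suc v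
    by (simp del: minor.simps)
qed

text \<open>The scalar product is the determinant with \<open>v\<close> placed on top of
  \<open>ns\<close>, expanded along this extra row; \<open>v\<close> occurs twice in it.\<close>

lemma minor_orthogonal:
  assumes ns: "set ns \<subseteq> vecs R" and v: "v \<in> set ns"
  shows "dt R k v (\<lambda>c. minor R [0..<k] (unit_vec R c # ns)) = \<zero>"
proof -
  have vc: "v \<in> vecs R" using assms by auto
  \<comment> \<open>The minor reads only the columns below \<open>k\<close>, so \<open>v\<close> may
    be cut off there before it is written as a finite sum of unit vectors.\<close>
  let ?w = "\<lambda>c. if c < k then v c else \<zero>" let ?u = "\<lambda>c. if c < k then \<zero> else v c"
  have wu: "?w \<in> vecs R" "?u \<in> vecs R" using vc by (auto simp: vecs_def)
  have "v = (\<lambda>c. \<one> \<otimes> ?w c \<oplus> \<one> \<otimes> ?u c)" using vc by (auto simp: vecsD)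
  then have "minor R [0..<k] (v # ns) = minor R [0..<k] (?w # ns) \<oplus> minor R [0..<k] (?u # ns)"
    using multilinD[OF minor_multilin, of "[]" ns \<one> \<one> ?w ?u "[0..<k]"] ns wu by (simp del: minor.simps)
  moreover have "minor R [0..<k] ([] @ ?u # ns) \<in> {\<zero>}"
    by (rule minor_in_ideal[OF zeroideal]) (use ns wu in auto)
  moreover have "minor R [0..<k] (?w # ns) \<in> carrier R" using ns wu by (intro minor_closed) auto
  ultimately have "minor R [0..<k] (v # ns) = minor R [0..<k] (?w # ns)" by simp
  then show ?thesis using minor_unit_sum[OF ns vc] minor_mem[OF v ns] by simp
qed

end

lemma subseq_delete_one:
  "subseq cs cols \<Longrightarrow> length cols = Suc (length cs) \<Longrightarrow> \<exists>xs c ys. cols = xs @ c # ys \<and> cs = xs @ ys"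
proof (induction cols arbitrary: cs)
  case (Cons d cols)
  show ?case
  proof (cases "subseq cs cols \<and> length cols = length cs")
    case True
    then have "cs = cols" by (metis subseq_same_length)
    then have "d # cols = [] @ d # cols" "cs = [] @ cols" by auto
    then show ?thesis by blast
  next
    case False
    then obtain cs' where cs': "cs = d # cs'" "subseq cs' cols"
      using Cons.prems by (auto elim: list_emb.cases)
    then obtain xs c ys where "cols = xs @ c # ys" "cs' = xs @ ys" using Cons.IH[of cs'] Cons.prems by auto
    then have "d # cols = (d # xs) @ c # ys" "cs = (d # xs) @ ys" using cs' by auto
    then show ?thesis by blast
  qed
qed simp

context domain
begin

text \<open>\<open>indep_minor\<close> yields a minor outside \<open>P\<close> on all columns but
  one; the unit vector of the omitted column completes it to a square matrix with the same
  determinant up to sign.\<close>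

lemma minor_exists:
  assumes P: "primeideal P R" and vs: "set vs \<subseteq> vecs R" "indep_mod R P {..<k} vs" "k = Suc (length vs)"
  shows "\<exists>c<k. minor R [0..<k] (unit_vec R c # vs) \<notin> P"
proof -
  interpret P: primeideal P R by (rule P)
  obtain cs where cs: "subseq cs [0..<k]" "length cs = length vs" "minor R cs vs \<notin> P"
    using indep_minor[OF P vs(1), of "[0..<k]"] vs(2) by (auto simp: lessThan_atLeast0)
  obtain xs c ys where xy: "[0..<k] = xs @ c # ys" "cs = xs @ ys"
    using subseq_delete_one[OF cs(1)] cs(2) vs(3) by auto
  have d: "c \<notin> set xs" "c \<notin> set ys" using distinct_upt[of 0 k] unfolding xy by auto
  have "c \<in> set [0..<k]" unfolding xy by simp
  then have ck: "c < k" by simp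
  obtain e where e: "e \<in> {\<one>, \<ominus> \<one>}" "minor R (xs @ c # ys) (unit_vec R c # vs) = e \<otimes> minor R cs vs"
    using minor_unit_vec[OF vs(1) d] vs(1) xy(2) by blast
  have m: "minor R cs vs \<in> carrier R" using vs(1) by simp
  have "e \<otimes> minor R cs vs \<notin> P"
  proof
    assume "e \<otimes> minor R cs vs \<in> P"
    moreover have "e \<in> carrier R" using e(1) by auto
    ultimately have "e \<otimes> (e \<otimes> minor R cs vs) \<in> P" by (rule P.I_l_closed)
    moreover have "e \<otimes> (e \<otimes> minor R cs vs) = minor R cs vs" using e(1) m by (auto simp: l_minus)
    ultimately show False using cs(3) by simp
  qed
  then show ?thesis using e(2) xy(1) ck by auto
qed

lemma indep_length:
  assumes "set vs \<subseteq> vecs R" "indep_mod R {\<zero>} (set cols) vs"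
  shows "length vs \<le> length cols"
  using indep_minor[OF zeroprimeideal assms] list_emb_length by metis

text \<open>Over the fraction field, the orthogonal complement of \<open>k - 1\<close> independent
  vectors is a line. Without fractions: otherwise \<open>w\<close> vanishes at \<open>j\<close> but
  not at \<open>i\<close>. For lack of columns some nontrivial combination of the vectors vanishes
  off \<open>i\<close> and \<open>j\<close>; orthogonality to \<open>w\<close> and then to
  \<open>x\<close> kills its two remaining entries, against independence.\<close>

lemma orthogonal_proportional:
  assumes x: "x \<in> vecs R" and y: "y \<in> vecs R" and vs: "set vs \<subseteq> vecs R" "indep_mod R {\<zero>} {..<k} vs" "k = Suc (length vs)"
    and ox: "\<And>v. v \<in> set vs \<Longrightarrow> dt R k v x = \<zero>" and oy: "\<And>v. v \<in> set vs \<Longrightarrow> dt R k v y = \<zero>"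
    and j: "j < k" "x j \<noteq> \<zero>" and i: "i < k"
  shows "x i \<otimes> y j = x j \<otimes> y i"
proof (rule ccontr)
  assume ne: "\<not> ?thesis"
  then have ij: "i \<noteq> j" using x y by (auto simp: vecsD m_comm)
  have xyc: "x c \<in> carrier R" "y c \<in> carrier R" for c using x y by (auto simp: vecsD)
  define w where "w = (\<lambda>c. x j \<otimes> y c \<oplus> (\<ominus> y j) \<otimes> x c)"
  have w: "w \<in> vecs R" using xyc by (auto simp: w_def vecs_def)
  have wj: "w j = \<zero>" using xyc[of j] unfolding w_def by algebra
  have wi: "w i \<noteq> \<zero>"
  proof
    assume "w i = \<zero>"
    moreover have "x i \<otimes> y j = x j \<otimes> y i \<ominus> (x j \<otimes> y i \<oplus> (\<ominus> y j) \<otimes> x i)" using xyc[of i] xyc[of j] by algebra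
    ultimately show False using ne xyc[of i] xyc[of j] by (simp add: w_def a_minus_def)
  qed
  have ow: "dt R k v w = \<zero>" if v: "v \<in> set vs" for v
  proof -
    have vv: "v \<in> vecs R" using v vs by auto
    have a: "(\<lambda>c. x j \<otimes> y c) \<in> vecs R" "(\<lambda>c. (\<ominus> y j) \<otimes> x c) \<in> vecs R" using xyc by (auto simp: vecs_def)
    have "dt R k w v = x j \<otimes> dt R k y v \<oplus> (\<ominus> y j) \<otimes> dt R k x v"
      unfolding w_def using dt_add[OF a vv] dt_smult[OF _ y vv] dt_smult[OF _ x vv] xyc by simp
    moreover have "dt R k y v = \<zero>" "dt R k x v = \<zero>" using dt_comm[OF vv x, of k] dt_comm[OF vv y, of k] ox[OF v] oy[OF v] by simp_all
    ultimately show ?thesis unfolding dt_comm[OF vv w, of k] using xyc by simp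
  qed
  define cols where "cols = filter (\<lambda>c. c \<noteq> i \<and> c \<noteq> j) [0..<k]"
  have sc: "set cols = {..<k} - {i, j}" by (auto simp: cols_def)
  have "card {i, j} = 2" using ij by simp
  then have "card (set cols) = k - 2" unfolding sc using i j by (subst card_Diff_subset) auto
  then have "length cols = k - 2" by (metis cols_def distinct_card distinct_filter distinct_upt)
  then have "\<not> indep_mod R {\<zero>} (set cols) vs" using indep_length[OF vs(1), of cols] vs(3) i j ij by auto
  then obtain a l where a: "a \<in> vecs R" "\<And>c. c \<in> set cols \<Longrightarrow> lc R a vs c = \<zero>" "l < length vs" "a l \<noteq> \<zero>"
    by (auto simp: indep_mod_def)
  let ?u = "lc R a vs"
  have u: "?u \<in> vecs R" using a vs by simp
  have uc: "?u c \<in> carrier R" for c using vecsD[OF u] .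
  have "dt R k ?u w = ?u i \<otimes> w i"
    by (rule dt_single[OF u w i]) (metis (no_types, lifting) Diff_iff a(2) insert_iff l_null lessThan_iff r_null sc singletonD uc vecsD w wj)
  then have "?u i \<otimes> w i = \<zero>" using dt_lc_zero[OF w a(1) vs(1)] ow by simp
  then have ui: "?u i = \<zero>" using wi integral uc vecsD[OF w] by blast
  have "dt R k ?u x = ?u j \<otimes> x j"
    by (rule dt_single[OF u x j(1)]) (metis (no_types, lifting) Diff_iff a(2) insert_iff l_null lessThan_iff sc singletonD ui xyc(1))
  then have "?u j \<otimes> x j = \<zero>" using dt_lc_zero[OF x a(1) vs(1)] ox by simp
  then have uj: "?u j = \<zero>" using j integral uc xyc by blast
  have "?u c = \<zero>" if "c < k" for c
    using a(2)[of c] ui uj that sc by (cases "c = i \<or> c = j") auto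
  then have "a l = \<zero>" using vs(2) a(1,3) by (auto simp: indep_mod_def)
  then show False using a(4) by simp
qed

end

lemma (in domain) psX_nonzero: "psX R \<noteq> \<zero>\<^bsub>ps R\<^esub>"
proof
  assume "psX R = \<zero>\<^bsub>ps R\<^esub>"
  then have "psX R 1 = \<zero>\<^bsub>ps R\<^esub> 1" by simp
  then show False by (simp add: psX_def)
qed

text \<open>In a vanishing combination the constant terms of all coefficients vanish by hypothesis;
  dividing the coefficients by \<open>X\<close> gives another vanishing combination, and so on
  through all degrees.\<close>

lemma (in domain) indep_lift:
  assumes vs: "set vs \<subseteq> vecs (ps R)" and ind: "indep_mod R {\<zero>} K (map (\<lambda>v c. v c 0) vs)"
  shows "indep_mod (ps R) {\<zero>\<^bsub>ps R\<^esub>} K vs"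
proof -
  interpret P: domain "ps R" by (rule ps_domain)
  have vr: "set (map (\<lambda>v c. v c 0) vs) \<subseteq> vecs R" using vs by (auto simp: vecs_def ps_carrierD)
  have "\<forall>i<length vs. a i n = \<zero>" if "a \<in> vecs (ps R)" "\<forall>c\<in>K. lc (ps R) a vs c = \<zero>\<^bsub>ps R\<^esub>" for a n
    using that
  proof (induction n arbitrary: a rule: less_induct)
    case (less n)
    have a0: "(\<lambda>i. a i 0) \<in> vecs R" using less.prems(1) by (auto simp: vecs_def ps_carrierD)
    have "lc R (\<lambda>i. a i 0) (map (\<lambda>v c. v c 0) vs) c = \<zero>" if "c \<in> K" for c
      using P.lc_hom[OF ps_hom(1) less.prems(1) vs, of c] less.prems(2) that by simp
    then have z: "a i 0 = \<zero>" if "i < length vs" for i using ind a0 that by (auto simp: indep_mod_def)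
    show ?case
    proof (cases n)
      case 0 then show ?thesis using z by simp
    next
      case (Suc m)
      let ?b = "\<lambda>i. shift (a i)"
      have b: "?b \<in> vecs (ps R)" using less.prems(1) by (auto simp: vecs_def)
      have "lc (ps R) ?b vs c = \<zero>\<^bsub>ps R\<^esub>" if c: "c \<in> K" for c
      proof -
        have "lc (ps R) (\<lambda>i. psX R \<otimes>\<^bsub>ps R\<^esub> ?b i) vs c = lc (ps R) a vs c"
        proof (rule P.lc_cong)
          fix i assume "i < length vs"
          then show "psX R \<otimes>\<^bsub>ps R\<^esub> shift (a i) = a i"
            using z ps_psX_eq[OF vecsD[OF less.prems(1)], of i] by simp
        qed
        then have "psX R \<otimes>\<^bsub>ps R\<^esub> lc (ps R) ?b vs c = lc (ps R) a vs c"
          using P.lc_smult[OF psX_closed b vs, of c] by metis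
        also have "\<dots> = \<zero>\<^bsub>ps R\<^esub>" using less.prems(2) c by blast
        finally have "psX R \<otimes>\<^bsub>ps R\<^esub> lc (ps R) ?b vs c = \<zero>\<^bsub>ps R\<^esub>" .
        moreover note psX_nonzero
        ultimately show ?thesis using P.integral psX_closed P.lc_closed[OF b vs, of c] by blast
      qed
      then have lb: "\<forall>c\<in>K. lc (ps R) ?b vs c = \<zero>\<^bsub>ps R\<^esub>" by blast
      have "m < n" using Suc by simp
      from less.IH[OF this b lb] show ?thesis using Suc by simp
    qed
  qed
  then have *: "a i n = \<zero>" if "a \<in> vecs (ps R)" "\<forall>c\<in>K. lc (ps R) a vs c = \<zero>\<^bsub>ps R\<^esub>" "i < length vs" for a i n
    using that by blast
  have "a i = \<zero>\<^bsub>ps R\<^esub>" if "a \<in> vecs (ps R)" "\<forall>c\<in>K. lc (ps R) a vs c = \<zero>\<^bsub>ps R\<^esub>" "i < length vs" for a i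
    by (rule ext) (use *[OF that] in simp)
  then show ?thesis unfolding indep_mod_def by blast
qed

declare ps_zero [simp del] ps_add [simp del] shift_nth [simp del]
declare cring.ps_a_inv [simp del] cring.ps_minus [simp del] cring.const_mult_nth [simp del]

lemma ps_at_0 [simp]: "\<zero>\<^bsub>ps R\<^esub> 0 = \<zero>\<^bsub>R\<^esub>" "\<one>\<^bsub>ps R\<^esub> 0 = \<one>\<^bsub>R\<^esub>" "(f \<oplus>\<^bsub>ps R\<^esub> g) 0 = f 0 \<oplus>\<^bsub>R\<^esub> g 0" "shift f 0 = f 1"
  by (simp_all add: ps_zero ps_one ps_add shift_nth)

lemma (in cring) ps_neg_at_0 [simp]:
  assumes "f \<in> carrier (ps R)"
  shows "(\<ominus>\<^bsub>ps R\<^esub> f) 0 = \<ominus> f 0"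
    "g \<in> carrier (ps R) \<Longrightarrow> (g \<ominus>\<^bsub>ps R\<^esub> f) 0 = g 0 \<ominus> f 0"
  using assms by (simp_all add: ps_a_inv ps_minus)

lemma ps_zero_fun: "(\<lambda>n. \<zero>\<^bsub>R\<^esub>) = \<zero>\<^bsub>ps R\<^esub>"
  by (simp add: ps_def)

section \<open>Colon ideals are locally principal\<close>

text \<open>\<open>T\<close> is a saturated set of denominators, and \<open>val\<close> says that
  every nonzero ideal becomes principal once \<open>T\<close> is inverted. The instances used are
  the nonzero elements and the complement of the ideal of a prime element.\<close>

locale local_setting = R: domain R for R (structure) +
  fixes T :: "'a set"
  assumes noeth: "noetherian_ring R" and fact: "factorial_domain (ps R)"
    and T_sub: "T \<subseteq> carrier R" and T_one: "\<one> \<in> T" and T_zero: "\<zero> \<notin> T"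
    and T_mult: "\<And>s t. s \<in> T \<Longrightarrow> t \<in> T \<Longrightarrow> s \<otimes> t \<in> T"
    and T_sat: "\<And>s t. s \<in> carrier R \<Longrightarrow> t \<in> carrier R \<Longrightarrow> s \<otimes> t \<in> T \<Longrightarrow> s \<in> T"
    and val: "\<And>I. ideal I R \<Longrightarrow> I \<noteq> {\<zero>} \<Longrightarrow> \<exists>a\<in>I. a \<noteq> \<zero> \<and> (\<forall>b\<in>I. \<exists>t\<in>T. a divides (t \<otimes> b))"
begin

abbreviation "C \<equiv> ps R"
abbreviation "B \<equiv> ps (ps R)"

text \<open>Inverting all series with constant coefficient in \<open>T\<close>, and not
  \<open>T\<close> alone, puts the variable into the Jacobson radical of the localization;
  \<open>TC_minus\<close> and \<open>TB_minus\<close> are the form in which Nakayama's lemma uses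
  this.\<close>

definition "TC = {s \<in> carrier C. s 0 \<in> T}"
definition "TB = {s \<in> carrier B. s 0 0 \<in> T}"

sublocale C: factorial_domain C by (rule fact)
sublocale B: domain B by (rule C.ps_domain)

lemma noethC: "noetherian_ring C" by (rule R.ps_noetherian[OF noeth])
lemma noethB: "noetherian_ring B" by (rule C.ps_noetherian[OF noethC])

lemma TC_mult: "s \<in> TC \<Longrightarrow> t \<in> TC \<Longrightarrow> s \<otimes>\<^bsub>C\<^esub> t \<in> TC"
  by (simp add: TC_def T_mult)

lemma TC_sub: "s \<in> TC \<Longrightarrow> s \<in> carrier C"
  by (simp add: TC_def)

lemma TC_one: "\<one>\<^bsub>C\<^esub> \<in> TC"
  using T_one C.one_closed by (simp add: TC_def ps_one)

lemma TC_const: "t \<in> T \<Longrightarrow> const R t \<in> TC"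
  using T_sub by (auto simp: TC_def)

lemma TB_mult: "s \<in> TB \<Longrightarrow> t \<in> TB \<Longrightarrow> s \<otimes>\<^bsub>B\<^esub> t \<in> TB"
  by (simp add: TB_def T_mult)

lemma TB_sub: "s \<in> TB \<Longrightarrow> s \<in> carrier B"
  by (simp add: TB_def)

lemma TB_one: "\<one>\<^bsub>B\<^esub> \<in> TB"
  using T_one B.one_closed by (simp add: TB_def ps_one)

lemma TB_const: "t \<in> TC \<Longrightarrow> const C t \<in> TB"
  by (auto simp: TB_def TC_def)

lemma TC_dvd: "s \<in> TC \<Longrightarrow> p \<in> carrier C \<Longrightarrow> p divides\<^bsub>C\<^esub> s \<Longrightarrow> p \<in> TC"
proof -
  assume s: "s \<in> TC" and p: "p \<in> carrier C" and "p divides\<^bsub>C\<^esub> s"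
  then obtain c where c: "c \<in> carrier C" "s = p \<otimes>\<^bsub>C\<^esub> c" by (auto elim: dividesE2)
  have "p 0 \<otimes> c 0 \<in> T" using s c(2) by (simp add: TC_def)
  then have "p 0 \<in> T" using T_sat[of "p 0" "c 0"] p c(1) by (simp add: ps_carrierD)
  then show ?thesis using p by (simp add: TC_def)
qed

lemma TC_nonzero: "s \<in> TC \<Longrightarrow> s \<noteq> \<zero>\<^bsub>C\<^esub>"
  using T_zero by (auto simp: TC_def)

lemma TC_minus: "t \<in> TC \<Longrightarrow> r \<in> carrier C \<Longrightarrow> t \<ominus>\<^bsub>C\<^esub> psX R \<otimes>\<^bsub>C\<^esub> r \<in> TC"
  using T_sub by (auto simp: TC_def ps_carrierD a_minus_def)

lemma TB_minus: "t \<in> TB \<Longrightarrow> r \<in> carrier B \<Longrightarrow> t \<ominus>\<^bsub>B\<^esub> psX C \<otimes>\<^bsub>B\<^esub> r \<in> TB"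
  using T_sub by (auto simp: TB_def ps_carrierD a_minus_def)

text \<open>The relations contain \<open>w\<close> whenever they contain \<open>X w\<close>, as
  \<open>C\<close> is a domain. A local basis of their constant terms over \<open>R\<close>
  therefore lifts: Nakayama's lemma makes the lifts generate, and \<open>indep_lift\<close> keeps
  them independent.\<close>

lemma relations_basis:
  fixes k :: nat
  assumes x: "x \<in> vecs C"
  defines "M \<equiv> {v \<in> vecs C. dt C k v x = \<zero>\<^bsub>C\<^esub>}"
  shows "\<exists>ns. set ns \<subseteq> M \<and> indep_mod C {\<zero>\<^bsub>C\<^esub>} {..<k} ns \<and>
    (\<forall>v\<in>M. \<exists>t\<in>TC. (\<lambda>c. t \<otimes>\<^bsub>C\<^esub> v c) \<in> span_on C {..<k} ns)"
proof -
  have Mv: "M \<subseteq> vecs C" by (auto simp: M_def)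
  have Madd: "(\<lambda>c. v c \<oplus>\<^bsub>C\<^esub> w c) \<in> M" if "v \<in> M" "w \<in> M" for v w
  proof -
    have "v \<in> vecs C" "w \<in> vecs C" "dt C k v x = \<zero>\<^bsub>C\<^esub>" "dt C k w x = \<zero>\<^bsub>C\<^esub>" using that by (simp_all add: M_def)
    moreover from this have "(\<lambda>c. v c \<oplus>\<^bsub>C\<^esub> w c) \<in> vecs C" by (simp add: vecs_def)
    ultimately show ?thesis unfolding M_def using C.dt_add[of v w x k] x by simp
  qed
  have Msm: "(\<lambda>c. a \<otimes>\<^bsub>C\<^esub> v c) \<in> M" if "a \<in> carrier C" "v \<in> M" for a v
  proof -
    have "v \<in> vecs C" "dt C k v x = \<zero>\<^bsub>C\<^esub>" using that by (simp_all add: M_def)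
    moreover from this have "(\<lambda>c. a \<otimes>\<^bsub>C\<^esub> v c) \<in> vecs C" using that by (simp add: vecs_def)
    ultimately show ?thesis unfolding M_def using C.dt_smult[of a v x k] x that by simp
  qed
  have Mz: "(\<lambda>c. \<zero>\<^bsub>C\<^esub>) \<in> M"
  proof -
    have z: "(\<lambda>c::nat. \<zero>\<^bsub>C\<^esub>) \<in> vecs C" by (simp add: vecs_def)
    have "dt C k (\<lambda>c. \<zero>\<^bsub>C\<^esub>) x = \<zero>\<^bsub>C\<^esub>"
    proof (induction k)
      case (Suc k)
      then show ?case using C.l_null[OF vecsD[OF x]] C.r_zero[OF C.zero_closed] by simp
    qed simp
    then show ?thesis using z by (simp add: M_def)
  qed
  define r0 :: "(nat \<Rightarrow> nat \<Rightarrow> 'a) \<Rightarrow> nat \<Rightarrow> 'a" where "r0 = (\<lambda>v c. v c 0)"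
  define M0 where "M0 = r0 ` M"
  have "\<exists>ns. set ns \<subseteq> M0 \<and> indep_mod R {\<zero>} {..<k} ns \<and> (\<forall>v\<in>M0. \<exists>t\<in>T. (\<lambda>c. t \<otimes> v c) \<in> span_on R {..<k} ns)"
  proof (rule R.local_basis[OF T_sub T_one T_mult val])
    show "M0 \<subseteq> vecs R" using Mv by (auto simp: M0_def r0_def vecs_def ps_carrierD)
    have "r0 (\<lambda>c. \<zero>\<^bsub>C\<^esub>) \<in> M0" unfolding M0_def by (rule imageI[OF Mz])
    then show "(\<lambda>c. \<zero>) \<in> M0" by (simp add: r0_def)
  next
    fix v w assume "v \<in> M0" "w \<in> M0"
    then obtain v' w' where vw: "v' \<in> M" "w' \<in> M" "v = r0 v'" "w = r0 w'" by (auto simp: M0_def)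
    have "r0 (\<lambda>c. v' c \<oplus>\<^bsub>C\<^esub> w' c) \<in> M0" unfolding M0_def by (rule imageI[OF Madd[OF vw(1,2)]])
    then show "(\<lambda>c. v c \<oplus> w c) \<in> M0" using vw by (simp add: r0_def)
  next
    fix a v assume a: "a \<in> carrier R" and "v \<in> M0"
    then obtain v' where v: "v' \<in> M" "v = r0 v'" by (auto simp: M0_def)
    have "r0 (\<lambda>c. const R a \<otimes>\<^bsub>C\<^esub> v' c) \<in> M0" unfolding M0_def by (rule imageI[OF Msm[OF _ v(1)]]) (use a in simp)
    then show "(\<lambda>c. a \<otimes> v c) \<in> M0" using v by (simp add: r0_def)
  qed
  then obtain ns0 where ns0: "set ns0 \<subseteq> M0" "indep_mod R {\<zero>} {..<k} ns0"
    "\<And>v. v \<in> M0 \<Longrightarrow> \<exists>t\<in>T. (\<lambda>c. t \<otimes> v c) \<in> span_on R {..<k} ns0" by blast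
  have "\<exists>ns. set ns \<subseteq> M \<and> map r0 ns = ns0" using ns0(1)
  proof (induction ns0)
    case (Cons n ns0)
    then obtain ns m where "set ns \<subseteq> M" "map r0 ns = ns0" "m \<in> M" "r0 m = n" by (auto simp: M0_def)
    then show ?case by (intro exI[of _ "m # ns"]) auto
  qed simp
  then obtain ns where ns: "set ns \<subseteq> M" "map r0 ns = ns0" by blast
  have nv: "set ns \<subseteq> vecs C" using ns(1) Mv by blast
  have ind: "indep_mod C {\<zero>\<^bsub>C\<^esub>} {..<k} ns"
    using R.indep_lift[OF nv] ns0(2) ns(2) unfolding r0_def by simp
  have "\<exists>t\<in>TC. (\<lambda>c. t \<otimes>\<^bsub>C\<^esub> v c) \<in> span_on C {..<k} ns" if "v \<in> M" for v
  proof (rule C.localized_Nakayama[OF noethC R.psX_closed _ TC_one TC_mult TC_minus nv Mv _ that])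
    show "TC \<subseteq> carrier C" by (auto simp: TC_def)
    fix v assume v: "v \<in> M"
    have vv: "v \<in> vecs C" using v Mv by blast
    have "r0 v \<in> M0" using v by (simp add: M0_def)
    then obtain t where t: "t \<in> T" "(\<lambda>c. t \<otimes> r0 v c) \<in> span_on R {..<k} ns0" using ns0(3) by blast
    then obtain a where a: "a \<in> vecs R" "\<And>c. c < k \<Longrightarrow> t \<otimes> v c 0 = lc R a ns0 c"
      by (auto simp: r0_def elim: span_onE)
    have tc: "t \<in> carrier R" using t T_sub by blast
    define a' where "a' = (\<lambda>i. const R (a i))"
    have a': "a' \<in> vecs C" using a(1) by (simp add: a'_def vecs_def)
    define u where "u = (\<lambda>c. const R t \<otimes>\<^bsub>C\<^esub> v c \<ominus>\<^bsub>C\<^esub> lc C a' ns c)"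
    \<comment> \<open>Only in the first \<open>k\<close> columns, the ones seen by
      \<open>dt\<close>, is \<open>u\<close> known to be divisible by \<open>X\<close>; elsewhere
      the quotient is set to zero.\<close>
    define w where "w = (\<lambda>c. if c < k then shift (u c) else \<zero>\<^bsub>C\<^esub>)"
    have lcv: "lc C a' ns \<in> vecs C" using a' nv by simp
    have vc: "v c \<in> carrier C" "lc C a' ns c \<in> carrier C" "const R t \<in> carrier C" "x c \<in> carrier C" for c
      using vecsD[OF vv] vecsD[OF lcv] vecsD[OF x] tc by auto
    have uc: "u c \<in> carrier C" for c unfolding u_def using vc by simp
    have uv: "u \<in> vecs C" using uc by (simp add: vecs_def)
    have wv: "w \<in> vecs C" using uc by (auto simp: w_def vecs_def)
    have u0: "u c 0 = \<zero>" if "c < k" for c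
    proof -
      have "lc C a' ns c 0 = lc R (\<lambda>i. a' i 0) (map (\<lambda>v c. v c 0) ns) c"
        using C.lc_hom[OF R.ps_hom(1) a' nv] by simp
      also have "\<dots> = lc R a ns0 c" using ns(2) by (simp add: a'_def r0_def)
      finally have e: "lc C a' ns c 0 = t \<otimes> v c 0" using a(2)[OF that] by simp
      have "t \<otimes> v c 0 \<in> carrier R" using tc vc(1)[of c] by (simp add: ps_carrierD)
      then show ?thesis unfolding u_def using vc tc e by (simp add: R.r_neg a_minus_def)
    qed
    have uw: "u c = psX R \<otimes>\<^bsub>C\<^esub> w c" if "c < k" for c
      using R.ps_psX_eq[OF uc u0[OF that]] that by (simp add: w_def)
    have "u = (\<lambda>c. const R t \<otimes>\<^bsub>C\<^esub> v c \<oplus>\<^bsub>C\<^esub> (\<ominus>\<^bsub>C\<^esub> \<one>\<^bsub>C\<^esub>) \<otimes>\<^bsub>C\<^esub> lc C a' ns c)"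
      unfolding u_def using vc by (simp add: a_minus_def C.l_minus)
    moreover have "(\<lambda>c. const R t \<otimes>\<^bsub>C\<^esub> v c) \<in> vecs C" "(\<lambda>c. (\<ominus>\<^bsub>C\<^esub> \<one>\<^bsub>C\<^esub>) \<otimes>\<^bsub>C\<^esub> lc C a' ns c) \<in> vecs C"
      using vc by (simp_all add: vecs_def)
    ultimately have "dt C k u x = const R t \<otimes>\<^bsub>C\<^esub> dt C k v x \<oplus>\<^bsub>C\<^esub> (\<ominus>\<^bsub>C\<^esub> \<one>\<^bsub>C\<^esub>) \<otimes>\<^bsub>C\<^esub> dt C k (lc C a' ns) x"
      using C.dt_add[of _ _ x k] C.dt_smult[OF vc(3) vv x, of k] C.dt_smult[OF _ lcv x, of "\<ominus>\<^bsub>C\<^esub> \<one>\<^bsub>C\<^esub>" k] x by simp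
    moreover have "dt C k v x = \<zero>\<^bsub>C\<^esub>" using v by (simp add: M_def)
    moreover have "dt C k (lc C a' ns) x = \<zero>\<^bsub>C\<^esub>"
      by (rule C.dt_lc_zero[OF x a' nv]) (use ns(1) in \<open>auto simp: M_def\<close>)
    ultimately have "dt C k u x = \<zero>\<^bsub>C\<^esub>" using C.r_null vc(3) C.r_null[OF C.a_inv_closed[OF C.one_closed]] C.r_zero[OF C.zero_closed] by metis
    moreover have "dt C k u x = dt C k (\<lambda>c. psX R \<otimes>\<^bsub>C\<^esub> w c) x" by (rule C.dt_cong) (rule uw)
    ultimately have "psX R \<otimes>\<^bsub>C\<^esub> dt C k w x = \<zero>\<^bsub>C\<^esub>" using C.dt_smult[OF R.psX_closed wv x] by metis
    then have "dt C k w x = \<zero>\<^bsub>C\<^esub>" using C.integral[OF _ R.psX_closed C.dt_closed[OF wv x]] R.psX_nonzero by blast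
    then have wM: "w \<in> M" using wv by (simp add: M_def)
    have "(\<lambda>c. const R t \<otimes>\<^bsub>C\<^esub> v c \<ominus>\<^bsub>C\<^esub> psX R \<otimes>\<^bsub>C\<^esub> w c) \<in> span_on C {..<k} ns"
    proof (rule span_onI[OF a'])
      fix c assume "c \<in> {..<k}"
      then have "psX R \<otimes>\<^bsub>C\<^esub> w c = const R t \<otimes>\<^bsub>C\<^esub> v c \<ominus>\<^bsub>C\<^esub> lc C a' ns c" using uw[of c] by (simp add: u_def)
      moreover have "p \<ominus>\<^bsub>C\<^esub> (p \<ominus>\<^bsub>C\<^esub> q) = q" if "p \<in> carrier C" "q \<in> carrier C" for p q using that by algebra
      ultimately show "const R t \<otimes>\<^bsub>C\<^esub> v c \<ominus>\<^bsub>C\<^esub> psX R \<otimes>\<^bsub>C\<^esub> w c = lc C a' ns c" using vc C.m_closed by metis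
    qed
    then show "\<exists>t\<in>TC. \<exists>v'\<in>M. (\<lambda>c. t \<otimes>\<^bsub>C\<^esub> v c \<ominus>\<^bsub>C\<^esub> psX R \<otimes>\<^bsub>C\<^esub> v' c) \<in> span_on C {..<k} ns"
      using TC_const[OF t(1)] wM by blast
  qed
  then show ?thesis using ns(1) ind by blast
qed

end

context local_setting
begin

lemma relations_rank:
  assumes x: "x \<in> vecs C" and j: "j < k" "x j \<noteq> \<zero>\<^bsub>C\<^esub>"
    and ns: "set ns \<subseteq> vecs C" "\<And>v. v \<in> set ns \<Longrightarrow> dt C k v x = \<zero>\<^bsub>C\<^esub>" "indep_mod C {\<zero>\<^bsub>C\<^esub>} {..<k} ns"
    and gen: "\<And>v. v \<in> vecs C \<Longrightarrow> dt C k v x = \<zero>\<^bsub>C\<^esub> \<Longrightarrow> \<exists>t\<in>TC. (\<lambda>c. t \<otimes>\<^bsub>C\<^esub> v c) \<in> span_on C {..<k} ns"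
  shows "k = Suc (length ns)"
proof -
  define cols where "cols = filter (\<lambda>c. c \<noteq> j) [0..<k]"
  have sc: "set cols = {..<k} - {j}" by (auto simp: cols_def)
  have dc: "distinct cols" by (simp add: cols_def)
  have "card (set cols) = k - 1" unfolding sc using j(1) by simp
  then have lc: "length cols = k - 1" using distinct_card[OF dc] by metis
  have ind: "indep_mod C {\<zero>\<^bsub>C\<^esub>} (set cols) ns"
    unfolding indep_mod_def
  proof (intro ballI impI)
    fix a assume a: "a \<in> vecs C" "\<forall>c\<in>set cols. lc C a ns c \<in> {\<zero>\<^bsub>C\<^esub>}"
    have l: "lc C a ns \<in> vecs C" using a ns by simp
    have "dt C k (lc C a ns) x = \<zero>\<^bsub>C\<^esub>" by (rule C.dt_lc_zero[OF x a(1) ns(1,2)])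
    moreover have "dt C k (lc C a ns) x = lc C a ns j \<otimes>\<^bsub>C\<^esub> x j"
    proof (rule C.dt_single[OF l x j(1)])
      fix c assume "c < k" "c \<noteq> j"
      then have "lc C a ns c = \<zero>\<^bsub>C\<^esub>" using a(2) sc by blast
      then show "lc C a ns c \<otimes>\<^bsub>C\<^esub> x c = \<zero>\<^bsub>C\<^esub>" using C.l_null[OF vecsD[OF x]] by metis
    qed
    ultimately have "lc C a ns j = \<zero>\<^bsub>C\<^esub>" using C.integral[OF _ vecsD[OF l] vecsD[OF x]] j(2) by metis
    then have "\<forall>c\<in>{..<k}. lc C a ns c \<in> {\<zero>\<^bsub>C\<^esub>}" using a(2) sc by blast
    then show "\<forall>i<length ns. a i \<in> {\<zero>\<^bsub>C\<^esub>}" using ns(3) a(1) unfolding indep_mod_def by blast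
  qed
  have le: "length ns \<le> k - 1" using C.indep_length[OF ns(1) ind] lc by simp
  obtain cs where cs: "subseq cs cols" "length cs = length ns" "minor C cs ns \<notin> {\<zero>\<^bsub>C\<^esub>}"
    using C.indep_minor[OF C.zeroprimeideal ns(1) ind] by blast
  have csub: "set cs \<subseteq> set cols"
  proof
    fix z assume "z \<in> set cs"
    then show "z \<in> set cols" using list_emb_set[OF cs(1)] by metis
  qed
  have "\<not> length ns < k - 1"
  proof
    assume less: "length ns < k - 1"
    have "card (set cs) \<le> length ns" using card_length[of cs] cs(2) by simp
    then have "set cols \<noteq> set cs" using distinct_card[OF dc] lc less by auto
    then obtain i where i: "i \<in> set cols" "i \<notin> set cs" using csub by blast
    have ik: "i < k" "i \<noteq> j" using i sc by auto
    have xc: "x c \<in> carrier C" for c using vecsD[OF x] .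
    \<comment> \<open>The relation between the entries \<open>x i\<close> and \<open>x j\<close>
      alone. A multiple \<open>t u\<close> is a combination of \<open>ns\<close> vanishing on all
      columns \<open>cs\<close> of a nonzero minor; so its coefficients vanish, although
      \<open>u i = x j\<close> is not zero.\<close>
    define u where "u = (\<lambda>c. if c = i then x j else if c = j then \<ominus>\<^bsub>C\<^esub> x i else \<zero>\<^bsub>C\<^esub>)"
    define u1 where "u1 = (\<lambda>c. if c = i then x j else \<zero>\<^bsub>C\<^esub>)"
    define u2 where "u2 = (\<lambda>c. if c = j then \<ominus>\<^bsub>C\<^esub> x i else \<zero>\<^bsub>C\<^esub>)"
    have uv: "u \<in> vecs C" "u1 \<in> vecs C" "u2 \<in> vecs C" using xc by (auto simp: u_def u1_def u2_def vecs_def)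
    have "u = (\<lambda>c. u1 c \<oplus>\<^bsub>C\<^esub> u2 c)"
    proof
      fix c show "u c = u1 c \<oplus>\<^bsub>C\<^esub> u2 c"
        unfolding u_def u1_def u2_def using ik(2) xc[of i] xc[of j]
        by (cases "c = i"; cases "c = j") simp_all
    qed
    then have "dt C k u x = dt C k u1 x \<oplus>\<^bsub>C\<^esub> dt C k u2 x" using C.dt_add[OF uv(2,3) x] by simp
    moreover have "dt C k u1 x = u1 i \<otimes>\<^bsub>C\<^esub> x i"
      by (rule C.dt_single[OF uv(2) x ik(1)]) (use C.l_null[OF xc] in \<open>simp add: u1_def\<close>)
    moreover have "dt C k u2 x = u2 j \<otimes>\<^bsub>C\<^esub> x j"
      by (rule C.dt_single[OF uv(3) x j(1)]) (use C.l_null[OF xc] in \<open>simp add: u2_def\<close>)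
    moreover have "x j \<otimes>\<^bsub>C\<^esub> x i \<oplus>\<^bsub>C\<^esub> \<ominus>\<^bsub>C\<^esub> x i \<otimes>\<^bsub>C\<^esub> x j = \<zero>\<^bsub>C\<^esub>" using xc[of i] xc[of j] by algebra
    ultimately have "dt C k u x = \<zero>\<^bsub>C\<^esub>" by (simp add: u1_def u2_def)
    then obtain t where t: "t \<in> TC" "(\<lambda>c. t \<otimes>\<^bsub>C\<^esub> u c) \<in> span_on C {..<k} ns" using gen[OF uv(1)] by blast
    obtain a where a: "a \<in> vecs C" "\<And>c. c \<in> {..<k} \<Longrightarrow> t \<otimes>\<^bsub>C\<^esub> u c = lc C a ns c" using span_onE[OF t(2)] by blast
    have tc: "t \<in> carrier C" using t TC_sub by blast
    have l: "lc C a ns \<in> vecs C" using a ns by simp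
    have z: "lc C a ns c \<in> {\<zero>\<^bsub>C\<^esub>}" if "c \<in> set cs" for c
    proof -
      have "c \<in> {..<k}" "c \<noteq> i" "c \<noteq> j" using that csub sc i by auto
      then show ?thesis using a(2)[of c] C.r_null[OF tc] by (simp add: u_def)
    qed
    have "a m = \<zero>\<^bsub>C\<^esub>" if m: "m < length ns" for m
    proof -
      define us v ws where "us = take m ns" and "v = ns ! m" and "ws = drop (Suc m) ns"
      have nse: "ns = us @ v # ws" "length us = m" using m by (auto simp: us_def v_def ws_def id_take_nth_drop)
      have cl: "set us \<subseteq> vecs C" "set ws \<subseteq> vecs C" "v \<in> vecs C" using ns(1) unfolding nse(1) by auto
      have "minor C cs (us @ lc C a ns # ws) \<in> {\<zero>\<^bsub>C\<^esub>}"
        by (rule C.minor_in_ideal[OF C.zeroideal l cl(1,2) z])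
      then have "a m \<otimes>\<^bsub>C\<^esub> minor C cs ns = \<zero>\<^bsub>C\<^esub>" using C.minor_lc[OF cl a(1), of cs] nse by simp
      then show ?thesis using C.integral[OF _ vecsD[OF a(1)] C.minor_closed[OF ns(1)]] cs(3) by blast
    qed
    then have "lc C a ns i = lc C (\<lambda>_. \<zero>\<^bsub>C\<^esub>) ns i" by (intro C.lc_cong) simp
    also have "\<dots> = \<zero>\<^bsub>C\<^esub>" using ns(1)
    proof (induction ns)
      case (Cons v vs)
      then have "v i \<in> carrier C" using vecsD by auto
      then show ?case using Cons C.l_null C.r_zero[OF C.zero_closed] by simp
    qed simp
    finally have "t \<otimes>\<^bsub>C\<^esub> u i = \<zero>\<^bsub>C\<^esub>" using a(2)[of i] ik by simp
    then show False using C.integral[OF _ tc vecsD[OF uv(1)]] TC_nonzero[OF t(1)] j(2) by (metis u_def)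
  qed
  then show ?thesis using le j(1) by linarith
qed

text \<open>The entries of \<open>D\<close> have no common prime factor apart from local units. The
  prime factors of \<open>b\<close> are treated one by one: a prime in \<open>TC\<close> is moved
  into the multiplier \<open>t\<close>, any other one must divide \<open>a\<close> and is
  cancelled.\<close>

lemma cancel_minors_C:
  assumes D: "D \<in> vecs C"
    and D_prime: "\<And>p. prime_el C p \<Longrightarrow> p \<notin> TC \<Longrightarrow> \<exists>c<k. \<not> p divides\<^bsub>C\<^esub> D c"
    and b: "b \<in> carrier C" "b \<noteq> \<zero>\<^bsub>C\<^esub>" and a: "a \<in> carrier C" and dv: "\<And>c. c < k \<Longrightarrow> b divides\<^bsub>C\<^esub> (a \<otimes>\<^bsub>C\<^esub> D c)"
  shows "\<exists>t\<in>TC. b divides\<^bsub>C\<^esub> (t \<otimes>\<^bsub>C\<^esub> a)"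
  using b a dv
proof (induction b arbitrary: a rule: C.prime_induct)
  case (unit u)
  show ?case
    by (rule bexI[OF _ TC_one]) (use unit C.unit_dvd[of u "\<one>\<^bsub>C\<^esub> \<otimes>\<^bsub>C\<^esub> a"] in simp)
next
  case (prime p b)
  note p = C.prime_elD[OF prime.hyps(1)] and bc = prime.hyps(2) and ac = prime.prems(1)
  have Dc: "D c \<in> carrier C" for c using vecsD[OF D] .
  show ?case
  proof (cases "p \<in> TC")
    case True
    have "b divides\<^bsub>C\<^esub> (a \<otimes>\<^bsub>C\<^esub> D c)" if "c < k" for c
    proof -
      have "b divides\<^bsub>C\<^esub> (p \<otimes>\<^bsub>C\<^esub> b)" using C.dvd_selfI[OF bc p(1)] C.m_comm[OF bc p(1)] by simp
      then show ?thesis using C.dvd_trans[OF _ prime.prems(2)[OF that] bc] by blast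
    qed
    then obtain t where t: "t \<in> TC" "b divides\<^bsub>C\<^esub> (t \<otimes>\<^bsub>C\<^esub> a)" using prime.IH[OF ac] by blast
    have "p \<otimes>\<^bsub>C\<^esub> b divides\<^bsub>C\<^esub> (p \<otimes>\<^bsub>C\<^esub> (t \<otimes>\<^bsub>C\<^esub> a))" by (rule C.divides_mult[OF bc p(1) t(2)])
    moreover have "p \<otimes>\<^bsub>C\<^esub> (t \<otimes>\<^bsub>C\<^esub> a) = (p \<otimes>\<^bsub>C\<^esub> t) \<otimes>\<^bsub>C\<^esub> a" using C.m_assoc[OF p(1) TC_sub[OF t(1)] ac] by simp
    ultimately show ?thesis using TC_mult[OF True t(1)] by (intro bexI[of _ "p \<otimes>\<^bsub>C\<^esub> t"]) simp_all
  next
    case False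
    obtain c where c: "c < k" "\<not> p divides\<^bsub>C\<^esub> D c" using D_prime[OF prime.hyps(1) False] by blast
    have "p divides\<^bsub>C\<^esub> (a \<otimes>\<^bsub>C\<^esub> D c)" using C.dvd_trans[OF C.dvd_selfI[OF p(1) bc] prime.prems(2)[OF c(1)] p(1)] .
    then have "p divides\<^bsub>C\<^esub> a" using C.prime_el_dvd[OF prime.hyps(1) _ ac Dc] c(2) by blast
    then obtain a' where a': "a' \<in> carrier C" "a = p \<otimes>\<^bsub>C\<^esub> a'" by (rule dividesE2)
    have "b divides\<^bsub>C\<^esub> (a' \<otimes>\<^bsub>C\<^esub> D c)" if "c < k" for c
      using C.dvd_mult_cancel[OF _ bc C.m_closed[OF a'(1) Dc] p(1,2)] prime.prems(2)[OF that] C.m_assoc[OF p(1) a'(1) Dc] a'(2) by simp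
    then obtain t where t: "t \<in> TC" "b divides\<^bsub>C\<^esub> (t \<otimes>\<^bsub>C\<^esub> a')" using prime.IH[OF a'(1)] by blast
    have "p \<otimes>\<^bsub>C\<^esub> b divides\<^bsub>C\<^esub> (p \<otimes>\<^bsub>C\<^esub> (t \<otimes>\<^bsub>C\<^esub> a'))" by (rule C.divides_mult[OF bc p(1) t(2)])
    moreover have "p \<otimes>\<^bsub>C\<^esub> (t \<otimes>\<^bsub>C\<^esub> a') = t \<otimes>\<^bsub>C\<^esub> a" using C.m_lcomm[OF p(1) TC_sub[OF t(1)] a'(1)] a'(2) by simp
    ultimately show ?thesis using t(1) by (intro bexI[of _ t]) simp_all
  qed
qed

end

section \<open>Cancelling minors and lifting relations in two variables\<close>

lemma (in domain) ps_order:
  assumes b: "b \<in> carrier (ps R)" "b \<noteq> \<zero>\<^bsub>ps R\<^esub>"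
  shows "\<exists>e b0. b0 \<in> carrier (ps R) \<and> b0 0 \<noteq> \<zero> \<and> b = psX R [^]\<^bsub>ps R\<^esub> (e::nat) \<otimes>\<^bsub>ps R\<^esub> b0"
proof -
  have "\<exists>n. b n \<noteq> \<zero>"
  proof (rule ccontr)
    assume "\<not> ?thesis"
    then have "b = (\<lambda>n. \<zero>)" by auto
    then show False using b(2) by (simp add: ps_zero_fun)
  qed
  then have l: "b (LEAST n. b n \<noteq> \<zero>) \<noteq> \<zero>" by (rule LeastI_ex)
  let ?n = "LEAST n. b n \<noteq> \<zero>"
  have "b i = \<zero>" if "i < ?n" for i using not_less_Least[OF that] by simp
  then have "b = psX R [^]\<^bsub>ps R\<^esub> ?n \<otimes>\<^bsub>ps R\<^esub> (\<lambda>i. b (i + ?n))" by (rule psX_pow_eq[OF b(1)])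
  moreover have "(\<lambda>i. b (i + ?n)) \<in> carrier (ps R)" using b(1) by (simp add: ps_carrier)
  ultimately show ?thesis using l by (intro exI[of _ ?n] exI[of _ "\<lambda>i. b (i + ?n)"]) simp
qed

lemma (in domain) psX_dvd:
  assumes "f \<in> carrier (ps R)"
  shows "psX R divides\<^bsub>ps R\<^esub> f \<longleftrightarrow> f 0 = \<zero>"
proof
  interpret P: domain "ps R" by (rule ps_domain)
  show "f 0 = \<zero>" if "psX R divides\<^bsub>ps R\<^esub> f"
    using that by (auto simp: ps_carrierD elim!: dividesE2)
  show "psX R divides\<^bsub>ps R\<^esub> f" if "f 0 = \<zero>"
    using ps_psX_eq[OF assms that] assms by (intro dividesI2[of "shift f"]) auto
qed

lemma (in domain) psX_dvd_cancel:
  assumes "a \<in> carrier (ps R)" "g \<in> carrier (ps R)" "g 0 \<noteq> \<zero>" "g divides\<^bsub>ps R\<^esub> (psX R \<otimes>\<^bsub>ps R\<^esub> a)"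
  shows "g divides\<^bsub>ps R\<^esub> a"
proof -
  interpret P: domain "ps R" by (rule ps_domain)
  obtain w where w: "w \<in> carrier (ps R)" "psX R \<otimes>\<^bsub>ps R\<^esub> a = g \<otimes>\<^bsub>ps R\<^esub> w" using assms(4) by (rule dividesE2)
  have "g 0 \<otimes> w 0 = (psX R \<otimes>\<^bsub>ps R\<^esub> a) 0" unfolding w(2) by simp
  also have "\<dots> = \<zero>" by (rule psX_mult(1)[OF assms(1)])
  finally have "w 0 = \<zero>" using integral[OF _ ps_carrierD[OF assms(2)] ps_carrierD[OF w(1)]] assms(3) by blast
  then have e: "w = psX R \<otimes>\<^bsub>ps R\<^esub> shift w" by (rule ps_psX_eq[OF w(1)])
  have sw: "shift w \<in> carrier (ps R)" using w(1) by simp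
  have "psX R \<otimes>\<^bsub>ps R\<^esub> a = psX R \<otimes>\<^bsub>ps R\<^esub> (g \<otimes>\<^bsub>ps R\<^esub> shift w)"
    using w(2) P.m_lcomm[OF assms(2) psX_closed sw] e by metis
  then have "a = g \<otimes>\<^bsub>ps R\<^esub> shift w"
    using P.m_lcancel[OF psX_nonzero psX_closed assms(1) P.m_closed[OF assms(2) sw]] by blast
  then show ?thesis using sw by (intro dividesI2)
qed

context local_setting
begin

lemma psX_dvd_mult:
  assumes "a \<in> carrier B" "d \<in> carrier B" "psX C divides\<^bsub>B\<^esub> (a \<otimes>\<^bsub>B\<^esub> d)" "d 0 \<noteq> \<zero>\<^bsub>C\<^esub>"
  shows "\<exists>a'\<in>carrier B. a = psX C \<otimes>\<^bsub>B\<^esub> a'"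
proof -
  have "a 0 \<otimes>\<^bsub>C\<^esub> d 0 = \<zero>\<^bsub>C\<^esub>" using C.psX_dvd[OF B.m_closed[OF assms(1,2)]] assms(3) by simp
  then have "a 0 = \<zero>\<^bsub>C\<^esub>" using C.integral[OF _ ps_carrierD[OF assms(1)] ps_carrierD[OF assms(2)]] assms(4) by blast
  then show ?thesis using C.ps_psX_eq[OF assms(1)] assms(1) by blast
qed

lemma cancel_minors_B:
  assumes D: "D \<in> vecs B"
    and D_prime: "\<And>p. prime_el C p \<Longrightarrow> p \<notin> TC \<Longrightarrow> \<exists>c<k. \<not> p divides\<^bsub>C\<^esub> D c 0"
    and nz: "\<exists>c<k. D c 0 \<noteq> \<zero>\<^bsub>C\<^esub>"
    and b: "b \<in> carrier B" "b \<noteq> \<zero>\<^bsub>B\<^esub>" and a: "a \<in> carrier B" and dv: "\<And>c. c < k \<Longrightarrow> b divides\<^bsub>B\<^esub> (a \<otimes>\<^bsub>B\<^esub> D c)"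
  shows "\<exists>s\<in>TB. b divides\<^bsub>B\<^esub> (s \<otimes>\<^bsub>B\<^esub> a)"
proof -
  have Dc: "D c \<in> carrier B" for c using vecsD[OF D] .
  have base: "\<exists>s\<in>TB. b divides\<^bsub>B\<^esub> (s \<otimes>\<^bsub>B\<^esub> a)"
    if b: "b \<in> carrier B" "b 0 \<noteq> \<zero>\<^bsub>C\<^esub>" and a: "a \<in> carrier B" and dv: "\<And>c. c < k \<Longrightarrow> b divides\<^bsub>B\<^esub> (a \<otimes>\<^bsub>B\<^esub> D c)" for a b
  proof -
    \<comment> \<open>Nakayama's lemma is applied in rank one: only coordinate 0 of these vectors
      counts.\<close>
    define M where "M = {v \<in> vecs B. \<forall>c<k. b divides\<^bsub>B\<^esub> (v (0::nat) \<otimes>\<^bsub>B\<^esub> D c)}"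
    let ?ns = "[\<lambda>_::nat. b]"
    have ns: "set ?ns \<subseteq> vecs B" using b by (simp add: vecs_def)
    have Mv: "M \<subseteq> vecs B" by (auto simp: M_def)
    have aM: "(\<lambda>_. a) \<in> M" using a dv by (simp add: M_def vecs_def)
    have TBc: "TB \<subseteq> carrier B" by (auto simp: TB_def)
    have "\<exists>t\<in>TB. (\<lambda>c. t \<otimes>\<^bsub>B\<^esub> (\<lambda>_. a) c) \<in> span_on B {..<1} ?ns"
    proof (rule B.localized_Nakayama[OF noethB C.psX_closed TBc TB_one TB_mult TB_minus ns Mv _ aM])
      fix v assume v: "v \<in> M"
      have vv: "v \<in> vecs B" using v Mv by blast
      have vc: "v 0 \<in> carrier B" by (rule vecsD[OF vv])
      have "b 0 divides\<^bsub>C\<^esub> (v 0 0 \<otimes>\<^bsub>C\<^esub> D c 0)" if c: "c < k" for c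
      proof -
        have "b divides\<^bsub>B\<^esub> (v 0 \<otimes>\<^bsub>B\<^esub> D c)" using v c by (simp add: M_def)
        then obtain w where w: "w \<in> carrier B" "v 0 \<otimes>\<^bsub>B\<^esub> D c = b \<otimes>\<^bsub>B\<^esub> w" by (rule dividesE2)
        have "v 0 0 \<otimes>\<^bsub>C\<^esub> D c 0 = (v 0 \<otimes>\<^bsub>B\<^esub> D c) 0" by simp
        also have "\<dots> = b 0 \<otimes>\<^bsub>C\<^esub> w 0" unfolding w(2) by simp
        finally show ?thesis using w(1) by (intro dividesI2[of "w 0"]) (simp_all add: ps_carrierD)
      qed
      moreover have "(\<lambda>c. D c 0) \<in> vecs C" using Dc by (simp add: vecs_def ps_carrierD)
      ultimately obtain t where t: "t \<in> TC" "b 0 divides\<^bsub>C\<^esub> (t \<otimes>\<^bsub>C\<^esub> v 0 0)"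
        using cancel_minors_C[of "\<lambda>c. D c 0" k "b 0" "v 0 0"] D_prime b(2) ps_carrierD[OF b(1)] ps_carrierD[OF vc] by blast
      then obtain y where y: "y \<in> carrier C" "t \<otimes>\<^bsub>C\<^esub> v 0 0 = b 0 \<otimes>\<^bsub>C\<^esub> y" by (auto elim: dividesE2)
      have cc: "const C t \<in> carrier B" "const C y \<in> carrier B" using y TC_sub[OF t(1)] by simp_all
      \<comment> \<open>Modulo y, a multiple of \<open>v 0\<close> is already a multiple of
        \<open>b\<close>. The difference is y times an element subject to the same divisibilities,
        because y does not divide \<open>b\<close>.\<close>
      define u where "u = const C t \<otimes>\<^bsub>B\<^esub> v 0 \<ominus>\<^bsub>B\<^esub> b \<otimes>\<^bsub>B\<^esub> const C y"
      have u: "u \<in> carrier B" using cc vc b by (simp add: u_def)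
      have "t \<otimes>\<^bsub>C\<^esub> v 0 0 \<in> carrier C" using TC_sub[OF t(1)] ps_carrierD[OF vc] by simp
      then have "u 0 = \<zero>\<^bsub>C\<^esub>" unfolding u_def using cc vc b y(2) by (simp add: C.r_neg a_minus_def[of C])
      then have uX: "u = psX C \<otimes>\<^bsub>B\<^esub> shift u" by (rule C.ps_psX_eq[OF u])
      have su: "shift u \<in> carrier B" using u by simp
      have "b divides\<^bsub>B\<^esub> (shift u \<otimes>\<^bsub>B\<^esub> D c)" if c: "c < k" for c
      proof (rule C.psX_dvd_cancel[OF _ b])
        have "b divides\<^bsub>B\<^esub> (v 0 \<otimes>\<^bsub>B\<^esub> D c)" using v c by (simp add: M_def)
        then obtain w where w: "w \<in> carrier B" "v 0 \<otimes>\<^bsub>B\<^esub> D c = b \<otimes>\<^bsub>B\<^esub> w" by (rule dividesE2)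
        have "psX C \<otimes>\<^bsub>B\<^esub> (shift u \<otimes>\<^bsub>B\<^esub> D c) = u \<otimes>\<^bsub>B\<^esub> D c"
          using B.m_assoc[OF C.psX_closed su Dc] uX by metis
        also have "\<dots> = const C t \<otimes>\<^bsub>B\<^esub> (v 0 \<otimes>\<^bsub>B\<^esub> D c) \<ominus>\<^bsub>B\<^esub> b \<otimes>\<^bsub>B\<^esub> (const C y \<otimes>\<^bsub>B\<^esub> D c)"
          unfolding u_def using cc vc b(1) Dc[of c] by algebra
        also have "\<dots> = b \<otimes>\<^bsub>B\<^esub> (const C t \<otimes>\<^bsub>B\<^esub> w \<ominus>\<^bsub>B\<^esub> const C y \<otimes>\<^bsub>B\<^esub> D c)"
          unfolding w(2) using cc w(1) b(1) Dc[of c] by algebra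
        finally show "b divides\<^bsub>B\<^esub> (psX C \<otimes>\<^bsub>B\<^esub> (shift u \<otimes>\<^bsub>B\<^esub> D c))"
          by (rule dividesI2[rotated]) (use cc w(1) Dc[of c] in simp)
        show "shift u \<otimes>\<^bsub>B\<^esub> D c \<in> carrier B" using su Dc by simp
      qed
      then have vM: "(\<lambda>_. shift u) \<in> M" using su by (simp add: M_def vecs_def)
      have "(\<lambda>c. const C t \<otimes>\<^bsub>B\<^esub> v c \<ominus>\<^bsub>B\<^esub> psX C \<otimes>\<^bsub>B\<^esub> shift u) \<in> span_on B {..<1} ?ns"
      proof (rule span_onI[of "\<lambda>_. const C y"])
        show "(\<lambda>_. const C y) \<in> vecs B" using cc by (simp add: vecs_def)
        fix c :: nat assume "c \<in> {..<1}"
        then have c: "c = 0" by simp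
        have "p \<ominus>\<^bsub>B\<^esub> (p \<ominus>\<^bsub>B\<^esub> b \<otimes>\<^bsub>B\<^esub> q) = q \<otimes>\<^bsub>B\<^esub> b" if "p \<in> carrier B" "q \<in> carrier B" for p q using that b(1) by algebra
        then have "const C t \<otimes>\<^bsub>B\<^esub> v 0 \<ominus>\<^bsub>B\<^esub> u = const C y \<otimes>\<^bsub>B\<^esub> b" unfolding u_def using cc vc by simp
        then show "const C t \<otimes>\<^bsub>B\<^esub> v c \<ominus>\<^bsub>B\<^esub> psX C \<otimes>\<^bsub>B\<^esub> shift u = lc B (\<lambda>_. const C y) ?ns c"
          unfolding c uX[symmetric] using cc b by simp
      qed
      then show "\<exists>t\<in>TB. \<exists>v'\<in>M. (\<lambda>c. t \<otimes>\<^bsub>B\<^esub> v c \<ominus>\<^bsub>B\<^esub> psX C \<otimes>\<^bsub>B\<^esub> v' c) \<in> span_on B {..<1} ?ns"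
        by (intro bexI[OF _ TB_const[OF t(1)]] bexI[OF _ vM])
    qed
    then obtain t where t: "t \<in> TB" "(\<lambda>c. t \<otimes>\<^bsub>B\<^esub> a) \<in> span_on B {..<1} ?ns" by blast
    obtain q where q: "q \<in> vecs B" "\<And>c. c \<in> {..<1} \<Longrightarrow> t \<otimes>\<^bsub>B\<^esub> a = lc B q ?ns c" using span_onE[OF t(2)] by blast
    have qc: "q 0 \<in> carrier B" using vecsD[OF q(1)] .
    have "t \<otimes>\<^bsub>B\<^esub> a = b \<otimes>\<^bsub>B\<^esub> q 0" using q(2)[of 0] qc b B.m_comm[OF qc b(1)] by simp
    then show ?thesis using t(1) qc by (intro bexI[of _ t] dividesI2)
  qed
  obtain e b0 where eb: "b0 \<in> carrier B" "b0 0 \<noteq> \<zero>\<^bsub>C\<^esub>" "b = psX C [^]\<^bsub>B\<^esub> (e::nat) \<otimes>\<^bsub>B\<^esub> b0"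
    using C.ps_order[OF b] by blast
  have "\<exists>s\<in>TB. psX C [^]\<^bsub>B\<^esub> e \<otimes>\<^bsub>B\<^esub> b0 divides\<^bsub>B\<^esub> (s \<otimes>\<^bsub>B\<^esub> a)"
    if "a \<in> carrier B" "\<And>c. c < k \<Longrightarrow> psX C [^]\<^bsub>B\<^esub> e \<otimes>\<^bsub>B\<^esub> b0 divides\<^bsub>B\<^esub> (a \<otimes>\<^bsub>B\<^esub> D c)" for a
    using that
  proof (induction e arbitrary: a)
    case 0
    then show ?case using base[OF eb(1,2), of a] eb(1) by simp
  next
    case (Suc e)
    let ?b = "psX C [^]\<^bsub>B\<^esub> e \<otimes>\<^bsub>B\<^esub> b0"
    have bc: "?b \<in> carrier B" using eb(1) by simp
    have bS: "psX C [^]\<^bsub>B\<^esub> Suc e \<otimes>\<^bsub>B\<^esub> b0 = psX C \<otimes>\<^bsub>B\<^esub> ?b" using eb(1) by (simp add: B.m_ac)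
    obtain c where c: "c < k" "D c 0 \<noteq> \<zero>\<^bsub>C\<^esub>" using nz by blast
    have "psX C divides\<^bsub>B\<^esub> (a \<otimes>\<^bsub>B\<^esub> D c)"
      using B.dvd_trans[OF B.dvd_selfI[OF C.psX_closed bc] _ C.psX_closed] Suc.prems(2)[OF c(1)] bS by simp
    then obtain a' where a': "a' \<in> carrier B" "a = psX C \<otimes>\<^bsub>B\<^esub> a'" using psX_dvd_mult[OF Suc.prems(1) Dc _ c(2)] by blast
    have "?b divides\<^bsub>B\<^esub> (a' \<otimes>\<^bsub>B\<^esub> D c)" if "c < k" for c
    proof (rule B.dvd_mult_cancel[OF _ bc B.m_closed[OF a'(1) Dc] C.psX_closed C.psX_nonzero])
      show "psX C \<otimes>\<^bsub>B\<^esub> ?b divides\<^bsub>B\<^esub> (psX C \<otimes>\<^bsub>B\<^esub> (a' \<otimes>\<^bsub>B\<^esub> D c))"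
        using Suc.prems(2)[OF that] bS a'(2) B.m_assoc[OF C.psX_closed a'(1) Dc] by simp
    qed
    then obtain s where s: "s \<in> TB" "?b divides\<^bsub>B\<^esub> (s \<otimes>\<^bsub>B\<^esub> a')" using Suc.IH[OF a'(1)] by blast
    have "psX C \<otimes>\<^bsub>B\<^esub> ?b divides\<^bsub>B\<^esub> (psX C \<otimes>\<^bsub>B\<^esub> (s \<otimes>\<^bsub>B\<^esub> a'))" by (rule B.divides_mult[OF bc C.psX_closed s(2)])
    moreover have "psX C \<otimes>\<^bsub>B\<^esub> (s \<otimes>\<^bsub>B\<^esub> a') = s \<otimes>\<^bsub>B\<^esub> a" using a' TB_sub[OF s(1)] by (simp add: B.m_lcomm)
    ultimately show ?case using s(1) bS by (intro bexI[of _ s]) simp_all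
  qed
  then show ?thesis using a dv eb(3) by blast
qed

text \<open>Lifting \<open>v\<close> by constants gives a combination of \<open>m\<close> that is y
  times some element; by saturation this element lies in \<open>I\<close>, so it is a combination of
  \<open>m\<close> itself, and y times that combination is subtracted.\<close>

lemma lift_relation:
  assumes m: "m \<in> vecs B" and sat: "\<And>u. u \<in> carrier B \<Longrightarrow> psX C \<otimes>\<^bsub>B\<^esub> u \<in> I \<Longrightarrow> u \<in> I"
    and span: "\<And>u. u \<in> I \<Longrightarrow> \<exists>d\<in>vecs B. u = dt B k d m" and mem: "\<And>d. d \<in> vecs B \<Longrightarrow> dt B k d m \<in> I"
    and v: "v \<in> vecs C" "dt C k v (\<lambda>c. m c 0) = \<zero>\<^bsub>C\<^esub>"
  shows "\<exists>w\<in>vecs B. dt B k w m = \<zero>\<^bsub>B\<^esub> \<and> (\<lambda>c. w c 0) = v"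
proof -
  define v0 where "v0 = (\<lambda>c. const C (v c))"
  have v0: "v0 \<in> vecs B" using vecsD[OF v(1)] by (simp add: v0_def vecs_def)
  let ?d = "dt B k v0 m"
  have dc: "?d \<in> carrier B" using v0 m by simp
  have "?d 0 = dt C k (\<lambda>c. v0 c 0) (\<lambda>c. m c 0)" by (rule B.dt_hom[OF C.ps_hom(1) v0 m])
  then have "?d 0 = \<zero>\<^bsub>C\<^esub>" using v(2) by (simp add: v0_def)
  then have e: "?d = psX C \<otimes>\<^bsub>B\<^esub> shift ?d" by (rule C.ps_psX_eq[OF dc])
  have sd: "shift ?d \<in> carrier B" using dc by simp
  have "shift ?d \<in> I" using sat[OF sd] mem[OF v0] e by simp
  then obtain d where d: "d \<in> vecs B" "shift ?d = dt B k d m" using span by blast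
  define w where "w = (\<lambda>c. v0 c \<oplus>\<^bsub>B\<^esub> (\<ominus>\<^bsub>B\<^esub> psX C) \<otimes>\<^bsub>B\<^esub> d c)"
  have xd: "(\<lambda>c. (\<ominus>\<^bsub>B\<^esub> psX C) \<otimes>\<^bsub>B\<^esub> d c) \<in> vecs B" using vecsD[OF d(1)] by (simp add: vecs_def)
  have w: "w \<in> vecs B" using vecsD[OF v0] vecsD[OF xd] by (simp add: w_def vecs_def)
  have "dt B k w m = ?d \<oplus>\<^bsub>B\<^esub> (\<ominus>\<^bsub>B\<^esub> psX C) \<otimes>\<^bsub>B\<^esub> dt B k d m"
    unfolding w_def using B.dt_add[OF v0 xd m] B.dt_smult[OF _ d(1) m, of "\<ominus>\<^bsub>B\<^esub> psX C" k] by simp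
  also have "\<dots> = psX C \<otimes>\<^bsub>B\<^esub> shift ?d \<oplus>\<^bsub>B\<^esub> (\<ominus>\<^bsub>B\<^esub> psX C) \<otimes>\<^bsub>B\<^esub> shift ?d"
    using e d(2) by simp
  also have "\<dots> = \<zero>\<^bsub>B\<^esub>" using sd by (simp add: B.l_minus B.r_neg)
  finally have "dt B k w m = \<zero>\<^bsub>B\<^esub>" .
  moreover have "w c 0 = v c" for c
    unfolding w_def using vecsD[OF d(1), of c] vecsD[OF v(1), of c] by (simp add: v0_def ps_carrierD)
  ultimately show ?thesis using w by blast
qed

end

lemma (in cring) ispan_dt:
  assumes ms: "set ms \<subseteq> carrier R"
  shows "ispan ms = {dt R (length ms) d (\<lambda>c. if c < length ms then ms ! c else \<zero>) | d. d \<in> vecs R}"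
proof (intro subset_antisym subsetI)
  fix x assume "x \<in> ispan ms"
  then obtain a where a: "a \<in> vecs R" "x = lc R a (map (\<lambda>x _. x) ms) ()" by (rule ispanE)
  then show "x \<in> {dt R (length ms) d (\<lambda>c. if c < length ms then ms ! c else \<zero>) | d. d \<in> vecs R}"
    using lc_eq_dt[OF ms a(1)] by blast
next
  fix x assume "x \<in> {dt R (length ms) d (\<lambda>c. if c < length ms then ms ! c else \<zero>) | d. d \<in> vecs R}"
  then obtain d where d: "d \<in> vecs R" "x = dt R (length ms) d (\<lambda>c. if c < length ms then ms ! c else \<zero>)" by blast
  then show "x \<in> ispan ms" using lc_eq_dt[OF ms d(1)] lc_ispan[OF d(1) ms] by simp
qed

lemma (in cring) colon_ideal:
  assumes g: "g \<in> carrier R" and f: "f \<in> carrier R"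
  shows "ideal {u \<in> carrier R. g divides (u \<otimes> f)} R"
proof (rule ideal_criterion)
  show "\<zero> \<in> {u \<in> carrier R. g divides (u \<otimes> f)}" using f divides_zero[OF g] by simp
  fix x y assume "x \<in> {u \<in> carrier R. g divides (u \<otimes> f)}" "y \<in> {u \<in> carrier R. g divides (u \<otimes> f)}"
  then obtain a b where "x \<in> carrier R" "y \<in> carrier R" "a \<in> carrier R" "x \<otimes> f = g \<otimes> a" "b \<in> carrier R" "y \<otimes> f = g \<otimes> b"
    by (auto elim!: dividesE2)
  then show "x \<oplus> y \<in> {u \<in> carrier R. g divides (u \<otimes> f)}"
    using f g by (auto simp: l_distr r_distr intro!: dividesI2[of "a \<oplus> b"])
next
  fix c x assume c: "c \<in> carrier R" and "x \<in> {u \<in> carrier R. g divides (u \<otimes> f)}"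
  then obtain a where "x \<in> carrier R" "a \<in> carrier R" "x \<otimes> f = g \<otimes> a"
    by (auto elim!: dividesE2)
  then show "c \<otimes> x \<in> {u \<in> carrier R. g divides (u \<otimes> f)}"
    using f g c by (auto simp: m_assoc m_lcomm intro!: dividesI2[of "c \<otimes> a"])
qed auto

context local_setting
begin

text \<open>The hypothesis that y does not divide \<open>g\<close> makes \<open>I = (g : f)\<close>
  saturated with respect to y, which is what allows relations modulo y to be lifted to relations
  between the generators themselves.\<close>

lemma colon_locally_principal_aux:
  assumes f: "f \<in> carrier B" and g: "g \<in> carrier B" "g 0 \<noteq> \<zero>\<^bsub>C\<^esub>"
  shows "\<exists>z\<in>carrier B. g divides\<^bsub>B\<^esub> (z \<otimes>\<^bsub>B\<^esub> f) \<and>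
    (\<exists>s\<in>TB. \<forall>h\<in>carrier B. g divides\<^bsub>B\<^esub> (h \<otimes>\<^bsub>B\<^esub> f) \<longrightarrow> z divides\<^bsub>B\<^esub> (s \<otimes>\<^bsub>B\<^esub> h))"
proof -
  define I where "I = {u \<in> carrier B. g divides\<^bsub>B\<^esub> (u \<otimes>\<^bsub>B\<^esub> f)}"
  have I: "ideal I B" unfolding I_def by (rule B.colon_ideal[OF g(1) f])
  obtain ms where ms: "set ms \<subseteq> I" "I = B.ispan ms" using B.noetherian_ideal_list[OF noethB I] by blast
  have mc: "set ms \<subseteq> carrier B" using ms(1) by (auto simp: I_def)
  define k where "k = length ms"
  define m where "m = (\<lambda>c. if c < k then ms ! c else \<zero>\<^bsub>B\<^esub>)"
  have mi: "m c \<in> I" if "c < k" for c using ms(1) that by (auto simp: m_def k_def)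
  have mcc: "m c \<in> carrier B" for c using mi[of c] by (cases "c < k") (auto simp: I_def m_def)
  have mv: "m \<in> vecs B" using mcc by (simp add: vecs_def)
  have Idt: "I = {dt B k d m | d. d \<in> vecs B}" using B.ispan_dt[OF mc] ms(2) by (simp add: m_def k_def)
  have span: "\<exists>d\<in>vecs B. u = dt B k d m" if "u \<in> I" for u using that unfolding Idt by blast
  have mem: "dt B k d m \<in> I" if "d \<in> vecs B" for d using that unfolding Idt by blast
  have sat: "u \<in> I" if u: "u \<in> carrier B" "psX C \<otimes>\<^bsub>B\<^esub> u \<in> I" for u
  proof -
    have "g divides\<^bsub>B\<^esub> (psX C \<otimes>\<^bsub>B\<^esub> (u \<otimes>\<^bsub>B\<^esub> f))" using u B.m_assoc[OF C.psX_closed u(1) f] by (simp add: I_def)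
    then show ?thesis using C.psX_dvd_cancel[OF B.m_closed[OF u(1) f] g] u(1) by (simp add: I_def)
  qed
  define x where "x = (\<lambda>c. m c 0)"
  have xv: "x \<in> vecs C" using mcc by (simp add: x_def vecs_def ps_carrierD)
  \<comment> \<open>If all generators vanished modulo y, so would \<open>g\<close>, which lies in
    \<open>I\<close>.\<close>
  have "\<exists>j<k. x j \<noteq> \<zero>\<^bsub>C\<^esub>"
  proof (rule ccontr)
    assume n: "\<not> ?thesis"
    have "g \<in> I" using g(1) f B.dvd_selfI[OF g(1) f] by (simp add: I_def)
    then obtain d where d: "d \<in> vecs B" "g = dt B k d m" using span by blast
    have dv: "(\<lambda>c. d c 0) \<in> vecs C" using vecsD[OF d(1)] by (simp add: vecs_def ps_carrierD)
    have "g 0 = dt C k (\<lambda>c. d c 0) x" unfolding x_def d(2) by (rule B.dt_hom[OF C.ps_hom(1) d(1) mv])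
    also have "\<dots> = dt C k x (\<lambda>c. d c 0)" by (rule C.dt_comm[OF dv xv])
    also have "\<dots> = dt C k (\<lambda>c. \<zero>\<^bsub>C\<^esub> \<otimes>\<^bsub>C\<^esub> x c) (\<lambda>c. d c 0)"
      by (rule C.dt_cong) (use n C.l_null[OF vecsD[OF xv]] in simp)
    also have "\<dots> = \<zero>\<^bsub>C\<^esub>" using C.dt_smult[OF C.zero_closed xv dv, of k] C.l_null[OF C.dt_closed[OF xv dv]] by simp
    finally show False using g(2) by simp
  qed
  then obtain j where j: "j < k" "x j \<noteq> \<zero>\<^bsub>C\<^esub>" by blast
  obtain nbs where nbs: "set nbs \<subseteq> {v \<in> vecs C. dt C k v x = \<zero>\<^bsub>C\<^esub>}" "indep_mod C {\<zero>\<^bsub>C\<^esub>} {..<k} nbs"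
    "\<forall>v\<in>{v \<in> vecs C. dt C k v x = \<zero>\<^bsub>C\<^esub>}. \<exists>t\<in>TC. (\<lambda>c. t \<otimes>\<^bsub>C\<^esub> v c) \<in> span_on C {..<k} nbs"
    using relations_basis[OF xv] by blast
  have nbv: "set nbs \<subseteq> vecs C" "\<And>v. v \<in> set nbs \<Longrightarrow> dt C k v x = \<zero>\<^bsub>C\<^esub>" using nbs(1) by auto
  have gen: "\<exists>t\<in>TC. (\<lambda>c. t \<otimes>\<^bsub>C\<^esub> v c) \<in> span_on C {..<k} nbs" if "v \<in> vecs C" "dt C k v x = \<zero>\<^bsub>C\<^esub>" for v
    using nbs(3) that by simp
  have rank: "k = Suc (length nbs)" by (rule relations_rank[OF xv j nbv nbs(2) gen])
  have "\<exists>ns. set ns \<subseteq> {w \<in> vecs B. dt B k w m = \<zero>\<^bsub>B\<^esub>} \<and> map (\<lambda>w c. w c 0) ns = nbs" using nbv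
  proof (induction nbs)
    case (Cons v vs)
    then obtain ns where ns: "set ns \<subseteq> {w \<in> vecs B. dt B k w m = \<zero>\<^bsub>B\<^esub>}" "map (\<lambda>w c. w c 0) ns = vs" by auto
    have "v \<in> vecs C" "dt C k v (\<lambda>c. m c 0) = \<zero>\<^bsub>C\<^esub>" using Cons.prems by (auto simp: x_def)
    then obtain w where "w \<in> vecs B" "dt B k w m = \<zero>\<^bsub>B\<^esub>" "(\<lambda>c. w c 0) = v"
      using lift_relation[OF mv sat span mem] by blast
    then show ?case using ns by (intro exI[of _ "w # ns"]) auto
  qed simp
  then obtain ns where ns: "set ns \<subseteq> {w \<in> vecs B. dt B k w m = \<zero>\<^bsub>B\<^esub>}" "map (\<lambda>w c. w c 0) ns = nbs" by blast
  have nv: "set ns \<subseteq> vecs B" "\<And>w. w \<in> set ns \<Longrightarrow> dt B k w m = \<zero>\<^bsub>B\<^esub>" using ns(1) by auto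
  define D where "D = (\<lambda>c. minor B [0..<k] (unit_vec B c # ns))"
  have Dv: "D \<in> vecs B" unfolding D_def by (rule B.minor_unit_vecs[OF nv(1)])
  have D0: "D c 0 = minor C [0..<k] (unit_vec C c # nbs)" for c
  proof -
    have "D c 0 = minor C [0..<k] (map (\<lambda>v c. v c 0) (unit_vec B c # ns))"
      unfolding D_def by (rule B.minor_hom[OF C.ps_hom(1)]) (use nv in simp)
    moreover have "(\<lambda>d. unit_vec B c d 0) = unit_vec C c" by (auto simp: unit_vec_def)
    ultimately show ?thesis using ns(2) by (simp del: minor.simps)
  qed
  \<comment> \<open>A basis of the relations stays independent modulo a prime \<open>p\<close> that
    is no denominator: if a combination is divisible by \<open>p\<close>, the quotient is again a
    relation, hence up to some \<open>t \<in> TC\<close> a combination of the basis, and comparing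
    coefficients shows that \<open>p\<close> divides \<open>t \<otimes> a i\<close>.\<close>
  have D_prime: "\<exists>c<k. \<not> p divides\<^bsub>C\<^esub> D c 0" if p: "prime_el C p" "p \<notin> TC" for p
  proof -
    note pc = C.prime_elD[OF p(1)]
    let ?P = "PIdl\<^bsub>C\<^esub> p"
    have "indep_mod C ?P {..<k} nbs"
      unfolding indep_mod_def
    proof (intro ballI impI allI)
      fix a i assume a: "a \<in> vecs C" "\<forall>c\<in>{..<k}. lc C a nbs c \<in> ?P" and i: "i < length nbs"
      have l: "lc C a nbs \<in> vecs C" using a(1) nbv(1) by simp
      have "\<forall>c. \<exists>q. q \<in> carrier C \<and> (c < k \<longrightarrow> lc C a nbs c = p \<otimes>\<^bsub>C\<^esub> q)"
      proof
        fix c show "\<exists>q. q \<in> carrier C \<and> (c < k \<longrightarrow> lc C a nbs c = p \<otimes>\<^bsub>C\<^esub> q)"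
        proof (cases "c < k")
          case True
          then have "p divides\<^bsub>C\<^esub> lc C a nbs c" using a(2) C.mem_PIdl_iff[OF pc(1)] by simp
          then show ?thesis by (auto elim: dividesE2)
        next
          case False then show ?thesis using C.zero_closed by blast
        qed
      qed
      from choice[OF this] obtain v where v: "\<And>c. v c \<in> carrier C" "\<And>c. c < k \<Longrightarrow> lc C a nbs c = p \<otimes>\<^bsub>C\<^esub> v c" by blast
      have vv: "v \<in> vecs C" using v(1) by (simp add: vecs_def)
      have "p \<otimes>\<^bsub>C\<^esub> dt C k v x = dt C k (\<lambda>c. p \<otimes>\<^bsub>C\<^esub> v c) x" using C.dt_smult[OF pc(1) vv xv] by simp
      also have "\<dots> = dt C k (lc C a nbs) x" by (rule C.dt_cong) (simp add: v(2))
      also have "\<dots> = \<zero>\<^bsub>C\<^esub>" by (rule C.dt_lc_zero[OF xv a(1) nbv])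
      finally have "dt C k v x = \<zero>\<^bsub>C\<^esub>" using C.integral[OF _ pc(1) C.dt_closed[OF vv xv]] pc(2) by blast
      then obtain t where t: "t \<in> TC" "(\<lambda>c. t \<otimes>\<^bsub>C\<^esub> v c) \<in> span_on C {..<k} nbs" using gen[OF vv] by blast
      obtain b where b: "b \<in> vecs C" "\<And>c. c \<in> {..<k} \<Longrightarrow> t \<otimes>\<^bsub>C\<^esub> v c = lc C b nbs c" using span_onE[OF t(2)] by blast
      have tc: "t \<in> carrier C" by (rule TC_sub[OF t(1)])
      let ?e = "\<lambda>i. t \<otimes>\<^bsub>C\<^esub> a i \<oplus>\<^bsub>C\<^esub> (\<ominus>\<^bsub>C\<^esub> p) \<otimes>\<^bsub>C\<^esub> b i"
      have e1: "(\<lambda>i. t \<otimes>\<^bsub>C\<^esub> a i) \<in> vecs C" "(\<lambda>i. (\<ominus>\<^bsub>C\<^esub> p) \<otimes>\<^bsub>C\<^esub> b i) \<in> vecs C" "?e \<in> vecs C"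
        using vecsD[OF a(1)] vecsD[OF b(1)] tc pc(1) by (simp_all add: vecs_def)
      have "lc C ?e nbs c \<in> {\<zero>\<^bsub>C\<^esub>}" if c: "c \<in> {..<k}" for c
      proof -
        have "lc C ?e nbs c = t \<otimes>\<^bsub>C\<^esub> lc C a nbs c \<oplus>\<^bsub>C\<^esub> (\<ominus>\<^bsub>C\<^esub> p) \<otimes>\<^bsub>C\<^esub> lc C b nbs c"
          using C.lc_add[OF e1(1,2) nbv(1)] C.lc_smult[OF tc a(1) nbv(1)] C.lc_smult[OF C.a_inv_closed[OF pc(1)] b(1) nbv(1)] by simp
        also have "\<dots> = t \<otimes>\<^bsub>C\<^esub> (p \<otimes>\<^bsub>C\<^esub> v c) \<oplus>\<^bsub>C\<^esub> (\<ominus>\<^bsub>C\<^esub> p) \<otimes>\<^bsub>C\<^esub> (t \<otimes>\<^bsub>C\<^esub> v c)" using v(2) b(2)[OF c] c by simp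
        also have "\<dots> = \<zero>\<^bsub>C\<^esub>" using tc pc(1) v(1)[of c] by algebra
        finally show ?thesis by simp
      qed
      then have "?e i \<in> {\<zero>\<^bsub>C\<^esub>}" using nbs(2) e1(3) i unfolding indep_mod_def by blast
      then have ez: "?e i = \<zero>\<^bsub>C\<^esub>" by simp
      have "t \<otimes>\<^bsub>C\<^esub> a i = ?e i \<oplus>\<^bsub>C\<^esub> p \<otimes>\<^bsub>C\<^esub> b i" using vecsD[OF a(1), of i] vecsD[OF b(1), of i] tc pc(1) by algebra
      then have "t \<otimes>\<^bsub>C\<^esub> a i = p \<otimes>\<^bsub>C\<^esub> b i" unfolding ez using vecsD[OF b(1), of i] pc(1) by simp
      then have "p divides\<^bsub>C\<^esub> (t \<otimes>\<^bsub>C\<^esub> a i)" using vecsD[OF b(1), of i] by (intro dividesI2)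
      then have "p divides\<^bsub>C\<^esub> t \<or> p divides\<^bsub>C\<^esub> a i" by (rule C.prime_el_dvd[OF p(1) _ tc vecsD[OF a(1)]])
      then show "a i \<in> ?P" using TC_dvd[OF t(1) pc(1)] p(2) C.mem_PIdl_iff[OF pc(1)] by blast
    qed
    then obtain c where "c < k" "minor C [0..<k] (unit_vec C c # nbs) \<notin> ?P"
      using C.minor_exists[OF C.prime_el_primeideal[OF p(1)] nbv(1) _ rank] by blast
    then show ?thesis using D0 C.mem_PIdl_iff[OF pc(1)] by auto
  qed
  have nz: "\<exists>c<k. D c 0 \<noteq> \<zero>\<^bsub>C\<^esub>"
    using C.minor_exists[OF C.zeroprimeideal nbv(1) nbs(2) rank] D0 by auto
  have lenn: "length ns = length nbs" using ns(2) by (metis length_map)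
  have ind: "indep_mod B {\<zero>\<^bsub>B\<^esub>} {..<k} ns" using C.indep_lift[OF nv(1)] ns(2) nbs(2) by simp
  have mj: "m j \<noteq> \<zero>\<^bsub>B\<^esub>" using j(2) by (auto simp: x_def)
  have kn: "k = Suc (length ns)" using rank lenn by simp
  have oD: "dt B k v D = \<zero>\<^bsub>B\<^esub>" if "v \<in> set ns" for v unfolding D_def by (rule B.minor_orthogonal[OF nv(1) that])
  \<comment> \<open>The generators \<open>m\<close> and the minors \<open>D\<close> are both
    orthogonal to the \<open>k - 1\<close> independent lifted relations.\<close>
  have prp: "m i \<otimes>\<^bsub>B\<^esub> D j = m j \<otimes>\<^bsub>B\<^esub> D i" if "i < k" for i
    by (rule B.orthogonal_proportional[OF mv Dv nv(1) ind kn nv(2) oD j(1) mj that])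
  have Dc: "D c \<in> carrier B" for c using vecsD[OF Dv] .
  obtain i0 where i0: "i0 < k" "D i0 \<noteq> \<zero>\<^bsub>B\<^esub>" using nz by fastforce
  have Dj: "D j \<noteq> \<zero>\<^bsub>B\<^esub>"
  proof
    assume "D j = \<zero>\<^bsub>B\<^esub>"
    then have "m j \<otimes>\<^bsub>B\<^esub> D i0 = \<zero>\<^bsub>B\<^esub>" using prp[OF i0(1)] B.r_null[OF mcc] by simp
    then show False using B.integral[OF _ mcc Dc] mj i0(2) by blast
  qed
  \<comment> \<open>Proportionality makes \<open>D j\<close> divide \<open>m j \<otimes> D c\<close>
    for all \<open>c\<close>; cancelling the minors shows that up to a denominator \<open>m\<close>
    is a multiple, by \<open>z\<close>, of \<open>D\<close>.\<close>
  have "\<exists>s\<in>TB. D j divides\<^bsub>B\<^esub> (s \<otimes>\<^bsub>B\<^esub> m j)"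
  proof (rule cancel_minors_B[OF Dv D_prime nz Dc Dj mcc])
    fix c assume "c < k"
    then show "D j divides\<^bsub>B\<^esub> (m j \<otimes>\<^bsub>B\<^esub> D c)" using prp[of c] B.m_comm[OF Dc mcc, of j c] mcc[of c] by (intro dividesI2[of "m c"]) simp_all
  qed
  then obtain s where s: "s \<in> TB" "D j divides\<^bsub>B\<^esub> (s \<otimes>\<^bsub>B\<^esub> m j)" by blast
  obtain z where z: "z \<in> carrier B" "s \<otimes>\<^bsub>B\<^esub> m j = D j \<otimes>\<^bsub>B\<^esub> z" using s(2) by (rule dividesE2)
  have sc: "s \<in> carrier B" by (rule TB_sub[OF s(1)])
  have sm: "s \<otimes>\<^bsub>B\<^esub> m i = z \<otimes>\<^bsub>B\<^esub> D i" if i: "i < k" for i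
  proof -
    have "D j \<otimes>\<^bsub>B\<^esub> (s \<otimes>\<^bsub>B\<^esub> m i) = s \<otimes>\<^bsub>B\<^esub> (m i \<otimes>\<^bsub>B\<^esub> D j)" using sc mcc[of i] Dc[of j] by algebra
    also have "\<dots> = (s \<otimes>\<^bsub>B\<^esub> m j) \<otimes>\<^bsub>B\<^esub> D i" unfolding prp[OF i] using sc mcc[of j] Dc[of i] by algebra
    also have "\<dots> = D j \<otimes>\<^bsub>B\<^esub> (z \<otimes>\<^bsub>B\<^esub> D i)" unfolding z(2) using z(1) Dc[of i] Dc[of j] by algebra
    finally show ?thesis
      using iffD1[OF B.m_lcancel[OF Dj Dc B.m_closed[OF sc mcc[of i]] B.m_closed[OF z(1) Dc[of i]]]] by simp
  qed
  have gnz: "g \<noteq> \<zero>\<^bsub>B\<^esub>" using g(2) by auto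
  \<comment> \<open>\<open>g\<close> divides \<open>s m_c f = z f D_c\<close> for all
    \<open>c\<close>; cancelling the minors once more puts \<open>z\<close> into the colon ideal up
    to the factor \<open>s'\<close>.\<close>
  have "\<exists>s'\<in>TB. g divides\<^bsub>B\<^esub> (s' \<otimes>\<^bsub>B\<^esub> (z \<otimes>\<^bsub>B\<^esub> f))"
  proof (rule cancel_minors_B[OF Dv D_prime nz g(1) gnz])
    show "z \<otimes>\<^bsub>B\<^esub> f \<in> carrier B" using z f by simp
    fix c assume c: "c < k"
    have "g divides\<^bsub>B\<^esub> (m c \<otimes>\<^bsub>B\<^esub> f)" using mi[OF c] by (simp add: I_def)
    then have "g divides\<^bsub>B\<^esub> (s \<otimes>\<^bsub>B\<^esub> (m c \<otimes>\<^bsub>B\<^esub> f))" using B.dvd_multI2 g(1) sc mcc f by simp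
    moreover have "s \<otimes>\<^bsub>B\<^esub> (m c \<otimes>\<^bsub>B\<^esub> f) = (s \<otimes>\<^bsub>B\<^esub> m c) \<otimes>\<^bsub>B\<^esub> f" using B.m_assoc[OF sc mcc f] by simp
    moreover have "(z \<otimes>\<^bsub>B\<^esub> D c) \<otimes>\<^bsub>B\<^esub> f = z \<otimes>\<^bsub>B\<^esub> f \<otimes>\<^bsub>B\<^esub> D c" using z(1) f Dc[of c] by algebra
    ultimately show "g divides\<^bsub>B\<^esub> (z \<otimes>\<^bsub>B\<^esub> f \<otimes>\<^bsub>B\<^esub> D c)" using sm[OF c] by simp
  qed
  then obtain s' where s': "s' \<in> TB" "g divides\<^bsub>B\<^esub> (s' \<otimes>\<^bsub>B\<^esub> (z \<otimes>\<^bsub>B\<^esub> f))" by blast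
  have s'c: "s' \<in> carrier B" by (rule TB_sub[OF s'(1)])
  let ?z = "s' \<otimes>\<^bsub>B\<^esub> z" let ?s = "s' \<otimes>\<^bsub>B\<^esub> s"
  have zc: "?z \<in> carrier B" "?s \<in> carrier B" using s'c z sc by simp_all
  have "?z divides\<^bsub>B\<^esub> (?s \<otimes>\<^bsub>B\<^esub> h)" if h: "h \<in> I" for h
  proof -
    let ?J = "{u \<in> carrier B. ?z divides\<^bsub>B\<^esub> (u \<otimes>\<^bsub>B\<^esub> ?s)}"
    have J: "ideal ?J B" by (rule B.colon_ideal[OF zc])
    have "set ms \<subseteq> ?J"
    proof
      fix u assume "u \<in> set ms"
      then obtain i where i: "i < k" "u = m i" by (auto simp: in_set_conv_nth k_def m_def)
      have "m i \<otimes>\<^bsub>B\<^esub> ?s = s' \<otimes>\<^bsub>B\<^esub> (s \<otimes>\<^bsub>B\<^esub> m i)" using mcc[of i] s'c sc by algebra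
      also have "\<dots> = ?z \<otimes>\<^bsub>B\<^esub> D i" unfolding sm[OF i(1)] using s'c z(1) Dc[of i] by algebra
      finally show "u \<in> ?J" using i(2) mcc Dc by (auto intro: dividesI2)
    qed
    then have "I \<subseteq> ?J" using B.genideal_minimal[OF J] B.Idl_ispan[OF mc] ms(2) by blast
    then show ?thesis using h zc B.m_comm[of h ?s] by (auto simp: I_def)
  qed
  moreover have "g divides\<^bsub>B\<^esub> (?z \<otimes>\<^bsub>B\<^esub> f)" using s'(2) B.m_assoc[OF s'c z(1) f] by simp
  ultimately show ?thesis using zc(1) TB_mult[OF s'(1) s(1)]
    by (intro bexI[of _ ?z] conjI bexI[of _ ?s]) (simp_all add: I_def)
qed

text \<open>Powers of y are split off \<open>g\<close> one at a time. If y divides \<open>f\<close>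
  it cancels; if not, it must divide every \<open>h\<close> in the colon ideal, and the generator
  gains a factor y.\<close>

lemma colon_locally_principal:
  assumes f: "f \<in> carrier B" and g: "g \<in> carrier B" "g \<noteq> \<zero>\<^bsub>B\<^esub>"
  shows "\<exists>z\<in>carrier B. g divides\<^bsub>B\<^esub> (z \<otimes>\<^bsub>B\<^esub> f) \<and>
    (\<exists>s\<in>TB. \<forall>h\<in>carrier B. g divides\<^bsub>B\<^esub> (h \<otimes>\<^bsub>B\<^esub> f) \<longrightarrow> z divides\<^bsub>B\<^esub> (s \<otimes>\<^bsub>B\<^esub> h))"
proof -
  obtain e g0 where eg: "g0 \<in> carrier B" "g0 0 \<noteq> \<zero>\<^bsub>C\<^esub>" "g = psX C [^]\<^bsub>B\<^esub> (e::nat) \<otimes>\<^bsub>B\<^esub> g0"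
    using C.ps_order[OF g] by blast
  have "\<exists>z\<in>carrier B. psX C [^]\<^bsub>B\<^esub> e \<otimes>\<^bsub>B\<^esub> g0 divides\<^bsub>B\<^esub> (z \<otimes>\<^bsub>B\<^esub> f) \<and>
    (\<exists>s\<in>TB. \<forall>h\<in>carrier B. psX C [^]\<^bsub>B\<^esub> e \<otimes>\<^bsub>B\<^esub> g0 divides\<^bsub>B\<^esub> (h \<otimes>\<^bsub>B\<^esub> f) \<longrightarrow> z divides\<^bsub>B\<^esub> (s \<otimes>\<^bsub>B\<^esub> h))"
    if "f \<in> carrier B" for f using that
  proof (induction e arbitrary: f)
    case 0
    then show ?case using colon_locally_principal_aux[OF 0 eg(1,2)] eg(1) by simp
  next
    case (Suc e)
    let ?g = "psX C [^]\<^bsub>B\<^esub> e \<otimes>\<^bsub>B\<^esub> g0" let ?X = "psX C"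
    have gc: "?g \<in> carrier B" using eg(1) by simp
    have Xc: "?X \<in> carrier B" by (rule C.psX_closed)
    have gS: "?X [^]\<^bsub>B\<^esub> Suc e \<otimes>\<^bsub>B\<^esub> g0 = ?X \<otimes>\<^bsub>B\<^esub> ?g" using eg(1) by (simp add: B.m_ac)
    have cancel: "?X \<otimes>\<^bsub>B\<^esub> ?g divides\<^bsub>B\<^esub> (?X \<otimes>\<^bsub>B\<^esub> a) \<longleftrightarrow> ?g divides\<^bsub>B\<^esub> a" if "a \<in> carrier B" for a
      using B.dvd_mult_cancel[OF _ gc that Xc C.psX_nonzero] B.divides_mult[OF gc Xc] by blast
    show ?case
    proof (cases "f 0 = \<zero>\<^bsub>C\<^esub>")
      case True
      define f1 where "f1 = shift f"
      have f1: "f1 \<in> carrier B" "f = ?X \<otimes>\<^bsub>B\<^esub> f1" using C.ps_psX_eq[OF Suc.prems True] Suc.prems by (simp_all add: f1_def)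
      obtain z s where z: "z \<in> carrier B" "?g divides\<^bsub>B\<^esub> (z \<otimes>\<^bsub>B\<^esub> f1)" "s \<in> TB"
        "\<And>h. h \<in> carrier B \<Longrightarrow> ?g divides\<^bsub>B\<^esub> (h \<otimes>\<^bsub>B\<^esub> f1) \<Longrightarrow> z divides\<^bsub>B\<^esub> (s \<otimes>\<^bsub>B\<^esub> h)" using Suc.IH[OF f1(1)] by blast
      have eq: "?X \<otimes>\<^bsub>B\<^esub> ?g divides\<^bsub>B\<^esub> (h \<otimes>\<^bsub>B\<^esub> f) \<longleftrightarrow> ?g divides\<^bsub>B\<^esub> (h \<otimes>\<^bsub>B\<^esub> f1)" if h: "h \<in> carrier B" for h
        using cancel[of "h \<otimes>\<^bsub>B\<^esub> f1"] B.m_lcomm[OF Xc h f1(1)] f1 h by simp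
      show ?thesis unfolding gS using eq z by (intro bexI[OF _ z(1)] conjI bexI[OF _ z(3)]) auto
    next
      case False
      obtain z s where z: "z \<in> carrier B" "?g divides\<^bsub>B\<^esub> (z \<otimes>\<^bsub>B\<^esub> f)" "s \<in> TB"
        "\<And>h. h \<in> carrier B \<Longrightarrow> ?g divides\<^bsub>B\<^esub> (h \<otimes>\<^bsub>B\<^esub> f) \<Longrightarrow> z divides\<^bsub>B\<^esub> (s \<otimes>\<^bsub>B\<^esub> h)" using Suc.IH[OF Suc.prems] by blast
      have zX: "?X \<otimes>\<^bsub>B\<^esub> z \<in> carrier B" using z(1) Xc by simp
      have sc: "s \<in> carrier B" by (rule TB_sub[OF z(3)])
      have 1: "?X \<otimes>\<^bsub>B\<^esub> ?g divides\<^bsub>B\<^esub> (?X \<otimes>\<^bsub>B\<^esub> z \<otimes>\<^bsub>B\<^esub> f)"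
        using cancel[of "z \<otimes>\<^bsub>B\<^esub> f"] z(1,2) Suc.prems B.m_assoc[OF Xc z(1) Suc.prems] by simp
      have 2: "?X \<otimes>\<^bsub>B\<^esub> z divides\<^bsub>B\<^esub> (s \<otimes>\<^bsub>B\<^esub> h)" if h: "h \<in> carrier B" "?X \<otimes>\<^bsub>B\<^esub> ?g divides\<^bsub>B\<^esub> (h \<otimes>\<^bsub>B\<^esub> f)" for h
      proof -
        have "?X divides\<^bsub>B\<^esub> (h \<otimes>\<^bsub>B\<^esub> f)" using B.dvd_trans[OF B.dvd_selfI[OF Xc gc] h(2) Xc] .
        then obtain h' where h': "h' \<in> carrier B" "h = ?X \<otimes>\<^bsub>B\<^esub> h'" using psX_dvd_mult[OF h(1) Suc.prems _ False] by blast
        then have "?g divides\<^bsub>B\<^esub> (h' \<otimes>\<^bsub>B\<^esub> f)" using h(2) cancel[of "h' \<otimes>\<^bsub>B\<^esub> f"] Suc.prems B.m_assoc[OF Xc h'(1) Suc.prems] by simp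
        then have "z divides\<^bsub>B\<^esub> (s \<otimes>\<^bsub>B\<^esub> h')" using z(4) h'(1) by blast
        then have "?X \<otimes>\<^bsub>B\<^esub> z divides\<^bsub>B\<^esub> (?X \<otimes>\<^bsub>B\<^esub> (s \<otimes>\<^bsub>B\<^esub> h'))" by (rule B.divides_mult[OF z(1) Xc])
        then show ?thesis using h'(2) B.m_lcomm[OF Xc sc h'(1)] by simp
      qed
      show ?thesis unfolding gS using 1 2 by (intro bexI[OF _ zX] conjI bexI[OF _ z(3)]) auto
    qed
  qed
  then show ?thesis using f eg(3) by blast
qed

end

section \<open>Substitution along monomial curves\<close>

text \<open>\<open>ev R h b\<close> applies \<open>h\<close> to the coefficients and substitutes \<open>t\<^sup>b\<close> for the variable (for \<open>b > 0\<close>).\<close>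

function ev :: "('a, 'b) ring_scheme \<Rightarrow> ('s \<Rightarrow> nat \<Rightarrow> 'a) \<Rightarrow> nat \<Rightarrow> (nat \<Rightarrow> 's) \<Rightarrow> nat \<Rightarrow> 'a" where
  "ev R h b f n = h (f 0) n \<oplus>\<^bsub>R\<^esub> (if 0 < b \<and> b \<le> n then ev R h b (shift f) (n - b) else \<zero>\<^bsub>R\<^esub>)"
  by pat_completeness auto
termination by (relation "measure (\<lambda>(R, h, b, f, n). n)") auto

declare ev.simps [simp del]

text \<open>The coefficients of the nested series carry x and the outer index carries y, so x goes
  to \<open>t^a\<close> and y to \<open>t^(a+1)\<close>.\<close>

definition curve :: "('a, 'b) ring_scheme \<Rightarrow> nat \<Rightarrow> (nat \<Rightarrow> nat \<Rightarrow> 'a) \<Rightarrow> nat \<Rightarrow> 'a" where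
  "curve R a = ev R (ev R (const R) a) (Suc a)"

locale ev_setting = R: cring R + S: cring S for R (structure) and S +
  fixes h and b :: nat
  assumes h: "h \<in> ring_hom S (ps R)" and b: "0 < b"
begin

sublocale P: cring "ps R" by (rule R.ps_cring)
sublocale Q: cring "ps S" by (rule S.ps_cring)
sublocale h: ring_hom_cring S "ps R" h
  by (rule ring_hom_cring.intro[OF S.is_cring P.is_cring]) (simp add: ring_hom_cring_axioms_def h)

lemma ev_closed [simp]:
  assumes "f \<in> carrier (ps S)" shows "ev R h b f \<in> carrier (ps R)"
proof -
  have "ev R h b f n \<in> carrier R" for n using assms
  proof (induction n arbitrary: f rule: less_induct)
    case (less n)
    have "h (f 0) n \<in> carrier R" using less.prems by (simp add: ps_carrierD)
    moreover have "ev R h b (shift f) (n - b) \<in> carrier R" if "b \<le> n"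
      by (rule less.IH) (use b that less.prems in auto)
    ultimately show ?case by (subst ev.simps) auto
  qed
  then show ?thesis by (simp add: ps_carrier)
qed

lemma ev_rec:
  assumes "f \<in> carrier (ps S)"
  shows "ev R h b f = h (f 0) \<oplus>\<^bsub>ps R\<^esub> psX R [^]\<^bsub>ps R\<^esub> b \<otimes>\<^bsub>ps R\<^esub> ev R h b (shift f)"
proof
  fix n
  have "(psX R [^]\<^bsub>ps R\<^esub> b \<otimes>\<^bsub>ps R\<^esub> ev R h b (shift f)) n = (if n < b then \<zero> else ev R h b (shift f) (n - b))"
    by (rule R.psX_pow_nth) (use assms in simp)
  then show "ev R h b f n = (h (f 0) \<oplus>\<^bsub>ps R\<^esub> psX R [^]\<^bsub>ps R\<^esub> b \<otimes>\<^bsub>ps R\<^esub> ev R h b (shift f)) n"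
    by (subst ev.simps) (use b in \<open>auto simp: ps_add\<close>)
qed

text \<open>Since \<open>b > 0\<close>, the recursion refers to smaller coefficient indices only.
  The laws for constants and for products are then proved by checking that both sides satisfy the
  same recursion.\<close>

lemma ev_unique:
  assumes U: "\<And>f. f \<in> carrier (ps S) \<Longrightarrow> U f \<in> carrier (ps R)"
    and A: "\<And>f. f \<in> carrier (ps S) \<Longrightarrow> A f \<in> carrier (ps R)" and B: "\<And>f. f \<in> carrier (ps S) \<Longrightarrow> B f \<in> carrier (ps R)"
    and rA: "\<And>f. f \<in> carrier (ps S) \<Longrightarrow> A f = U f \<oplus>\<^bsub>ps R\<^esub> psX R [^]\<^bsub>ps R\<^esub> b \<otimes>\<^bsub>ps R\<^esub> A (shift f)"
    and rB: "\<And>f. f \<in> carrier (ps S) \<Longrightarrow> B f = U f \<oplus>\<^bsub>ps R\<^esub> psX R [^]\<^bsub>ps R\<^esub> b \<otimes>\<^bsub>ps R\<^esub> B (shift f)"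
    and f: "f \<in> carrier (ps S)"
  shows "A f = B f"
proof
  fix n show "A f n = B f n" using f
  proof (induction n arbitrary: f rule: less_induct)
    case (less n)
    have s: "shift f \<in> carrier (ps S)" using less.prems by simp
    have "A f n = U f n \<oplus> (if n < b then \<zero> else A (shift f) (n - b))"
      unfolding rA[OF less.prems] ps_add R.psX_pow_nth[OF A[OF s]] ..
    also have "\<dots> = U f n \<oplus> (if n < b then \<zero> else B (shift f) (n - b))"
      using less.IH[OF _ s, of "n - b"] b by auto
    also have "\<dots> = B f n"
      unfolding rB[OF less.prems] ps_add R.psX_pow_nth[OF B[OF s]] ..
    finally show ?case .
  qed
qed

lemma ev_add:
  assumes "f \<in> carrier (ps S)" "g \<in> carrier (ps S)"
  shows "ev R h b (f \<oplus>\<^bsub>ps S\<^esub> g) = ev R h b f \<oplus>\<^bsub>ps R\<^esub> ev R h b g"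
proof
  fix n show "ev R h b (f \<oplus>\<^bsub>ps S\<^esub> g) n = (ev R h b f \<oplus>\<^bsub>ps R\<^esub> ev R h b g) n" using assms
  proof (induction n arbitrary: f g rule: less_induct)
    case (less n)
    have s: "shift f \<in> carrier (ps S)" "shift g \<in> carrier (ps S)" using less.prems by simp_all
    have sh: "shift (f \<oplus>\<^bsub>ps S\<^esub> g) = shift f \<oplus>\<^bsub>ps S\<^esub> shift g" by (simp add: fun_eq_iff shift_nth ps_add)
    have hh: "h (f 0 \<oplus>\<^bsub>S\<^esub> g 0) n = h (f 0) n \<oplus> h (g 0) n"
      using less.prems ps_add[of R "h (f 0)" "h (g 0)" n] by (simp add: ps_carrierD)
    have e: "(ev R h b f \<oplus>\<^bsub>ps R\<^esub> ev R h b g) n = ev R h b f n \<oplus> ev R h b g n" by (rule ps_add)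
    have c: "h (f 0) n \<in> carrier R" "h (g 0) n \<in> carrier R" "ev R h b (shift f) (n - b) \<in> carrier R" "ev R h b (shift g) (n - b) \<in> carrier R"
      using less.prems s by (simp_all add: ps_carrierD)
    show ?case
    proof (cases "b \<le> n")
      case True
      have "ev R h b (shift f \<oplus>\<^bsub>ps S\<^esub> shift g) (n - b) = ev R h b (shift f) (n - b) \<oplus> ev R h b (shift g) (n - b)"
        using less.IH[OF _ s, of "n - b"] True b ps_add[of R "ev R h b (shift f)" "ev R h b (shift g)" "n - b"] by simp
      then show ?thesis unfolding e
        by (subst (1 2 3) ev.simps) (use True b c in \<open>simp add: sh hh R.a_ac\<close>)
    next
      case False
      then show ?thesis unfolding e by (subst (1 2 3) ev.simps) (use c in \<open>simp add: hh\<close>)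
    qed
  qed
qed

lemma ev_zero: "ev R h b \<zero>\<^bsub>ps S\<^esub> = \<zero>\<^bsub>ps R\<^esub>"
proof -
  let ?z = "ev R h b \<zero>\<^bsub>ps S\<^esub>"
  have zc: "?z \<in> carrier (ps R)" by simp
  have "?z \<oplus>\<^bsub>ps R\<^esub> ?z = ?z" using ev_add[of "\<zero>\<^bsub>ps S\<^esub>" "\<zero>\<^bsub>ps S\<^esub>"] by simp
  then show ?thesis using P.add.r_cancel_one[OF zc zc] by simp
qed

lemma ev_psX:
  assumes "f \<in> carrier (ps S)"
  shows "ev R h b (psX S \<otimes>\<^bsub>ps S\<^esub> f) = psX R [^]\<^bsub>ps R\<^esub> b \<otimes>\<^bsub>ps R\<^esub> ev R h b f"
proof -
  have "shift (psX S \<otimes>\<^bsub>ps S\<^esub> f) = f" by (simp add: fun_eq_iff shift_nth S.psX_mult[OF assms])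
  moreover have "(psX S \<otimes>\<^bsub>ps S\<^esub> f) 0 = \<zero>\<^bsub>S\<^esub>" by (rule S.psX_mult(1)[OF assms])
  moreover have "psX R [^]\<^bsub>ps R\<^esub> b \<otimes>\<^bsub>ps R\<^esub> ev R h b f \<in> carrier (ps R)" using assms by simp
  ultimately show ?thesis using ev_rec[of "psX S \<otimes>\<^bsub>ps S\<^esub> f"] assms by simp
qed

lemma ev_const:
  assumes a: "a \<in> carrier S" and f: "f \<in> carrier (ps S)"
  shows "ev R h b (const S a \<otimes>\<^bsub>ps S\<^esub> f) = h a \<otimes>\<^bsub>ps R\<^esub> ev R h b f"
proof (rule ev_unique[where A = "\<lambda>f. ev R h b (const S a \<otimes>\<^bsub>ps S\<^esub> f)" and B = "\<lambda>f. h a \<otimes>\<^bsub>ps R\<^esub> ev R h b f" and U = "\<lambda>f. h a \<otimes>\<^bsub>ps R\<^esub> h (f 0)", OF _ _ _ _ _ f])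
  fix f assume f: "f \<in> carrier (ps S)"
  have sh: "shift (const S a \<otimes>\<^bsub>ps S\<^esub> f) = const S a \<otimes>\<^bsub>ps S\<^esub> shift f"
    using f a by (simp add: fun_eq_iff shift_nth S.const_mult_nth)
  show "ev R h b (const S a \<otimes>\<^bsub>ps S\<^esub> f) = h a \<otimes>\<^bsub>ps R\<^esub> h (f 0) \<oplus>\<^bsub>ps R\<^esub> psX R [^]\<^bsub>ps R\<^esub> b \<otimes>\<^bsub>ps R\<^esub> ev R h b (const S a \<otimes>\<^bsub>ps S\<^esub> shift f)"
    using ev_rec[of "const S a \<otimes>\<^bsub>ps S\<^esub> f"] a f by (simp add: sh ps_carrierD)
  have c: "h a \<in> carrier (ps R)" "h (f 0) \<in> carrier (ps R)" "ev R h b (shift f) \<in> carrier (ps R)" "psX R [^]\<^bsub>ps R\<^esub> b \<in> carrier (ps R)"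
    using a f by (simp_all add: ps_carrierD)
  show "h a \<otimes>\<^bsub>ps R\<^esub> ev R h b f = h a \<otimes>\<^bsub>ps R\<^esub> h (f 0) \<oplus>\<^bsub>ps R\<^esub> psX R [^]\<^bsub>ps R\<^esub> b \<otimes>\<^bsub>ps R\<^esub> (h a \<otimes>\<^bsub>ps R\<^esub> ev R h b (shift f))"
    unfolding ev_rec[OF f] using c by (simp add: P.r_distr P.m_lcomm)
qed (use a in \<open>simp_all add: ps_carrierD\<close>)

lemma ev_mult:
  assumes f: "f \<in> carrier (ps S)" and g: "g \<in> carrier (ps S)"
  shows "ev R h b (f \<otimes>\<^bsub>ps S\<^esub> g) = ev R h b f \<otimes>\<^bsub>ps R\<^esub> ev R h b g"
proof (rule ev_unique[where A = "\<lambda>f. ev R h b (f \<otimes>\<^bsub>ps S\<^esub> g)" and B = "\<lambda>f. ev R h b f \<otimes>\<^bsub>ps R\<^esub> ev R h b g" and U = "\<lambda>f. h (f 0) \<otimes>\<^bsub>ps R\<^esub> ev R h b g", OF _ _ _ _ _ f])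
  fix f assume f: "f \<in> carrier (ps S)"
  have c0: "const S (f 0) \<in> carrier (ps S)" "shift f \<in> carrier (ps S)" "f 0 \<in> carrier S" using f by (simp_all add: ps_carrierD)
  have "f \<otimes>\<^bsub>ps S\<^esub> g = const S (f 0) \<otimes>\<^bsub>ps S\<^esub> g \<oplus>\<^bsub>ps S\<^esub> psX S \<otimes>\<^bsub>ps S\<^esub> (shift f \<otimes>\<^bsub>ps S\<^esub> g)"
    by (subst S.ps_decomp[OF f]) (use c0 g in \<open>simp add: Q.l_distr Q.m_assoc\<close>)
  then show "ev R h b (f \<otimes>\<^bsub>ps S\<^esub> g) = h (f 0) \<otimes>\<^bsub>ps R\<^esub> ev R h b g \<oplus>\<^bsub>ps R\<^esub> psX R [^]\<^bsub>ps R\<^esub> b \<otimes>\<^bsub>ps R\<^esub> ev R h b (shift f \<otimes>\<^bsub>ps S\<^esub> g)"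
    using c0 g by (simp add: ev_add ev_const ev_psX)
  have c: "h (f 0) \<in> carrier (ps R)" "ev R h b (shift f) \<in> carrier (ps R)" "ev R h b g \<in> carrier (ps R)" "psX R [^]\<^bsub>ps R\<^esub> b \<in> carrier (ps R)"
    using c0 g by simp_all
  show "ev R h b f \<otimes>\<^bsub>ps R\<^esub> ev R h b g = h (f 0) \<otimes>\<^bsub>ps R\<^esub> ev R h b g \<oplus>\<^bsub>ps R\<^esub> psX R [^]\<^bsub>ps R\<^esub> b \<otimes>\<^bsub>ps R\<^esub> (ev R h b (shift f) \<otimes>\<^bsub>ps R\<^esub> ev R h b g)"
    unfolding ev_rec[OF f] using c by (simp add: P.l_distr P.m_assoc)
qed (use g in \<open>simp_all add: ps_carrierD\<close>)

lemma ev_one: "ev R h b \<one>\<^bsub>ps S\<^esub> = \<one>\<^bsub>ps R\<^esub>"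
proof -
  have "shift \<one>\<^bsub>ps S\<^esub> = \<zero>\<^bsub>ps S\<^esub>" by (simp add: fun_eq_iff shift_nth ps_one ps_zero)
  then show ?thesis using ev_rec[of "\<one>\<^bsub>ps S\<^esub>"] by (simp add: ev_zero)
qed

lemma ev_hom: "ev R h b \<in> ring_hom (ps S) (ps R)"
  by (rule ring_hom_memI) (simp_all add: ev_add ev_mult ev_one)

end

context cring
begin

lemma ev_const_hom: "0 < a \<Longrightarrow> ev R (const R) a \<in> ring_hom (ps R) (ps R)"
proof -
  assume "0 < a"
  then interpret ev_setting R R "const R" a
    using is_cring const_hom by (simp add: ev_setting_def ev_setting_axioms_def)
  show ?thesis by (rule ev_hom)
qed

lemma curve_hom: "0 < a \<Longrightarrow> ring_hom_cring (ps (ps R)) (ps R) (curve R a)"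
proof -
  assume a: "0 < a"
  interpret ev_setting R "ps R" "ev R (const R) a" "Suc a"
    using is_cring ps_cring ev_const_hom[OF a] by (simp add: ev_setting_def ev_setting_axioms_def)
  show ?thesis unfolding curve_def using ps_cring cring.ps_cring[OF ps_cring] ev_hom
    by (simp add: ring_hom_cring_def ring_hom_cring_axioms_def)
qed

lemma ev_const_nth:
  "0 < a \<Longrightarrow> u \<in> carrier (ps R) \<Longrightarrow> ev R (const R) a u m = (if a dvd m then u (m div a) else \<zero>)"
proof (induction m arbitrary: u rule: less_induct)
  case (less m)
  have u: "u i \<in> carrier R" for i using less.prems by (simp add: ps_carrierD)
  show ?case
  proof (cases "a \<le> m")
    case True
    then have m: "m \<noteq> 0" using less.prems by simp
    have "ev R (const R) a (shift u) (m - a) = (if a dvd (m - a) then shift u ((m - a) div a) else \<zero>)"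
      by (rule less.IH) (use less.prems True in auto)
    moreover have "a dvd (m - a) \<longleftrightarrow> a dvd m" using True by (simp add: dvd_minus_self)
    moreover have "Suc ((m - a) div a) = m div a" using True less.prems by (simp add: le_div_geq)
    ultimately show ?thesis by (subst ev.simps) (use True m less.prems u in \<open>auto simp: const_def shift_nth\<close>)
  next
    case False
    then have "a dvd m \<longleftrightarrow> m = 0" using nat_dvd_not_less[of m a] by auto
    then show ?thesis by (subst ev.simps) (use False u in \<open>auto simp: const_def\<close>)
  qed
qed

text \<open>The coefficient of \<open>t^m\<close> collects the \<open>f j i\<close> with
  \<open>a * i + Suc a * j = m\<close>. Only the cases with no or one relevant term are needed,
  which avoids a summation formula.\<close>

lemma curve_nth_zero:
  assumes a: "0 < a"
  shows "f \<in> carrier (ps (ps R)) \<Longrightarrow> (\<And>i j. a * i + Suc a * j = m \<Longrightarrow> f j i = \<zero>) \<Longrightarrow> curve R a f m = \<zero>"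
proof (induction m arbitrary: f rule: less_induct)
  case (less m)
  have f0: "f 0 \<in> carrier (ps R)" using less.prems(1) by (simp add: ps_carrierD)
  have "ev R (const R) a (f 0) m = \<zero>"
    using ev_const_nth[OF a f0, of m] less.prems(2)[of "m div a" 0] by simp
  moreover have "curve R a (shift f) (m - Suc a) = \<zero>" if "Suc a \<le> m"
  proof (rule less.IH)
    fix i j assume "a * i + Suc a * j = m - Suc a"
    then have "a * i + Suc a * Suc j = m" using that by simp
    then show "shift f j i = \<zero>" using less.prems(2) by (simp add: shift_nth)
  qed (use that less.prems(1) in auto)
  ultimately show ?case unfolding curve_def by (subst ev.simps) auto
qed

lemma curve_nth:
  assumes a: "0 < a"
  shows "f \<in> carrier (ps (ps R)) \<Longrightarrow> a * i0 + Suc a * j0 = m \<Longrightarrow>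
    (\<And>i j. a * i + Suc a * j = m \<Longrightarrow> j \<noteq> j0 \<Longrightarrow> f j i = \<zero>) \<Longrightarrow> curve R a f m = f j0 i0"
proof (induction j0 arbitrary: f m)
  case 0
  have f0: "f 0 \<in> carrier (ps R)" "f 0 i0 \<in> carrier R" using 0(1) by (simp_all add: ps_carrierD)
  have "ev R (const R) a (f 0) m = f 0 i0"
    using ev_const_nth[OF a f0(1), of m] 0(2) a by auto
  moreover have "curve R a (shift f) (m - Suc a) = \<zero>" if "Suc a \<le> m"
  proof (rule curve_nth_zero[OF a])
    fix i j assume "a * i + Suc a * j = m - Suc a"
    then have "a * i + Suc a * Suc j = m" using that by simp
    then show "shift f j i = \<zero>" using 0(3) by (simp add: shift_nth)
  qed (use 0(1) in simp)
  ultimately show ?case unfolding curve_def by (subst ev.simps) (use f0 in auto)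
next
  case (Suc j0)
  have f0: "f 0 \<in> carrier (ps R)" "f (Suc j0) i0 \<in> carrier R" using Suc.prems(1) by (simp_all add: ps_carrierD)
  have "ev R (const R) a (f 0) m = \<zero>"
    using ev_const_nth[OF a f0(1), of m] Suc.prems(3)[of "m div a" 0] by simp
  moreover have m: "Suc a \<le> m" using Suc.prems(2) by auto
  moreover have "curve R a (shift f) (m - Suc a) = shift f j0 i0"
  proof (rule Suc.IH)
    show "a * i0 + Suc a * j0 = m - Suc a" using Suc.prems(2) by simp
    fix i j assume "a * i + Suc a * j = m - Suc a" "j \<noteq> j0"
    then have "a * i + Suc a * Suc j = m" "Suc j \<noteq> Suc j0" using m by simp_all
    then show "shift f j i = \<zero>" using Suc.prems(3) by (simp add: shift_nth)
  qed (use Suc.prems(1) in simp)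
  ultimately show ?case unfolding curve_def by (subst ev.simps) (use f0 in \<open>auto simp: shift_nth\<close>)
qed

end

section \<open>Orders in one variable and total degrees in two\<close>

definition ord_ge :: "('a, 'b) ring_scheme \<Rightarrow> nat \<Rightarrow> (nat \<Rightarrow> 'a) \<Rightarrow> bool" where
  "ord_ge R n u \<longleftrightarrow> u \<in> carrier (ps R) \<and> (\<forall>i<n. u i = \<zero>\<^bsub>R\<^esub>)"

text \<open>Total degree at least \<open>n\<close>; the coefficient of \<open>x\<^sup>i y\<^sup>j\<close> is \<open>f j i\<close>.\<close>

definition deg_ge :: "('a, 'b) ring_scheme \<Rightarrow> nat \<Rightarrow> (nat \<Rightarrow> nat \<Rightarrow> 'a) \<Rightarrow> bool" where
  "deg_ge R n f \<longleftrightarrow> f \<in> carrier (ps (ps R)) \<and> (\<forall>j i. i + j < n \<longrightarrow> f j i = \<zero>\<^bsub>R\<^esub>)"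

context cring
begin


lemma ord_ge_mono: "ord_ge R n u \<Longrightarrow> m \<le> n \<Longrightarrow> ord_ge R m u" by (simp add: ord_ge_def)

lemma ord_ge_minus: "ord_ge R n u \<Longrightarrow> ord_ge R n v \<Longrightarrow> ord_ge R n (u \<ominus>\<^bsub>ps R\<^esub> v)"
proof -
  interpret P: cring "ps R" by (rule ps_cring)
  assume "ord_ge R n u" "ord_ge R n v"
  moreover have "\<zero> \<ominus> \<zero> = \<zero>" by (simp add: a_minus_def)
  ultimately show ?thesis by (auto simp: ord_ge_def ps_minus)
qed

lemma ord_ge_add: "ord_ge R n u \<Longrightarrow> ord_ge R n v \<Longrightarrow> ord_ge R n (u \<oplus>\<^bsub>ps R\<^esub> v)"
proof -
  interpret P: cring "ps R" by (rule ps_cring)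
  assume "ord_ge R n u" "ord_ge R n v"
  then show ?thesis by (auto simp: ord_ge_def ps_add)
qed

lemma ord_ge_mult:
  assumes "ord_ge R m u" "ord_ge R n v"
  shows "ord_ge R (m + n) (u \<otimes>\<^bsub>ps R\<^esub> v)"
proof -
  interpret P: cring "ps R" by (rule ps_cring)
  let ?u = "\<lambda>i. u (i + m)" let ?v = "\<lambda>i. v (i + n)"
  have c: "?u \<in> carrier (ps R)" "?v \<in> carrier (ps R)" "u \<in> carrier (ps R)" "v \<in> carrier (ps R)"
    using assms by (simp_all add: ord_ge_def ps_carrier)
  have "u = psX R [^]\<^bsub>ps R\<^esub> m \<otimes>\<^bsub>ps R\<^esub> ?u" "v = psX R [^]\<^bsub>ps R\<^esub> n \<otimes>\<^bsub>ps R\<^esub> ?v"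
    using assms c by (auto intro!: psX_pow_eq simp: ord_ge_def)
  then have "u \<otimes>\<^bsub>ps R\<^esub> v = (psX R [^]\<^bsub>ps R\<^esub> m \<otimes>\<^bsub>ps R\<^esub> ?u) \<otimes>\<^bsub>ps R\<^esub> (psX R [^]\<^bsub>ps R\<^esub> n \<otimes>\<^bsub>ps R\<^esub> ?v)" by argo
  also have "\<dots> = psX R [^]\<^bsub>ps R\<^esub> (m + n) \<otimes>\<^bsub>ps R\<^esub> (?u \<otimes>\<^bsub>ps R\<^esub> ?v)"
    using c(1,2) by (simp add: P.nat_pow_mult[symmetric] P.m_ac)
  finally have e: "u \<otimes>\<^bsub>ps R\<^esub> v = psX R [^]\<^bsub>ps R\<^esub> (m + n) \<otimes>\<^bsub>ps R\<^esub> (?u \<otimes>\<^bsub>ps R\<^esub> ?v)" .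
  have "(u \<otimes>\<^bsub>ps R\<^esub> v) i = \<zero>" if "i < m + n" for i
    unfolding e using psX_pow_nth[OF P.m_closed[OF c(1,2)], of "m + n" i] that by simp
  then show ?thesis using c by (simp add: ord_ge_def)
qed

lemma ord_ge_0: "u \<in> carrier (ps R) \<Longrightarrow> ord_ge R 0 u" by (simp add: ord_ge_def)

lemma ord_ge_mult_right: "u \<in> carrier (ps R) \<Longrightarrow> ord_ge R n v \<Longrightarrow> ord_ge R n (u \<otimes>\<^bsub>ps R\<^esub> v)"
  using ord_ge_mult[OF ord_ge_0] by fastforce

lemma deg_ge_mult: "deg_ge R m f \<Longrightarrow> deg_ge R n g \<Longrightarrow> deg_ge R (m + n) (f \<otimes>\<^bsub>ps (ps R)\<^esub> g)"
proof -
  interpret P: cring "ps R" by (rule ps_cring)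
  interpret Q: cring "ps (ps R)" by (rule P.ps_cring)
  assume f: "deg_ge R m f" and g: "deg_ge R n g"
  \<comment> \<open>Total degree at least \<open>m + n\<close> means that the coefficient of
    \<open>y^j\<close> has order at least \<open>m + n - j\<close> in x; shifting \<open>f\<close>
    lowers \<open>m\<close> by one.\<close>
  have "ord_ge R (m + n - j) ((f \<otimes>\<^bsub>ps (ps R)\<^esub> g) j)" for j using f
  proof (induction j arbitrary: f m)
    case 0
    have "ord_ge R m (f 0)" "ord_ge R n (g 0)" using 0 g by (auto simp: deg_ge_def ord_ge_def ps_carrierD)
    then show ?case using ord_ge_mult by simp
  next
    case (Suc j)
    have f0: "ord_ge R m (f 0)" using Suc.prems by (auto simp: deg_ge_def ord_ge_def ps_carrierD)
    have gj: "ord_ge R (n - Suc j) (g (Suc j))" using g by (auto simp: deg_ge_def ord_ge_def ps_carrierD)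
    have sf: "deg_ge R (m - 1) (shift f)" using Suc.prems by (auto simp: deg_ge_def shift_nth)
    have "ord_ge R (m + (n - Suc j)) (f 0 \<otimes>\<^bsub>ps R\<^esub> g (Suc j))" by (rule ord_ge_mult[OF f0 gj])
    then have 1: "ord_ge R (m + n - Suc j) (f 0 \<otimes>\<^bsub>ps R\<^esub> g (Suc j))" by (rule ord_ge_mono) simp
    have "ord_ge R (m - 1 + n - j) ((shift f \<otimes>\<^bsub>ps (ps R)\<^esub> g) j)" by (rule Suc.IH[OF sf])
    then have 2: "ord_ge R (m + n - Suc j) ((shift f \<otimes>\<^bsub>ps (ps R)\<^esub> g) j)" by (rule ord_ge_mono) simp
    show ?case unfolding ps_mult_Suc by (rule ord_ge_add[OF 1 2])
  qed
  then show ?thesis using f g by (auto simp: deg_ge_def ord_ge_def)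
qed

lemma deg_ge_0: "f \<in> carrier (ps (ps R)) \<Longrightarrow> deg_ge R 0 f" by (simp add: deg_ge_def)

lemma deg_ge_mult_right: "f \<in> carrier (ps (ps R)) \<Longrightarrow> deg_ge R n g \<Longrightarrow> deg_ge R n (f \<otimes>\<^bsub>ps (ps R)\<^esub> g)"
  using deg_ge_mult[OF deg_ge_0] by fastforce

lemma ps2_add_nth: "(f \<oplus>\<^bsub>ps (ps R)\<^esub> g) j i = f j i \<oplus> g j i"
  by (simp add: ps_add)

lemma ps2_minus_nth:
  assumes "f \<in> carrier (ps (ps R))" "g \<in> carrier (ps (ps R))"
  shows "(f \<ominus>\<^bsub>ps (ps R)\<^esub> g) j i = f j i \<ominus> g j i"
proof -
  have "(f \<ominus>\<^bsub>ps (ps R)\<^esub> g) j = f j \<ominus>\<^bsub>ps R\<^esub> g j" by (rule cring.ps_minus[OF ps_cring assms])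
  then show ?thesis using ps_minus[OF ps_carrierD[OF assms(1)] ps_carrierD[OF assms(2)], of j j i] by simp
qed

lemma deg_ge_add: "deg_ge R n f \<Longrightarrow> deg_ge R n g \<Longrightarrow> deg_ge R n (f \<oplus>\<^bsub>ps (ps R)\<^esub> g)"
proof -
  interpret Q: cring "ps (ps R)" by (rule cring.ps_cring[OF ps_cring])
  assume "deg_ge R n f" "deg_ge R n g"
  then show ?thesis by (auto simp: deg_ge_def ps2_add_nth)
qed

lemma deg_ge_minus: "deg_ge R n f \<Longrightarrow> deg_ge R n g \<Longrightarrow> deg_ge R n (f \<ominus>\<^bsub>ps (ps R)\<^esub> g)"
proof -
  interpret Q: cring "ps (ps R)" by (rule cring.ps_cring[OF ps_cring])
  assume "deg_ge R n f" "deg_ge R n g"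
  moreover have "\<zero> \<ominus> \<zero> = \<zero>" by (simp add: a_minus_def)
  ultimately show ?thesis by (auto simp: deg_ge_def ps2_minus_nth)
qed

text \<open>Such a \<open>d\<close> differs from its constant term only by a series of order above
  \<open>n\<close>. Gaps of this kind arise on the curves, see \<open>curve_low\<close>.\<close>

lemma lowest_mult:
  assumes d: "d \<in> carrier (ps R)" and y: "y \<in> carrier (ps R)" and z: "\<And>i. 0 < i \<Longrightarrow> i \<le> n \<Longrightarrow> d i = \<zero>" and i: "i \<le> n"
  shows "(d \<otimes>\<^bsub>ps R\<^esub> y) i = d 0 \<otimes> y i"
proof -
  interpret P: cring "ps R" by (rule ps_cring)
  have d0: "d 0 \<in> carrier R" using d by (simp add: ps_carrierD)
  let ?e = "d \<ominus>\<^bsub>ps R\<^esub> const R (d 0)"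
  have ec: "?e \<in> carrier (ps R)" using d d0 by simp
  have "?e j = \<zero>" if "j < Suc n" for j
  proof (cases "j = 0")
    case True then show ?thesis using d0 d by (simp add: a_minus_def r_neg)
  next
    case False
    then have "d j = \<zero>" "const R (d 0) j = \<zero>" using z that by (simp_all add: const_def)
    then show ?thesis using ps_minus[OF d const_closed[OF d0], of j] by (simp add: a_minus_def)
  qed
  then have "ord_ge R (Suc n) ?e" using ec by (simp add: ord_ge_def)
  then have "ord_ge R (Suc n) (?e \<otimes>\<^bsub>ps R\<^esub> y)" using ord_ge_mult[OF _ ord_ge_0[OF y]] by fastforce
  then have 0: "(?e \<otimes>\<^bsub>ps R\<^esub> y) i = \<zero>" using i by (simp add: ord_ge_def)
  have "d \<otimes>\<^bsub>ps R\<^esub> y = const R (d 0) \<otimes>\<^bsub>ps R\<^esub> y \<oplus>\<^bsub>ps R\<^esub> ?e \<otimes>\<^bsub>ps R\<^esub> y"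
  proof -
    have "a \<otimes>\<^bsub>ps R\<^esub> y = k \<otimes>\<^bsub>ps R\<^esub> y \<oplus>\<^bsub>ps R\<^esub> (a \<ominus>\<^bsub>ps R\<^esub> k) \<otimes>\<^bsub>ps R\<^esub> y" if "a \<in> carrier (ps R)" "k \<in> carrier (ps R)" for a k
      using that y by algebra
    from this[OF d const_closed[OF d0]] show ?thesis .
  qed
  then have "(d \<otimes>\<^bsub>ps R\<^esub> y) i = (const R (d 0) \<otimes>\<^bsub>ps R\<^esub> y) i \<oplus> (?e \<otimes>\<^bsub>ps R\<^esub> y) i" by (simp only: ps_add)
  then show ?thesis using 0 const_mult_nth[OF d0 y, of i] d0 y by (simp add: ps_carrierD)
qed

lemma lowest_mult_ord:
  assumes d: "d \<in> carrier (ps R)" and y: "ord_ge R l y" and z: "\<And>i. 0 < i \<Longrightarrow> i \<le> n \<Longrightarrow> d i = \<zero>" and i: "i \<le> n"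
  shows "(d \<otimes>\<^bsub>ps R\<^esub> y) (l + i) = d 0 \<otimes> y (l + i)"
proof -
  interpret P: cring "ps R" by (rule ps_cring)
  let ?y = "\<lambda>i. y (i + l)"
  have yc: "?y \<in> carrier (ps R)" using y by (simp add: ord_ge_def ps_carrier)
  have "y = psX R [^]\<^bsub>ps R\<^esub> l \<otimes>\<^bsub>ps R\<^esub> ?y" by (rule psX_pow_eq) (use y in \<open>auto simp: ord_ge_def\<close>)
  then have "d \<otimes>\<^bsub>ps R\<^esub> y = psX R [^]\<^bsub>ps R\<^esub> l \<otimes>\<^bsub>ps R\<^esub> (d \<otimes>\<^bsub>ps R\<^esub> ?y)"
    using P.m_lcomm[OF d P.nat_pow_closed[OF psX_closed] yc, of l] by argo
  then have "(d \<otimes>\<^bsub>ps R\<^esub> y) (l + i) = (d \<otimes>\<^bsub>ps R\<^esub> ?y) i"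
    using psX_pow_nth[OF P.m_closed[OF d yc], of l "l + i"] by simp
  also have "\<dots> = d 0 \<otimes> ?y i" by (rule lowest_mult[OF d yc z i])
  finally show ?thesis by (simp add: add.commute)
qed

lemma const2_mult_nth:
  assumes "a \<in> carrier R" "f \<in> carrier (ps (ps R))"
  shows "(const (ps R) (const R a) \<otimes>\<^bsub>ps (ps R)\<^esub> f) j i = a \<otimes> f j i"
  using cring.const_mult_nth[OF ps_cring const_closed[OF assms(1)] assms(2), of j]
    const_mult_nth[OF assms(1) ps_carrierD[OF assms(2)], of j i] by simp

lemma lowest_mult_deg:
  assumes d: "d \<in> carrier (ps (ps R))" and f: "deg_ge R n f" and ij: "i + j = n"
  shows "(d \<otimes>\<^bsub>ps (ps R)\<^esub> f) j i = d 0 0 \<otimes> f j i"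
proof -
  interpret P: cring "ps R" by (rule ps_cring)
  interpret Q: cring "ps (ps R)" by (rule P.ps_cring)
  have fc: "f \<in> carrier (ps (ps R))" using f by (simp add: deg_ge_def)
  have d0: "d 0 0 \<in> carrier R" using d by (simp add: ps_carrierD)
  let ?k = "const (ps R) (const R (d 0 0))"
  have kc: "?k \<in> carrier (ps (ps R))" using d0 by simp
  let ?e = "d \<ominus>\<^bsub>ps (ps R)\<^esub> ?k"
  have ec: "?e \<in> carrier (ps (ps R))" using d kc by simp
  have "?e 0 0 = \<zero>" unfolding ps2_minus_nth[OF d kc] using d0 by (simp add: a_minus_def r_neg)
  then have "deg_ge R 1 ?e" using ec by (simp add: deg_ge_def)
  then have "deg_ge R (1 + n) (?e \<otimes>\<^bsub>ps (ps R)\<^esub> f)" using f by (rule deg_ge_mult)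
  then have 0: "(?e \<otimes>\<^bsub>ps (ps R)\<^esub> f) j i = \<zero>" using ij by (simp add: deg_ge_def)
  have "a \<otimes>\<^bsub>ps (ps R)\<^esub> f = k \<otimes>\<^bsub>ps (ps R)\<^esub> f \<oplus>\<^bsub>ps (ps R)\<^esub> (a \<ominus>\<^bsub>ps (ps R)\<^esub> k) \<otimes>\<^bsub>ps (ps R)\<^esub> f" if "a \<in> carrier (ps (ps R))" "k \<in> carrier (ps (ps R))" for a k
    using that fc by algebra
  from this[OF d kc] have "(d \<otimes>\<^bsub>ps (ps R)\<^esub> f) j i = (?k \<otimes>\<^bsub>ps (ps R)\<^esub> f) j i \<oplus> (?e \<otimes>\<^bsub>ps (ps R)\<^esub> f) j i"
    by (simp only: ps2_add_nth)
  then show ?thesis using 0 const2_mult_nth[OF d0 fc, of j i] d0 ps_carrierD[OF ps_carrierD[OF fc]] by simp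
qed

text \<open>The smallest positive exponent on the curve is \<open>n + 1\<close>. The resulting gap
  lets images act as constants on the \<open>n + 1\<close> lowest coefficients of another
  series.\<close>

lemma curve_low:
  assumes "d \<in> carrier (ps (ps R))"
  shows "curve R (Suc n) d 0 = d 0 0" "0 < i \<Longrightarrow> i \<le> n \<Longrightarrow> curve R (Suc n) d i = \<zero>"
proof -
  show "curve R (Suc n) d 0 = d 0 0" by (rule curve_nth) (use assms in auto)
  show "curve R (Suc n) d i = \<zero>" if "0 < i" "i \<le> n"
  proof (rule curve_nth_zero)
    fix i' j assume e: "Suc n * i' + Suc (Suc n) * j = i"
    have "i' = 0" using e that by (cases i') auto
    moreover have "j = 0" using e that by (cases j) auto
    ultimately show "d j i' = \<zero>" using e that by simp
  qed (use assms in auto)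
qed

text \<open>
  For \<open>a = n + 1\<close>, the curve sends the monomial \<open>x\<^bsup>n-j\<^esup> y\<^sup>j\<close> to \<open>t\<^bsup>n(n+1)+j\<^esup>\<close>, and all
  monomials of higher degree to powers above \<open>n(n+1)+n\<close>: the lowest homogeneous component can
  be read off from its image.
\<close>

lemma curve_deg:
  assumes e: "deg_ge R n e"
  shows "ord_ge R (n * Suc n) (curve R (Suc n) e)" "j \<le> n \<Longrightarrow> curve R (Suc n) e (n * Suc n + j) = e j (n - j)"
proof -
  interpret c: ring_hom_cring "ps (ps R)" "ps R" "curve R (Suc n)" by (rule curve_hom) simp
  have ec: "e \<in> carrier (ps (ps R))" using e by (simp add: deg_ge_def)
  \<comment> \<open>The exponent of a monomial on the curve is at least \<open>Suc n\<close> times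
    its degree.\<close>
  have small: "e j i = \<zero>" if "Suc n * i + Suc (Suc n) * j < n * Suc n" for i j
  proof -
    have "Suc n * (i + j) \<le> Suc n * i + Suc (Suc n) * j" by (simp add: algebra_simps)
    then have "Suc n * (i + j) < Suc n * n" using that by (metis le_less_trans mult.commute)
    then have "i + j < n" by (metis nat_mult_less_cancel1 zero_less_Suc)
    then show ?thesis using e by (simp add: deg_ge_def)
  qed
  have "curve R (Suc n) e m = \<zero>" if "m < n * Suc n" for m
    by (rule curve_nth_zero[OF _ ec]) (use small that in auto)
  then show "ord_ge R (n * Suc n) (curve R (Suc n) e)" using ec by (simp add: ord_ge_def)
  show "curve R (Suc n) e (n * Suc n + j) = e j (n - j)" if j: "j \<le> n"
  proof (rule curve_nth[OF _ ec])
    have "Suc n * (n - j) + Suc n * j = Suc n * n" using j by (metis add_mult_distrib2 le_add_diff_inverse2)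
    then show "Suc n * (n - j) + Suc (Suc n) * j = n * Suc n + j" by (simp add: mult.commute)
    fix i' j' assume eq: "Suc n * i' + Suc (Suc n) * j' = n * Suc n + j" and ne: "j' \<noteq> j"
    have eq': "Suc n * (i' + j') + j' = Suc n * n + j" using eq by (simp add: algebra_simps)
    \<comment> \<open>The exponent equals \<open>Suc n\<close> times the degree plus
      \<open>j'\<close>. Degree \<open>n\<close> would determine \<open>j'\<close>, and a larger
      degree would give an exponent above \<open>n * Suc n + j\<close> because
      \<open>j \<le> n\<close>. So the competing monomials have degree below \<open>n\<close>, where
      \<open>e\<close> vanishes.\<close>
    have "i' + j' < n"
    proof (rule ccontr)
      assume "\<not> i' + j' < n"
      then consider "i' + j' = n" | "Suc n \<le> i' + j'" by linarith
      then show False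
      proof cases
        case 1 then show ?thesis using eq' ne by simp
      next
        case 2
        then have "Suc n * Suc n \<le> Suc n * (i' + j')" by (rule mult_le_mono2)
        then have "Suc n * n + Suc n \<le> Suc n * n + j" using eq' by simp
        then show ?thesis using j by simp
      qed
    qed
    then show "e j' i' = \<zero>" using e by (simp add: deg_ge_def)
  qed simp
qed

end

section \<open>Approximate solutions along one curve\<close>

context domain
begin

lemma ord_ge_cancel:
  assumes d: "d \<in> carrier (ps R)" "d 0 \<noteq> \<zero>" and w: "w \<in> carrier (ps R)" and dw: "ord_ge R l (d \<otimes>\<^bsub>ps R\<^esub> w)"
  shows "ord_ge R l w"
proof -
  interpret P: domain "ps R" by (rule ps_domain)
  have "psX R [^]\<^bsub>ps R\<^esub> k divides\<^bsub>ps R\<^esub> w" if "k \<le> l" for k using that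
  proof (induction k)
    case 0
    then show ?case using w by (intro dividesI2[of w]) simp_all
  next
    case (Suc k)
    then obtain v where v: "v \<in> carrier (ps R)" "w = psX R [^]\<^bsub>ps R\<^esub> k \<otimes>\<^bsub>ps R\<^esub> v" by (auto elim: dividesE2)
    have "d \<otimes>\<^bsub>ps R\<^esub> w = psX R [^]\<^bsub>ps R\<^esub> k \<otimes>\<^bsub>ps R\<^esub> (d \<otimes>\<^bsub>ps R\<^esub> v)"
      unfolding v(2) by (rule P.m_lcomm) (use d v in simp_all)
    then have "(d \<otimes>\<^bsub>ps R\<^esub> w) k = (d \<otimes>\<^bsub>ps R\<^esub> v) 0" using psX_pow_nth[OF P.m_closed[OF d(1) v(1)], of k k] by simp
    moreover have "(d \<otimes>\<^bsub>ps R\<^esub> w) k = \<zero>" using dw Suc.prems by (simp add: ord_ge_def)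
    ultimately have "v 0 = \<zero>" using d v integral[of "d 0" "v 0"] by (simp add: ps_carrierD)
    then have "v = psX R \<otimes>\<^bsub>ps R\<^esub> shift v" by (rule ps_psX_eq[OF v(1)])
    then have "w = psX R [^]\<^bsub>ps R\<^esub> Suc k \<otimes>\<^bsub>ps R\<^esub> shift v"
      using v P.m_assoc[OF P.nat_pow_closed[OF psX_closed] psX_closed ps_shift_closed[OF v(1)], of k] by simp
    then show ?case using v by (intro dividesI2[of "shift v"]) simp_all
  qed
  then obtain v where v: "v \<in> carrier (ps R)" "w = psX R [^]\<^bsub>ps R\<^esub> l \<otimes>\<^bsub>ps R\<^esub> v" by (auto elim: dividesE2)
  then show ?thesis using w psX_pow_nth[OF v(1), of l] by (simp add: ord_ge_def)
qed

text \<open>The multiplier is found one coefficient at a time: if the errors \<open>x\<close>,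
  \<open>y\<close> have order \<open>k\<close>, then
  \<open>F 0 \<otimes> y k = G 0 \<otimes> x k\<close>, and \<open>cop\<close> makes the pair of
  \<open>x k\<close> and \<open>y k\<close> a multiple of the pair of \<open>F 0\<close> and
  \<open>G 0\<close>.\<close>

lemma approx_multiple:
  assumes c: "F \<in> carrier (ps R)" "G \<in> carrier (ps R)" "U \<in> carrier (ps R)" "V \<in> carrier (ps R)"
    and p: "F 0 \<noteq> \<zero>" and cop: "\<And>z w. z \<in> carrier R \<Longrightarrow> w \<in> carrier R \<Longrightarrow> F 0 \<otimes> z = G 0 \<otimes> w \<Longrightarrow> F 0 divides w"
    and FG: "ord_ge R l (F \<otimes>\<^bsub>ps R\<^esub> V \<ominus>\<^bsub>ps R\<^esub> U \<otimes>\<^bsub>ps R\<^esub> G)"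
  shows "\<exists>g\<in>carrier (ps R). ord_ge R l (g \<otimes>\<^bsub>ps R\<^esub> F \<ominus>\<^bsub>ps R\<^esub> U) \<and> ord_ge R l (g \<otimes>\<^bsub>ps R\<^esub> G \<ominus>\<^bsub>ps R\<^esub> V)"
proof -
  interpret P: domain "ps R" by (rule ps_domain)
  have "\<exists>g\<in>carrier (ps R). ord_ge R k (g \<otimes>\<^bsub>ps R\<^esub> F \<ominus>\<^bsub>ps R\<^esub> U) \<and> ord_ge R k (g \<otimes>\<^bsub>ps R\<^esub> G \<ominus>\<^bsub>ps R\<^esub> V)" if "k \<le> l" for k
    using that
  proof (induction k)
    case 0
    have "ord_ge R 0 (\<zero>\<^bsub>ps R\<^esub> \<otimes>\<^bsub>ps R\<^esub> H \<ominus>\<^bsub>ps R\<^esub> W)" if "H \<in> carrier (ps R)" "W \<in> carrier (ps R)" for H W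
      by (rule ord_ge_0) (use that in \<open>simp only: P.zero_closed P.m_closed P.minus_closed\<close>)
    then show ?case using c P.zero_closed by blast
  next
    case (Suc k)
    then obtain g where g: "g \<in> carrier (ps R)" "ord_ge R k (g \<otimes>\<^bsub>ps R\<^esub> F \<ominus>\<^bsub>ps R\<^esub> U)" "ord_ge R k (g \<otimes>\<^bsub>ps R\<^esub> G \<ominus>\<^bsub>ps R\<^esub> V)" by auto
    define x where "x = g \<otimes>\<^bsub>ps R\<^esub> F \<ominus>\<^bsub>ps R\<^esub> U"
    define y where "y = g \<otimes>\<^bsub>ps R\<^esub> G \<ominus>\<^bsub>ps R\<^esub> V"
    have xy: "ord_ge R k x" "ord_ge R k y" "x \<in> carrier (ps R)" "y \<in> carrier (ps R)"
      using g c by (simp_all add: x_def y_def)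
    have "x \<otimes>\<^bsub>ps R\<^esub> G \<ominus>\<^bsub>ps R\<^esub> F \<otimes>\<^bsub>ps R\<^esub> y = F \<otimes>\<^bsub>ps R\<^esub> V \<ominus>\<^bsub>ps R\<^esub> U \<otimes>\<^bsub>ps R\<^esub> G"
      unfolding x_def y_def using c g(1) by algebra
    then have o: "ord_ge R l (G \<otimes>\<^bsub>ps R\<^esub> x \<ominus>\<^bsub>ps R\<^esub> F \<otimes>\<^bsub>ps R\<^esub> y)" using FG P.m_comm[OF xy(3) c(2)] by simp
    have kc: "x k \<in> carrier R" "y k \<in> carrier R" "F 0 \<in> carrier R" "G 0 \<in> carrier R" using xy c by (simp_all add: ps_carrierD)
    have "(G \<otimes>\<^bsub>ps R\<^esub> x) k = G 0 \<otimes> x k" "(F \<otimes>\<^bsub>ps R\<^esub> y) k = F 0 \<otimes> y k"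
      using lowest_mult_ord[OF c(2) xy(1), of 0 0] lowest_mult_ord[OF c(1) xy(2), of 0 0] by simp_all
    moreover have "(G \<otimes>\<^bsub>ps R\<^esub> x \<ominus>\<^bsub>ps R\<^esub> F \<otimes>\<^bsub>ps R\<^esub> y) k = (G \<otimes>\<^bsub>ps R\<^esub> x) k \<ominus> (F \<otimes>\<^bsub>ps R\<^esub> y) k"
      by (rule ps_minus) (use c xy in simp_all)
    moreover have "(G \<otimes>\<^bsub>ps R\<^esub> x \<ominus>\<^bsub>ps R\<^esub> F \<otimes>\<^bsub>ps R\<^esub> y) k = \<zero>" using o Suc.prems by (simp add: ord_ge_def)
    ultimately have "G 0 \<otimes> x k \<ominus> F 0 \<otimes> y k = \<zero>" by simp
    then have eq: "F 0 \<otimes> y k = G 0 \<otimes> x k" using kc by (simp add: r_right_minus_eq)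
    then obtain z where z: "z \<in> carrier R" "x k = F 0 \<otimes> z" using cop[OF kc(2,1) eq] by (auto elim: dividesE2)
    have "F 0 \<otimes> y k = F 0 \<otimes> (G 0 \<otimes> z)" unfolding eq z(2) using kc z(1) by (simp add: m_lcomm)
    then have yz: "y k = G 0 \<otimes> z" using m_lcancel[OF p kc(3) kc(2)] kc z(1) by simp
    let ?X = "psX R [^]\<^bsub>ps R\<^esub> k"
    define w where "w = ?X \<otimes>\<^bsub>ps R\<^esub> const R z"
    have w: "w \<in> carrier (ps R)" using z by (simp add: w_def)
    have wo: "ord_ge R k w" using psX_pow_nth[OF const_closed[OF z(1)], of k] w by (simp add: ord_ge_def w_def)
    have wk: "w k = z" using psX_pow_nth[OF const_closed[OF z(1)], of k k] by (simp add: w_def)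
    have upd: "ord_ge R (Suc k) (x' \<ominus>\<^bsub>ps R\<^esub> H \<otimes>\<^bsub>ps R\<^esub> w)"
      if H: "H \<in> carrier (ps R)" and x': "ord_ge R k x'" "x' k = H 0 \<otimes> z" for H x'
    proof -
      have x'c: "x' \<in> carrier (ps R)" using x' by (simp add: ord_ge_def)
      have ok: "ord_ge R k (x' \<ominus>\<^bsub>ps R\<^esub> H \<otimes>\<^bsub>ps R\<^esub> w)" by (rule ord_ge_minus[OF x'(1) ord_ge_mult_right[OF H wo]])
      have "(H \<otimes>\<^bsub>ps R\<^esub> w) k = H 0 \<otimes> w k" using lowest_mult_ord[OF H wo, of 0 0] by simp
      moreover have "(x' \<ominus>\<^bsub>ps R\<^esub> H \<otimes>\<^bsub>ps R\<^esub> w) k = x' k \<ominus> (H \<otimes>\<^bsub>ps R\<^esub> w) k" by (rule ps_minus) (use x'c H w in simp_all)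
      moreover have "H 0 \<otimes> z \<in> carrier R" using H z by (simp add: ps_carrierD)
      ultimately have "(x' \<ominus>\<^bsub>ps R\<^esub> H \<otimes>\<^bsub>ps R\<^esub> w) k = \<zero>" using x'(2) wk by (simp add: a_minus_def r_neg)
      then show ?thesis using ok by (auto simp: ord_ge_def less_Suc_eq)
    qed
    have e1: "(g \<ominus>\<^bsub>ps R\<^esub> w) \<otimes>\<^bsub>ps R\<^esub> F \<ominus>\<^bsub>ps R\<^esub> U = x \<ominus>\<^bsub>ps R\<^esub> F \<otimes>\<^bsub>ps R\<^esub> w"
      unfolding x_def using c g(1) w by algebra
    have e2: "(g \<ominus>\<^bsub>ps R\<^esub> w) \<otimes>\<^bsub>ps R\<^esub> G \<ominus>\<^bsub>ps R\<^esub> V = y \<ominus>\<^bsub>ps R\<^esub> G \<otimes>\<^bsub>ps R\<^esub> w"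
      unfolding y_def using c g(1) w by algebra
    have "ord_ge R (Suc k) (x \<ominus>\<^bsub>ps R\<^esub> F \<otimes>\<^bsub>ps R\<^esub> w)" by (rule upd[OF c(1) xy(1) z(2)])
    moreover have "ord_ge R (Suc k) (y \<ominus>\<^bsub>ps R\<^esub> G \<otimes>\<^bsub>ps R\<^esub> w)" by (rule upd[OF c(2) xy(2) yz])
    ultimately show ?case by (intro bexI[of _ "g \<ominus>\<^bsub>ps R\<^esub> w"] conjI) (simp_all only: e1 e2 P.minus_closed[OF g(1) w])
  qed
  then show ?thesis by blast
qed

end

section \<open>Solving the equation in two variables\<close>

context domain
begin

text \<open>
  The equation \<open>c \<cdot> G = s \<cdot> F\<close> is solved degree by degree. A solution on the curve
  \<open>(t\<^bsup>n+1\<^esup>, t\<^bsup>n+2\<^esup>)\<close> determines, up to a common factor, the homogeneous corrections of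
  degree \<open>n\<close>.
\<close>

lemma homogeneous_correction:
  assumes c: "c \<in> carrier (ps (ps R))" "s \<in> carrier (ps (ps R))" "c 0 0 \<noteq> \<zero>"
    and p: "p \<in> carrier R" "q \<in> carrier R" "p \<noteq> \<zero>"
    and cop: "\<And>z w. z \<in> carrier R \<Longrightarrow> w \<in> carrier R \<Longrightarrow> p \<otimes> z = q \<otimes> w \<Longrightarrow> p divides w"
    and curves: "f \<in> carrier (ps R)" "g \<in> carrier (ps R)" "f 0 = p" "g 0 = q"
      "curve R (Suc n) c \<otimes>\<^bsub>ps R\<^esub> g = curve R (Suc n) s \<otimes>\<^bsub>ps R\<^esub> f"
    and F: "F \<in> carrier (ps (ps R))" "G \<in> carrier (ps (ps R))"
    and e: "deg_ge R n (c \<otimes>\<^bsub>ps (ps R)\<^esub> G \<ominus>\<^bsub>ps (ps R)\<^esub> s \<otimes>\<^bsub>ps (ps R)\<^esub> F)"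
  shows "\<exists>A D. deg_ge R n A \<and> deg_ge R n D \<and>
    deg_ge R (Suc n) (c \<otimes>\<^bsub>ps (ps R)\<^esub> (G \<oplus>\<^bsub>ps (ps R)\<^esub> D) \<ominus>\<^bsub>ps (ps R)\<^esub> s \<otimes>\<^bsub>ps (ps R)\<^esub> (F \<oplus>\<^bsub>ps (ps R)\<^esub> A))"
proof -
  interpret P: domain "ps R" by (rule ps_domain)
  interpret Q: domain "ps (ps R)" by (rule P.ps_domain)
  let ?\<phi> = "curve R (Suc n)"
  interpret h: ring_hom_cring "ps (ps R)" "ps R" ?\<phi> by (rule curve_hom) simp
  define E where "E = c \<otimes>\<^bsub>ps (ps R)\<^esub> G \<ominus>\<^bsub>ps (ps R)\<^esub> s \<otimes>\<^bsub>ps (ps R)\<^esub> F"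
  define L where "L = n * Suc n"
  define a where "a = ?\<phi> c"
  define b where "b = ?\<phi> s"
  define U where "U = ?\<phi> F"
  define V where "V = ?\<phi> G"
  have Ec: "E \<in> carrier (ps (ps R))" using c F by (simp add: E_def)
  have Ed: "deg_ge R n E" using e by (simp add: E_def)
  have cl: "a \<in> carrier (ps R)" "b \<in> carrier (ps R)" "U \<in> carrier (ps R)" "V \<in> carrier (ps R)"
    using c F by (simp_all add: a_def b_def U_def V_def)
  have \<phi>E: "?\<phi> E = a \<otimes>\<^bsub>ps R\<^esub> V \<ominus>\<^bsub>ps R\<^esub> b \<otimes>\<^bsub>ps R\<^esub> U"
    using c F unfolding E_def a_def b_def U_def V_def by (simp add: a_minus_def)
  have \<phi>Eo: "ord_ge R L (?\<phi> E)" using curve_deg(1)[OF Ed] by (simp add: L_def)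
  have ag: "a \<otimes>\<^bsub>ps R\<^esub> g = b \<otimes>\<^bsub>ps R\<^esub> f" using curves(5) by (simp add: a_def b_def)
  have a0: "a 0 = c 0 0" "b 0 = s 0 0" using curve_low(1) c by (simp_all add: a_def b_def)
  have 1: "a \<otimes>\<^bsub>ps R\<^esub> (f \<otimes>\<^bsub>ps R\<^esub> V \<ominus>\<^bsub>ps R\<^esub> U \<otimes>\<^bsub>ps R\<^esub> g) = f \<otimes>\<^bsub>ps R\<^esub> (a \<otimes>\<^bsub>ps R\<^esub> V) \<ominus>\<^bsub>ps R\<^esub> U \<otimes>\<^bsub>ps R\<^esub> (a \<otimes>\<^bsub>ps R\<^esub> g)"
    using cl curves(1,2) by algebra
  have 2: "f \<otimes>\<^bsub>ps R\<^esub> (a \<otimes>\<^bsub>ps R\<^esub> V \<ominus>\<^bsub>ps R\<^esub> b \<otimes>\<^bsub>ps R\<^esub> U) = f \<otimes>\<^bsub>ps R\<^esub> (a \<otimes>\<^bsub>ps R\<^esub> V) \<ominus>\<^bsub>ps R\<^esub> U \<otimes>\<^bsub>ps R\<^esub> (b \<otimes>\<^bsub>ps R\<^esub> f)"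
    using cl curves(1,2) by algebra
  \<comment> \<open>Because \<open>a g = b f\<close>, crossing the exact pair with the approximate
    one yields, after multiplication by \<open>a\<close>, just \<open>f\<close> times the error;
    \<open>a\<close> is cancelled afterwards since its constant term is nonzero.\<close>
  have "ord_ge R L (a \<otimes>\<^bsub>ps R\<^esub> (f \<otimes>\<^bsub>ps R\<^esub> V \<ominus>\<^bsub>ps R\<^esub> U \<otimes>\<^bsub>ps R\<^esub> g))"
    unfolding 1 ag 2[symmetric] \<phi>E[symmetric] by (rule ord_ge_mult_right[OF curves(1) \<phi>Eo])
  then have "ord_ge R L (f \<otimes>\<^bsub>ps R\<^esub> V \<ominus>\<^bsub>ps R\<^esub> U \<otimes>\<^bsub>ps R\<^esub> g)"
    by (rule ord_ge_cancel[rotated -1]) (simp_all only: a0 c(3) cl curves P.m_closed P.minus_closed not_False_eq_True)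
  then have "\<exists>\<gamma>\<in>carrier (ps R). ord_ge R L (\<gamma> \<otimes>\<^bsub>ps R\<^esub> f \<ominus>\<^bsub>ps R\<^esub> U) \<and> ord_ge R L (\<gamma> \<otimes>\<^bsub>ps R\<^esub> g \<ominus>\<^bsub>ps R\<^esub> V)"
    using approx_multiple[OF curves(1,2) cl(3,4)] p(3) cop unfolding curves(3,4) by blast
  then obtain \<gamma> where \<gamma>: "\<gamma> \<in> carrier (ps R)" "ord_ge R L (\<gamma> \<otimes>\<^bsub>ps R\<^esub> f \<ominus>\<^bsub>ps R\<^esub> U)" "ord_ge R L (\<gamma> \<otimes>\<^bsub>ps R\<^esub> g \<ominus>\<^bsub>ps R\<^esub> V)"
    by blast
  \<comment> \<open>\<open>\<gamma>\<close> times \<open>f\<close> and \<open>g\<close> solves the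
    equation on the curve exactly and agrees with \<open>U\<close> and \<open>V\<close> below degree
    \<open>L\<close>. The differences are the corrections sought, as seen along the curve.\<close>
  define x where "x = \<gamma> \<otimes>\<^bsub>ps R\<^esub> f \<ominus>\<^bsub>ps R\<^esub> U"
  define y where "y = \<gamma> \<otimes>\<^bsub>ps R\<^esub> g \<ominus>\<^bsub>ps R\<^esub> V"
  have xy: "ord_ge R L x" "ord_ge R L y" using \<gamma> by (simp_all add: x_def y_def)
  have xyc: "x \<in> carrier (ps R)" "y \<in> carrier (ps R)" using xy by (simp_all add: ord_ge_def)
  have "a \<otimes>\<^bsub>ps R\<^esub> y \<ominus>\<^bsub>ps R\<^esub> b \<otimes>\<^bsub>ps R\<^esub> x = \<gamma> \<otimes>\<^bsub>ps R\<^esub> (a \<otimes>\<^bsub>ps R\<^esub> g \<ominus>\<^bsub>ps R\<^esub> b \<otimes>\<^bsub>ps R\<^esub> f) \<ominus>\<^bsub>ps R\<^esub> (a \<otimes>\<^bsub>ps R\<^esub> V \<ominus>\<^bsub>ps R\<^esub> b \<otimes>\<^bsub>ps R\<^esub> U)"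
    unfolding x_def y_def using cl curves(1,2) \<gamma>(1) by algebra
  also have "\<dots> = \<gamma> \<otimes>\<^bsub>ps R\<^esub> \<zero>\<^bsub>ps R\<^esub> \<ominus>\<^bsub>ps R\<^esub> ?\<phi> E"
    unfolding ag \<phi>E P.r_neg[OF P.m_closed[OF cl(2) curves(1)], folded a_minus_def] by (rule refl)
  also have "\<dots> = \<ominus>\<^bsub>ps R\<^esub> ?\<phi> E" using \<gamma>(1) h.hom_closed[OF Ec] by algebra
  finally have eq: "a \<otimes>\<^bsub>ps R\<^esub> y \<ominus>\<^bsub>ps R\<^esub> b \<otimes>\<^bsub>ps R\<^esub> x = \<ominus>\<^bsub>ps R\<^esub> ?\<phi> E" .
  \<comment> \<open>Thanks to the gap in degrees 1 to \<open>n\<close>, the series \<open>a\<close>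
    and \<open>b\<close> act on the coefficients \<open>L\<close> to \<open>L + n\<close> as the
    constants \<open>c 0 0\<close> and \<open>s 0 0\<close>, exactly as \<open>c\<close> and
    \<open>s\<close> act on a lowest homogeneous component.\<close>
  have coeff: "c 0 0 \<otimes> y (L + j) \<ominus> s 0 0 \<otimes> x (L + j) = \<ominus> E j (n - j)" if j: "j \<le> n" for j
  proof -
    have "(a \<otimes>\<^bsub>ps R\<^esub> y) (L + j) = a 0 \<otimes> y (L + j)"
      by (rule lowest_mult_ord[OF cl(1) xy(2) _ j]) (use curve_low(2)[OF c(1)] in \<open>simp add: a_def\<close>)
    moreover have "(b \<otimes>\<^bsub>ps R\<^esub> x) (L + j) = b 0 \<otimes> x (L + j)"
      by (rule lowest_mult_ord[OF cl(2) xy(1) _ j]) (use curve_low(2)[OF c(2)] in \<open>simp add: b_def\<close>)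
    moreover have "(a \<otimes>\<^bsub>ps R\<^esub> y \<ominus>\<^bsub>ps R\<^esub> b \<otimes>\<^bsub>ps R\<^esub> x) (L + j) = (a \<otimes>\<^bsub>ps R\<^esub> y) (L + j) \<ominus> (b \<otimes>\<^bsub>ps R\<^esub> x) (L + j)"
      by (rule ps_minus) (use cl xyc in simp_all)
    moreover have "(\<ominus>\<^bsub>ps R\<^esub> ?\<phi> E) (L + j) = \<ominus> (?\<phi> E (L + j))" by (rule ps_a_inv[OF h.hom_closed[OF Ec]])
    moreover have "?\<phi> E (L + j) = E j (n - j)" using curve_deg(2)[OF Ed j] by (simp add: L_def)
    ultimately show ?thesis using eq a0 by metis
  qed
  \<comment> \<open>The \<open>n + 1\<close> coefficients from \<open>t^L\<close> on are read back
    as a homogeneous polynomial of degree \<open>n\<close>; all later ones are discarded.\<close>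
  define A where "A = (\<lambda>j i. if i + j = n then x (L + j) else \<zero>)"
  define D where "D = (\<lambda>j i. if i + j = n then y (L + j) else \<zero>)"
  have Ad: "deg_ge R n A" "deg_ge R n D"
    using xyc by (auto simp: deg_ge_def A_def D_def ps_carrier ps_carrierD)
  then have Ac: "A \<in> carrier (ps (ps R))" "D \<in> carrier (ps (ps R))" by (simp_all add: deg_ge_def)
  define W where "W = c \<otimes>\<^bsub>ps (ps R)\<^esub> D \<ominus>\<^bsub>ps (ps R)\<^esub> s \<otimes>\<^bsub>ps (ps R)\<^esub> A"
  have Wd: "deg_ge R n W" unfolding W_def by (intro deg_ge_minus deg_ge_mult_right c Ad)
  have e': "c \<otimes>\<^bsub>ps (ps R)\<^esub> (G \<oplus>\<^bsub>ps (ps R)\<^esub> D) \<ominus>\<^bsub>ps (ps R)\<^esub> s \<otimes>\<^bsub>ps (ps R)\<^esub> (F \<oplus>\<^bsub>ps (ps R)\<^esub> A) = E \<oplus>\<^bsub>ps (ps R)\<^esub> W"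
    unfolding E_def W_def using c(1,2) F Ac by algebra
  have "(E \<oplus>\<^bsub>ps (ps R)\<^esub> W) j i = \<zero>" if ij: "i + j = n" for i j
  proof -
    have "W j i = (c \<otimes>\<^bsub>ps (ps R)\<^esub> D) j i \<ominus> (s \<otimes>\<^bsub>ps (ps R)\<^esub> A) j i"
      unfolding W_def by (rule ps2_minus_nth) (use c Ac in simp_all)
    also have "\<dots> = c 0 0 \<otimes> D j i \<ominus> s 0 0 \<otimes> A j i"
      using lowest_mult_deg[OF c(1) Ad(2) ij] lowest_mult_deg[OF c(2) Ad(1) ij] by argo
    also have "\<dots> = c 0 0 \<otimes> y (L + j) \<ominus> s 0 0 \<otimes> x (L + j)" using ij by (simp add: A_def D_def)
    also have "\<dots> = \<ominus> E j (n - j)" by (rule coeff) (use ij in simp)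
    also have "n - j = i" using ij by simp
    finally show ?thesis unfolding ps2_add_nth using ps_carrierD[OF ps_carrierD[OF Ec]] r_neg by metis
  qed
  moreover have "deg_ge R n (E \<oplus>\<^bsub>ps (ps R)\<^esub> W)" by (rule deg_ge_add[OF Ed Wd])
  ultimately have "deg_ge R (Suc n) (E \<oplus>\<^bsub>ps (ps R)\<^esub> W)" unfolding deg_ge_def by (metis less_Suc_eq)
  then show ?thesis using Ad unfolding e'[symmetric] by blast
qed

lemma solution_from_curves:
  assumes c: "c \<in> carrier (ps (ps R))" "s \<in> carrier (ps (ps R))" "c 0 0 \<noteq> \<zero>"
    and p: "p \<in> carrier R" "q \<in> carrier R" "p \<noteq> \<zero>"
    and cop: "\<And>z w. z \<in> carrier R \<Longrightarrow> w \<in> carrier R \<Longrightarrow> p \<otimes> z = q \<otimes> w \<Longrightarrow> p divides w"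
    and cs: "c 0 0 \<otimes> q = s 0 0 \<otimes> p"
    and curves: "\<And>n. 0 < n \<Longrightarrow> \<exists>f\<in>carrier (ps R). \<exists>g\<in>carrier (ps R). f 0 = p \<and> g 0 = q \<and>
      curve R (Suc n) c \<otimes>\<^bsub>ps R\<^esub> g = curve R (Suc n) s \<otimes>\<^bsub>ps R\<^esub> f"
  shows "\<exists>F\<in>carrier (ps (ps R)). \<exists>G\<in>carrier (ps (ps R)). F 0 0 = p \<and> G 0 0 = q \<and>
    c \<otimes>\<^bsub>ps (ps R)\<^esub> G = s \<otimes>\<^bsub>ps (ps R)\<^esub> F"
proof -
  interpret P: domain "ps R" by (rule ps_domain)
  interpret Q: domain "ps (ps R)" by (rule P.ps_domain)
  define err where "err = (\<lambda>F G. c \<otimes>\<^bsub>ps (ps R)\<^esub> G \<ominus>\<^bsub>ps (ps R)\<^esub> s \<otimes>\<^bsub>ps (ps R)\<^esub> F)"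
  define ok where "ok = (\<lambda>n (F, G). F \<in> carrier (ps (ps R)) \<and> G \<in> carrier (ps (ps R)) \<and> F 0 0 = p \<and> G 0 0 = q
    \<and> deg_ge R (Suc n) (err F G))"
  define ext :: "nat \<Rightarrow> (nat \<Rightarrow> nat \<Rightarrow> 'a) \<times> (nat \<Rightarrow> nat \<Rightarrow> 'a) \<Rightarrow> (nat \<Rightarrow> nat \<Rightarrow> 'a) \<times> (nat \<Rightarrow> nat \<Rightarrow> 'a) \<Rightarrow> bool"
    where "ext = (\<lambda>n u v. \<forall>j i. i + j < Suc n \<longrightarrow> fst v j i = fst u j i \<and> snd v j i = snd u j i)"
  have "\<exists>u. \<forall>n. ok n (u n) \<and> ext n (u n) (u (Suc n))"
  proof (rule dependent_nat_choice)
    \<comment> \<open>The start is a pair of constants, whose error in degree zero vanishes by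
      \<open>cs\<close>; hence curves are required for positive \<open>n\<close> only.\<close>
    let ?F = "const (ps R) (const R p)" let ?G = "const (ps R) (const R q)"
    have cl: "?F \<in> carrier (ps (ps R))" "?G \<in> carrier (ps (ps R))" using p by simp_all
    have "err ?F ?G 0 0 = c 0 0 \<otimes> q \<ominus> s 0 0 \<otimes> p"
      unfolding err_def using ps2_minus_nth[OF Q.m_closed[OF c(1) cl(2)] Q.m_closed[OF c(2) cl(1)], of 0 0] by simp
    also have "\<dots> = \<zero>" using cs c(2) p by (simp add: a_minus_def r_neg ps_carrierD)
    finally have "deg_ge R 1 (err ?F ?G)" using c cl by (simp add: deg_ge_def err_def)
    then have "ok 0 (?F, ?G)" using cl by (simp add: ok_def)
    then show "\<exists>u. ok 0 u" by blast
  next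
    fix u n
    assume u: "ok n u"
    obtain F G where FG: "u = (F, G)" by (cases u)
    have F: "F \<in> carrier (ps (ps R))" "G \<in> carrier (ps (ps R))" "F 0 0 = p" "G 0 0 = q"
      and d: "deg_ge R (Suc n) (err F G)" using u by (simp_all add: FG ok_def)
    obtain f g where fg: "f \<in> carrier (ps R)" "g \<in> carrier (ps R)" "f 0 = p" "g 0 = q"
      "curve R (Suc (Suc n)) c \<otimes>\<^bsub>ps R\<^esub> g = curve R (Suc (Suc n)) s \<otimes>\<^bsub>ps R\<^esub> f" using curves[of "Suc n"] by auto
    \<comment> \<open>The error starts in degree \<open>Suc n\<close>, so the curve of index
      \<open>Suc (Suc n)\<close> is the one that resolves it. Corrections of positive degree leave
      the constants \<open>p\<close> and \<open>q\<close> alone.\<close>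
    have "\<exists>A D. deg_ge R (Suc n) A \<and> deg_ge R (Suc n) D \<and>
      deg_ge R (Suc (Suc n)) (c \<otimes>\<^bsub>ps (ps R)\<^esub> (G \<oplus>\<^bsub>ps (ps R)\<^esub> D) \<ominus>\<^bsub>ps (ps R)\<^esub> s \<otimes>\<^bsub>ps (ps R)\<^esub> (F \<oplus>\<^bsub>ps (ps R)\<^esub> A))"
      by (rule homogeneous_correction[OF c p _ fg F(1,2) d[unfolded err_def]]) (rule cop)
    then obtain A D where AD: "deg_ge R (Suc n) A" "deg_ge R (Suc n) D"
      "deg_ge R (Suc (Suc n)) (c \<otimes>\<^bsub>ps (ps R)\<^esub> (G \<oplus>\<^bsub>ps (ps R)\<^esub> D) \<ominus>\<^bsub>ps (ps R)\<^esub> s \<otimes>\<^bsub>ps (ps R)\<^esub> (F \<oplus>\<^bsub>ps (ps R)\<^esub> A))"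
      by blast
    let ?v = "(F \<oplus>\<^bsub>ps (ps R)\<^esub> A, G \<oplus>\<^bsub>ps (ps R)\<^esub> D)"
    have same: "(H \<oplus>\<^bsub>ps (ps R)\<^esub> K) j i = H j i"
      if "H \<in> carrier (ps (ps R))" "deg_ge R (Suc n) K" "i + j < Suc n" for H K i j
      using that ps_carrierD[OF ps_carrierD[OF that(1)], of j i] by (simp add: ps2_add_nth deg_ge_def)
    have cl: "F \<oplus>\<^bsub>ps (ps R)\<^esub> A \<in> carrier (ps (ps R))" "G \<oplus>\<^bsub>ps (ps R)\<^esub> D \<in> carrier (ps (ps R))"
      using F AD by (simp_all add: deg_ge_def)
    have "ok (Suc n) ?v" using cl AD(3) same[OF F(1) AD(1), of 0 0] same[OF F(2) AD(2), of 0 0] F(3,4)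
      by (simp only: ok_def err_def prod.case)
    moreover have "ext n u ?v" using same[OF F(1) AD(1)] same[OF F(2) AD(2)] by (simp add: ext_def FG)
    ultimately show "\<exists>v. ok (Suc n) v \<and> ext n u v" by blast
  qed
  then obtain u where u: "\<And>n. ok n (u n)" "\<And>n. ext n (u n) (u (Suc n))" by blast
  define Fs where "Fs n = fst (u n)" for n
  define Gs where "Gs n = snd (u n)" for n
  have s: "Fs n \<in> carrier (ps (ps R))" "Gs n \<in> carrier (ps (ps R))" "Fs n 0 0 = p" "Gs n 0 0 = q" "deg_ge R (Suc n) (err (Fs n) (Gs n))" for n
    using u(1)[of n] by (auto simp: ok_def Fs_def Gs_def split: prod.splits)
  have st: "Fs (i + j + k) j i = Fs (i + j) j i" "Gs (i + j + k) j i = Gs (i + j) j i" for i j k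
  proof (induction k)
    case (Suc k)
    { case 1 show ?case using u(2)[of "i + j + k"] Suc(1) by (simp add: ext_def Fs_def) }
    { case 2 show ?case using u(2)[of "i + j + k"] Suc(2) by (simp add: ext_def Gs_def) }
  qed simp_all
  \<comment> \<open>From stage \<open>i + j\<close> on, the coefficient of \<open>x^i y^j\<close> no
    longer changes.\<close>
  define F where "F = (\<lambda>j i. Fs (i + j) j i)"
  define G where "G = (\<lambda>j i. Gs (i + j) j i)"
  have cl: "F \<in> carrier (ps (ps R))" "G \<in> carrier (ps (ps R))"
    using ps_carrierD[OF ps_carrierD[OF s(1)]] ps_carrierD[OF ps_carrierD[OF s(2)]] by (simp_all add: F_def G_def ps_carrier)
  have agree: "deg_ge R m (H \<ominus>\<^bsub>ps (ps R)\<^esub> K)"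
    if "H \<in> carrier (ps (ps R))" "K \<in> carrier (ps (ps R))" "\<And>i j. i + j < m \<Longrightarrow> K j i = H j i" for H K m
  proof -
    have "(H \<ominus>\<^bsub>ps (ps R)\<^esub> K) j i = \<zero>" if "i + j < m" for i j
      unfolding ps2_minus_nth[OF \<open>H \<in> _\<close> \<open>K \<in> _\<close>] \<open>\<And>i j. _ \<Longrightarrow> K j i = H j i\<close>[OF that]
      by (simp only: a_minus_def r_neg ps_carrierD[OF ps_carrierD[OF \<open>H \<in> _\<close>]])
    then show ?thesis using that(1,2) unfolding deg_ge_def by blast
  qed
  have lim: "deg_ge R (Suc n) (F \<ominus>\<^bsub>ps (ps R)\<^esub> Fs n)" "deg_ge R (Suc n) (G \<ominus>\<^bsub>ps (ps R)\<^esub> Gs n)" for n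
  proof -
    have same: "Fs n j i = F j i" "Gs n j i = G j i" if "i + j < Suc n" for i j
      using st[of i j "n - (i + j)"] that by (simp_all add: F_def G_def)
    show "deg_ge R (Suc n) (F \<ominus>\<^bsub>ps (ps R)\<^esub> Fs n)" by (rule agree[OF cl(1) s(1) same(1)])
    show "deg_ge R (Suc n) (G \<ominus>\<^bsub>ps (ps R)\<^esub> Gs n)" by (rule agree[OF cl(2) s(2) same(2)])
  qed
  have E: "deg_ge R (Suc n) (err F G)" for n
  proof -
    have "err F G = err (Fs n) (Gs n) \<oplus>\<^bsub>ps (ps R)\<^esub> (c \<otimes>\<^bsub>ps (ps R)\<^esub> (G \<ominus>\<^bsub>ps (ps R)\<^esub> Gs n) \<ominus>\<^bsub>ps (ps R)\<^esub> s \<otimes>\<^bsub>ps (ps R)\<^esub> (F \<ominus>\<^bsub>ps (ps R)\<^esub> Fs n))"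
      unfolding err_def using c(1,2) cl s(1,2)[of n] by algebra
    moreover have "deg_ge R (Suc n) \<dots>" by (intro deg_ge_add deg_ge_minus deg_ge_mult_right s lim c)
    ultimately show ?thesis by simp
  qed
  have "err F G = \<zero>\<^bsub>ps (ps R)\<^esub>"
  proof (intro HOL.ext)
    fix j i show "err F G j i = \<zero>\<^bsub>ps (ps R)\<^esub> j i" using E[of "i + j"] by (simp add: deg_ge_def ps_zero)
  qed
  then have "c \<otimes>\<^bsub>ps (ps R)\<^esub> G = s \<otimes>\<^bsub>ps (ps R)\<^esub> F" using c cl by (simp add: err_def Q.r_right_minus_eq)
  moreover have "F 0 0 = p" "G 0 0 = q" using s by (simp_all add: F_def G_def)
  ultimately show ?thesis using cl by blast
qed

end

section \<open>Unique factorization over a factorial power series ring\<close>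

context domain
begin

text \<open>Division carried out coefficient by coefficient: as long as every remainder stays in
  \<open>M\<close>, the constants \<open>d\<close> produced on the way are the coefficients of the
  quotient.\<close>

lemma ps_dvd_coinduct:
  assumes F: "F \<in> carrier (ps R)" and M: "M \<subseteq> carrier (ps R)"
    and step: "\<And>a. a \<in> M \<Longrightarrow> \<exists>d\<in>carrier R. \<exists>a'\<in>M. a = const R d \<otimes>\<^bsub>ps R\<^esub> F \<oplus>\<^bsub>ps R\<^esub> psX R \<otimes>\<^bsub>ps R\<^esub> a'"
    and a: "a \<in> M"
  shows "F divides\<^bsub>ps R\<^esub> a"
proof -
  interpret P: domain "ps R" by (rule ps_domain)
  have "\<forall>a\<in>M. \<exists>da. fst da \<in> carrier R \<and> snd da \<in> M \<and> a = const R (fst da) \<otimes>\<^bsub>ps R\<^esub> F \<oplus>\<^bsub>ps R\<^esub> psX R \<otimes>\<^bsub>ps R\<^esub> snd da"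
  proof
    fix a assume "a \<in> M"
    from step[OF this] obtain d a' where "d \<in> carrier R" "a' \<in> M" "a = const R d \<otimes>\<^bsub>ps R\<^esub> F \<oplus>\<^bsub>ps R\<^esub> psX R \<otimes>\<^bsub>ps R\<^esub> a'" by blast
    then show "\<exists>da. fst da \<in> carrier R \<and> snd da \<in> M \<and> a = const R (fst da) \<otimes>\<^bsub>ps R\<^esub> F \<oplus>\<^bsub>ps R\<^esub> psX R \<otimes>\<^bsub>ps R\<^esub> snd da"
      by (intro exI[of _ "(d, a')"]) simp
  qed
  from bchoice[OF this] obtain D where D: "\<And>a. a \<in> M \<Longrightarrow> fst (D a) \<in> carrier R" "\<And>a. a \<in> M \<Longrightarrow> snd (D a) \<in> M"
      "\<And>a. a \<in> M \<Longrightarrow> a = const R (fst (D a)) \<otimes>\<^bsub>ps R\<^esub> F \<oplus>\<^bsub>ps R\<^esub> psX R \<otimes>\<^bsub>ps R\<^esub> snd (D a)" by blast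
  define as where "as i = ((\<lambda>a. snd (D a)) ^^ i) a" for i
  have as: "as i \<in> M" for i by (induction i) (simp_all add: as_def a D(2))
  define ds where "ds i = fst (D (as i))" for i
  have dc: "ds i \<in> carrier R" for i using D(1)[OF as] by (simp add: ds_def)
  have "as 0 = ds \<otimes>\<^bsub>ps R\<^esub> F"
  proof (rule ps_limit[OF F _ dc])
    show "as i \<in> carrier (ps R)" for i using as M by blast
    have "as (Suc i) = snd (D (as i))" for i by (simp add: as_def)
    then show "as i = const R (ds i) \<otimes>\<^bsub>ps R\<^esub> F \<oplus>\<^bsub>ps R\<^esub> psX R \<otimes>\<^bsub>ps R\<^esub> as (Suc i)" for i
      using D(3)[OF as, of i] by (simp add: ds_def)
  qed
  moreover have dsc: "ds \<in> carrier (ps R)" using dc by (simp add: ps_carrier)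
  ultimately have "a = F \<otimes>\<^bsub>ps R\<^esub> ds" using P.m_comm[OF dsc F] by (simp add: as_def)
  then show ?thesis using dsc by (intro dividesI2)
qed

lemma ps_diff_eq:
  assumes b: "b \<in> carrier (ps R)" and e: "e \<in> carrier (ps R)" and be: "b 0 = e 0"
  shows "b = e \<oplus>\<^bsub>ps R\<^esub> psX R \<otimes>\<^bsub>ps R\<^esub> shift (b \<ominus>\<^bsub>ps R\<^esub> e)"
proof -
  interpret P: domain "ps R" by (rule ps_domain)
  have "(b \<ominus>\<^bsub>ps R\<^esub> e) 0 = \<zero>" using b e be by (simp add: ps_carrierD a_minus_def r_neg)
  then have "psX R \<otimes>\<^bsub>ps R\<^esub> shift (b \<ominus>\<^bsub>ps R\<^esub> e) = b \<ominus>\<^bsub>ps R\<^esub> e"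
    by (rule ps_psX_eq[OF P.minus_closed[OF b e], symmetric])
  moreover have "b = e \<oplus>\<^bsub>ps R\<^esub> (b \<ominus>\<^bsub>ps R\<^esub> e)" using b e by algebra
  ultimately show ?thesis by simp
qed

lemma ps_unitI:
  assumes a: "a \<in> carrier (ps R)" "a 0 \<in> Units R"
  shows "a \<in> Units (ps R)"
proof -
  interpret P: domain "ps R" by (rule ps_domain)
  have "a divides\<^bsub>ps R\<^esub> \<one>\<^bsub>ps R\<^esub>"
  proof (rule ps_dvd_coinduct[OF a(1) subset_refl _ P.one_closed])
    fix b assume b: "b \<in> carrier (ps R)"
    let ?d = "b 0 \<otimes> inv (a 0)"
    have d: "?d \<in> carrier R" using a b by (simp add: ps_carrierD)
    have e: "const R ?d \<otimes>\<^bsub>ps R\<^esub> a \<in> carrier (ps R)" using d a by simp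
    have "b 0 = (const R ?d \<otimes>\<^bsub>ps R\<^esub> a) 0" using a b by (simp add: m_assoc ps_carrierD)
    from ps_diff_eq[OF b e this] show "\<exists>d\<in>carrier R. \<exists>b'\<in>carrier (ps R). b = const R d \<otimes>\<^bsub>ps R\<^esub> a \<oplus>\<^bsub>ps R\<^esub> psX R \<otimes>\<^bsub>ps R\<^esub> b'"
      using d ps_shift_closed[OF P.minus_closed[OF b e]] by blast
  qed
  then obtain c where "c \<in> carrier (ps R)" "\<one>\<^bsub>ps R\<^esub> = a \<otimes>\<^bsub>ps R\<^esub> c" by (rule dividesE2)
  then show ?thesis using a(1) P.m_comm[of a c] unfolding Units_def by auto
qed

text \<open>\<open>F 0\<close> divides \<open>a 0\<close>, and subtracting the matching multiple of
  \<open>F\<close> leaves \<open>X\<close> times an element with the same property, since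
  \<open>X\<close> does not divide \<open>F\<close>. The hypothesis \<open>cop\<close> has the shape
  of the conclusion, so the lemma can be iterated over the variables.\<close>

lemma ps_coprime_lift:
  assumes F: "F \<in> carrier (ps R)" "F 0 \<noteq> \<zero>" and G: "G \<in> carrier (ps R)"
    and cop: "\<And>w. w \<in> carrier R \<Longrightarrow> F 0 divides (G 0 \<otimes> w) \<Longrightarrow> F 0 divides w"
    and a: "a \<in> carrier (ps R)" "F divides\<^bsub>ps R\<^esub> (G \<otimes>\<^bsub>ps R\<^esub> a)"
  shows "F divides\<^bsub>ps R\<^esub> a"
proof (rule ps_dvd_coinduct[OF F(1)])
  interpret P: domain "ps R" by (rule ps_domain)
  let ?M = "{a \<in> carrier (ps R). F divides\<^bsub>ps R\<^esub> (G \<otimes>\<^bsub>ps R\<^esub> a)}"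
  show "?M \<subseteq> carrier (ps R)" "a \<in> ?M" using a by auto
  fix a assume "a \<in> ?M"
  then obtain b where a: "a \<in> carrier (ps R)" and b: "b \<in> carrier (ps R)" "G \<otimes>\<^bsub>ps R\<^esub> a = F \<otimes>\<^bsub>ps R\<^esub> b"
    by (auto elim: dividesE2)
  have "G 0 \<otimes> a 0 = F 0 \<otimes> b 0" using arg_cong[OF b(2), of "\<lambda>f. f 0"] by simp
  then have "F 0 divides (G 0 \<otimes> a 0)" using b by (intro dividesI2[of "b 0"]) (simp_all add: ps_carrierD)
  then have "F 0 divides a 0" by (rule cop[OF ps_carrierD[OF a]])
  then obtain d where d: "d \<in> carrier R" "a 0 = F 0 \<otimes> d" by (rule dividesE2)
  define k where "k = const R d"
  have k: "k \<in> carrier (ps R)" using d by (simp add: k_def)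
  define a' where "a' = shift (a \<ominus>\<^bsub>ps R\<^esub> k \<otimes>\<^bsub>ps R\<^esub> F)"
  have kF: "k \<otimes>\<^bsub>ps R\<^esub> F \<in> carrier (ps R)" using k F by simp
  have a': "a' \<in> carrier (ps R)" unfolding a'_def by (rule ps_shift_closed[OF P.minus_closed[OF a kF]])
  have "a 0 = (k \<otimes>\<^bsub>ps R\<^esub> F) 0" using d m_comm[of "F 0" d] F by (simp add: k_def ps_carrierD)
  from ps_diff_eq[OF a kF this] have eq: "a = k \<otimes>\<^bsub>ps R\<^esub> F \<oplus>\<^bsub>ps R\<^esub> psX R \<otimes>\<^bsub>ps R\<^esub> a'" by (simp only: a'_def)
  have "psX R \<otimes>\<^bsub>ps R\<^esub> (G \<otimes>\<^bsub>ps R\<^esub> a') = G \<otimes>\<^bsub>ps R\<^esub> (k \<otimes>\<^bsub>ps R\<^esub> F \<oplus>\<^bsub>ps R\<^esub> psX R \<otimes>\<^bsub>ps R\<^esub> a') \<ominus>\<^bsub>ps R\<^esub> F \<otimes>\<^bsub>ps R\<^esub> (G \<otimes>\<^bsub>ps R\<^esub> k)"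
    using psX_closed F(1) G a' k by algebra
  also have "\<dots> = F \<otimes>\<^bsub>ps R\<^esub> b \<ominus>\<^bsub>ps R\<^esub> F \<otimes>\<^bsub>ps R\<^esub> (G \<otimes>\<^bsub>ps R\<^esub> k)" unfolding eq[symmetric] b(2) by (rule refl)
  also have "\<dots> = F \<otimes>\<^bsub>ps R\<^esub> (b \<ominus>\<^bsub>ps R\<^esub> G \<otimes>\<^bsub>ps R\<^esub> k)" using F(1) G b(1) k by algebra
  finally have "F divides\<^bsub>ps R\<^esub> (psX R \<otimes>\<^bsub>ps R\<^esub> (G \<otimes>\<^bsub>ps R\<^esub> a'))"
    by (rule dividesI2[rotated]) (rule P.minus_closed[OF b(1) P.m_closed[OF G k]])
  then have "F divides\<^bsub>ps R\<^esub> (G \<otimes>\<^bsub>ps R\<^esub> a')" by (rule psX_dvd_cancel[OF P.m_closed[OF G a'] F])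
  then show "\<exists>d\<in>carrier R. \<exists>a'\<in>?M. a = const R d \<otimes>\<^bsub>ps R\<^esub> F \<oplus>\<^bsub>ps R\<^esub> psX R \<otimes>\<^bsub>ps R\<^esub> a'"
    using d(1) a' eq unfolding k_def by blast
qed

lemma const_dvd_const_iff:
  assumes "a \<in> carrier R" "b \<in> carrier R"
  shows "const R a divides\<^bsub>ps R\<^esub> const R b \<longleftrightarrow> a divides b"
proof
  assume "const R a divides\<^bsub>ps R\<^esub> const R b"
  then obtain c where c: "c \<in> carrier (ps R)" "const R b = const R a \<otimes>\<^bsub>ps R\<^esub> c" by (rule dividesE2)
  have "b = a \<otimes> c 0" using arg_cong[OF c(2), of "\<lambda>f. f 0"] by simp
  then show "a divides b" using c by (intro dividesI2[of "c 0"]) (simp_all add: ps_carrierD)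
next
  interpret h: ring_hom_cring R "ps R" "const R" by (rule ps_hom)
  assume "a divides b"
  then obtain c where "c \<in> carrier R" "b = a \<otimes> c" by (rule dividesE2)
  then show "const R a divides\<^bsub>ps R\<^esub> const R b" using assms by (intro dividesI2[of "const R c"]) simp_all
qed

text \<open>A constant that is irreducible in \<open>R\<close> stays irreducible among power series,
  since a series with invertible constant term is a unit. It is then prime there, and divisibility
  between constants descends to \<open>R\<close>.\<close>

lemma factorial_of_ps:
  assumes "noetherian_ring R" "factorial_domain (ps R)"
  shows "factorial_domain R"
proof -
  interpret nR: noetherian_domain R using assms(1) domain_axioms by (simp add: noetherian_domain_def)
  interpret P: factorial_domain "ps R" by (rule assms)
  interpret h: ring_hom_cring R "ps R" "const R" by (rule ps_hom)
  show ?thesis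
  proof (rule nR.factorial_domainI)
    fix p assume p: "p \<in> carrier R" "p \<noteq> \<zero>" "p \<notin> Units R"
      and irr: "\<And>a b. a \<in> carrier R \<Longrightarrow> b \<in> carrier R \<Longrightarrow> p = a \<otimes> b \<Longrightarrow> a \<in> Units R \<or> b \<in> Units R"
    have kc: "const R p \<in> carrier (ps R)" using p by simp
    have unit0: "f 0 \<in> Units R" if f: "f \<in> Units (ps R)" for f
    proof -
      obtain g where "f \<in> carrier (ps R)" "g \<in> carrier (ps R)" "f \<otimes>\<^bsub>ps R\<^esub> g = \<one>\<^bsub>ps R\<^esub>" using f unfolding Units_def by auto
      then have "f 0 \<otimes> g 0 = \<one>" "f 0 \<in> carrier R" "g 0 \<in> carrier R" using ps_mult_0[of R f g] by (simp_all add: ps_carrierD)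
      then show ?thesis using m_comm[of "f 0" "g 0"] unfolding Units_def by auto
    qed
    have k0: "const R p \<noteq> \<zero>\<^bsub>ps R\<^esub>" using p(2) const_0[of p] by (metis ps_at_0(1))
    have kU: "const R p \<notin> Units (ps R)" using unit0[of "const R p"] p(3) by auto
    have kp: "prime_el (ps R) (const R p)"
    proof (rule P.irreducible_prime_el[OF kc k0 kU])
      fix a b assume ab: "a \<in> carrier (ps R)" "b \<in> carrier (ps R)" "const R p = a \<otimes>\<^bsub>ps R\<^esub> b"
      have "p = a 0 \<otimes> b 0" using arg_cong[OF ab(3), of "\<lambda>f. f 0"] by simp
      from irr[OF ps_carrierD[OF ab(1)] ps_carrierD[OF ab(2)] this]
      show "a \<in> Units (ps R) \<or> b \<in> Units (ps R)" using ps_unitI ab(1,2) by blast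
    qed
    have pr: "p divides a \<or> p divides b" if "p divides a \<otimes> b" "a \<in> carrier R" "b \<in> carrier R" for a b
    proof -
      have "const R p divides\<^bsub>ps R\<^esub> const R a \<otimes>\<^bsub>ps R\<^esub> const R b"
        using const_dvd_const_iff[OF p(1) m_closed[OF that(2,3)]] that(1) unfolding h.hom_mult[OF that(2,3)] by blast
      from P.prime_el_dvd[OF kp this const_closed[OF that(2)] const_closed[OF that(3)]]
      show ?thesis unfolding const_dvd_const_iff[OF p(1) that(2)] const_dvd_const_iff[OF p(1) that(3)] .
    qed
    show "prime_el R p" unfolding prime_el_def using p pr by (auto intro!: primeI)
  qed
qed

end

lemma (in factorial_domain) unit_if_no_prime_divisor:
  assumes "a \<in> carrier R" "a \<noteq> \<zero>" "\<And>p. prime_el R p \<Longrightarrow> \<not> p divides a"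
  shows "a \<in> Units R"
  using assms
proof (induction a rule: prime_induct)
  case (prime p a)
  then show ?case using dvd_selfI[of p a] prime_elD(1)[of p] by blast
qed

section \<open>From local generators to a global one\<close>

locale factorial_setting = domain R for R (structure) +
  assumes noeth: "noetherian_ring R" and fact: "factorial_domain (ps R)"
begin

abbreviation "C \<equiv> ps R"
abbreviation "B \<equiv> ps (ps R)"

sublocale factorial_domain R by (rule factorial_of_ps[OF noeth fact])
sublocale C: factorial_domain C by (rule fact)
sublocale B: domain B by (rule C.ps_domain)

lemma local_setting_nonzero: "local_setting R (carrier R - {\<zero>})"
proof (rule local_setting.intro[OF domain_axioms], rule local_setting_axioms.intro)
  fix I assume I: "ideal I R" "I \<noteq> {\<zero>}"
  interpret I: ideal I R by (rule I)
  obtain a where a: "a \<in> I" "a \<noteq> \<zero>" using I(2) I.zero_closed by blast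
  have "\<exists>t\<in>carrier R - {\<zero>}. a divides t \<otimes> b" if "b \<in> I" for b
    using a that by (intro bexI[of _ a] dvd_selfI) (auto simp: I.Icarr)
  then show "\<exists>a\<in>I. a \<noteq> \<zero> \<and> (\<forall>b\<in>I. \<exists>t\<in>carrier R - {\<zero>}. a divides t \<otimes> b)" using a by blast
qed (use noeth fact in \<open>auto simp: integral_iff\<close>)

text \<open>For the content \<open>d\<close> of \<open>I\<close> and a member
  \<open>d \<otimes> j\<close> with \<pi> not dividing \<open>j\<close>, multiplication by the
  denominator \<open>j\<close> makes every member of \<open>I\<close> divisible by
  \<open>d \<otimes> j\<close>.\<close>

lemma local_setting_prime:
  assumes p: "prime_el R \<pi>"
  shows "local_setting R {t \<in> carrier R. \<not> \<pi> divides t}"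
proof (rule local_setting.intro[OF domain_axioms], rule local_setting_axioms.intro)
  note pc = prime_elD[OF p]
  show "noetherian_ring R" "factorial_domain (ps R)" by (fact noeth, fact fact)
  show "\<one> \<in> {t \<in> carrier R. \<not> \<pi> divides t}" using prime_not_dvd_unit[OF p Units_one_closed] by simp
  show "\<zero> \<notin> {t \<in> carrier R. \<not> \<pi> divides t}" using divides_zero[OF pc(1)] by simp
  show "s \<otimes> t \<in> {t \<in> carrier R. \<not> \<pi> divides t}"
    if "s \<in> {t \<in> carrier R. \<not> \<pi> divides t}" "t \<in> {t \<in> carrier R. \<not> \<pi> divides t}" for s t
    using that prime_el_dvd[OF p, of s t] by auto
  show "s \<in> {t \<in> carrier R. \<not> \<pi> divides t}"
    if "s \<in> carrier R" "t \<in> carrier R" "s \<otimes> t \<in> {t \<in> carrier R. \<not> \<pi> divides t}" for s t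
    using that dvd_multI[of \<pi> s t] pc by auto
  fix I assume I: "ideal I R" "I \<noteq> {\<zero>}"
  interpret I: ideal I R by (rule I)
  obtain a where a: "a \<in> I" "a \<noteq> \<zero>" using I(2) I.zero_closed by blast
  obtain d where d: "d \<in> carrier R" "d \<noteq> \<zero>" "\<And>b. b \<in> I \<Longrightarrow> d divides b"
    "\<exists>j\<in>carrier R. d \<otimes> j \<in> I \<and> \<not> \<pi> divides j"
    using ideal_content[OF I(1) a] p by blast
  obtain j where j: "j \<in> carrier R" "d \<otimes> j \<in> I" "\<not> \<pi> divides j" using d(4) by blast
  have "j \<noteq> \<zero>" using j(3) divides_zero[OF pc(1)] by auto
  then have "d \<otimes> j \<noteq> \<zero>" using d j by (simp add: integral_iff)
  moreover have "\<exists>t\<in>{t \<in> carrier R. \<not> \<pi> divides t}. d \<otimes> j divides t \<otimes> b" if b: "b \<in> I" for b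
  proof -
    obtain e where e: "e \<in> carrier R" "b = d \<otimes> e" using d(3)[OF b] by (rule dividesE2)
    have "j \<otimes> b = (d \<otimes> j) \<otimes> e" unfolding e(2) using d(1) j(1) e(1) by algebra
    then show ?thesis using j e(1) by (intro bexI[of _ j] dividesI2[of e]) auto
  qed
  ultimately show "\<exists>a\<in>I. a \<noteq> \<zero> \<and> (\<forall>b\<in>I. \<exists>t\<in>{t \<in> carrier R. \<not> \<pi> divides t}. a divides t \<otimes> b)"
    using j(2) by blast
qed auto

lemma B_nth: "f \<in> carrier B \<Longrightarrow> f j i \<in> carrier R"
  by (simp add: ps_carrierD)

lemma constant_coefficient_ideal:
  assumes N: "ideal N B"
  shows "ideal {a 0 0 | a. a \<in> N} R"
proof (rule ideal_criterion)
  interpret N: additive_subgroup N B by (rule ideal.axioms(1)[OF N])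
  let ?A = "{a 0 0 | a. a \<in> N}"
  have AI: "a 0 0 \<in> ?A" if "a \<in> N" for a using that by blast
  show "?A \<subseteq> carrier R" using B_nth ideal.Icarr[OF N] by blast
  from AI[OF N.zero_closed] show "\<zero> \<in> ?A" by simp
  show "x \<oplus> y \<in> ?A" if xy: "x \<in> ?A" "y \<in> ?A" for x y
  proof -
    obtain a b where ab: "a \<in> N" "b \<in> N" "x = a 0 0" "y = b 0 0" using xy by blast
    from AI[OF N.a_closed[OF ab(1,2)]] show ?thesis by (simp only: ab(3,4) ps2_add_nth)
  qed
  show "r \<otimes> x \<in> ?A" if r: "r \<in> carrier R" "x \<in> ?A" for r x
  proof -
    obtain a where a: "a \<in> N" "x = a 0 0" using r(2) by blast
    have "const C (const R r) \<in> carrier B" using r(1) by simp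
    from AI[OF ideal.I_l_closed[OF N a(1) this]] show ?thesis by (simp only: a(2) ps_mult_0 const_0 C.const_0)
  qed
qed

text \<open>The generator is nonzero because \<open>g\<close> lies in the colon ideal, so
  \<open>s \<otimes> g\<close>, which is not zero, is a multiple of it.\<close>

lemma colon_local_generator:
  assumes f: "f \<in> carrier B" and g: "g \<in> carrier B" "g \<noteq> \<zero>\<^bsub>B\<^esub>" and T: "local_setting R T"
  obtains z s where "z \<in> carrier B" "z \<noteq> \<zero>\<^bsub>B\<^esub>" "g divides\<^bsub>B\<^esub> (z \<otimes>\<^bsub>B\<^esub> f)" "s \<in> carrier B" "s 0 0 \<in> T"
    "\<forall>h\<in>carrier B. g divides\<^bsub>B\<^esub> (h \<otimes>\<^bsub>B\<^esub> f) \<longrightarrow> z divides\<^bsub>B\<^esub> (s \<otimes>\<^bsub>B\<^esub> h)"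
proof -
  obtain z s where zs: "z \<in> carrier B" "g divides\<^bsub>B\<^esub> (z \<otimes>\<^bsub>B\<^esub> f)" "s \<in> carrier B" "s 0 0 \<in> T"
    "\<And>h. h \<in> carrier B \<Longrightarrow> g divides\<^bsub>B\<^esub> (h \<otimes>\<^bsub>B\<^esub> f) \<Longrightarrow> z divides\<^bsub>B\<^esub> (s \<otimes>\<^bsub>B\<^esub> h)"
    using local_setting.colon_locally_principal[OF T f g] local_setting.TB_def[OF T] by auto
  have "s \<noteq> \<zero>\<^bsub>B\<^esub>" using zs(4) local_setting.T_zero[OF T] by auto
  then have sg: "s \<otimes>\<^bsub>B\<^esub> g \<noteq> \<zero>\<^bsub>B\<^esub>" using zs(3) g by (simp add: B.integral_iff)
  obtain x where x: "x \<in> carrier B" "s \<otimes>\<^bsub>B\<^esub> g = z \<otimes>\<^bsub>B\<^esub> x"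
    using zs(5)[OF g(1) B.dvd_selfI[OF g(1) f]] by (rule dividesE2)
  then have "z \<noteq> \<zero>\<^bsub>B\<^esub>" using sg by auto
  then show ?thesis using that zs by blast
qed

text \<open>
  \<open>f1\<close> generates the colon ideal \<open>(g : f)\<close> generically, so that every other element is a fraction of it;
  the content of the constant coefficients of the numerators is \<open>\<sigma>\<close>.
\<close>

lemma colon_generators:
  assumes f: "f \<in> carrier B" and g: "g \<in> carrier B" "g \<noteq> \<zero>\<^bsub>B\<^esub>"
  obtains c s f1 g1 \<sigma> p q where "c \<in> carrier B" "s \<in> carrier B" "f1 \<in> carrier B" "g1 \<in> carrier B"
    "\<sigma> \<in> carrier R" "p \<in> carrier R" "q \<in> carrier R" "\<sigma> \<noteq> \<zero>" "p \<noteq> \<zero>" "c 0 0 = \<sigma> \<otimes> p" "s 0 0 = \<sigma> \<otimes> q"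
    "coprime_el R p q" "c \<otimes>\<^bsub>B\<^esub> g1 = s \<otimes>\<^bsub>B\<^esub> f1" "f1 \<noteq> \<zero>\<^bsub>B\<^esub>"
    "g divides\<^bsub>B\<^esub> (f1 \<otimes>\<^bsub>B\<^esub> f)" "g divides\<^bsub>B\<^esub> (g1 \<otimes>\<^bsub>B\<^esub> f)"
    "\<forall>h\<in>carrier B. g divides\<^bsub>B\<^esub> (h \<otimes>\<^bsub>B\<^esub> f) \<longrightarrow> f1 divides\<^bsub>B\<^esub> (c \<otimes>\<^bsub>B\<^esub> h)"
    "\<forall>\<pi>. prime_el R \<pi> \<longrightarrow> (\<exists>u\<in>carrier B. \<exists>v\<in>carrier B. c \<otimes>\<^bsub>B\<^esub> v = s \<otimes>\<^bsub>B\<^esub> u \<and>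
      (\<not> \<pi> divides p \<longrightarrow> \<not> \<pi> divides (u 0 0)) \<and> (\<not> \<pi> divides q \<longrightarrow> \<not> \<pi> divides (v 0 0)) \<and>
      (\<forall>h\<in>carrier B. g divides\<^bsub>B\<^esub> (h \<otimes>\<^bsub>B\<^esub> f) \<longrightarrow> (\<exists>y\<in>carrier B. u \<otimes>\<^bsub>B\<^esub> h = y \<otimes>\<^bsub>B\<^esub> f1 \<and> v \<otimes>\<^bsub>B\<^esub> h = y \<otimes>\<^bsub>B\<^esub> g1)))"
proof -
  define I where "I = {u \<in> carrier B. g divides\<^bsub>B\<^esub> (u \<otimes>\<^bsub>B\<^esub> f)}"
  have I: "ideal I B" unfolding I_def by (rule B.colon_ideal[OF g(1) f])
  have Ic: "h \<in> carrier B" if "h \<in> I" for h using that by (simp add: I_def)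
  have If: "g divides\<^bsub>B\<^esub> (h \<otimes>\<^bsub>B\<^esub> f)" if "h \<in> I" for h using that by (simp add: I_def)
  obtain f1 c where f1: "f1 \<in> carrier B" "f1 \<noteq> \<zero>\<^bsub>B\<^esub>" "g divides\<^bsub>B\<^esub> (f1 \<otimes>\<^bsub>B\<^esub> f)"
    and c: "c \<in> carrier B" "c 0 0 \<in> carrier R - {\<zero>}"
    and f1c': "\<forall>h\<in>carrier B. g divides\<^bsub>B\<^esub> (h \<otimes>\<^bsub>B\<^esub> f) \<longrightarrow> f1 divides\<^bsub>B\<^esub> (c \<otimes>\<^bsub>B\<^esub> h)"
    by (rule colon_local_generator[OF f g local_setting_nonzero], rule that)
  note f1c = f1c'[rule_format]
  have f1I: "f1 \<in> I" using f1 by (simp add: I_def)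
  \<comment> \<open>The numerators \<open>a\<close> of the members \<open>f1 a / c\<close> of the
    colon ideal; \<open>c\<close> is the numerator of \<open>f1\<close> itself.\<close>
  define N where "N = {a \<in> carrier B. \<exists>h\<in>I. c \<otimes>\<^bsub>B\<^esub> h = f1 \<otimes>\<^bsub>B\<^esub> a}"
  have N_add: "a \<oplus>\<^bsub>B\<^esub> b \<in> N" if ab: "a \<in> N" "b \<in> N" for a b
  proof -
    obtain h k where h: "h \<in> I" "c \<otimes>\<^bsub>B\<^esub> h = f1 \<otimes>\<^bsub>B\<^esub> a" and k: "k \<in> I" "c \<otimes>\<^bsub>B\<^esub> k = f1 \<otimes>\<^bsub>B\<^esub> b" using ab unfolding N_def by blast
    have abc: "a \<in> carrier B" "b \<in> carrier B" using ab by (simp_all add: N_def)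
    have "c \<otimes>\<^bsub>B\<^esub> (h \<oplus>\<^bsub>B\<^esub> k) = f1 \<otimes>\<^bsub>B\<^esub> (a \<oplus>\<^bsub>B\<^esub> b)"
      by (simp only: B.r_distr h(2) k(2) Ic[OF h(1)] Ic[OF k(1)] c(1) f1(1) abc)
    moreover have "h \<oplus>\<^bsub>B\<^esub> k \<in> I" by (rule additive_subgroup.a_closed[OF ideal.axioms(1)[OF I] h(1) k(1)])
    ultimately show ?thesis using B.a_closed[OF abc] unfolding N_def by blast
  qed
  have N_mult: "r \<otimes>\<^bsub>B\<^esub> a \<in> N" if a: "a \<in> N" and r: "r \<in> carrier B" for a r
  proof -
    obtain h where h: "h \<in> I" "c \<otimes>\<^bsub>B\<^esub> h = f1 \<otimes>\<^bsub>B\<^esub> a" using a unfolding N_def by blast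
    have ac: "a \<in> carrier B" using a by (simp add: N_def)
    have "c \<otimes>\<^bsub>B\<^esub> (r \<otimes>\<^bsub>B\<^esub> h) = f1 \<otimes>\<^bsub>B\<^esub> (r \<otimes>\<^bsub>B\<^esub> a)"
      unfolding B.m_lcomm[OF c(1) r Ic[OF h(1)]] h(2) by (rule B.m_lcomm[OF r f1(1) ac])
    moreover have "r \<otimes>\<^bsub>B\<^esub> h \<in> I" by (rule ideal.I_l_closed[OF I h(1) r])
    ultimately show ?thesis using B.m_closed[OF r ac] unfolding N_def by blast
  qed
  have cN: "c \<in> N" using c(1) f1I B.m_comm[OF c(1) f1(1)] unfolding N_def by blast
  define A where "A = {a 0 0 | a. a \<in> N}"
  have N: "ideal N B"
  proof (rule B.ideal_criterion)
    show "N \<subseteq> carrier B" by (auto simp: N_def)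
    have "\<zero>\<^bsub>B\<^esub> \<otimes>\<^bsub>B\<^esub> c \<in> N" by (rule N_mult[OF cN B.zero_closed])
    then show "\<zero>\<^bsub>B\<^esub> \<in> N" unfolding B.l_null[OF c(1)] .
    show "a \<oplus>\<^bsub>B\<^esub> b \<in> N" if "a \<in> N" "b \<in> N" for a b by (rule N_add[OF that])
    show "r \<otimes>\<^bsub>B\<^esub> a \<in> N" if "r \<in> carrier B" "a \<in> N" for r a by (rule N_mult[OF that(2,1)])
  qed
  have AI: "a 0 0 \<in> A" if "a \<in> N" for a using that unfolding A_def by blast
  have A: "ideal A R" unfolding A_def by (rule constant_coefficient_ideal[OF N])
  have cA: "c 0 0 \<in> A" by (rule AI[OF cN])
  obtain \<sigma> where \<sigma>: "\<sigma> \<in> carrier R" "\<sigma> \<noteq> \<zero>" "\<And>b. b \<in> A \<Longrightarrow> \<sigma> divides b"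
    "\<And>\<pi>. prime_el R \<pi> \<Longrightarrow> \<exists>j\<in>carrier R. \<sigma> \<otimes> j \<in> A \<and> \<not> \<pi> divides j"
    using ideal_content[OF A cA] c(2) by blast
  obtain p where p: "p \<in> carrier R" "c 0 0 = \<sigma> \<otimes> p" using \<sigma>(3)[OF cA] by (rule dividesE2)
  have p0: "p \<noteq> \<zero>" using p \<sigma>(1) c(2) by auto
  define J where "J = {j \<in> carrier R. \<sigma> \<otimes> j \<in> A}"
  have J: "ideal J R"
  proof (rule ideal_criterion)
    show "J \<subseteq> carrier R" "\<zero> \<in> J" using \<sigma>(1) additive_subgroup.zero_closed[OF ideal.axioms(1)[OF A]] by (auto simp: J_def)
    show "x \<oplus> y \<in> J" if "x \<in> J" "y \<in> J" for x y
      using that additive_subgroup.a_closed[OF ideal.axioms(1)[OF A]] \<sigma>(1) by (simp add: J_def r_distr)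
    show "r \<otimes> x \<in> J" if "r \<in> carrier R" "x \<in> J" for r x
      using that ideal.I_l_closed[OF A, of "\<sigma> \<otimes> x" r] \<sigma>(1) by (simp add: J_def m_lcomm)
  qed
  \<comment> \<open>After division by \<open>\<sigma>\<close> the constant coefficients of the
    numerators have no common prime factor, so prime avoidance finds one that is coprime to
    \<open>p\<close>. The member of \<open>I\<close> with this numerator becomes
    \<open>g1\<close>.\<close>
  have "\<exists>q\<in>J. coprime_el R p q"
    by (rule ideal_coprime_to[OF J p(1) p0]) (use \<sigma>(4) in \<open>auto simp: J_def\<close>)
  then obtain q where q: "q \<in> carrier R" "\<sigma> \<otimes> q \<in> A" "coprime_el R p q" by (auto simp: J_def)
  then obtain s where s: "s \<in> N" "s 0 0 = \<sigma> \<otimes> q" unfolding A_def by auto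
  have sc: "s \<in> carrier B" using s by (simp add: N_def)
  obtain g1 where g1: "g1 \<in> I" "c \<otimes>\<^bsub>B\<^esub> g1 = f1 \<otimes>\<^bsub>B\<^esub> s" using s unfolding N_def by blast
  have g1c: "g1 \<in> carrier B" by (rule Ic[OF g1(1)])
  have cg: "c \<otimes>\<^bsub>B\<^esub> g1 = s \<otimes>\<^bsub>B\<^esub> f1" unfolding g1(2) by (rule B.m_comm[OF f1(1) sc])
  have loc: "\<exists>u\<in>carrier B. \<exists>v\<in>carrier B. c \<otimes>\<^bsub>B\<^esub> v = s \<otimes>\<^bsub>B\<^esub> u \<and>
      (\<not> \<pi> divides p \<longrightarrow> \<not> \<pi> divides (u 0 0)) \<and> (\<not> \<pi> divides q \<longrightarrow> \<not> \<pi> divides (v 0 0)) \<and>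
      (\<forall>h\<in>carrier B. g divides\<^bsub>B\<^esub> (h \<otimes>\<^bsub>B\<^esub> f) \<longrightarrow> (\<exists>y\<in>carrier B. u \<otimes>\<^bsub>B\<^esub> h = y \<otimes>\<^bsub>B\<^esub> f1 \<and> v \<otimes>\<^bsub>B\<^esub> h = y \<otimes>\<^bsub>B\<^esub> g1))"
    if pi: "prime_el R \<pi>" for \<pi>
  proof -
    note pc = prime_elD[OF pi]
    obtain z t where z: "z \<in> carrier B" "z \<noteq> \<zero>\<^bsub>B\<^esub>" "g divides\<^bsub>B\<^esub> (z \<otimes>\<^bsub>B\<^esub> f)"
      and t: "t \<in> carrier B" "t 0 0 \<in> {t \<in> carrier R. \<not> \<pi> divides t}"
      and zt': "\<forall>h\<in>carrier B. g divides\<^bsub>B\<^esub> (h \<otimes>\<^bsub>B\<^esub> f) \<longrightarrow> z divides\<^bsub>B\<^esub> (t \<otimes>\<^bsub>B\<^esub> h)"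
      by (rule colon_local_generator[OF f g local_setting_prime[OF pi]], rule that)
    note zt = zt'[rule_format]
    obtain u where u: "u \<in> carrier B" "t \<otimes>\<^bsub>B\<^esub> f1 = z \<otimes>\<^bsub>B\<^esub> u" using zt[OF f1(1,3)] by (rule dividesE2)
    obtain v where v: "v \<in> carrier B" "t \<otimes>\<^bsub>B\<^esub> g1 = z \<otimes>\<^bsub>B\<^esub> v" using zt[OF g1c If[OF g1(1)]] by (rule dividesE2)
    \<comment> \<open>\<open>a\<close> is the numerator of the local generator \<open>z\<close>,
      while \<open>u\<close> and \<open>v\<close> are the quotients of \<open>f1\<close> and
      \<open>g1\<close> by \<open>z\<close>, up to \<open>t\<close>. Comparing constant coefficients
      gives \<open>t 0 0 \<otimes> p = r \<otimes> u 0 0\<close>, likewise with \<open>q\<close> and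
      \<open>v\<close>, and \<pi> does not divide \<open>t 0 0\<close>.\<close>
    obtain a where a: "a \<in> carrier B" "c \<otimes>\<^bsub>B\<^esub> z = f1 \<otimes>\<^bsub>B\<^esub> a" using f1c[OF z(1,3)] by (rule dividesE2)
    have "a \<in> N" using a z unfolding N_def I_def by blast
    then have "\<sigma> divides (a 0 0)" by (intro \<sigma>(3) AI)
    then obtain r where r: "r \<in> carrier R" "a 0 0 = \<sigma> \<otimes> r" by (rule dividesE2)
    have cancel: "(t 0 0) \<otimes> k = r \<otimes> w 0 0"
      if w: "w \<in> carrier B" and b: "b \<in> carrier B" "b 0 0 = \<sigma> \<otimes> k" "k \<in> carrier R" and e: "t \<otimes>\<^bsub>B\<^esub> (f1 \<otimes>\<^bsub>B\<^esub> b) = c \<otimes>\<^bsub>B\<^esub> (z \<otimes>\<^bsub>B\<^esub> w)" for w b k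
    proof -
      have "f1 \<otimes>\<^bsub>B\<^esub> (t \<otimes>\<^bsub>B\<^esub> b) = t \<otimes>\<^bsub>B\<^esub> (f1 \<otimes>\<^bsub>B\<^esub> b)" by (rule B.m_lcomm[OF f1(1) t(1) b(1)])
      also have "\<dots> = (c \<otimes>\<^bsub>B\<^esub> z) \<otimes>\<^bsub>B\<^esub> w" unfolding e by (rule B.m_assoc[symmetric, OF c(1) z(1) w])
      also have "\<dots> = f1 \<otimes>\<^bsub>B\<^esub> (a \<otimes>\<^bsub>B\<^esub> w)" unfolding a(2) by (rule B.m_assoc[OF f1(1) a(1) w])
      finally have "t \<otimes>\<^bsub>B\<^esub> b = a \<otimes>\<^bsub>B\<^esub> w"
        using B.m_lcancel[OF f1(2,1) B.m_closed[OF t(1) b(1)] B.m_closed[OF a(1) w]] by blast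
      then have "(t \<otimes>\<^bsub>B\<^esub> b) 0 0 = (a \<otimes>\<^bsub>B\<^esub> w) 0 0" by simp
      then have "t 0 0 \<otimes> (\<sigma> \<otimes> k) = (\<sigma> \<otimes> r) \<otimes> w 0 0" by (simp only: ps_mult_0 b(2) r(2))
      then have "\<sigma> \<otimes> (t 0 0 \<otimes> k) = \<sigma> \<otimes> (r \<otimes> w 0 0)"
        using m_assoc[OF \<sigma>(1) r(1) B_nth[OF w]] m_lcomm[OF \<sigma>(1) B_nth[OF t(1)] b(3)] by metis
      then show ?thesis
        using m_lcancel[OF \<sigma>(2,1) m_closed[OF B_nth[OF t(1)] b(3)] m_closed[OF r(1) B_nth[OF w]]] by blast
    qed
    have nd: "\<not> \<pi> divides (w 0 0)" if w: "w \<in> carrier B" and k: "k \<in> carrier R" "\<not> \<pi> divides k" and e: "(t 0 0) \<otimes> k = r \<otimes> w 0 0" for w k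
    proof
      assume "\<pi> divides (w 0 0)"
      then have "\<pi> divides (t 0 0 \<otimes> k)" unfolding e by (intro dvd_multI2 pc r B_nth[OF w])
      then show False using prime_el_dvd[OF pi _ B_nth[OF t(1)] k(1)] k(2) t(2) by blast
    qed
    have "(t 0 0) \<otimes> p = r \<otimes> u 0 0"
    proof (rule cancel[OF u(1) c(1) p(2,1)])
      show "t \<otimes>\<^bsub>B\<^esub> (f1 \<otimes>\<^bsub>B\<^esub> c) = c \<otimes>\<^bsub>B\<^esub> (z \<otimes>\<^bsub>B\<^esub> u)"
        unfolding u(2)[symmetric] using t(1) f1(1) c(1) by algebra
    qed
    then have 1: "\<not> \<pi> divides p \<longrightarrow> \<not> \<pi> divides (u 0 0)" using nd[OF u(1) p(1)] by blast
    have "(t 0 0) \<otimes> q = r \<otimes> v 0 0"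
    proof (rule cancel[OF v(1) sc s(2) q(1)])
      show "t \<otimes>\<^bsub>B\<^esub> (f1 \<otimes>\<^bsub>B\<^esub> s) = c \<otimes>\<^bsub>B\<^esub> (z \<otimes>\<^bsub>B\<^esub> v)"
        unfolding v(2)[symmetric] g1(2)[symmetric] by (rule B.m_lcomm[OF t(1) c(1) g1c])
    qed
    then have 2: "\<not> \<pi> divides q \<longrightarrow> \<not> \<pi> divides (v 0 0)" using nd[OF v(1) q(1)] by blast
    have "z \<otimes>\<^bsub>B\<^esub> (c \<otimes>\<^bsub>B\<^esub> v) = c \<otimes>\<^bsub>B\<^esub> (t \<otimes>\<^bsub>B\<^esub> g1)" unfolding v(2) by (rule B.m_lcomm[OF z(1) c(1) v(1)])
    also have "\<dots> = t \<otimes>\<^bsub>B\<^esub> (s \<otimes>\<^bsub>B\<^esub> f1)" unfolding cg[symmetric] by (rule B.m_lcomm[OF c(1) t(1) g1c])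
    also have "\<dots> = s \<otimes>\<^bsub>B\<^esub> (z \<otimes>\<^bsub>B\<^esub> u)" unfolding u(2)[symmetric] by (rule B.m_lcomm[OF t(1) sc f1(1)])
    also have "\<dots> = z \<otimes>\<^bsub>B\<^esub> (s \<otimes>\<^bsub>B\<^esub> u)" by (rule B.m_lcomm[OF sc z(1) u(1)])
    finally have 3: "c \<otimes>\<^bsub>B\<^esub> v = s \<otimes>\<^bsub>B\<^esub> u"
      using B.m_lcancel[OF z(2,1) B.m_closed[OF c(1) v(1)] B.m_closed[OF sc u(1)]] by blast
    have 4: "\<exists>y\<in>carrier B. u \<otimes>\<^bsub>B\<^esub> h = y \<otimes>\<^bsub>B\<^esub> f1 \<and> v \<otimes>\<^bsub>B\<^esub> h = y \<otimes>\<^bsub>B\<^esub> g1"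
      if h: "h \<in> carrier B" "g divides\<^bsub>B\<^esub> (h \<otimes>\<^bsub>B\<^esub> f)" for h
    proof -
      obtain y where y: "y \<in> carrier B" "t \<otimes>\<^bsub>B\<^esub> h = z \<otimes>\<^bsub>B\<^esub> y" using zt[OF h] by (rule dividesE2)
      have gen: "w \<otimes>\<^bsub>B\<^esub> h = y \<otimes>\<^bsub>B\<^esub> k" if w: "w \<in> carrier B" and k: "k \<in> carrier B" and e: "t \<otimes>\<^bsub>B\<^esub> k = z \<otimes>\<^bsub>B\<^esub> w" for w k
      proof -
        have "z \<otimes>\<^bsub>B\<^esub> (w \<otimes>\<^bsub>B\<^esub> h) = (t \<otimes>\<^bsub>B\<^esub> k) \<otimes>\<^bsub>B\<^esub> h" unfolding e by (rule B.m_assoc[symmetric, OF z(1) w h(1)])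
        also have "\<dots> = (t \<otimes>\<^bsub>B\<^esub> h) \<otimes>\<^bsub>B\<^esub> k" using t(1) k h(1) by algebra
        also have "\<dots> = z \<otimes>\<^bsub>B\<^esub> (y \<otimes>\<^bsub>B\<^esub> k)" unfolding y(2) by (rule B.m_assoc[OF z(1) y(1) k])
        finally show ?thesis
          using B.m_lcancel[OF z(2,1) B.m_closed[OF w h(1)] B.m_closed[OF y(1) k]] by blast
      qed
      show ?thesis using y(1) gen[OF u(1) f1(1) u(2)] gen[OF v(1) g1c v(2)] by blast
    qed
    show ?thesis using u(1) v(1) 1 2 3 4 by blast
  qed
  show ?thesis
    by (rule that[OF c(1) sc f1(1) g1c \<sigma>(1) p(1) q(1) \<sigma>(2) p0 p(2) s(2) q(3) cg f1(2,3) If[OF g1(1)]]) (fact f1c', intro allI impI, fact loc)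
qed

text \<open>Along the curve the quotient of \<open>c\<close> and \<open>s\<close> is reduced to
  lowest terms in the factorial ring \<open>C\<close>. The constant terms of the result are
  \<open>p e\<close> and \<open>q e\<close> for some \<open>e\<close>; rescaling succeeds if
  \<open>e\<close> is a unit, and this is where the local pairs are needed.\<close>

lemma curve_solutions:
  assumes c: "c \<in> carrier B" "s \<in> carrier B"
    and p: "r \<in> carrier R" "p \<in> carrier R" "q \<in> carrier R" "r \<noteq> \<zero>" "p \<noteq> \<zero>"
    and c0: "c 0 0 = r \<otimes> p" "s 0 0 = r \<otimes> q" and cop: "coprime_el R p q"
    and loc: "\<And>\<pi>. prime_el R \<pi> \<Longrightarrow> \<exists>u\<in>carrier B. \<exists>v\<in>carrier B. c \<otimes>\<^bsub>B\<^esub> v = s \<otimes>\<^bsub>B\<^esub> u \<and>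
      (\<not> \<pi> divides p \<longrightarrow> \<not> \<pi> divides (u 0 0)) \<and> (\<not> \<pi> divides q \<longrightarrow> \<not> \<pi> divides (v 0 0))"
  shows "\<exists>f\<in>carrier C. \<exists>g\<in>carrier C. f 0 = p \<and> g 0 = q \<and>
    curve R (Suc n) c \<otimes>\<^bsub>C\<^esub> g = curve R (Suc n) s \<otimes>\<^bsub>C\<^esub> f"
proof -
  let ?\<phi> = "curve R (Suc n)"
  have hom: "ring_hom_cring B C ?\<phi>" by (rule curve_hom) simp
  note \<phi>_closed = ring_hom_closed[OF ring_hom_cring.homh[OF hom]] and \<phi>_mult = ring_hom_mult[OF ring_hom_cring.homh[OF hom]]
  define a where "a = ?\<phi> c"
  define b where "b = ?\<phi> s"
  have ab: "a \<in> carrier C" "b \<in> carrier C" using c \<phi>_closed by (simp_all add: a_def b_def)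
  have ab0: "a 0 = r \<otimes> p" "b 0 = r \<otimes> q" using curve_low(1) c c0 by (simp_all add: a_def b_def)
  have sp: "r \<otimes> p \<noteq> \<zero>" using p by (simp add: integral_iff)
  then have "a \<noteq> \<zero>\<^bsub>C\<^esub>" using ab0(1) by auto
  then obtain d f g where dfg: "d \<in> carrier C" "f \<in> carrier C" "g \<in> carrier C" "a = d \<otimes>\<^bsub>C\<^esub> f" "b = d \<otimes>\<^bsub>C\<^esub> g"
    and fg: "coprime_el C f g" and d_ne: "d \<noteq> \<zero>\<^bsub>C\<^esub>"
    using C.coprime_quotients[OF ab] by blast
  have cl: "d 0 \<in> carrier R" "f 0 \<in> carrier R" "g 0 \<in> carrier R" using dfg by (simp_all add: ps_carrierD)
  have df0: "d 0 \<otimes> f 0 = r \<otimes> p" using arg_cong[OF dfg(4), of "\<lambda>f. f 0"] ab0(1) by simp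
  have dg0: "d 0 \<otimes> g 0 = r \<otimes> q" using arg_cong[OF dfg(5), of "\<lambda>f. f 0"] ab0(2) by simp
  have ne: "d 0 \<noteq> \<zero>" "f 0 \<noteq> \<zero>" using df0 sp cl by auto
  have f_ne: "f \<noteq> \<zero>\<^bsub>C\<^esub>" using ne(2) by auto
  have ag: "a \<otimes>\<^bsub>C\<^esub> g = b \<otimes>\<^bsub>C\<^esub> f" unfolding dfg(4,5) using dfg(1-3) by algebra
  have "(r \<otimes> d 0) \<otimes> (p \<otimes> g 0) = (r \<otimes> p) \<otimes> (d 0 \<otimes> g 0)" using p cl by algebra
  also have "\<dots> = (r \<otimes> q) \<otimes> (d 0 \<otimes> f 0)" unfolding df0 dg0 by (rule m_comm) (use p in simp_all)
  also have "\<dots> = (r \<otimes> d 0) \<otimes> (q \<otimes> f 0)" using p cl by algebra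
  finally have pg: "p \<otimes> g 0 = q \<otimes> f 0" using m_lcancel[of "r \<otimes> d 0"] p cl ne by (simp add: integral_iff)
  have "p divides (f 0)"
    by (rule coprime_el_dvd[OF p(2,5) cop p(3) cl(2)]) (rule dividesI2[OF cl(3) pg[symmetric]])
  then obtain e where e: "e \<in> carrier R" "f 0 = p \<otimes> e" by (rule dividesE2)
  have "p \<otimes> g 0 = p \<otimes> (q \<otimes> e)" unfolding pg e(2) by (rule m_lcomm) (use p e in simp_all)
  then have ge: "g 0 = q \<otimes> e" using m_lcancel[OF p(5,2) cl(3)] p(3) e(1) by simp
  have "e \<in> Units R"
  proof (rule unit_if_no_prime_divisor[OF e(1)])
    show "e \<noteq> \<zero>" using e ne p by auto
    fix \<pi> assume pi: "prime_el R \<pi>"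
    note pc = prime_elD(1)[OF pi]
    \<comment> \<open>If \<pi> divided \<open>e\<close>, it would divide \<open>f 0\<close> and
      \<open>g 0\<close>. The local pair also solves the equation on the curve, so \<open>f\<close>
      divides the image of \<open>u\<close> if \<pi> fails to divide \<open>p\<close>, and
      \<open>g\<close> that of \<open>v\<close> if it fails to divide \<open>q\<close>. Both are
      excluded by the constant terms, so \<pi> divides \<open>p\<close> and \<open>q\<close>, which
      are coprime.\<close>
    show "\<not> \<pi> divides e"
    proof
      assume "\<pi> divides e"
      then have pfg: "\<pi> divides (f 0)" "\<pi> divides (g 0)" unfolding e(2) ge by (auto intro: dvd_multI2 pc p e)
      obtain u v where uv: "u \<in> carrier B" "v \<in> carrier B" "c \<otimes>\<^bsub>B\<^esub> v = s \<otimes>\<^bsub>B\<^esub> u"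
        and nd: "\<not> \<pi> divides p \<longrightarrow> \<not> \<pi> divides (u 0 0)" "\<not> \<pi> divides q \<longrightarrow> \<not> \<pi> divides (v 0 0)"
        using loc[OF pi] by blast
      define x where "x = ?\<phi> u"
      define y where "y = ?\<phi> v"
      have xy: "x \<in> carrier C" "y \<in> carrier C" using uv \<phi>_closed by (simp_all add: x_def y_def)
      have xy0: "x 0 = u 0 0" "y 0 = v 0 0" using curve_low(1) uv by (simp_all add: x_def y_def)
      have eq: "a \<otimes>\<^bsub>C\<^esub> y = b \<otimes>\<^bsub>C\<^esub> x"
        using uv \<phi>_mult c unfolding a_def b_def x_def y_def by metis
      have "d \<otimes>\<^bsub>C\<^esub> (f \<otimes>\<^bsub>C\<^esub> y) = d \<otimes>\<^bsub>C\<^esub> (g \<otimes>\<^bsub>C\<^esub> x)"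
        using eq unfolding dfg(4,5) C.m_assoc[OF dfg(1,2) xy(2)] C.m_assoc[OF dfg(1,3) xy(1)] .
      then have fy: "f \<otimes>\<^bsub>C\<^esub> y = g \<otimes>\<^bsub>C\<^esub> x"
        using C.m_lcancel[OF d_ne dfg(1) C.m_closed[OF dfg(2) xy(2)] C.m_closed[OF dfg(3) xy(1)]] by blast
      have nth: "\<pi> divides (w 0)" if "k divides\<^bsub>C\<^esub> w" and k: "\<pi> divides (k 0)" "k \<in> carrier C" for k w
      proof -
        obtain l where l: "l \<in> carrier C" "w = k \<otimes>\<^bsub>C\<^esub> l" using \<open>k divides\<^bsub>C\<^esub> w\<close> by (rule dividesE2)
        show ?thesis unfolding l(2) ps_mult_0
          by (rule dvd_multI[OF k(1) pc ps_carrierD[OF k(2)] ps_carrierD[OF l(1)]])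
      qed
      have 1: "\<pi> divides p"
      proof (rule ccontr)
        assume n: "\<not> \<pi> divides p"
        have "f divides\<^bsub>C\<^esub> x"
          by (rule C.coprime_el_dvd[OF dfg(2) f_ne fg dfg(3) xy(1)]) (rule dividesI2[OF xy(2) fy[symmetric]])
        from nth[OF this pfg(1) dfg(2)] show False using nd(1) n xy0 by simp
      qed
      have 2: "\<pi> divides q"
      proof (rule ccontr)
        assume n: "\<not> \<pi> divides q"
        then have "q \<noteq> \<zero>" using divides_zero[OF pc] by auto
        then have "d 0 \<otimes> g 0 \<noteq> \<zero>" unfolding dg0 using p by (simp add: integral_iff)
        then have "g \<noteq> \<zero>\<^bsub>C\<^esub>" using cl by auto
        moreover have "coprime_el C g f" using fg by (auto simp: coprime_el_def)
        ultimately have "g divides\<^bsub>C\<^esub> y"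
          by (intro C.coprime_el_dvd[OF dfg(3) _ _ dfg(2) xy(2)] dividesI2[OF xy(1) fy])
        from nth[OF this pfg(2) dfg(3)] show False using nd(2) n xy0 by simp
      qed
      show False using 1 2 cop pi unfolding coprime_el_def by blast
    qed
  qed
  then have i: "inv e \<in> carrier R" "e \<otimes> inv e = \<one>" by simp_all
  define k where "k = const R (inv e)"
  have k: "k \<in> carrier C" using i by (simp add: k_def)
  have "(f \<otimes>\<^bsub>C\<^esub> k) 0 = p" using i e p by (simp add: k_def m_assoc)
  moreover have "(g \<otimes>\<^bsub>C\<^esub> k) 0 = q" using i e p ge by (simp add: k_def m_assoc)
  moreover have "a \<otimes>\<^bsub>C\<^esub> (g \<otimes>\<^bsub>C\<^esub> k) = b \<otimes>\<^bsub>C\<^esub> (f \<otimes>\<^bsub>C\<^esub> k)"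
    unfolding C.m_assoc[OF ab(1) dfg(3) k, symmetric] ag by (rule C.m_assoc[OF ab(2) dfg(2) k])
  ultimately show ?thesis using k dfg(2,3) unfolding a_def b_def by blast
qed

text \<open>\<open>ps_coprime_lift\<close> is applied once for each variable, on top of Euclid's
  lemma in \<open>R\<close>.\<close>

lemma coprime_constants_dvd:
  assumes F: "F \<in> carrier B" "F 0 0 \<noteq> \<zero>" and G: "G \<in> carrier B" and cop: "coprime_el R (F 0 0) (G 0 0)"
    and h: "h \<in> carrier B" "F divides\<^bsub>B\<^esub> (G \<otimes>\<^bsub>B\<^esub> h)"
  shows "F divides\<^bsub>B\<^esub> h"
proof (rule C.ps_coprime_lift[OF F(1) _ G _ h])
  note F0 = ps_carrierD[OF F(1), of 0] and G0 = ps_carrierD[OF G, of 0]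
  show "F 0 \<noteq> \<zero>\<^bsub>C\<^esub>" using F(2) by auto
  show "F 0 divides\<^bsub>C\<^esub> w" if w: "w \<in> carrier C" "F 0 divides\<^bsub>C\<^esub> (G 0 \<otimes>\<^bsub>C\<^esub> w)" for w
  proof (rule ps_coprime_lift[OF F0 F(2) G0 _ w])
    show "F 0 0 divides x" if "x \<in> carrier R" "F 0 0 divides (G 0 0 \<otimes> x)" for x
      by (rule coprime_el_dvd[OF B_nth[OF F(1)] F(2) cop B_nth[OF G] that])
  qed
qed

lemma colon_principal:
  assumes f: "f \<in> carrier B" and g: "g \<in> carrier B" "g \<noteq> \<zero>\<^bsub>B\<^esub>"
  shows "\<exists>w\<in>carrier B. g divides\<^bsub>B\<^esub> (w \<otimes>\<^bsub>B\<^esub> f) \<and>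
    (\<forall>h\<in>carrier B. g divides\<^bsub>B\<^esub> (h \<otimes>\<^bsub>B\<^esub> f) \<longrightarrow> w divides\<^bsub>B\<^esub> h)"
proof (rule colon_generators[OF f g])
  fix c s f1 g1 r p q
  assume c: "c \<in> carrier B" "s \<in> carrier B" and f1: "f1 \<in> carrier B" "g1 \<in> carrier B"
    and p: "r \<in> carrier R" "p \<in> carrier R" "q \<in> carrier R" "r \<noteq> \<zero>" "p \<noteq> \<zero>"
    and c0: "c 0 0 = r \<otimes> p" "s 0 0 = r \<otimes> q"
    and cop: "coprime_el R p q" and cg: "c \<otimes>\<^bsub>B\<^esub> g1 = s \<otimes>\<^bsub>B\<^esub> f1" and f1_ne: "f1 \<noteq> \<zero>\<^bsub>B\<^esub>"
    and gf: "g divides\<^bsub>B\<^esub> (f1 \<otimes>\<^bsub>B\<^esub> f)" "g divides\<^bsub>B\<^esub> (g1 \<otimes>\<^bsub>B\<^esub> f)"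
    and gen: "\<forall>h\<in>carrier B. g divides\<^bsub>B\<^esub> (h \<otimes>\<^bsub>B\<^esub> f) \<longrightarrow> f1 divides\<^bsub>B\<^esub> (c \<otimes>\<^bsub>B\<^esub> h)"
    and loc: "\<forall>\<pi>. prime_el R \<pi> \<longrightarrow> (\<exists>u\<in>carrier B. \<exists>v\<in>carrier B. c \<otimes>\<^bsub>B\<^esub> v = s \<otimes>\<^bsub>B\<^esub> u \<and>
      (\<not> \<pi> divides p \<longrightarrow> \<not> \<pi> divides (u 0 0)) \<and> (\<not> \<pi> divides q \<longrightarrow> \<not> \<pi> divides (v 0 0)) \<and>
      (\<forall>h\<in>carrier B. g divides\<^bsub>B\<^esub> (h \<otimes>\<^bsub>B\<^esub> f) \<longrightarrow> (\<exists>y\<in>carrier B. u \<otimes>\<^bsub>B\<^esub> h = y \<otimes>\<^bsub>B\<^esub> f1 \<and> v \<otimes>\<^bsub>B\<^esub> h = y \<otimes>\<^bsub>B\<^esub> g1)))"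
  have c00: "c 0 0 \<noteq> \<zero>" using p c0 by (simp add: integral_iff)
  then have c_ne: "c \<noteq> \<zero>\<^bsub>B\<^esub>" by auto
  have "\<exists>F\<in>carrier B. \<exists>G\<in>carrier B. F 0 0 = p \<and> G 0 0 = q \<and> c \<otimes>\<^bsub>B\<^esub> G = s \<otimes>\<^bsub>B\<^esub> F"
  proof (rule solution_from_curves[OF c c00 p(2,3,5)])
    show "p divides w" if w: "z \<in> carrier R" "w \<in> carrier R" "p \<otimes> z = q \<otimes> w" for z w
      by (rule coprime_el_dvd[OF p(2,5) cop p(3) w(2)]) (rule dividesI2[OF w(1) w(3)[symmetric]])
    show "c 0 0 \<otimes> q = s 0 0 \<otimes> p" unfolding c0 using p(1-3) by algebra
    show "\<exists>f\<in>carrier C. \<exists>g\<in>carrier C. f 0 = p \<and> g 0 = q \<and> curve R (Suc n) c \<otimes>\<^bsub>C\<^esub> g = curve R (Suc n) s \<otimes>\<^bsub>C\<^esub> f" for n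
      by (rule curve_solutions[OF c p c0 cop]) (use loc in blast)
  qed
  then obtain F G where F: "F \<in> carrier B" "F 0 0 = p" and G: "G \<in> carrier B" "G 0 0 = q"
    and cG: "c \<otimes>\<^bsub>B\<^esub> G = s \<otimes>\<^bsub>B\<^esub> F" by blast
  have F_ne: "F 0 0 \<noteq> \<zero>" "F \<noteq> \<zero>\<^bsub>B\<^esub>" using F(2) p(5) by auto
  have FG: "F divides\<^bsub>B\<^esub> h" if "h \<in> carrier B" "F divides\<^bsub>B\<^esub> (G \<otimes>\<^bsub>B\<^esub> h)" for h
    by (rule coprime_constants_dvd[OF F(1) F_ne(1) G(1) _ that]) (simp only: F(2) G(2) cop)
  have "c \<otimes>\<^bsub>B\<^esub> (F \<otimes>\<^bsub>B\<^esub> g1) = F \<otimes>\<^bsub>B\<^esub> (s \<otimes>\<^bsub>B\<^esub> f1)" unfolding cg[symmetric] by (rule B.m_lcomm[OF c(1) F(1) f1(2)])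
  also have "\<dots> = (s \<otimes>\<^bsub>B\<^esub> F) \<otimes>\<^bsub>B\<^esub> f1" using c(2) F(1) f1(1) by algebra
  also have "\<dots> = c \<otimes>\<^bsub>B\<^esub> (G \<otimes>\<^bsub>B\<^esub> f1)" unfolding cG[symmetric] by (rule B.m_assoc[OF c(1) G(1) f1(1)])
  finally have Fg1: "F \<otimes>\<^bsub>B\<^esub> g1 = G \<otimes>\<^bsub>B\<^esub> f1"
    using B.m_lcancel[OF c_ne c(1) B.m_closed[OF F(1) f1(2)] B.m_closed[OF G(1) f1(1)]] by blast
  \<comment> \<open>\<open>F\<close> and \<open>G\<close> inherit coprimality from their constant
    coefficients \<open>p\<close> and \<open>q\<close>.\<close>
  have "F divides\<^bsub>B\<^esub> f1" by (rule FG[OF f1(1)]) (rule dividesI2[OF f1(2) Fg1[symmetric]])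
  then obtain w where w: "w \<in> carrier B" "f1 = F \<otimes>\<^bsub>B\<^esub> w" by (rule dividesE2)
  have w_ne: "w \<noteq> \<zero>\<^bsub>B\<^esub>" using f1_ne w(2) F(1) by auto
  have "F \<otimes>\<^bsub>B\<^esub> g1 = F \<otimes>\<^bsub>B\<^esub> (G \<otimes>\<^bsub>B\<^esub> w)" unfolding Fg1 w(2) by (rule B.m_lcomm[OF G(1) F(1) w(1)])
  then have g1: "g1 = G \<otimes>\<^bsub>B\<^esub> w" using B.m_lcancel[OF F_ne(2) F(1) f1(2) B.m_closed[OF G(1) w(1)]] by blast
  \<comment> \<open>With \<open>x\<close> and \<open>y\<close> the quotients of \<open>f1 f\<close>
    and \<open>g1 f\<close> by \<open>g\<close>, the equation \<open>G x = F y\<close> makes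
    \<open>F\<close> divide \<open>x\<close>, and \<open>F\<close> can be cancelled.\<close>
  have w_mem: "g divides\<^bsub>B\<^esub> (w \<otimes>\<^bsub>B\<^esub> f)"
  proof -
    obtain x where x: "x \<in> carrier B" "f1 \<otimes>\<^bsub>B\<^esub> f = g \<otimes>\<^bsub>B\<^esub> x" using gf(1) by (rule dividesE2)
    obtain y where y: "y \<in> carrier B" "g1 \<otimes>\<^bsub>B\<^esub> f = g \<otimes>\<^bsub>B\<^esub> y" using gf(2) by (rule dividesE2)
    have "g \<otimes>\<^bsub>B\<^esub> (G \<otimes>\<^bsub>B\<^esub> x) = G \<otimes>\<^bsub>B\<^esub> (f1 \<otimes>\<^bsub>B\<^esub> f)" unfolding x(2) by (rule B.m_lcomm[OF g(1) G(1) x(1)])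
    also have "\<dots> = (F \<otimes>\<^bsub>B\<^esub> g1) \<otimes>\<^bsub>B\<^esub> f" unfolding Fg1 by (rule B.m_assoc[symmetric, OF G(1) f1(1) f])
    also have "\<dots> = F \<otimes>\<^bsub>B\<^esub> (g \<otimes>\<^bsub>B\<^esub> y)" unfolding y(2)[symmetric] by (rule B.m_assoc[OF F(1) f1(2) f])
    also have "\<dots> = g \<otimes>\<^bsub>B\<^esub> (F \<otimes>\<^bsub>B\<^esub> y)" by (rule B.m_lcomm[OF F(1) g(1) y(1)])
    finally have "G \<otimes>\<^bsub>B\<^esub> x = F \<otimes>\<^bsub>B\<^esub> y"
      using B.m_lcancel[OF g(2,1) B.m_closed[OF G(1) x(1)] B.m_closed[OF F(1) y(1)]] by blast
    then have "F divides\<^bsub>B\<^esub> x" by (intro FG[OF x(1)] dividesI2[OF y(1)])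
    then obtain x' where x': "x' \<in> carrier B" "x = F \<otimes>\<^bsub>B\<^esub> x'" by (rule dividesE2)
    have "F \<otimes>\<^bsub>B\<^esub> (w \<otimes>\<^bsub>B\<^esub> f) = f1 \<otimes>\<^bsub>B\<^esub> f" unfolding w(2) by (rule B.m_assoc[symmetric, OF F(1) w(1) f])
    also have "\<dots> = F \<otimes>\<^bsub>B\<^esub> (g \<otimes>\<^bsub>B\<^esub> x')" unfolding x(2) x'(2) by (rule B.m_lcomm[OF g(1) F(1) x'(1)])
    finally have "w \<otimes>\<^bsub>B\<^esub> f = g \<otimes>\<^bsub>B\<^esub> x'"
      using B.m_lcancel[OF F_ne(2) F(1) B.m_closed[OF w(1) f] B.m_closed[OF g(1) x'(1)]] by blast
    then show ?thesis by (rule dividesI2[OF x'(1)])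
  qed
  \<comment> \<open>The multipliers \<open>u\<close> with \<open>w\<close> dividing
    \<open>u h\<close> include \<open>c\<close> and, for every prime, one whose constant coefficient
    escapes it, because no prime divides both \<open>p\<close> and \<open>q\<close>. So some
    multiplier has constant coefficient coprime to that of \<open>c\<close>, and the two together
    give \<open>w\<close> dividing \<open>h\<close>.\<close>
  have w_gen: "w divides\<^bsub>B\<^esub> h" if h: "h \<in> carrier B" "g divides\<^bsub>B\<^esub> (h \<otimes>\<^bsub>B\<^esub> f)" for h
  proof -
    define K where "K = {u 0 0 | u. u \<in> {u \<in> carrier B. w divides\<^bsub>B\<^esub> (u \<otimes>\<^bsub>B\<^esub> h)}}"
    have K: "ideal K R" unfolding K_def by (rule constant_coefficient_ideal[OF B.colon_ideal[OF w(1) h(1)]])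
    have KI: "u 0 0 \<in> K" if "u \<in> carrier B" "w divides\<^bsub>B\<^esub> (u \<otimes>\<^bsub>B\<^esub> h)" for u using that unfolding K_def by blast
    have w_dvd: "w divides\<^bsub>B\<^esub> f1" "w divides\<^bsub>B\<^esub> g1"
      unfolding w(2) g1 using B.dvd_multI2[OF B.divides_refl[OF w(1)] w(1) _ w(1)] F(1) G(1) by blast+
    have "f1 divides\<^bsub>B\<^esub> (c \<otimes>\<^bsub>B\<^esub> h)" using gen h by blast
    from B.dvd_trans[OF w_dvd(1) this w(1)] have wc: "w divides\<^bsub>B\<^esub> (c \<otimes>\<^bsub>B\<^esub> h)" .
    have "\<exists>k\<in>K. coprime_el R (c 0 0) k"
    proof (rule ideal_coprime_to[OF K B_nth[OF c(1)] c00])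
      fix \<pi> assume pi: "prime_el R \<pi>"
      obtain u v where uv: "u \<in> carrier B" "v \<in> carrier B"
        and nd: "\<not> \<pi> divides p \<longrightarrow> \<not> \<pi> divides (u 0 0)" "\<not> \<pi> divides q \<longrightarrow> \<not> \<pi> divides (v 0 0)"
        and uvh: "\<forall>h\<in>carrier B. g divides\<^bsub>B\<^esub> (h \<otimes>\<^bsub>B\<^esub> f) \<longrightarrow> (\<exists>y\<in>carrier B. u \<otimes>\<^bsub>B\<^esub> h = y \<otimes>\<^bsub>B\<^esub> f1 \<and> v \<otimes>\<^bsub>B\<^esub> h = y \<otimes>\<^bsub>B\<^esub> g1)"
        using loc[THEN spec, THEN mp, OF pi] by blast
      obtain y where y: "y \<in> carrier B" "u \<otimes>\<^bsub>B\<^esub> h = y \<otimes>\<^bsub>B\<^esub> f1" "v \<otimes>\<^bsub>B\<^esub> h = y \<otimes>\<^bsub>B\<^esub> g1"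
        using uvh[THEN bspec, THEN mp, OF h] by blast
      have "u 0 0 \<in> K" by (rule KI[OF uv(1)]) (simp only: y(2), rule B.dvd_multI2[OF w_dvd(1) w(1) y(1) f1(1)])
      moreover have "v 0 0 \<in> K" by (rule KI[OF uv(2)]) (simp only: y(3), rule B.dvd_multI2[OF w_dvd(2) w(1) y(1) f1(2)])
      moreover have "\<not> \<pi> divides p \<or> \<not> \<pi> divides q" using cop pi unfolding coprime_el_def by blast
      ultimately show "\<exists>k\<in>K. \<not> \<pi> divides k" using nd by blast
    qed
    then obtain u where u: "u \<in> carrier B" "w divides\<^bsub>B\<^esub> (u \<otimes>\<^bsub>B\<^esub> h)" "coprime_el R (c 0 0) (u 0 0)" unfolding K_def by blast
    obtain x where x: "x \<in> carrier B" "c \<otimes>\<^bsub>B\<^esub> h = w \<otimes>\<^bsub>B\<^esub> x" using wc by (rule dividesE2)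
    obtain y where y: "y \<in> carrier B" "u \<otimes>\<^bsub>B\<^esub> h = w \<otimes>\<^bsub>B\<^esub> y" using u(2) by (rule dividesE2)
    have "w \<otimes>\<^bsub>B\<^esub> (u \<otimes>\<^bsub>B\<^esub> x) = u \<otimes>\<^bsub>B\<^esub> (c \<otimes>\<^bsub>B\<^esub> h)" unfolding x(2) by (rule B.m_lcomm[OF w(1) u(1) x(1)])
    also have "\<dots> = c \<otimes>\<^bsub>B\<^esub> (w \<otimes>\<^bsub>B\<^esub> y)" unfolding y(2)[symmetric] by (rule B.m_lcomm[OF u(1) c(1) h(1)])
    also have "\<dots> = w \<otimes>\<^bsub>B\<^esub> (c \<otimes>\<^bsub>B\<^esub> y)" by (rule B.m_lcomm[OF c(1) w(1) y(1)])
    finally have "u \<otimes>\<^bsub>B\<^esub> x = c \<otimes>\<^bsub>B\<^esub> y"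
      using B.m_lcancel[OF w_ne w(1) B.m_closed[OF u(1) x(1)] B.m_closed[OF c(1) y(1)]] by blast
    then have "c divides\<^bsub>B\<^esub> x"
      by (intro coprime_constants_dvd[OF c(1) c00 u(1) u(3) x(1)] dividesI2[OF y(1)])
    then obtain x' where x': "x' \<in> carrier B" "x = c \<otimes>\<^bsub>B\<^esub> x'" by (rule dividesE2)
    have "c \<otimes>\<^bsub>B\<^esub> h = c \<otimes>\<^bsub>B\<^esub> (w \<otimes>\<^bsub>B\<^esub> x')" unfolding x(2) x'(2) by (rule B.m_lcomm[OF w(1) c(1) x'(1)])
    then have "h = w \<otimes>\<^bsub>B\<^esub> x'" using B.m_lcancel[OF c_ne c(1) h(1) B.m_closed[OF w(1) x'(1)]] by blast
    then show ?thesis by (rule dividesI2[OF x'(1)])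
  qed
  show ?thesis using w(1) w_mem w_gen by blast
qed

lemma factorial_ps_ps: "factorial_domain B"
proof -
  have "noetherian_domain B"
    using C.ps_noetherian[OF ps_noetherian[OF noeth]] B.domain_axioms by (simp add: noetherian_domain_def)
  then show ?thesis
  proof (rule noetherian_domain.factorial_domainI)
    fix p assume p: "p \<in> carrier B" "p \<noteq> \<zero>\<^bsub>B\<^esub>" "p \<notin> Units B"
      and irr: "\<And>a b. a \<in> carrier B \<Longrightarrow> b \<in> carrier B \<Longrightarrow> p = a \<otimes>\<^bsub>B\<^esub> b \<Longrightarrow> a \<in> Units B \<or> b \<in> Units B"
    have "p divides\<^bsub>B\<^esub> a \<or> p divides\<^bsub>B\<^esub> b"
      if ab: "a \<in> carrier B" "b \<in> carrier B" "p divides\<^bsub>B\<^esub> a \<otimes>\<^bsub>B\<^esub> b" for a b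
    proof -
      obtain w where w: "w \<in> carrier B" "p divides\<^bsub>B\<^esub> (w \<otimes>\<^bsub>B\<^esub> a)"
        "\<And>h. h \<in> carrier B \<Longrightarrow> p divides\<^bsub>B\<^esub> (h \<otimes>\<^bsub>B\<^esub> a) \<Longrightarrow> w divides\<^bsub>B\<^esub> h"
        using colon_principal[OF ab(1) p(1,2)] by blast
      obtain x where x: "x \<in> carrier B" "p = w \<otimes>\<^bsub>B\<^esub> x"
        using w(3)[OF p(1) B.dvd_selfI[OF p(1) ab(1)]] by (rule dividesE2)
      have wb: "w divides\<^bsub>B\<^esub> b" using w(3)[OF ab(2)] ab B.m_comm[of a b] by simp
      from irr[OF w(1) x] show ?thesis
      proof
        assume "w \<in> Units B"
        then have i: "inv\<^bsub>B\<^esub> w \<in> carrier B" "inv\<^bsub>B\<^esub> w \<otimes>\<^bsub>B\<^esub> w = \<one>\<^bsub>B\<^esub>" by simp_all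
        have "inv\<^bsub>B\<^esub> w \<otimes>\<^bsub>B\<^esub> (w \<otimes>\<^bsub>B\<^esub> a) = a" using i w(1) ab(1) by (simp add: B.m_assoc[symmetric])
        then show ?thesis using B.dvd_multI2[OF w(2) p(1) i(1) B.m_closed[OF w(1) ab(1)]] by simp
      next
        assume "x \<in> Units B"
        then have i: "inv\<^bsub>B\<^esub> x \<in> carrier B" "x \<otimes>\<^bsub>B\<^esub> inv\<^bsub>B\<^esub> x = \<one>\<^bsub>B\<^esub>" by simp_all
        have "p \<otimes>\<^bsub>B\<^esub> inv\<^bsub>B\<^esub> x = w" unfolding x(2) using i w(1) x(1) by (simp add: B.m_assoc)
        then have "p divides\<^bsub>B\<^esub> w" by (intro dividesI2[OF i(1)]) simp
        then show ?thesis using B.dvd_trans[OF _ wb p(1)] by blast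
      qed
    qed
    then show "prime_el B p" unfolding prime_el_def using p by (auto intro!: primeI)
  qed
qed

end

theorem (in domain) factorial_ps_of_factorial_ps:
  assumes "noetherian_ring R" "factorial_domain (ps R)"
  shows "factorial_domain (ps (ps R))"
  using factorial_setting.factorial_ps_ps[OF factorial_setting.intro[OF domain_axioms factorial_setting_axioms.intro[OF assms]]] .

section \<open>Transport along isomorphisms\<close>

lemma ring_iso_hom_cring:
  assumes "cring S" "cring T" "h \<in> ring_iso S T"
  shows "ring_hom_cring S T h"
  using assms by (simp add: ring_hom_cring_def ring_hom_cring_axioms_def ring_iso_def)

lemma ring_iso_inverse:
  assumes S: "cring S" and h: "h \<in> ring_iso S T"
  shows "inv_into (carrier S) h \<in> ring_iso T S"
proof -
  interpret S: cring S by (rule S)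
  note hE = ring_iso_memE[OF h]
  let ?g = "inv_into (carrier S) h"
  have im: "h ` carrier S = carrier T" and inj: "inj_on h (carrier S)" using hE(5) by (auto simp: bij_betw_def)
  have g: "?g y \<in> carrier S" "h (?g y) = y" if "y \<in> carrier T" for y
    using that im by (auto simp: inv_into_into f_inv_into_f)
  have eq: "?g y = x" if "x \<in> carrier S" "y = h x" for x y using that inj by simp
  show ?thesis
  proof (rule ring_iso_memI)
    show "?g x \<in> carrier S" if "x \<in> carrier T" for x by (rule g(1)[OF that])
    show "?g (x \<otimes>\<^bsub>T\<^esub> y) = ?g x \<otimes>\<^bsub>S\<^esub> ?g y" if "x \<in> carrier T" "y \<in> carrier T" for x y
      by (rule eq) (use g that hE(2) in simp_all)
    show "?g (x \<oplus>\<^bsub>T\<^esub> y) = ?g x \<oplus>\<^bsub>S\<^esub> ?g y" if "x \<in> carrier T" "y \<in> carrier T" for x y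
      by (rule eq) (use g that hE(3) in simp_all)
    show "?g \<one>\<^bsub>T\<^esub> = \<one>\<^bsub>S\<^esub>" by (rule eq) (use hE(4) in simp_all)
    show "bij_betw ?g (carrier T) (carrier S)" by (rule bij_betw_inv_into[OF hE(5)])
  qed
qed

text \<open>The map need not respect the zero field of the record \<open>T\<close> while
  \<open>T\<close> is not known to be a ring, so this is a separate hypothesis.\<close>

lemma ring_iso_cring:
  assumes "cring S" "h \<in> ring_iso S T" "h \<zero>\<^bsub>S\<^esub> = \<zero>\<^bsub>T\<^esub>"
  shows "cring T"
  using cring.ring_iso_imp_img_cring[OF assms(1,2)] assms(3) by simp

lemma ring_iso_domain:
  assumes "domain S" "cring T" "h \<in> ring_iso S T"
  shows "domain T"
proof -
  interpret S: domain S by (rule assms)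
  interpret h: ring_hom_cring S T h by (rule ring_iso_hom_cring[OF S.is_cring assms(2,3)])
  show ?thesis using S.ring_iso_imp_img_domain[OF assms(3)] by simp
qed

lemma ring_iso_noetherian:
  assumes S: "cring S" and T: "cring T" and h: "h \<in> ring_iso S T" and N: "noetherian_ring S"
  shows "noetherian_ring T"
proof -
  interpret h: ring_hom_cring S T h by (rule ring_iso_hom_cring[OF S T h])
  note vimage = ring_hom_ring.ideal_vimage[OF ring_hom_ringI2[OF h.R.ring_axioms h.S.ring_axioms h.homh]]
  show ?thesis
  proof (rule h.S.noetherian_ringI)
    fix J assume J: "ideal J T"
    define I where "I = {x \<in> carrier S. h x \<in> J}"
    have "ideal I S" unfolding I_def by (rule vimage[OF J])
    then obtain A where A: "A \<subseteq> carrier S" "finite A" "I = Idl\<^bsub>S\<^esub> A"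
      using noetherian_ring.finetely_gen[OF N] by blast
    have hA: "h ` A \<subseteq> carrier T" using A(1) by auto
    have "A \<subseteq> I" unfolding A(3) by (rule h.R.genideal_self[OF A(1)])
    then have "h ` A \<subseteq> J" by (auto simp: I_def)
    then have 1: "Idl\<^bsub>T\<^esub> (h ` A) \<subseteq> J" by (rule h.S.genideal_minimal[OF J])
    have "Idl\<^bsub>S\<^esub> A \<subseteq> {x \<in> carrier S. h x \<in> Idl\<^bsub>T\<^esub> (h ` A)}"
    proof (rule h.R.genideal_minimal)
      show "ideal {x \<in> carrier S. h x \<in> Idl\<^bsub>T\<^esub> (h ` A)} S" by (rule vimage[OF h.S.genideal_ideal[OF hA]])
      show "A \<subseteq> {x \<in> carrier S. h x \<in> Idl\<^bsub>T\<^esub> (h ` A)}" using A(1) h.S.genideal_self[OF hA] by auto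
    qed
    then have 2: "h x \<in> Idl\<^bsub>T\<^esub> (h ` A)" if "x \<in> I" for x using that unfolding A(3) by blast
    have "J \<subseteq> Idl\<^bsub>T\<^esub> (h ` A)"
    proof
      fix y assume y: "y \<in> J"
      then have "y \<in> carrier T" by (rule ideal.Icarr[OF J])
      then obtain x where "x \<in> carrier S" "y = h x" using ring_iso_memE(5)[OF h] by (auto simp: bij_betw_def)
      then show "y \<in> Idl\<^bsub>T\<^esub> (h ` A)" using 2[of x] y by (simp add: I_def)
    qed
    then show "\<exists>A\<subseteq>carrier T. finite A \<and> J = Idl\<^bsub>T\<^esub> A" using 1 hA A(2) by blast
  qed
qed

text \<open>Being Noetherian leaves only the primality of irreducible elements to transfer;
  divisibility and units, hence irreducibility, correspond under \<open>h\<close>.\<close>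

lemma ring_iso_factorial_domain:
  assumes S: "factorial_domain S" and N: "noetherian_ring S" and T: "cring T" and h: "h \<in> ring_iso S T"
  shows "factorial_domain T"
proof -
  interpret S: factorial_domain S by (rule S)
  interpret h: ring_hom_cring S T h by (rule ring_iso_hom_cring[OF S.is_cring T h])
  interpret T: domain T by (rule ring_iso_domain[OF S.domain_axioms T h])
  have "noetherian_ring T" by (rule ring_iso_noetherian[OF S.is_cring T h N])
  then interpret nT: noetherian_domain T using T.domain_axioms by (simp add: noetherian_domain_def)
  have inj: "h x = h y \<longleftrightarrow> x = y" if "x \<in> carrier S" "y \<in> carrier S" for x y
    using that ring_iso_memE(5)[OF h] by (auto simp: bij_betw_def inj_on_def)
  have surj: "\<exists>x\<in>carrier S. y = h x" if "y \<in> carrier T" for y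
    using that ring_iso_memE(5)[OF h] by (auto simp: bij_betw_def)
  have dvd: "h a divides\<^bsub>T\<^esub> h b \<longleftrightarrow> a divides\<^bsub>S\<^esub> b" if ab: "a \<in> carrier S" "b \<in> carrier S" for a b
  proof
    assume "a divides\<^bsub>S\<^esub> b"
    then obtain c where "c \<in> carrier S" "b = a \<otimes>\<^bsub>S\<^esub> c" by (rule dividesE2)
    then show "h a divides\<^bsub>T\<^esub> h b" using ab by (intro dividesI2[of "h c"]) simp_all
  next
    assume "h a divides\<^bsub>T\<^esub> h b"
    then obtain y where y: "y \<in> carrier T" "h b = h a \<otimes>\<^bsub>T\<^esub> y" by (rule dividesE2)
    obtain c where c: "c \<in> carrier S" "y = h c" using surj[OF y(1)] by blast
    have "h b = h (a \<otimes>\<^bsub>S\<^esub> c)" using y(2) c ab by simp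
    then have "b = a \<otimes>\<^bsub>S\<^esub> c" using inj[of b "a \<otimes>\<^bsub>S\<^esub> c"] ab c by simp
    then show "a divides\<^bsub>S\<^esub> b" by (rule dividesI2[OF c(1)])
  qed
  have unit: "h a \<in> Units T \<longleftrightarrow> a \<in> Units S" if a: "a \<in> carrier S" for a
  proof -
    have "h a divides\<^bsub>T\<^esub> \<one>\<^bsub>T\<^esub> \<longleftrightarrow> a divides\<^bsub>S\<^esub> \<one>\<^bsub>S\<^esub>" using dvd[OF a S.one_closed] unfolding h.hom_one .
    then show ?thesis unfolding h.S.divides_one[OF h.hom_closed[OF a]] S.divides_one[OF a] .
  qed
  show ?thesis
  proof (rule nT.factorial_domainI)
    fix p' assume p': "p' \<in> carrier T" "p' \<noteq> \<zero>\<^bsub>T\<^esub>" "p' \<notin> Units T"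
      and irr: "\<And>a b. a \<in> carrier T \<Longrightarrow> b \<in> carrier T \<Longrightarrow> p' = a \<otimes>\<^bsub>T\<^esub> b \<Longrightarrow> a \<in> Units T \<or> b \<in> Units T"
    obtain p where p: "p \<in> carrier S" "p' = h p" using surj[OF p'(1)] by blast
    have "prime_el S p"
    proof (rule S.irreducible_prime_el[OF p(1)])
      show "p \<noteq> \<zero>\<^bsub>S\<^esub>" using p'(2) p(2) by auto
      show "p \<notin> Units S" using p'(3) unit[OF p(1)] p(2) by blast
      show "a \<in> Units S \<or> b \<in> Units S" if "a \<in> carrier S" "b \<in> carrier S" "p = a \<otimes>\<^bsub>S\<^esub> b" for a b
        using irr[OF h.hom_closed[OF that(1)] h.hom_closed[OF that(2)]] unit[OF that(1)] unit[OF that(2)]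
        unfolding p(2) that(3) h.hom_mult[OF that(1,2)] by blast
    qed
    then have pr: "p divides\<^bsub>S\<^esub> a \<or> p divides\<^bsub>S\<^esub> b"
      if "a \<in> carrier S" "b \<in> carrier S" "p divides\<^bsub>S\<^esub> a \<otimes>\<^bsub>S\<^esub> b" for a b
      using S.prime_el_dvd[OF _ that(3,1,2)] by blast
    have "p' divides\<^bsub>T\<^esub> a \<or> p' divides\<^bsub>T\<^esub> b"
      if "a \<in> carrier T" "b \<in> carrier T" "p' divides\<^bsub>T\<^esub> a \<otimes>\<^bsub>T\<^esub> b" for a b
    proof -
      obtain x y where xy: "x \<in> carrier S" "a = h x" "y \<in> carrier S" "b = h y"
        using surj[OF \<open>a \<in> carrier T\<close>] surj[OF \<open>b \<in> carrier T\<close>] by blast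
      have "h p divides\<^bsub>T\<^esub> h (x \<otimes>\<^bsub>S\<^esub> y)" using that(3) unfolding xy(2,4) p(2) h.hom_mult[OF xy(1,3)] .
      then have "p divides\<^bsub>S\<^esub> x \<otimes>\<^bsub>S\<^esub> y" using dvd[OF p(1) S.m_closed[OF xy(1,3)]] by blast
      from pr[OF xy(1,3) this] show ?thesis using dvd[OF p(1) xy(1)] dvd[OF p(1) xy(3)] xy(2,4) p(2) by blast
    qed
    then show "prime_el T p'" unfolding prime_el_def using p' by (auto intro!: primeI)
  qed
qed

lemma ps_ring_iso:
  assumes S: "cring S" and T: "cring T" and h: "h \<in> ring_iso S T"
  shows "(\<lambda>f n. h (f n)) \<in> ring_iso (ps S) (ps T)"
proof -
  interpret h: ring_hom_cring S T h by (rule ring_iso_hom_cring[OF S T h])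
  have im: "h ` carrier S = carrier T" and inj: "inj_on h (carrier S)"
    using ring_iso_memE(5)[OF h] by (auto simp: bij_betw_def)
  have mult: "h (conv S f g n) = conv T (\<lambda>n. h (f n)) (\<lambda>n. h (g n)) n"
    if "\<And>i. f i \<in> carrier S" "\<And>i. g i \<in> carrier S" for f g n
    using that(1)
  proof (induction n arbitrary: f)
    case (Suc n)
    have sc: "\<And>i. shift f i \<in> carrier S" using Suc.prems by (simp add: shift_def)
    have "(\<lambda>n. h (shift f n)) = shift (\<lambda>n. h (f n))" by (simp add: shift_def)
    then show ?case using Suc.IH[OF sc] Suc.prems that(2) h.R.conv_closed[of "shift f" g n, OF sc that(2)] by simp
  qed (simp add: that(2))
  show ?thesis
  proof (rule ring_iso_memI)
    show "bij_betw (\<lambda>f n. h (f n)) (carrier (ps S)) (carrier (ps T))"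
      unfolding bij_betw_def
    proof
      show "inj_on (\<lambda>f n. h (f n)) (carrier (ps S))"
      proof (rule inj_onI)
        fix f g assume fg: "f \<in> carrier (ps S)" "g \<in> carrier (ps S)" "(\<lambda>n. h (f n)) = (\<lambda>n. h (g n))"
        have "f n = g n" for n
          using inj_onD[OF inj fun_cong[OF fg(3), of n] ps_carrierD[OF fg(1)] ps_carrierD[OF fg(2)]] .
        then show "f = g" by blast
      qed
      show "(\<lambda>f n. h (f n)) ` carrier (ps S) = carrier (ps T)"
      proof (intro subset_antisym subsetI)
        fix g assume g: "g \<in> carrier (ps T)"
        let ?f = "\<lambda>n. inv_into (carrier S) h (g n)"
        have gn: "g n \<in> h ` carrier S" for n unfolding im by (rule ps_carrierD[OF g])
        have "?f \<in> carrier (ps S)" using inv_into_into[OF gn] by (simp add: ps_carrier)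
        moreover have "g = (\<lambda>n. h (?f n))" using f_inv_into_f[OF gn] by simp
        ultimately show "g \<in> (\<lambda>f n. h (f n)) ` carrier (ps S)" by (intro image_eqI[where x = ?f])
      qed (auto simp: ps_carrier)
    qed
  qed (auto simp: ps_def mult)
qed

section \<open>Splitting off the last variable\<close>

lemma psr_carrier:
  "f \<in> carrier (power_series_ring R n) \<longleftrightarrow>
    (\<forall>e. f e \<in> carrier R) \<and> (\<forall>e. \<not> Poly_Mapping.keys e \<subseteq> {..<n} \<longrightarrow> f e = \<zero>\<^bsub>R\<^esub>)"
  by (simp add: power_series_ring_def)

lemma psr_mult:
  "(f \<otimes>\<^bsub>power_series_ring R n\<^esub> g) e = finsum R (\<lambda>(a, b). f a \<otimes>\<^bsub>R\<^esub> g b) {(a, b). a + b = e}"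
  by (simp add: power_series_ring_def)

definition drop_var :: "nat \<Rightarrow> (nat \<Rightarrow>\<^sub>0 nat) \<Rightarrow> (nat \<Rightarrow>\<^sub>0 nat)" where
  "drop_var n e = e - Poly_Mapping.single n (Poly_Mapping.lookup e n)"

definition uncurry_var :: "nat \<Rightarrow> (nat \<Rightarrow> (nat \<Rightarrow>\<^sub>0 nat) \<Rightarrow> 'a) \<Rightarrow> (nat \<Rightarrow>\<^sub>0 nat) \<Rightarrow> 'a" where
  "uncurry_var n u e = u (Poly_Mapping.lookup e n) (drop_var n e)"

lemma lookup_drop_var: "Poly_Mapping.lookup (drop_var n e) i = (if i = n then 0 else Poly_Mapping.lookup e i)"
  by (auto simp: drop_var_def lookup_minus lookup_single when_def)

lemma drop_var_add_single: "drop_var n e + Poly_Mapping.single n (Poly_Mapping.lookup e n) = e"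
  by (rule poly_mapping_eqI) (simp add: lookup_add lookup_drop_var lookup_single when_def)

lemma drop_var_single: "Poly_Mapping.lookup a n = 0 \<Longrightarrow> drop_var n (a + Poly_Mapping.single n i) = a"
  by (rule poly_mapping_eqI) (auto simp: lookup_add lookup_drop_var lookup_single when_def)

lemma drop_var_plus: "drop_var n (a + b) = drop_var n a + drop_var n b"
  by (rule poly_mapping_eqI) (simp add: lookup_add lookup_drop_var)

lemma drop_var_zero_iff: "Poly_Mapping.lookup e n = 0 \<and> drop_var n e = 0 \<longleftrightarrow> e = 0"
proof
  assume "Poly_Mapping.lookup e n = 0 \<and> drop_var n e = 0"
  then show "e = 0" using drop_var_add_single[of n e] by simp
qed (simp add: drop_var_def)

lemma keys_drop_var: "Poly_Mapping.keys (drop_var n e) = Poly_Mapping.keys e - {n}"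
  by (auto simp: in_keys_iff lookup_drop_var split: if_splits)

lemma keys_drop_var_subset: "Poly_Mapping.keys (drop_var n e) \<subseteq> {..<n} \<longleftrightarrow> Poly_Mapping.keys e \<subseteq> {..<Suc n}"
  by (auto simp: keys_drop_var less_Suc_eq)

context cring
begin

text \<open>The recursion of \<open>conv\<close> unrolled. Evaluating at one exponent vector keeps
  the sum in \<open>R\<close>, so nothing is presupposed about \<open>S\<close> being a
  ring.\<close>

lemma conv_finsum:
  fixes S (structure)
  assumes S: "S = power_series_ring R n" and "\<And>i j. (u i \<otimes>\<^bsub>S\<^esub> v j) e \<in> carrier R"
  shows "conv S u v k e = (\<Oplus>i\<in>{..k}. (u i \<otimes>\<^bsub>S\<^esub> v (k - i)) e)"
  using assms(2)
proof (induction k arbitrary: u)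
  case (Suc k)
  have "conv S u v (Suc k) e = (u 0 \<otimes>\<^bsub>S\<^esub> v (Suc k)) e \<oplus> conv S (shift u) v k e"
    by (simp add: S power_series_ring_def)
  also have "conv S (shift u) v k e = (\<Oplus>i\<in>{..k}. (u (Suc i) \<otimes>\<^bsub>S\<^esub> v (k - i)) e)"
    using Suc.IH[of "shift u"] Suc.prems by (simp add: shift_def)
  also have "(u 0 \<otimes>\<^bsub>S\<^esub> v (Suc k)) e \<oplus> \<dots> = (\<Oplus>i\<in>{..Suc k}. (u i \<otimes>\<^bsub>S\<^esub> v (Suc k - i)) e)"
    using Suc.prems by (subst finsum_Suc2) (auto intro!: a_comm)
  finally show ?case .
qed simp

lemma psr_mult_nth_closed:
  assumes "\<And>e. f e \<in> carrier R" "\<And>e. g e \<in> carrier R"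
  shows "(f \<otimes>\<^bsub>power_series_ring R n\<^esub> g) e \<in> carrier R"
  unfolding psr_mult by (rule finsum_closed) (use assms in auto)

text \<open>A splitting of \<open>e\<close> is a splitting of the exponent of the last variable
  together with one of the remaining vector \<open>e0\<close>, so the sum over splittings of
  \<open>e\<close> decomposes into blocks indexed by \<open>i \<le> k\<close>.\<close>

lemma uncurry_var_mult:
  assumes u: "u \<in> carrier (ps (power_series_ring R n))" and v: "v \<in> carrier (ps (power_series_ring R n))"
  shows "uncurry_var n (u \<otimes>\<^bsub>ps (power_series_ring R n)\<^esub> v) =
    uncurry_var n u \<otimes>\<^bsub>power_series_ring R (Suc n)\<^esub> uncurry_var n v"
proof
  fix e :: "nat \<Rightarrow>\<^sub>0 nat"
  define k where "k = Poly_Mapping.lookup e n"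
  define e0 where "e0 = drop_var n e"
  let ?S = "power_series_ring R n"
  let ?s = "Poly_Mapping.single n"
  let ?D = "{(a, b). a + b = e0}"
  let ?\<psi> = "\<lambda>i (a, b). (a + ?s i, b + ?s (k - i))"
  let ?F = "\<lambda>(a, b). uncurry_var n u a \<otimes> uncurry_var n v b"
  have uc: "u i a \<in> carrier R" and vc: "v i a \<in> carrier R" for i a
    using ps_carrierD[OF u] ps_carrierD[OF v] by (simp_all add: psr_carrier)
  have e0: "Poly_Mapping.lookup e0 n = 0" "e0 + ?s k = e" using drop_var_add_single[of n e] by (simp_all add: e0_def lookup_drop_var k_def)
  have D0: "Poly_Mapping.lookup a n = 0" "Poly_Mapping.lookup b n = 0" if "(a, b) \<in> ?D" for a b
    using that e0(1) by (auto simp: lookup_add)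
  have inj: "inj_on (?\<psi> i) ?D" for i by (auto simp: inj_on_def)
  have im: "{(a, b). a + b = e} = (\<Union>i\<in>{..k}. ?\<psi> i ` ?D)"
  proof (intro subset_antisym subsetI)
    fix x assume "x \<in> {(a, b). a + b = e}"
    then obtain a b where ab: "x = (a, b)" "a + b = e" by auto
    let ?i = "Poly_Mapping.lookup a n"
    have k: "k = ?i + Poly_Mapping.lookup b n" unfolding k_def ab(2)[symmetric] by (simp add: lookup_add)
    have d: "(drop_var n a, drop_var n b) \<in> ?D" unfolding e0_def ab(2)[symmetric] by (simp add: drop_var_plus)
    have x: "x = ?\<psi> ?i (drop_var n a, drop_var n b)" using k drop_var_add_single[of n a] drop_var_add_single[of n b] by (simp add: ab(1))
    have "?i \<in> {..k}" using k by simp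
    then show "x \<in> (\<Union>i\<in>{..k}. ?\<psi> i ` ?D)" by (rule UN_I) (rule image_eqI[where f = "?\<psi> ?i", OF x d])
  next
    fix x assume "x \<in> (\<Union>i\<in>{..k}. ?\<psi> i ` ?D)"
    then obtain i a b where i: "i \<le> k" "a + b = e0" "x = (a + ?s i, b + ?s (k - i))" by auto
    have ss: "?s i + ?s (k - i) = ?s k" using i(1) by (simp add: single_add[symmetric])
    have "(a + ?s i) + (b + ?s (k - i)) = (a + b) + (?s i + ?s (k - i))" by (simp only: ac_simps)
    then have "(a + ?s i) + (b + ?s (k - i)) = e" unfolding i(2) ss e0(2) .
    then show "x \<in> {(a, b). a + b = e}" by (simp add: i(3))
  qed
  have "(uncurry_var n u \<otimes>\<^bsub>power_series_ring R (Suc n)\<^esub> uncurry_var n v) e = finsum R ?F (\<Union>i\<in>{..k}. ?\<psi> i ` ?D)"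
    unfolding psr_mult im by (rule refl)
  also have "\<dots> = (\<Oplus>i\<in>{..k}. finsum R ?F (?\<psi> i ` ?D))"
  proof (rule add.finprod_UN_disjoint)
    show "finite (?\<psi> i ` ?D)" for i by (rule finite_imageI[OF finite_exponent_splittings])
    show "pairwise (\<lambda>i j. disjnt (?\<psi> i ` ?D) (?\<psi> j ` ?D)) {..k}"
    proof (rule pairwiseI)
      fix i j :: nat assume ij: "i \<noteq> j"
      have lk: "Poly_Mapping.lookup (fst x) n = i" if "x \<in> ?\<psi> i ` ?D" for x i
        using that D0(1) by (auto simp: lookup_add)
      show "disjnt (?\<psi> i ` ?D) (?\<psi> j ` ?D)"
        unfolding disjnt_iff
      proof (intro allI notI, elim conjE)
        fix x assume "x \<in> ?\<psi> i ` ?D" "x \<in> ?\<psi> j ` ?D"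
        from lk[OF this(1)] lk[OF this(2)] ij show False by simp
      qed
    qed
  qed (auto simp: uncurry_var_def uc vc)
  also have "\<dots> = (\<Oplus>i\<in>{..k}. (u i \<otimes>\<^bsub>?S\<^esub> v (k - i)) e0)"
  proof (rule add.finprod_cong')
    fix i assume i: "i \<in> {..k}"
    have "finsum R ?F (?\<psi> i ` ?D) = finsum R (\<lambda>x. ?F (?\<psi> i x)) ?D"
      by (rule finsum_reindex[OF _ inj]) (auto simp: uncurry_var_def uc vc)
    also have "\<dots> = finsum R (\<lambda>(a, b). u i a \<otimes> v (k - i) b) ?D"
    proof (rule add.finprod_cong')
      fix x assume "x \<in> ?D"
      then obtain a b where x: "x = (a, b)" "(a, b) \<in> ?D" by auto
      show "?F (?\<psi> i x) = (case x of (a, b) \<Rightarrow> u i a \<otimes> v (k - i) b)"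
        using D0[OF x(2)] by (simp add: x(1) uncurry_var_def drop_var_single lookup_add)
    qed (auto simp: uc vc)
    finally show "finsum R ?F (?\<psi> i ` ?D) = (u i \<otimes>\<^bsub>?S\<^esub> v (k - i)) e0" unfolding psr_mult .
  qed (auto intro!: psr_mult_nth_closed uc vc)
  also have "\<dots> = conv ?S u v k e0"
    by (rule conv_finsum[symmetric, OF refl]) (rule psr_mult_nth_closed[OF uc vc])
  also have "\<dots> = uncurry_var n (u \<otimes>\<^bsub>ps ?S\<^esub> v) e" by (simp add: uncurry_var_def ps_def k_def e0_def)
  finally show "uncurry_var n (u \<otimes>\<^bsub>ps ?S\<^esub> v) e = (uncurry_var n u \<otimes>\<^bsub>power_series_ring R (Suc n)\<^esub> uncurry_var n v) e" by simp
qed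

lemma uncurry_var_iso: "uncurry_var n \<in> ring_iso (ps (power_series_ring R n)) (power_series_ring R (Suc n))"
proof (rule ring_iso_memI)
  let ?S = "power_series_ring R n" let ?T = "power_series_ring R (Suc n)"
  show closed: "uncurry_var n u \<in> carrier ?T" if u: "u \<in> carrier (ps ?S)" for u
    using ps_carrierD[OF u] by (simp add: psr_carrier uncurry_var_def keys_drop_var_subset)
  show "uncurry_var n (u \<otimes>\<^bsub>ps ?S\<^esub> v) = uncurry_var n u \<otimes>\<^bsub>?T\<^esub> uncurry_var n v"
    if "u \<in> carrier (ps ?S)" "v \<in> carrier (ps ?S)" for u v by (rule uncurry_var_mult[OF that])
  show "uncurry_var n (u \<oplus>\<^bsub>ps ?S\<^esub> v) = uncurry_var n u \<oplus>\<^bsub>?T\<^esub> uncurry_var n v" for u v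
    by (simp add: uncurry_var_def ps_def power_series_ring_def fun_eq_iff)
  show "uncurry_var n \<one>\<^bsub>ps ?S\<^esub> = \<one>\<^bsub>?T\<^esub>"
    using drop_var_zero_iff[of _ n] by (auto simp: uncurry_var_def ps_def power_series_ring_def fun_eq_iff)
  show "bij_betw (uncurry_var n) (carrier (ps ?S)) (carrier ?T)"
    unfolding bij_betw_def
  proof
    show "inj_on (uncurry_var n) (carrier (ps ?S))"
    proof (rule inj_onI)
      fix u v assume u: "u \<in> carrier (ps ?S)" and v: "v \<in> carrier (ps ?S)" and eq: "uncurry_var n u = uncurry_var n v"
      have "u k e = v k e" for k e
      proof (cases "Poly_Mapping.keys e \<subseteq> {..<n}")
        case True
        then have 0: "Poly_Mapping.lookup e n = 0" by (auto simp: in_keys_iff)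
        show ?thesis using fun_cong[OF eq, of "e + Poly_Mapping.single n k"] 0
          by (simp add: uncurry_var_def drop_var_single lookup_add)
      next
        case False
        then show ?thesis using ps_carrierD[OF u, of k] ps_carrierD[OF v, of k] by (simp add: psr_carrier)
      qed
      then show "u = v" by blast
    qed
    show "uncurry_var n ` carrier (ps ?S) = carrier ?T"
    proof (intro subset_antisym subsetI)
      fix f assume f: "f \<in> carrier ?T"
      define u where "u = (\<lambda>k e. if Poly_Mapping.keys e \<subseteq> {..<n} then f (e + Poly_Mapping.single n k) else \<zero>)"
      have "u \<in> carrier (ps ?S)" using f by (simp add: ps_carrier psr_carrier u_def)
      moreover have "f = uncurry_var n u"
        using f by (auto simp: uncurry_var_def u_def drop_var_add_single keys_drop_var_subset psr_carrier)
      ultimately show "f \<in> uncurry_var n ` carrier (ps ?S)" by (intro image_eqI[where x = u])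
    qed (use closed in blast)
  qed
qed

lemma psr_0_iso: "(\<lambda>a e. if e = 0 then a else \<zero>) \<in> ring_iso R (power_series_ring R 0)"
proof (rule ring_iso_memI)
  let ?c = "\<lambda>a e :: nat \<Rightarrow>\<^sub>0 nat. if e = 0 then a else \<zero>"
  let ?S = "power_series_ring R 0"
  show closed: "?c a \<in> carrier ?S" if "a \<in> carrier R" for a using that by (auto simp: psr_carrier)
  show "?c (a \<oplus> b) = ?c a \<oplus>\<^bsub>?S\<^esub> ?c b" if "a \<in> carrier R" "b \<in> carrier R" for a b
    by (auto simp: power_series_ring_def fun_eq_iff)
  show "?c \<one> = \<one>\<^bsub>?S\<^esub>" by (auto simp: power_series_ring_def)
  show "?c (a \<otimes> b) = ?c a \<otimes>\<^bsub>?S\<^esub> ?c b" if ab: "a \<in> carrier R" "b \<in> carrier R" for a b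
  proof
    fix e :: "nat \<Rightarrow>\<^sub>0 nat"
    have z: "x = 0 \<and> y = 0" if xy: "x + y = 0" for x y :: "nat \<Rightarrow>\<^sub>0 nat"
    proof -
      have "Poly_Mapping.lookup x i = 0" "Poly_Mapping.lookup y i = 0" for i
        using arg_cong[OF xy, of "\<lambda>e. Poly_Mapping.lookup e i"] by (simp_all add: lookup_add)
      then have "x = 0" "y = 0" by (auto intro: poly_mapping_eqI)
      then show ?thesis by (rule conjI)
    qed
    show "?c (a \<otimes> b) e = (?c a \<otimes>\<^bsub>?S\<^esub> ?c b) e"
    proof (cases "e = 0")
      case True
      have "{(x, y). x + y = (0 :: nat \<Rightarrow>\<^sub>0 nat)} = {(0, 0)}"
      proof (intro subset_antisym subsetI)
        fix p :: "(nat \<Rightarrow>\<^sub>0 nat) \<times> (nat \<Rightarrow>\<^sub>0 nat)"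
        assume "p \<in> {(x, y). x + y = 0}"
        then obtain x y where xy: "p = (x, y)" "x + y = 0" by auto
        from z[OF xy(2)] show "p \<in> {(0, 0)}" unfolding xy(1) by simp
      qed simp
      then have "(?c a \<otimes>\<^bsub>?S\<^esub> ?c b) e = finsum R (\<lambda>(x, y). ?c a x \<otimes> ?c b y) {(0, 0)}"
        unfolding psr_mult True by (rule arg_cong)
      also have "\<dots> = a \<otimes> b" using ab by simp
      finally show ?thesis using True by simp
    next
      case False
      have "(?c a \<otimes>\<^bsub>?S\<^esub> ?c b) e = finsum R (\<lambda>x. \<zero>) {(x, y). x + y = e}"
        unfolding psr_mult
      proof (rule add.finprod_cong')
        fix x assume "x \<in> {(x, y). x + y = e}"
        then have "fst x \<noteq> 0 \<or> snd x \<noteq> 0" using False by auto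
        then show "(case x of (x, y) \<Rightarrow> ?c a x \<otimes> ?c b y) = \<zero>" using ab by (cases x) auto
      qed auto
      then show ?thesis using False by simp
    qed
  qed
  show "bij_betw ?c (carrier R) (carrier ?S)"
    unfolding bij_betw_def
  proof
    show "inj_on ?c (carrier R)"
    proof (rule inj_onI)
      fix a b assume "?c a = ?c b"
      from fun_cong[OF this, of 0] show "a = b" by simp
    qed
    show "?c ` carrier R = carrier ?S"
    proof (intro subset_antisym subsetI)
      fix f assume f: "f \<in> carrier ?S"
      have "f 0 \<in> carrier R" using f by (simp add: psr_carrier)
      moreover have "f = ?c (f 0)" using f by (auto simp: psr_carrier fun_eq_iff)
      ultimately show "f \<in> ?c ` carrier R" by (rule image_eqI[where f = ?c, rotated])
    qed (use closed in blast)
  qed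
qed

text \<open>The ring axioms in several variables are never verified directly but transported along
  the isomorphisms with iterated one-variable series.\<close>

lemma psr_cring: "cring (power_series_ring R n)"
proof (induction n)
  case 0
  show ?case by (rule ring_iso_cring[OF is_cring psr_0_iso]) (auto simp: power_series_ring_def)
next
  case (Suc n)
  show ?case
    by (rule ring_iso_cring[OF cring.ps_cring[OF Suc] uncurry_var_iso])
      (simp add: uncurry_var_def ps_def power_series_ring_def fun_eq_iff)
qed

lemma psr_noetherian: "noetherian_ring R \<Longrightarrow> noetherian_ring (power_series_ring R n)"
proof (induction n)
  case 0
  then show ?case by (rule ring_iso_noetherian[OF is_cring psr_cring psr_0_iso])
next
  case (Suc n)
  then show ?case
    by (intro ring_iso_noetherian[OF cring.ps_cring[OF psr_cring] psr_cring uncurry_var_iso] cring.ps_noetherian[OF psr_cring])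
qed

lemma domain_of_ps:
  assumes "domain (ps R)"
  shows "domain R"
proof -
  interpret P: domain "ps R" by (rule assms)
  interpret c: ring_hom_cring R "ps R" "const R" by (rule ps_hom)
  have z: "a = \<zero>" if "const R a = \<zero>\<^bsub>ps R\<^esub>" for a using arg_cong[OF that, of "\<lambda>f. f 0"] by simp
  show ?thesis
  proof unfold_locales
    show "\<one> \<noteq> \<zero>" using c.hom_one c.hom_zero P.one_not_zero by metis
    fix a b assume ab: "a \<otimes> b = \<zero>" "a \<in> carrier R" "b \<in> carrier R"
    have "const R a \<otimes>\<^bsub>ps R\<^esub> const R b = \<zero>\<^bsub>ps R\<^esub>" using c.hom_mult[OF ab(2,3)] ab(1) by simp
    then show "a = \<zero> \<or> b = \<zero>" using P.integral[OF _ const_closed[OF ab(2)] const_closed[OF ab(3)]] z by blast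
  qed
qed

end

theorem mainTheorem2:
  fixes R :: "('a, 'b) ring_scheme"
  assumes "cring R"
    and "noetherian_ring R"
    and "factorial_domain (power_series_ring R 1)"
  shows "\<forall>n\<ge>1. factorial_domain (power_series_ring R n)"
proof -
  interpret cring R by (rule assms)
  let ?A = "power_series_ring R"
  have cr: "cring (?A n)" "cring (ps (?A n))" for n using psr_cring cring.ps_cring by blast+
  have N: "noetherian_ring (?A n)" for n by (rule psr_noetherian[OF assms(2)])
  have iso: "uncurry_var n \<in> ring_iso (ps (?A n)) (?A (Suc n))" for n by (rule uncurry_var_iso)
  \<comment> \<open>The ring in \<open>n\<close> variables plays the role of the coefficient ring,
    so that the induction hypothesis is the factoriality of one-variable series over it, and the
    step adds one more variable.\<close>
  have "factorial_domain (?A (Suc n))" for n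
  proof (induction n)
    case 0
    show ?case using assms(3) by simp
  next
    case (Suc n)
    have f: "factorial_domain (ps (?A n))"
      by (rule ring_iso_factorial_domain[OF Suc N cr(2) ring_iso_inverse[OF cr(2) iso]])
    have "domain (?A n)" by (rule cring.domain_of_ps[OF cr(1) factorial_domain.axioms(1)[OF f]])
    then have "factorial_domain (ps (ps (?A n)))" by (rule domain.factorial_ps_of_factorial_ps[OF _ N f])
    then have "factorial_domain (ps (?A (Suc n)))"
      by (rule ring_iso_factorial_domain[OF _ cring.ps_noetherian[OF cr(2) cring.ps_noetherian[OF cr(1) N]] cr(2)
            ps_ring_iso[OF cr(2) cr(1) iso]])
    then show ?case by (rule ring_iso_factorial_domain[OF _ cring.ps_noetherian[OF cr(1) N] cr(1) iso])
  qed
  then show ?thesis by (metis Suc_le_D One_nat_def)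
qed

end
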